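(* Let $(V,m)$ be a quantum $L_\infty$-algebra, i.e. $V$ is a super vector space with an odd non-degenerate symmetric bilinear form and $m\in\mathfrak h[\Pi V]$ is an even solution of the quantum master equation. Fix a cyclic strong deformation retract $(i,p,s)$ from $V$ to $\operatorname{H}(V)$, with associated subspace $\mathcal L_s=\Pi\operatorname{im}(s)\subset \Pi V$ and quadratic function $\sigma$. Then the formula $$m'=\rho(m)=\hbar\log\int_{\mathcal L_s}e^{\frac{m}{\hbar}}e^{\frac{-\sigma}{2\hbar}}$$ defines a quantum $L_\infty$-algebra $(\operatorname{H}(V),m')$, and moreover $(\operatorname{H}(V),m')$ is the minimal model of $(V,m)$.
   Context: **Basics.** A super vector space is a $\mathbb Z/2$-graded real vector space with an odd differential $d$; $|v|$ is parity, $\Pi$ is parity reversion, $\operatorname{H}$ is homology. Odd bilinear forms are compatible with $d$: $\langle dx,y\rangle+(-1)^{|x|}\langle x,dy\rangle=0$. Non-degeneracy forces finite dimension. If $V$ carries an odd symmetric non-degenerate form, then $W=\Pi V$ carries the odd symplectic form $\tau(\Pi x,\Pi y)=(-1)^{|x|}\langle x,y\rangle$, and conversely an odd symplectic $W$ gives such a form on $V=\Pi W$. $\hat S W^*=\prod_{n\ge 0}S^nW^*$ is the algebra of formal functions, with derivation differential $d$ induced by that of $W$, and Laplacian $\Delta=\sum_i\partial_{x_i}\partial_{\xi_i}$, where $\{x_i,\xi_i\}$ is a basis of $W^*$ ($x_i$ even, $\xi_i$ odd) in which the symplectic form is canonical, $\sum_i d_{DR}x_i\,d_{DR}\xi_i$.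 The odd Poisson bracket is $[f,g]=(-1)^{|f|}\Delta(fg)-(-1)^{|f|}\Delta(f)g-f\Delta(g)$. Put $\overline W=W\otimes\mathbb R((\hbar))$; everything is extended $\hbar^{\pm1}$-linearly to $\hat S\overline W^*$ (symmetric tensors over $\mathbb R((\hbar))$). **Cyclic SDR.** A cyclic strong deformation retract from $V$ to $\operatorname{H}(V)$ (with induced form) consists of even morphisms $i\colon \operatorname{H}(V)\hookrightarrow V$, $p\colon V\twoheadrightarrow \operatorname{H}(V)$ (commuting with differentials) and an odd linear map $s\colon V\to V$ with $pi=\mathrm{id}$, $ds+sd=\mathrm{id}-ip$, $si=0$, $ps=0$, $s^2=0$, $\langle ix,iy\rangle=\langle x,y\rangle$, $\ker p\perp\operatorname{im} i$, $\langle sx,y\rangle=(-1)^{|x|}\langle x,sy\rangle$. Then $W=\Pi V=\Pi\operatorname{im}(i)\oplus\Pi\operatorname{im}(s)\oplus\Pi\operatorname{im}(d)$, $\Pi\operatorname{im}(i)$ is identified with $\operatorname{H}(W)=\Pi \operatorname{H}(V)$, $\Pi\operatorname{im}(i)^\perp=\Pi\operatorname{im}(s)\oplus\Pi\operatorname{im}(d)$, and $\mathcal L_s:=\Pi\operatorname{im}(s)$ is a Lagrangian subspace of $\Pi\operatorname{im}(i)^\perp$. **Integral.** $\sigma$ is the non-degenerate quadratic function $w\mapsto\langle w,dw\rangle$ on $\mathcal L_s$, extended to $W$ by the projection $W\to\mathcal L_s$; sign conventions are such that $d=-\tfrac12[\sigma,\cdot]$ on $\hat SW^*$. Choose linear coordinates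 on $\mathcal L_s$, $x_1,\dots,x_k$ even and $\xi_{k+1},\dots,\xi_n$ odd ($n-k$ even), with $\sigma=\sum_i\epsilon(x_i)x_i^2-(\xi_{k+1}\xi_{k+2}+\dots+\xi_{n-1}\xi_n)$, $\epsilon(x_i)=\pm1$. The integral over $\mathcal L_s$ is the normalized formal Gaussian integral, the $\mathbb R((\hbar))$-linear iterated integral determined by: for each even $x=x_i$, $\int e^{-\epsilon(x)x^2/2\hbar}=1$, $\int x^{2r+2}e^{-\epsilon(x)x^2/2\hbar}=\epsilon(x)(2r+1)\hbar\int x^{2r}e^{-\epsilon(x)x^2/2\hbar}$ and odd powers integrate to $0$; for each pair $\xi,\eta$ of consecutive odd coordinates, the functions $1,\xi,\eta,\xi\eta$ times $e^{\xi\eta/2\hbar}$ integrate to $1,0,0,2\hbar$. For $f\in S\overline W^*$, $\int_{\mathcal L_s}fe^{-\sigma/2\hbar}\in S\overline{\operatorname{H}(W)}^*$ is obtained by restricting $f$ to $\operatorname{H}(W)\oplus\mathcal L_s$ (coordinates of $\Pi\operatorname{im}(d)$ set to $0$) and applying $\mathrm{id}_{\operatorname{H}(W)}\otimes\int_{\mathcal L_s}$. It is extended termwise to series such as $e^{f/\hbar}$ with $f\in\mathfrak h[W]$. **The dgla $\mathfrak h[W]$.** Give $f\hbar^g$, $f$ a monomial of degree $n$ in $\hat SW^*$, the weight $2g+n$. $\mathfrak h[W]\subset\hat SW^*[[\hbar]]$ is the subspace of elements of weight $>2$; with differential $d+\hbar\Delta$ and bracket $[\cdot,\cdot]$ it is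 a pronilpotent (odd) dgla. $\exp$ and $\log$ denote the usual power series. An even $m\in\mathfrak h[W]$ satisfies the quantum master equation (QME) if $(d+\hbar\Delta)e^{m/\hbar}=0$, equivalently the Maurer–Cartan (MC) equation $(d+\hbar\Delta)m+\frac12[m,m]=0$. A quantum $L_\infty$-algebra structure on $V$ is an even solution $m\in\mathfrak h[\Pi V]$ of the QME. **Homotopy and minimal models.** $\mathbb R[t,dt]$ is the free cdga on $t$ (even), $dt$ (odd) with $d(t)=dt$; $\mathfrak g[t,dt]=\mathfrak g\otimes\mathbb R[t,dt]$ (completed tensor product). Two MC elements $\xi,\eta$ of $\mathfrak g$ are homotopic if there is an MC element $H(t)$ of $\mathfrak g[t,dt]$ with $H(0)=\xi$, $H(1)=\eta$. The map $\iota\colon\mathfrak h[\Pi \operatorname{H}(V)]\to\mathfrak h[\Pi V]$ is the dgla morphism given by pulling back functions along $p$ (extension by zero on the complement $\Pi\operatorname{im}(i)^\perp$). The minimal model of a quantum $L_\infty$-algebra $(V,m)$ is a quantum $L_\infty$-algebra $(\operatorname{H}(V),m')$ such that $\iota(m')$ is homotopic to $m$ as an MC element of $\mathfrak h[\Pi V]$. *)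

theory Defs
  imports "HOL-Analysis.Analysis" "HOL-Computational_Algebra.Computational_Algebra"
begin

section \<open>Super vector spaces with odd forms\<close>

text \<open>The class \<open>real_vector\<close> is used rather than \<open>euclidean_space\<close>, which would exclude the zero
  space (the homology of an acyclic space).\<close>

record 'v super =
  Ev :: "'v set"
  Od :: "'v set"
  dif :: "'v \<Rightarrow> 'v"

definition hpart :: "'v super \<Rightarrow> nat \<Rightarrow> 'v set" where
  "hpart V p = (if even p then Ev V else Od V)"

definition super_space :: "'v::real_vector super \<Rightarrow> bool" where
  "super_space V \<longleftrightarrow>
     subspace (Ev V) \<and> subspace (Od V) \<and> Ev V \<inter> Od V = {0} \<and>
     (\<forall>v. \<exists>a\<in>Ev V. \<exists>c\<in>Od V. v = a + c) \<and>
     linear (dif V) \<and> (\<forall>p. dif V ` hpart V p \<subseteq> hpart V (Suc p)) \<and> (\<forall>v. dif V (dif V v) = 0)"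

definition ev_proj :: "'v::real_vector super \<Rightarrow> 'v \<Rightarrow> 'v" where
  "ev_proj V v = (THE a. a \<in> Ev V \<and> v - a \<in> Od V)"

definition od_proj :: "'v::real_vector super \<Rightarrow> 'v \<Rightarrow> 'v" where
  "od_proj V v = v - ev_proj V v"

text \<open>The grading involution \<open>v \<mapsto> (-1)\<^sup>|\<^sup>v\<^sup>| v\<close>, extended linearly.\<close>

definition grade :: "'v::real_vector super \<Rightarrow> 'v \<Rightarrow> 'v" where
  "grade V v = ev_proj V v - od_proj V v"

text \<open>Parity reversion keeps the underlying vectors and the differential (so \<open>d (\<Pi> x) = \<Pi> (d x)\<close>)
  and exchanges the two homogeneous parts.\<close>

definition parity_rev :: "'v super \<Rightarrow> 'v super" where
  "parity_rev V = V\<lparr>Ev := Od V, Od := Ev V\<rparr>"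

text \<open>Odd symmetric non-degenerate forms. Finite dimension is part of non-degeneracy.\<close>

definition odd_sym_form :: "'v::real_vector super \<Rightarrow> ('v \<Rightarrow> 'v \<Rightarrow> real) \<Rightarrow> bool" where
  "odd_sym_form V b \<longleftrightarrow>
     bilinear b \<and>
     (\<forall>p q. \<forall>x\<in>hpart V p. \<forall>y\<in>hpart V q. even (p + q) \<longrightarrow> b x y = 0) \<and>
     (\<forall>p q. \<forall>x\<in>hpart V p. \<forall>y\<in>hpart V q. b x y = (-1) ^ (p * q) * b y x) \<and>
     (\<forall>p. \<forall>x\<in>hpart V p. \<forall>y. b (dif V x) y + (-1) ^ p * b x (dif V y) = 0) \<and>
     (\<exists>B. finite B \<and> span B = (UNIV :: 'v set)) \<and>
     (\<forall>x. (\<forall>y. b x y = 0) \<longrightarrow> x = 0)"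

text \<open>The odd symplectic form \<open>\<tau>(\<Pi> x, \<Pi> y) = (-1)\<^sup>|\<^sup>x\<^sup>| \<langle>x, y\<rangle>\<close> on \<open>\<Pi> V\<close>; here \<open>|x|\<close> is the parity in \<open>V\<close>.\<close>

definition sympl :: "'v::real_vector super \<Rightarrow> ('v \<Rightarrow> 'v \<Rightarrow> real) \<Rightarrow> 'v \<Rightarrow> 'v \<Rightarrow> real" where
  "sympl V b x y = b (grade V x) y"

section \<open>Homology and cyclic strong deformation retracts\<close>

text \<open>\<open>(H, \<pi>)\<close> is a model of the quotient \<open>ker d / im d\<close>, where \<open>\<pi>\<close> restricted to the cycles is the
  quotient map (its values elsewhere play no role), and \<open>bH\<close> is the form induced by \<open>b\<close>.\<close>

definition homology_of ::
  "'v::real_vector super \<Rightarrow> ('v \<Rightarrow> 'v \<Rightarrow> real) \<Rightarrow>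
   'h::real_vector super \<Rightarrow> ('h \<Rightarrow> 'h \<Rightarrow> real) \<Rightarrow> ('v \<Rightarrow> 'h) \<Rightarrow> bool" where
  "homology_of V b H bH \<pi> \<longleftrightarrow>
     super_space H \<and> (\<forall>x. dif H x = 0) \<and>
     linear \<pi> \<and> (\<forall>p. \<forall>v\<in>hpart V p. dif V v = 0 \<longrightarrow> \<pi> v \<in> hpart H p) \<and>
     \<pi> ` {v. dif V v = 0} = UNIV \<and>
     (\<forall>v. dif V v = 0 \<longrightarrow> (\<pi> v = 0 \<longleftrightarrow> v \<in> range (dif V))) \<and>
     (\<forall>v w. dif V v = 0 \<longrightarrow> dif V w = 0 \<longrightarrow> bH (\<pi> v) (\<pi> w) = b v w)"

definition cyclic_sdr ::
  "'v::real_vector super \<Rightarrow> ('v \<Rightarrow> 'v \<Rightarrow> real) \<Rightarrow>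
   'h::real_vector super \<Rightarrow> ('h \<Rightarrow> 'h \<Rightarrow> real) \<Rightarrow>
   ('h \<Rightarrow> 'v) \<Rightarrow> ('v \<Rightarrow> 'h) \<Rightarrow> ('v \<Rightarrow> 'v) \<Rightarrow> bool" where
  "cyclic_sdr V b H bH i p s \<longleftrightarrow>
     linear i \<and> (\<forall>q. i ` hpart H q \<subseteq> hpart V q) \<and> (\<forall>x. dif V (i x) = i (dif H x)) \<and>
     linear p \<and> (\<forall>q. p ` hpart V q \<subseteq> hpart H q) \<and> (\<forall>v. dif H (p v) = p (dif V v)) \<and>
     linear s \<and> (\<forall>q. s ` hpart V q \<subseteq> hpart V (Suc q)) \<and>
     (\<forall>x. p (i x) = x) \<and>
     (\<forall>v. dif V (s v) + s (dif V v) = v - i (p v)) \<and>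
     (\<forall>x. s (i x) = 0) \<and> (\<forall>v. p (s v) = 0) \<and> (\<forall>v. s (s v) = 0) \<and>
     (\<forall>x y. b (i x) (i y) = bH x y) \<and>
     (\<forall>v y. p v = 0 \<longrightarrow> b v (i y) = 0) \<and>
     (\<forall>q. \<forall>x\<in>hpart V q. \<forall>y. b (s x) y = (-1) ^ q * b x (s y))"

section \<open>Formal functions\<close>

text \<open>
  A formal function \<open>F\<close> on \<open>W\<close> with coefficients in \<open>\<real>((\<hbar>))\<close> is given by its Taylor coefficients at \<open>0\<close>:
  \<open>F [w\<^sub>1, \<dots>, w\<^sub>n] = \<partial>\<^bsub>w\<^sub>n\<^esub> \<dots> \<partial>\<^bsub>w\<^sub>1\<^esub> F (0)\<close>, with left derivatives. For each \<open>n\<close> these form a supersymmetric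
  \<open>n\<close>-linear map \<open>W\<^sup>n \<rightarrow> \<real>((\<hbar>))\<close>, which over \<open>\<real>\<close> is the same as an element of \<open>S\<^sup>n W\<^sup>* \<otimes> \<real>((\<hbar>))\<close> for finite
  dimensional \<open>W\<close>; a family indexed by all \<open>n\<close> is an element of the product over \<open>n\<close>. In particular
  \<open>(\<partial>\<^sub>w F) ws = F (w # ws)\<close>. The variable \<open>\<hbar>\<close> is \<open>fls_X\<close>.
\<close>

type_synonym 'v ffun = "'v list \<Rightarrow> real fls"

definition formal_fun :: "'v::real_vector super \<Rightarrow> 'v ffun \<Rightarrow> bool" where
  "formal_fun W F \<longleftrightarrow>
     (\<forall>xs ys u v. F (xs @ (u + v) # ys) = F (xs @ u # ys) + F (xs @ v # ys)) \<and>
     (\<forall>xs ys a u. F (xs @ (a *\<^sub>R u) # ys) = fls_const a * F (xs @ u # ys)) \<and>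
     (\<forall>xs ys p q. \<forall>u\<in>hpart W p. \<forall>v\<in>hpart W q.
        F (xs @ u # v # ys) = (-1) ^ (p * q) * F (xs @ v # u # ys))"

definition ffgrade :: "'v::real_vector super \<Rightarrow> 'v ffun \<Rightarrow> 'v ffun" where
  "ffgrade W F = (\<lambda>ws. F (map (grade W) ws))"

definition even_fun :: "'v::real_vector super \<Rightarrow> 'v ffun \<Rightarrow> bool" where
  "even_fun W F \<longleftrightarrow> ffgrade W F = F"

definition odd_fun :: "'v::real_vector super \<Rightarrow> 'v ffun \<Rightarrow> bool" where
  "odd_fun W F \<longleftrightarrow> ffgrade W F = (\<lambda>ws. - F ws)"

text \<open>The Taylor coefficients of a product, by the Leibniz rule
  \<open>\<partial>\<^sub>w (F G) = (\<partial>\<^sub>w F) G + (-1)\<^bsup>|w||F|\<^esup> F (\<partial>\<^sub>w G)\<close>, for \<open>w\<close> split into its even and odd parts.\<close>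

primrec taylor_mult :: "'v::real_vector super \<Rightarrow> 'v list \<Rightarrow> 'v ffun \<Rightarrow> 'v ffun \<Rightarrow> real fls" where
  "taylor_mult W [] F G = F [] * G []"
| "taylor_mult W (w # ws) F G =
     taylor_mult W ws (\<lambda>us. F (w # us)) G
   + taylor_mult W ws F (\<lambda>us. G (ev_proj W w # us))
   + taylor_mult W ws (ffgrade W F) (\<lambda>us. G (od_proj W w # us))"

definition ffmult :: "'v::real_vector super \<Rightarrow> 'v ffun \<Rightarrow> 'v ffun \<Rightarrow> 'v ffun" where
  "ffmult W F G = (\<lambda>ws. taylor_mult W ws F G)"

definition ffone :: "'v ffun" where
  "ffone = (\<lambda>ws. if ws = [] then 1 else 0)"

primrec ffpow :: "'v::real_vector super \<Rightarrow> 'v ffun \<Rightarrow> nat \<Rightarrow> 'v ffun" where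
  "ffpow W F 0 = ffone"
| "ffpow W F (Suc k) = ffmult W F (ffpow W F k)"

text \<open>The infinite sums below are taken in the \<open>\<hbar>\<close>-adic topology of \<open>\<real>((\<hbar>))\<close>, separately for every
  Taylor coefficient.\<close>

definition ffexp :: "'v::real_vector super \<Rightarrow> 'v ffun \<Rightarrow> 'v ffun" where
  "ffexp W F = (\<lambda>ws. \<Sum>k. fls_const (1 / fact k) * ffpow W F k ws)"

definition ffln :: "'v::real_vector super \<Rightarrow> 'v ffun \<Rightarrow> 'v ffun" where
  "ffln W F = (\<lambda>ws. \<Sum>k. fls_const ((-1) ^ k / real (Suc k)) *
                            ffpow W (\<lambda>us. F us - ffone us) (Suc k) ws)"

section \<open>The BV structure and the quantum master equation\<close>

text \<open>The derivation induced by the dual differential \<open>(d \<phi>)(w) = -(-1)\<^bsup>|\<phi>|\<^esup> \<phi>(d w)\<close> on \<open>W\<^sup>*\<close>, that is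
  \<open>(d F)(w\<^sub>1, \<dots>, w\<^sub>n) = \<Sum>\<^sub>i (-1)\<^bsup>|w\<^sub>1| + \<dots> + |w\<^sub>i|\<^esup> F(w\<^sub>1, \<dots>, d w\<^sub>i, \<dots>, w\<^sub>n)\<close>. With the conventions for \<open>lap\<close>
  and \<open>sigma\<close> below, this is \<open>-1/2 [\<sigma>, F]\<close>.\<close>

definition ffdif :: "'v::real_vector super \<Rightarrow> 'v ffun \<Rightarrow> 'v ffun" where
  "ffdif W F = (\<lambda>ws. \<Sum>j<length ws.
     F (map (grade W) (take j ws) @ dif W (grade W (ws ! j)) # drop (Suc j) ws))"

text \<open>The basis \<open>es, fs\<close> of \<open>W\<close> is dual to a basis \<open>x\<^sub>i, \<xi>\<^sub>i\<close> of \<open>W\<^sup>*\<close> in which \<open>\<tau>\<close> is canonical; the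
  Laplacian does not depend on the choice of such a basis.\<close>

definition darboux ::
  "'v::real_vector super \<Rightarrow> ('v \<Rightarrow> 'v \<Rightarrow> real) \<Rightarrow> 'v list \<Rightarrow> 'v list \<Rightarrow> bool" where
  "darboux W \<tau> es fs \<longleftrightarrow>
     length es = length fs \<and> set es \<subseteq> Ev W \<and> set fs \<subseteq> Od W \<and>
     distinct (es @ fs) \<and> independent (set (es @ fs)) \<and> span (set (es @ fs)) = UNIV \<and>
     (\<forall>j<length es. \<forall>k<length fs. \<tau> (es ! j) (fs ! k) = (if j = k then 1 else 0))"

definition lap :: "'v::real_vector super \<Rightarrow> ('v \<Rightarrow> 'v \<Rightarrow> real) \<Rightarrow> 'v ffun \<Rightarrow> 'v ffun" where
  "lap W \<tau> F = (\<lambda>ws. case (SOME (es, fs). darboux W \<tau> es fs) of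
     (es, fs) \<Rightarrow> \<Sum>j<length es. F (fs ! j # es ! j # ws))"

definition bracket ::
  "'v::real_vector super \<Rightarrow> ('v \<Rightarrow> 'v \<Rightarrow> real) \<Rightarrow> 'v ffun \<Rightarrow> 'v ffun \<Rightarrow> 'v ffun" where
  "bracket W \<tau> F G = (\<lambda>ws.
     lap W \<tau> (ffmult W (ffgrade W F) G) ws
   - ffmult W (lap W \<tau> (ffgrade W F)) G ws
   - ffmult W F (lap W \<tau> G) ws)"

definition hdif :: "'v::real_vector super \<Rightarrow> ('v \<Rightarrow> 'v \<Rightarrow> real) \<Rightarrow> 'v ffun \<Rightarrow> 'v ffun" where
  "hdif W \<tau> F = (\<lambda>ws. ffdif W F ws + fls_X * lap W \<tau> F ws)"

text \<open>The underlying space of the dgla \<open>\<hh>[W]\<close>: only non-negative powers of \<open>\<hbar>\<close>, and weight \<open>2 g + n > 2\<close>.\<close>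

definition hfun :: "'v::real_vector super \<Rightarrow> 'v ffun set" where
  "hfun W = {F. formal_fun W F \<and>
     (\<forall>ws g. fls_nth (F ws) g \<noteq> 0 \<longrightarrow> 0 \<le> g \<and> 2 * g + int (length ws) > 2)}"

definition qme :: "'v::real_vector super \<Rightarrow> ('v \<Rightarrow> 'v \<Rightarrow> real) \<Rightarrow> 'v ffun \<Rightarrow> bool" where
  "qme W \<tau> m \<longleftrightarrow> hdif W \<tau> (ffexp W (\<lambda>ws. m ws / fls_X)) = (\<lambda>ws. 0)"

definition quantum_Linf :: "'v::real_vector super \<Rightarrow> ('v \<Rightarrow> 'v \<Rightarrow> real) \<Rightarrow> 'v ffun \<Rightarrow> bool" where
  "quantum_Linf V b m \<longleftrightarrow>
     super_space V \<and> odd_sym_form V b \<and>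
     m \<in> hfun (parity_rev V) \<and> even_fun (parity_rev V) m \<and> qme (parity_rev V) (sympl V b) m"

section \<open>Homotopy of Maurer--Cartan elements\<close>

text \<open>An element \<open>A(t) + B(t) dt\<close> of the completed tensor product \<open>\<hh>[W][t, dt]\<close> is a pair \<open>(A, B)\<close>.
  In every weight \<open>\<hh>[W]\<close> is finite dimensional, so \<open>A\<close> and \<open>B\<close> are the functions of \<open>t\<close> all of whose
  coefficients are polynomials.\<close>

type_synonym 'v tdt = "(real \<Rightarrow> 'v ffun) \<times> (real \<Rightarrow> 'v ffun)"

definition poly_path :: "'v::real_vector super \<Rightarrow> (real \<Rightarrow> 'v ffun) \<Rightarrow> bool" where
  "poly_path W A \<longleftrightarrow> (\<forall>t. A t \<in> hfun W) \<and>
     (\<forall>ws g. \<exists>q :: real poly. \<forall>t. fls_nth (A t ws) g = poly q t)"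

definition tderiv :: "(real \<Rightarrow> 'v ffun) \<Rightarrow> real \<Rightarrow> 'v ffun" where
  "tderiv A t = (\<lambda>ws. Abs_fls (\<lambda>g. deriv (\<lambda>u. fls_nth (A u ws) g) t))"

text \<open>The differential \<open>d + \<hbar>\<Delta> + d\<^sub>t\<close> and the bracket, extended so that coefficients in \<open>\<real>[t, dt]\<close> stand
  on the right: \<open>d\<^sub>t (F \<omega>) = (-1)\<^bsup>|F|\<^esup> F d\<omega>\<close>, \<open>[F, G \<omega>] = [F, G] \<omega>\<close> and
  \<open>[F dt, G] = -(-1)\<^bsup>|G|\<^esup> [F, G] dt\<close>.\<close>

definition tdt_dif ::
  "'v::real_vector super \<Rightarrow> ('v \<Rightarrow> 'v \<Rightarrow> real) \<Rightarrow> 'v tdt \<Rightarrow> 'v tdt" where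
  "tdt_dif W \<tau> X = (case X of (A, B) \<Rightarrow>
     (\<lambda>t. hdif W \<tau> (A t),
      \<lambda>t ws. hdif W \<tau> (B t) ws + ffgrade W (tderiv A t) ws))"

definition tdt_bracket ::
  "'v::real_vector super \<Rightarrow> ('v \<Rightarrow> 'v \<Rightarrow> real) \<Rightarrow> 'v tdt \<Rightarrow> 'v tdt \<Rightarrow> 'v tdt" where
  "tdt_bracket W \<tau> X Y = (case X of (A, B) \<Rightarrow> case Y of (C, D) \<Rightarrow>
     (\<lambda>t. bracket W \<tau> (A t) (C t),
      \<lambda>t ws. bracket W \<tau> (A t) (D t) ws - bracket W \<tau> (B t) (ffgrade W (C t)) ws))"

definition tdt_mc :: "'v::real_vector super \<Rightarrow> ('v \<Rightarrow> 'v \<Rightarrow> real) \<Rightarrow> 'v tdt \<Rightarrow> bool" where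
  "tdt_mc W \<tau> X \<longleftrightarrow>
     poly_path W (fst X) \<and> poly_path W (snd X) \<and>
     (\<forall>t. even_fun W (fst X t) \<and> odd_fun W (snd X t)) \<and>
     (\<forall>t ws. fst (tdt_dif W \<tau> X) t ws
              + fls_const (1 / 2) * fst (tdt_bracket W \<tau> X X) t ws = 0) \<and>
     (\<forall>t ws. snd (tdt_dif W \<tau> X) t ws
              + fls_const (1 / 2) * snd (tdt_bracket W \<tau> X X) t ws = 0)"

definition mc_homotopic ::
  "'v::real_vector super \<Rightarrow> ('v \<Rightarrow> 'v \<Rightarrow> real) \<Rightarrow> 'v ffun \<Rightarrow> 'v ffun \<Rightarrow> bool" where
  "mc_homotopic W \<tau> F G \<longleftrightarrow> (\<exists>X. tdt_mc W \<tau> X \<and> fst X 0 = F \<and> fst X 1 = G)"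

definition pullback :: "('v \<Rightarrow> 'h) \<Rightarrow> 'h ffun \<Rightarrow> 'v ffun" where
  "pullback p F = (\<lambda>ws. F (map p ws))"

definition minimal_model ::
  "'v::real_vector super \<Rightarrow> ('v \<Rightarrow> 'v \<Rightarrow> real) \<Rightarrow>
   'h::real_vector super \<Rightarrow> ('h \<Rightarrow> 'h \<Rightarrow> real) \<Rightarrow> ('v \<Rightarrow> 'h) \<Rightarrow> 'v ffun \<Rightarrow> 'h ffun \<Rightarrow> bool" where
  "minimal_model V b H bH p m m' \<longleftrightarrow>
     quantum_Linf H bH m' \<and> mc_homotopic (parity_rev V) (sympl V b) (pullback p m') m"

section \<open>The Gaussian integral over the Lagrangian subspace\<close>

text \<open>The projection of \<open>\<Pi> V\<close> onto \<open>\<Pi> im s\<close> along \<open>\<Pi> im i \<oplus> \<Pi> im d\<close> is \<open>s d\<close>. The quadratic function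
  \<open>w \<mapsto> \<langle>w, d w\<rangle>\<close> has the second Taylor coefficient \<open>2 (-1)\<^bsup>|w\<^sub>1|\<^esup> \<langle>w\<^sub>1, d w\<^sub>2\<rangle>\<close>, \<open>|w\<^sub>1|\<close> being the parity in
  \<open>\<Pi> V\<close>; the sign comes from evaluating the function at \<open>w = \<Sum> \<xi>\<^sub>i \<epsilon>\<^sub>i\<close> with odd coordinates \<open>\<xi>\<^sub>i\<close>.\<close>

definition sigma ::
  "'v::real_vector super \<Rightarrow> ('v \<Rightarrow> 'v \<Rightarrow> real) \<Rightarrow> ('v \<Rightarrow> 'v) \<Rightarrow> 'v ffun" where
  "sigma V b s ws = (case ws of
     [w1, w2] \<Rightarrow> fls_const (2 * b (grade (parity_rev V) (s (dif V w1))) (dif V (s (dif V w2))))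
   | _ \<Rightarrow> 0)"

text \<open>Linear coordinates on \<open>\<Pi> im s\<close> are given by the dual basis. The list \<open>us\<close> holds the even basis
  vectors with the signs \<open>\<epsilon>(x\<^sub>i)\<close>, and \<open>vs\<close> the consecutive pairs of odd basis vectors. The conditions
  on Taylor coefficients say \<open>\<sigma> = \<Sum> \<epsilon>(x\<^sub>i) x\<^sub>i\<^sup>2 - \<Sum> \<xi> \<eta>\<close>: the function \<open>x\<^sup>2\<close> has \<open>\<partial>\<^sub>x \<partial>\<^sub>x x\<^sup>2 = 2\<close>, and
  \<open>-\<xi> \<eta>\<close> has \<open>\<partial>\<^sub>\<eta> \<partial>\<^sub>\<xi> (-\<xi> \<eta>) = -1\<close>. Mixed even-odd coefficients vanish, \<open>\<sigma>\<close> being even.\<close>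

definition gauss_coords ::
  "'v::real_vector super \<Rightarrow> ('v \<Rightarrow> 'v \<Rightarrow> real) \<Rightarrow> ('v \<Rightarrow> 'v) \<Rightarrow>
   ('v \<times> real) list \<Rightarrow> ('v \<times> 'v) list \<Rightarrow> bool" where
  "gauss_coords V b s us vs \<longleftrightarrow>
     (let W = parity_rev V; B = map fst us @ map fst vs @ map snd vs in
       fst ` set us \<subseteq> Ev W \<and> fst ` set vs \<subseteq> Od W \<and> snd ` set vs \<subseteq> Od W \<and>
       distinct B \<and> independent (set B) \<and> span (set B) = range s \<and>
       snd ` set us \<subseteq> {1, -1} \<and>
       (\<forall>j<length us. \<forall>k<length us.
          sigma V b s [fst (us ! j), fst (us ! k)] = (if j = k then fls_const (2 * snd (us ! j)) else 0)) \<and>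
       (\<forall>j<length vs. \<forall>k<length vs.
          sigma V b s [fst (vs ! j), fst (vs ! k)] = 0 \<and>
          sigma V b s [snd (vs ! j), snd (vs ! k)] = 0 \<and>
          sigma V b s [fst (vs ! j), snd (vs ! k)] = (if j = k then -1 else 0)))"

text \<open>\<open>gauss_moment \<epsilon> n\<close> is the integral of \<open>x\<^sup>n exp (-\<epsilon> x\<^sup>2 / 2\<hbar>)\<close>.\<close>

fun gauss_moment :: "real \<Rightarrow> nat \<Rightarrow> real fls" where
  "gauss_moment \<epsilon> 0 = 1"
| "gauss_moment \<epsilon> (Suc 0) = 0"
| "gauss_moment \<epsilon> (Suc (Suc n)) = fls_const (\<epsilon> * real (Suc n)) * fls_X * gauss_moment \<epsilon> n"

text \<open>Integration of \<open>G exp (-\<sigma> / 2\<hbar>)\<close> over one even coordinate \<open>x\<close>, applied to the expansion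
  \<open>G = \<Sum>\<^sub>n x\<^sup>n / n! (\<partial>\<^sub>x)\<^sup>n G |\<^bsub>x = 0\<^esub>\<close>, and over one pair of odd coordinates, applied to
  \<open>G = g\<^sub>0 + \<xi> g\<^sub>1 + \<eta> g\<^sub>2 + \<xi> \<eta> g\<^sub>3\<close>, where \<open>g\<^sub>3 = \<partial>\<^sub>\<eta> \<partial>\<^sub>\<xi> G\<close>. Each leaves a function of the remaining coordinates.\<close>

definition int_even :: "'v \<times> real \<Rightarrow> 'v ffun \<Rightarrow> 'v ffun" where
  "int_even u G = (\<lambda>ws. \<Sum>n. fls_const (1 / fact n) * gauss_moment (snd u) n *
                               G (replicate n (fst u) @ ws))"

definition int_odd :: "'v \<times> 'v \<Rightarrow> 'v ffun \<Rightarrow> 'v ffun" where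
  "int_odd v G = (\<lambda>ws. G ws + 2 * fls_X * G (fst v # snd v # ws))"

text \<open>The remaining arguments are taken in \<open>\<Pi> im i\<close>, so that \<open>F\<close> is only ever evaluated on
  \<open>\<Pi> im i \<oplus> \<Pi> im s\<close>. The result does not depend on the coordinates.\<close>

definition gauss_int ::
  "'v::real_vector super \<Rightarrow> ('v \<Rightarrow> 'v \<Rightarrow> real) \<Rightarrow> ('h \<Rightarrow> 'v) \<Rightarrow> ('v \<Rightarrow> 'v) \<Rightarrow> 'v ffun \<Rightarrow> 'h ffun" where
  "gauss_int V b i s F = (\<lambda>hs. case (SOME (us, vs). gauss_coords V b s us vs) of
     (us, vs) \<Rightarrow> foldr int_even us (foldr int_odd vs F) (map i hs))"

definition rho ::
  "'v::real_vector super \<Rightarrow> ('v \<Rightarrow> 'v \<Rightarrow> real) \<Rightarrow> 'h::real_vector super \<Rightarrow>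
   ('h \<Rightarrow> 'v) \<Rightarrow> ('v \<Rightarrow> 'v) \<Rightarrow> 'v ffun \<Rightarrow> 'h ffun" where
  "rho V b H i s m = (\<lambda>hs. fls_X * ffln (parity_rev H)
     (gauss_int V b i s (ffexp (parity_rev V) (\<lambda>ws. m ws / fls_X))) hs)"

end

theory Submission
  imports Defs "HOL-Library.Function_Algebras"
begin

text \<open>
  Let \<open>P\<close> be the propagator, the even bivector on \<open>\<L>\<^sub>s\<close> inverse to \<open>\<sigma>\<close>, acting on functions as a constant
  coefficient operator of order two. By Wick's theorem the Gaussian integral of \<open>F\<close> is the restriction to
  \<open>H(W)\<close> of \<open>U\<^sub>1 F\<close>, where \<open>U\<^sub>\<tau> F\<close> solves the heat equation \<open>d/d\<tau> U\<^sub>\<tau> F = \<hbar> P U\<^sub>\<tau> F\<close> with \<open>U\<^sub>0 F = F\<close>. Since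
  \<open>[d, P]\<close> is the part \<open>\<Delta>\<^sub>\<bottom>\<close> of the Laplacian in the directions complementary to \<open>H(W)\<close>, the function
  \<open>U\<^sub>\<tau> e\<^bsup>m/\<hbar>\<^esup>\<close> is annihilated by \<open>d + \<hbar>\<Delta> - \<tau>\<hbar>\<Delta>\<^sub>\<bottom>\<close>; at \<open>\<tau> = 1\<close> this restricts to the master equation on \<open>H(W)\<close>.

  The logarithm \<open>N\<^sub>\<tau> = \<hbar> log U\<^sub>\<tau> e\<^bsup>m/\<hbar>\<^esup>\<close> satisfies \<open>N' = \<hbar> P N + P(N, N)\<close>, an equation without negative powers of
  \<open>\<hbar>\<close>, so \<open>N\<^sub>\<tau>\<close> has none either. With \<open>pr = i p\<close> and \<open>\<phi>\<^sub>t = pr + t (1 - pr)\<close>, the path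
  \<open>A\<^sub>t = \<phi>\<^sub>t\<^sup>* N\<^bsub>1-t\<^sup>2\<^esub>\<close> runs from \<open>pr\<^sup>* N\<^sub>1 = p\<^sup>* \<rho>(m)\<close> to \<open>m\<close>. It solves the master equation for every \<open>t\<close>, because
  rescaling by \<open>t\<close> multiplies \<open>\<Delta>\<^sub>\<bottom>\<close> by \<open>t\<^sup>2\<close>, and it becomes a homotopy with the \<open>dt\<close>-component
  \<open>B\<^sub>t\<close> obtained by applying to \<open>N\<^bsub>1-t\<^sup>2\<^esub>\<close> the derivation along \<open>\<phi>\<^sub>t\<^sup>*\<close> induced by \<open>s\<close>.
\<close>

section \<open>The algebra of formal functions\<close>

text \<open>The time \<open>1 - t^2\<close> is forced: at time \<open>\<tau>\<close> the
  annihilating operator carries the complementary Laplacian with factor \<open>1 - \<tau>\<close>,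
  and rescaling by \<open>t\<close> produces \<open>t^2\<close>. The derivative of
  \<open>\<phi>_t\<close> is \<open>1 - pr = d s + s d\<close>, so the derivation induced by
  \<open>s\<close> is a Cartan homotopy for the motion of \<open>\<phi>_t\<close>. Its commutator
  with \<open>\<hbar>\<Delta>\<close> contracts \<open>s\<close> into the dual basis and returns, up
  to sign, \<open>2 t \<hbar> P\<close>, which is the motion of the time. A single derivation thus
  accounts for both parts of the derivative of the path. The quadratic equations for the path are
  never attacked directly. They are read off from linear ones for exponentials, an exponential being
  invertible. The obstacle is finiteness. The weight \<open>2 g + n\<close> is preserved by
  \<open>\<hbar> P\<close>, so it does not bound the number of propagators that contribute to a
  given coefficient; the order \<open>3 g + n\<close> does. It also makes every coefficient
  polynomial in the time, as the notion of homotopy demands.\<close>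

text \<open>As functions are encoded by their Taylor coefficients, inserting a first argument is differentiation
  in its direction.\<close>

definition dd :: "'v \<Rightarrow> 'v ffun \<Rightarrow> 'v ffun" where
  "dd w F = (\<lambda>ws. F (w # ws))"

definition sc :: "real fls \<Rightarrow> 'v ffun \<Rightarrow> 'v ffun" where
  "sc c F = (\<lambda>ws. c * F ws)"

lemma dd_apply: "dd w F ws = F (w # ws)"
  by (simp add: dd_def)

lemma sc_apply [simp]: "sc c F ws = c * F ws"
  by (simp add: sc_def)

lemma dd_simps [simp]:
  "dd w (F + G) = dd w F + dd w G" "dd w (F - G) = dd w F - dd w G"
  "dd w (- F) = - dd w F" "dd w 0 = 0" "dd w (sc c F) = sc c (dd w F)"
  by (auto simp: dd_def fun_eq_iff)

lemma sc_simps [simp]: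
  "sc c (F + G) = sc c F + sc c G" "sc c (F - G) = sc c F - sc c G" "sc c (- F) = - sc c F"
  "sc c 0 = 0" "sc 0 F = 0" "sc 1 F = F" "sc c (sc c' F) = sc (c * c') F"
  by (auto simp: fun_eq_iff algebra_simps)

lemma sc_neg1: "sc (-1) F = - F"
  by (auto simp: fun_eq_iff)

lemma sc_add_left: "sc (c + c') F = sc c F + sc c' F"
  by (auto simp: fun_eq_iff algebra_simps)

lemma sum_fun_apply: "(\<Sum>i\<in>A. f i) x = (\<Sum>i\<in>A. f i x)"
  by (induction A rule: infinite_finite_induct) auto

section \<open>Coefficients of Laurent series and support conditions\<close>

lemma fls_mult_nth_nz:
  fixes f g :: "real fls"
  assumes "fls_nth (f * g) n \<noteq> 0"
  obtains i j where "fls_nth f i \<noteq> 0" "fls_nth g j \<noteq> 0" "i + j = n"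
proof -
  have "\<exists>i\<in>{fls_subdegree f..n - fls_subdegree g}. fls_nth f i * fls_nth g (n - i) \<noteq> 0"
  proof (rule ccontr)
    assume "\<not> ?thesis"
    then have "(\<Sum>i=fls_subdegree f..n - fls_subdegree g. fls_nth f i * fls_nth g (n - i)) = 0"
      by (intro sum.neutral) auto
    with assms show False by (simp add: fls_times_nth(2))
  qed
  then obtain i where "fls_nth f i \<noteq> 0" "fls_nth g (n - i) \<noteq> 0" by auto
  then show ?thesis using that[of i "n - i"] by simp
qed

lemma fls_X_mult_nth [simp]: "fls_nth (fls_X * f) n = fls_nth f (n - 1)" for f :: "real fls"
  by (simp add: fls_X_times_conv_shift)

lemma fls_const_mult_nth [simp]: "fls_nth (fls_const c * f) n = c * fls_nth f n" for f :: "real fls"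
  by simp

text \<open>\<open>R g n\<close> restricts the powers \<open>g\<close> of \<hbar> that may occur in
  Taylor coefficients of order \<open>n\<close>. Weight bounds and the absence of negative powers
  are instances. The order is an integer, so that derivatives can shift it without
  truncation.\<close>

definition supp_in :: "(int \<Rightarrow> int \<Rightarrow> bool) \<Rightarrow> 'v ffun \<Rightarrow> bool" where
  "supp_in R F \<longleftrightarrow> (\<forall>ws g. fls_nth (F ws) g \<noteq> 0 \<longrightarrow> R g (int (length ws)))"

lemma supp_inD: "supp_in R F \<Longrightarrow> fls_nth (F ws) g \<noteq> 0 \<Longrightarrow> R g (int (length ws))"
  by (auto simp: supp_in_def)

lemma supp_in_mono: "supp_in R F \<Longrightarrow> (\<And>g n. n \<ge> 0 \<Longrightarrow> R g n \<Longrightarrow> S g n) \<Longrightarrow> supp_in S F"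
  unfolding supp_in_def by (metis of_nat_0_le_iff)

lemma supp_in_add: "supp_in R F \<Longrightarrow> supp_in R G \<Longrightarrow> supp_in R (F + G)"
  unfolding supp_in_def by (metis add.right_neutral fls_plus_nth plus_fun_apply)

lemma supp_in_diff: "supp_in R F \<Longrightarrow> supp_in R G \<Longrightarrow> supp_in R (F - G)"
  unfolding supp_in_def by (metis diff_zero fls_minus_nth minus_apply)

lemma supp_in_zero [simp]: "supp_in R 0"
  by (auto simp: supp_in_def)

lemma supp_in_sum: "(\<And>i. i \<in> A \<Longrightarrow> supp_in R (f i)) \<Longrightarrow> supp_in R (\<Sum>i\<in>A. f i)"
  by (induction A rule: infinite_finite_induct) (auto intro: supp_in_add)

lemma supp_in_const: "supp_in R F \<Longrightarrow> supp_in R (sc (fls_const c) F)"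
  unfolding supp_in_def by (auto simp del: fls_const_mult_nth)

lemma supp_in_X: "supp_in R F \<Longrightarrow> supp_in (\<lambda>g n. R (g - 1) n) (sc fls_X F)"
  unfolding supp_in_def by auto

lemma supp_in_dd: "supp_in R F \<Longrightarrow> supp_in (\<lambda>g n. R g (n + 1)) (dd w F)"
  unfolding supp_in_def dd_def
proof (intro allI impI)
  fix ws g assume *: "\<forall>ws g. fls_nth (F ws) g \<noteq> 0 \<longrightarrow> R g (int (length ws))" and "fls_nth (F (w # ws)) g \<noteq> 0"
  then have "R g (int (length (w # ws)))" by blast
  then show "R g (int (length ws) + 1)" by (simp add: add.commute)
qed

lemma supp_in_ffgrade: "supp_in R F \<Longrightarrow> supp_in R (ffgrade W F)"
  unfolding supp_in_def ffgrade_def by (metis length_map)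

text \<open>Each argument is spent on one of the two factors, whose bound is then replaced by that
  of its derivative. The induction therefore runs over all \<open>R\<close> and \<open>S\<close> at
  once.\<close>

lemma taylor_mult_supp:
  assumes "fls_nth (taylor_mult W ws F G) g \<noteq> 0" "supp_in R F" "supp_in S G"
  shows "\<exists>g1 n1 g2 n2. n1 \<ge> 0 \<and> n2 \<ge> 0 \<and> R g1 n1 \<and> S g2 n2 \<and> g = g1 + g2 \<and> int (length ws) = n1 + n2"
  using assms
proof (induction ws arbitrary: F G R S)
  case Nil
  from Nil(1) obtain i j where "fls_nth (F []) i \<noteq> 0" "fls_nth (G []) j \<noteq> 0" "i + j = g"
    by (auto elim: fls_mult_nth_nz)
  with supp_inD[OF Nil(2), of "[]" i] supp_inD[OF Nil(3), of "[]" j] show ?case by force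
next
  case (Cons w ws)
  have split: "fls_nth (taylor_mult W ws (dd w F) G) g \<noteq> 0 \<or>
      fls_nth (taylor_mult W ws F (dd (ev_proj W w) G)) g \<noteq> 0 \<or>
      fls_nth (taylor_mult W ws (ffgrade W F) (dd (od_proj W w) G)) g \<noteq> 0"
    using Cons.prems(1) by (auto simp: dd_def)
  have R: "supp_in R (ffgrade W F)" using Cons.prems(2) by (rule supp_in_ffgrade)
  have A: "\<exists>g1 n1 g2 n2. n1 \<ge> 0 \<and> n2 \<ge> 0 \<and> R g1 n1 \<and> S g2 n2 \<and> g = g1 + g2 \<and> int (length (w # ws)) = n1 + n2"
    if "n1 \<ge> 0 \<and> n2 \<ge> 0 \<and> R g1 (n1 + 1) \<and> S g2 n2 \<and> g = g1 + g2 \<and> int (length ws) = n1 + n2"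
    for n1 n2 g1 g2
    using that by (intro exI[of _ g1] exI[of _ "n1+1"] exI[of _ g2] exI[of _ n2]) auto
  have B: "\<exists>g1 n1 g2 n2. n1 \<ge> 0 \<and> n2 \<ge> 0 \<and> R g1 n1 \<and> S g2 n2 \<and> g = g1 + g2 \<and> int (length (w # ws)) = n1 + n2"
    if "n1 \<ge> 0 \<and> n2 \<ge> 0 \<and> R g1 n1 \<and> S g2 (n2+1) \<and> g = g1 + g2 \<and> int (length ws) = n1 + n2"
    for n1 n2 g1 g2
    using that by (intro exI[of _ g1] exI[of _ "n1"] exI[of _ g2] exI[of _ "n2 + 1"]) auto
  from split show ?case
  proof (elim disjE)
    assume "fls_nth (taylor_mult W ws (dd w F) G) g \<noteq> 0"
    from Cons.IH[OF this supp_in_dd[OF Cons.prems(2)] Cons.prems(3)] show ?case using A by blast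
  next
    assume "fls_nth (taylor_mult W ws F (dd (ev_proj W w) G)) g \<noteq> 0"
    from Cons.IH[OF this Cons.prems(2) supp_in_dd[OF Cons.prems(3)]] show ?case using B by blast
  next
    assume "fls_nth (taylor_mult W ws (ffgrade W F) (dd (od_proj W w) G)) g \<noteq> 0"
    from Cons.IH[OF this R supp_in_dd[OF Cons.prems(3)]] show ?case using B by blast
  qed
qed

lemma supp_in_mult:
  assumes "supp_in R F" "supp_in S G"
    and "\<And>g1 n1 g2 n2. n1 \<ge> 0 \<Longrightarrow> n2 \<ge> 0 \<Longrightarrow> R g1 n1 \<Longrightarrow> S g2 n2 \<Longrightarrow> T (g1 + g2) (n1 + n2)"
  shows "supp_in T (ffmult W F G)"
  unfolding supp_in_def ffmult_def
  using taylor_mult_supp[OF _ assms(1,2)] assms(3) by metis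

section \<open>Parity projections and the grading involution\<close>

locale super_sp =
  fixes W :: "'v::real_vector super"
  assumes sp: "super_space W"
begin

abbreviation "ev \<equiv> ev_proj W"
abbreviation "od \<equiv> od_proj W"
abbreviation "gr \<equiv> grade W"
abbreviation "gm \<equiv> ffgrade W"
abbreviation mult (infixl "\<odot>" 70) where "F \<odot> G \<equiv> ffmult W F G"
abbreviation "ff \<equiv> formal_fun W"

lemma sub_Ev: "subspace (Ev W)" and sub_Od: "subspace (Od W)"
  using sp by (auto simp: super_space_def)

lemma Ev_Od_0: "x \<in> Ev W \<Longrightarrow> x \<in> Od W \<Longrightarrow> x = 0"
  using sp unfolding super_space_def by blast

lemma ev_od: "ev v \<in> Ev W \<and> v - ev v \<in> Od W"
proof -
  obtain a c where ac: "a \<in> Ev W" "c \<in> Od W" "v = a + c"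
    using sp unfolding super_space_def by metis
  show ?thesis unfolding ev_proj_def
  proof (rule theI)
    show "a \<in> Ev W \<and> v - a \<in> Od W" using ac by simp
    then have v: "v - a \<in> Od W" by simp
    fix a' assume a': "a' \<in> Ev W \<and> v - a' \<in> Od W"
    have "a' - a \<in> Ev W" using a' ac sub_Ev by (simp add: subspace_diff)
    moreover have "(v - a) - (v - a') \<in> Od W" using a' v sub_Od by (blast intro: subspace_diff)
    then have "a' - a \<in> Od W" by simp
    ultimately show "a' = a" using Ev_Od_0[of "a' - a"] by simp
  qed
qed

lemma ev_in [simp]: "ev v \<in> Ev W" and od_in [simp]: "od v \<in> Od W"
  using ev_od by (auto simp: od_proj_def)

lemma ev_plus_od: "ev v + od v = v"
  by (simp add: od_proj_def)

lemma ev_eqI: "a \<in> Ev W \<Longrightarrow> c \<in> Od W \<Longrightarrow> ev (a + c) = a"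
proof -
  assume a: "a \<in> Ev W" "c \<in> Od W"
  have "ev (a + c) - a \<in> Ev W" using a sub_Ev by (simp add: subspace_diff)
  moreover have "c - (a + c - ev (a + c)) \<in> Od W"
    using a(2) conjunct2[OF ev_od, of "a + c"] sub_Od by (blast intro: subspace_diff)
  ultimately show ?thesis using Ev_Od_0[of "ev (a + c) - a"] by simp
qed

lemma od_eqI: "a \<in> Ev W \<Longrightarrow> c \<in> Od W \<Longrightarrow> od (a + c) = c"
  by (simp add: od_proj_def ev_eqI)

lemma zero_in [simp]: "0 \<in> Ev W" "0 \<in> Od W"
  using sub_Ev sub_Od by (auto simp: subspace_0)

lemma ev_Ev [simp]: "w \<in> Ev W \<Longrightarrow> ev w = w" and od_Ev [simp]: "w \<in> Ev W \<Longrightarrow> od w = 0"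
  and ev_Od [simp]: "w \<in> Od W \<Longrightarrow> ev w = 0" and od_Od [simp]: "w \<in> Od W \<Longrightarrow> od w = w"
  using ev_eqI[of w 0] ev_eqI[of 0 w] od_eqI[of w 0] od_eqI[of 0 w] by auto

lemma linear_ev: "linear ev"
proof
  fix x y r
  have "ev ((ev x + ev y) + (od x + od y)) = ev x + ev y"
    by (intro ev_eqI) (auto intro: subspace_add sub_Ev sub_Od)
  then show "ev (x + y) = ev x + ev y" by (simp add: od_proj_def)
  have "ev (r *\<^sub>R ev x + r *\<^sub>R od x) = r *\<^sub>R ev x"
    by (intro ev_eqI) (auto intro: subspace_scale sub_Ev sub_Od)
  then show "ev (r *\<^sub>R x) = r *\<^sub>R ev x" by (simp add: od_proj_def algebra_simps)
qed

lemma linear_od: "linear od"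
  unfolding od_proj_def by (intro linear_compose_sub linear_ev linear_ident[unfolded id_def])

lemma linear_gr: "linear gr"
  unfolding grade_def by (intro linear_compose_sub linear_ev linear_od)

lemmas ev_add = linear_add[OF linear_ev] and od_add = linear_add[OF linear_od]
  and gr_add = linear_add[OF linear_gr] and ev_scale = linear_scale[OF linear_ev]
  and od_scale = linear_scale[OF linear_od] and gr_scale = linear_scale[OF linear_gr]

lemma gr_Ev [simp]: "w \<in> Ev W \<Longrightarrow> gr w = w" and gr_Od [simp]: "w \<in> Od W \<Longrightarrow> gr w = - w"
  by (auto simp: grade_def)

lemma gr_in_Ev [simp]: "w \<in> Ev W \<Longrightarrow> gr w \<in> Ev W" and gr_in_Od [simp]: "w \<in> Od W \<Longrightarrow> gr w \<in> Od W"
  using sub_Od by (auto simp: subspace_neg)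

lemma gr_split: "gr w = ev w - od w"
  by (simp add: grade_def)

lemma gr_gr [simp]: "gr (gr w) = w"
proof -
  have "gr (ev w - od w) = ev w + od w"
    using linear_diff[OF linear_gr, of "ev w" "od w"] by simp
  then show ?thesis by (simp add: gr_split[symmetric] ev_plus_od)
qed

lemma ev_gr [simp]: "ev (gr w) = ev w" and od_gr [simp]: "od (gr w) = - od w"
  by (simp_all add: gr_split linear_diff[OF linear_ev] linear_diff[OF linear_od])

lemma hpart_0: "hpart W 0 = Ev W"
  by (auto simp: hpart_def)

lemma lin_dif: "linear (dif W)" and dif_dif [simp]: "dif W (dif W v) = 0"
  using sp by (auto simp: super_space_def)

lemma dif_Ev: "w \<in> Ev W \<Longrightarrow> dif W w \<in> Od W" and dif_Od: "w \<in> Od W \<Longrightarrow> dif W w \<in> Ev W"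
proof -
  have h: "dif W ` hpart W p \<subseteq> hpart W (Suc p)" for p using sp by (simp add: super_space_def)
  show "w \<in> Ev W \<Longrightarrow> dif W w \<in> Od W" "w \<in> Od W \<Longrightarrow> dif W w \<in> Ev W"
    using h[of 0] h[of 1] by (auto simp: hpart_def)
qed

end

section \<open>Symmetry laws of formal functions and closure properties\<close>

lemma formal_funD:
  assumes "formal_fun W F"
  shows "F (xs @ (u + v) # ys) = F (xs @ u # ys) + F (xs @ v # ys)"
    and "F (xs @ (a *\<^sub>R u) # ys) = fls_const a * F (xs @ u # ys)"
    and "u \<in> hpart W p \<Longrightarrow> v \<in> hpart W q \<Longrightarrow> F (xs @ u # v # ys) = (-1) ^ (p * q) * F (xs @ v # u # ys)"
  using assms unfolding formal_fun_def by blast+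

context super_sp
begin

lemma ff_add: "ff F \<Longrightarrow> F (xs @ (u + v) # ys) = F (xs @ u # ys) + F (xs @ v # ys)"
  and ff_scale: "ff F \<Longrightarrow> F (xs @ (a *\<^sub>R u) # ys) = fls_const a * F (xs @ u # ys)"
  by (rule formal_funD; assumption)+

lemma ff_zero: "ff F \<Longrightarrow> F (xs @ 0 # ys) = 0"
  using ff_scale[of F xs 0 0 ys] by simp

lemma ff_neg: "ff F \<Longrightarrow> F (xs @ (- u) # ys) = - F (xs @ u # ys)"
  using ff_scale[of F xs "-1" u ys] by simp

lemma ff_diff: "ff F \<Longrightarrow> F (xs @ (u - v) # ys) = F (xs @ u # ys) - F (xs @ v # ys)"
  using ff_add[of F xs u "- v" ys] ff_neg[of F xs v ys] by simp

lemmas ff_add0 = ff_add[where xs="[]", simplified]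
  and ff_scale0 = ff_scale[where xs="[]", simplified]
  and ff_zero0 = ff_zero[where xs="[]", simplified]
  and ff_neg0 = ff_neg[where xs="[]", simplified]
  and ff_diff0 = ff_diff[where xs="[]", simplified]

text \<open>The vector \<open>v\<close> is split into its homogeneous parts; an even
  \<open>u\<close> passes either of them without a sign.\<close>

lemma ff_swap_Ev: assumes "ff F" "u \<in> Ev W" shows "F (xs @ u # v # ys) = F (xs @ v # u # ys)"
proof -
  have h: "F (xs @ u # v # ys) = F (xs @ v # u # ys)" if "v \<in> hpart W q" for v q
    using formal_funD(3)[OF assms(1), of u 0 v q xs ys] that assms(2) by (simp add: hpart_0)
  have "F (xs @ u # (ev v + od v) # ys) = F (xs @ u # ev v # ys) + F (xs @ u # od v # ys)"
    using ff_add[OF assms(1), of "xs @ [u]" "ev v" "od v" ys] by simp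
  also have "\<dots> = F (xs @ ev v # u # ys) + F (xs @ od v # u # ys)"
    using h[of "ev v" 0] h[of "od v" 1] by (simp add: hpart_def)
  also have "\<dots> = F (xs @ (ev v + od v) # u # ys)"
    using ff_add[OF assms(1), of xs "ev v" "od v" "u # ys"] by simp
  finally show ?thesis by (simp add: ev_plus_od)
qed

lemma ff_swap_Od: "ff F \<Longrightarrow> u \<in> Od W \<Longrightarrow> v \<in> Od W \<Longrightarrow> F (xs @ u # v # ys) = - F (xs @ v # u # ys)"
  using formal_funD(3)[of W F u 1 v 1 xs ys] by (simp add: hpart_def)

text \<open>The sign \<open>(-1) ^ (p * q)\<close> is trivial as soon as one of the vectors is even,
  so the rule for an even against an arbitrary vector and the rule for two odd ones cover all
  cases.\<close>

lemma ffI: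
  assumes "\<And>xs ys u v. F (xs @ (u + v) # ys) = F (xs @ u # ys) + F (xs @ v # ys)"
    and "\<And>xs ys a u. F (xs @ (a *\<^sub>R u) # ys) = fls_const a * F (xs @ u # ys)"
    and ev: "\<And>xs ys u v. u \<in> Ev W \<Longrightarrow> F (xs @ u # v # ys) = F (xs @ v # u # ys)"
    and oo: "\<And>xs ys u v. u \<in> Od W \<Longrightarrow> v \<in> Od W \<Longrightarrow> F (xs @ u # v # ys) = - F (xs @ v # u # ys)"
  shows "ff F"
  unfolding formal_fun_def
proof (intro conjI allI ballI)
  fix xs ys :: "'v list" and p q :: nat and u v :: 'v
  assume uv: "u \<in> hpart W p" "v \<in> hpart W q"
  show "F (xs @ u # v # ys) = (- 1) ^ (p * q) * F (xs @ v # u # ys)"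
  proof (cases "even p \<or> even q")
    case True
    then have "F (xs @ u # v # ys) = F (xs @ v # u # ys)"
      using uv ev[of u xs v ys] ev[of v xs u ys] unfolding hpart_def by metis
    moreover have "(- 1) ^ (p * q) = (1 :: real fls)" using True by auto
    ultimately show ?thesis by (metis mult_1)
  next
    case False
    then have "F (xs @ u # v # ys) = - F (xs @ v # u # ys)"
      using uv oo[of u v xs ys] unfolding hpart_def by metis
    moreover have "(- 1) ^ (p * q) = (- 1 :: real fls)" using False by auto
    ultimately show ?thesis by (metis mult_minus1)
  qed
qed (rule assms)+

text \<open>A coinduction principle: the arguments in front of a position are stripped off by
  differentiating, so in a class closed under derivatives the laws need only be checked at the head
  of the list.\<close>

lemma formal_bisim:
  assumes "P F"
    and nil: "\<And>F ys u v. P F \<Longrightarrow> F ((u + v) # ys) = F (u # ys) + F (v # ys)"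
    "\<And>F ys a u. P F \<Longrightarrow> F ((a *\<^sub>R u) # ys) = fls_const a * F (u # ys)"
    "\<And>F ys u v. P F \<Longrightarrow> u \<in> Ev W \<Longrightarrow> F (u # v # ys) = F (v # u # ys)"
    "\<And>F ys u v. P F \<Longrightarrow> u \<in> Od W \<Longrightarrow> v \<in> Od W \<Longrightarrow> F (u # v # ys) = - F (v # u # ys)"
    and step: "\<And>F w. P F \<Longrightarrow> P (dd w F)"
  shows "ff F"
proof (rule ffI)
  show "F (xs @ (u + v) # ys) = F (xs @ u # ys) + F (xs @ v # ys)" for xs ys u v
    using assms(1)
  proof (induction xs arbitrary: F)
    case (Cons x xs)
    from Cons.IH[OF step[OF Cons.prems, of x]] show ?case by (simp only: dd_def append_Cons)
  next
    case Nil show ?case unfolding append_Nil by (rule nil(1)[OF Nil.prems])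
  qed
  show "F (xs @ (a *\<^sub>R u) # ys) = fls_const a * F (xs @ u # ys)" for xs ys a u
    using assms(1)
  proof (induction xs arbitrary: F)
    case (Cons x xs)
    from Cons.IH[OF step[OF Cons.prems, of x]] show ?case by (simp only: dd_def append_Cons)
  next
    case Nil show ?case unfolding append_Nil by (rule nil(2)[OF Nil.prems])
  qed
  show "F (xs @ u # v # ys) = F (xs @ v # u # ys)" if "u \<in> Ev W" for xs ys u v
    using assms(1)
  proof (induction xs arbitrary: F)
    case (Cons x xs)
    from Cons.IH[OF step[OF Cons.prems, of x]] show ?case by (simp only: dd_def append_Cons)
  next
    case Nil show ?case unfolding append_Nil by (rule nil(3)[OF Nil.prems that])
  qed
  show "F (xs @ u # v # ys) = - F (xs @ v # u # ys)" if "u \<in> Od W" "v \<in> Od W" for xs ys u v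
    using assms(1)
  proof (induction xs arbitrary: F)
    case (Cons x xs)
    from Cons.IH[OF step[OF Cons.prems, of x]] show ?case by (simp only: dd_def append_Cons)
  next
    case Nil show ?case unfolding append_Nil by (rule nil(4)[OF Nil.prems that])
  qed
qed

lemma ff_dd: assumes "ff F" shows "ff (dd w F)"
proof (rule ffI; unfold dd_def)
  fix xs ys u v
  show "F (w # xs @ (u + v) # ys) = F (w # xs @ u # ys) + F (w # xs @ v # ys)"
    using ff_add[OF assms, of "w # xs"] by simp
  show "F (w # xs @ (a *\<^sub>R u) # ys) = fls_const a * F (w # xs @ u # ys)" for a
    using ff_scale[OF assms, of "w # xs"] by simp
  show "F (w # xs @ u # v # ys) = F (w # xs @ v # u # ys)" if "u \<in> Ev W"
    using ff_swap_Ev[OF assms that, of "w # xs" v ys] unfolding append_Cons .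
  show "F (w # xs @ u # v # ys) = - F (w # xs @ v # u # ys)" if "u \<in> Od W" "v \<in> Od W"
    using ff_swap_Od[OF assms that, of "w # xs" ys] unfolding append_Cons .
qed

lemma ff_plus: assumes "ff F" "ff G" shows "ff (F + G)"
proof (rule ffI; unfold plus_fun_apply)
  fix xs ys u v
  show "F (xs @ (u + v) # ys) + G (xs @ (u + v) # ys) =
      F (xs @ u # ys) + G (xs @ u # ys) + (F (xs @ v # ys) + G (xs @ v # ys))"
    by (simp add: ff_add assms)
  show "F (xs @ a *\<^sub>R u # ys) + G (xs @ a *\<^sub>R u # ys) = fls_const a * (F (xs @ u # ys) + G (xs @ u # ys))" for a
    by (simp add: ff_scale assms distrib_left)
  show "F (xs @ u # v # ys) + G (xs @ u # v # ys) = F (xs @ v # u # ys) + G (xs @ v # u # ys)" if "u \<in> Ev W"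
    by (intro arg_cong2[where f=plus] ff_swap_Ev assms that)
  show "F (xs @ u # v # ys) + G (xs @ u # v # ys) = - (F (xs @ v # u # ys) + G (xs @ v # u # ys))"
    if "u \<in> Od W" "v \<in> Od W"
    unfolding minus_add_distrib by (intro arg_cong2[where f=plus] ff_swap_Od assms that)
qed

lemma ff_sc: assumes "ff F" shows "ff (sc c F)"
proof (rule ffI; unfold sc_apply)
  fix xs ys u v
  show "c * F (xs @ (u + v) # ys) = c * F (xs @ u # ys) + c * F (xs @ v # ys)"
    by (simp add: ff_add assms distrib_left)
  show "c * F (xs @ (a *\<^sub>R u) # ys) = fls_const a * (c * F (xs @ u # ys))" for a
    by (simp add: ff_scale assms)
  show "c * F (xs @ u # v # ys) = c * F (xs @ v # u # ys)" if "u \<in> Ev W"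
    by (intro arg_cong2[where f=times] refl ff_swap_Ev assms that)
  show "c * F (xs @ u # v # ys) = - (c * F (xs @ v # u # ys))" if "u \<in> Od W" "v \<in> Od W"
    unfolding mult_minus_right[symmetric] by (intro arg_cong2[where f=times] refl ff_swap_Od assms that)
qed

lemma ff_uminus: "ff F \<Longrightarrow> ff (- F)"
  using ff_sc[of F "-1"] by (simp add: sc_neg1)

lemma ff_minus: "ff F \<Longrightarrow> ff G \<Longrightarrow> ff (F - G)"
  using ff_plus[of F "- G"] ff_uminus[of G] by simp

lemma ff_0: "ff 0"
  by (rule ffI) simp_all

lemma ff_sum: "(\<And>i. i \<in> A \<Longrightarrow> ff (f i)) \<Longrightarrow> ff (\<Sum>i\<in>A. f i)"
  by (induction A rule: infinite_finite_induct) (auto intro: ff_plus ff_0)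

lemma dd_add_vec: "ff F \<Longrightarrow> dd (u + v) F = dd u F + dd v F"
  and dd_scale_vec: "ff F \<Longrightarrow> dd (a *\<^sub>R u) F = sc (fls_const a) (dd u F)"
  and dd_zero_vec: "ff F \<Longrightarrow> dd 0 F = 0"
  and dd_neg_vec: "ff F \<Longrightarrow> dd (- u) F = - dd u F"
  and dd_diff_vec: "ff F \<Longrightarrow> dd (u - v) F = dd u F - dd v F"
  by (auto simp: dd_def fun_eq_iff ff_add0 ff_scale0 ff_zero0 ff_neg0 ff_diff0)

lemma ff_gm: assumes "ff F" shows "ff (gm F)"
proof (rule ffI; unfold ffgrade_def map_append list.map)
  fix xs ys u v
  let ?x = "map gr xs" and ?y = "map gr ys"
  show "F (?x @ gr (u + v) # ?y) = F (?x @ gr u # ?y) + F (?x @ gr v # ?y)"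
    unfolding gr_add by (rule ff_add[OF assms])
  show "F (?x @ gr (a *\<^sub>R u) # ?y) = fls_const a * F (?x @ gr u # ?y)" for a
    unfolding gr_scale by (rule ff_scale[OF assms])
  show "F (?x @ gr u # gr v # ?y) = F (?x @ gr v # gr u # ?y)" if "u \<in> Ev W"
    using that by (intro ff_swap_Ev assms gr_in_Ev)
  show "F (?x @ gr u # gr v # ?y) = - F (?x @ gr v # gr u # ?y)" if "u \<in> Od W" "v \<in> Od W"
    using that by (intro ff_swap_Od assms gr_in_Od)
qed

lemma gm_gm [simp]: "gm (gm F) = F"
  by (simp add: ffgrade_def comp_def)

lemma gm_simps [simp]: "gm (F + G) = gm F + gm G" "gm (F - G) = gm F - gm G" "gm (- F) = - gm F"
  "gm 0 = 0" "gm (sc c F) = sc c (gm F)"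
  by (auto simp: ffgrade_def fun_eq_iff)

lemma gm_dd: "gm (dd w F) = dd (gr w) (gm F)"
  by (auto simp: ffgrade_def dd_def)

lemma gm_nil: "gm F [] = F []"
  by (simp add: ffgrade_def)

section \<open>The supercommutative product\<close>

lemma mult_nil: "(F \<odot> G) [] = F [] * G []"
  by (simp add: ffmult_def)

lemma mult_dd: "dd w (F \<odot> G) = dd w F \<odot> G + F \<odot> dd (ev w) G + gm F \<odot> dd (od w) G"
  by (auto simp: ffmult_def dd_def)

lemma mult_cons: "(F \<odot> G) (w # ws) = (dd w F \<odot> G) ws + (F \<odot> dd (ev w) G) ws + (gm F \<odot> dd (od w) G) ws"
  by (auto simp: ffmult_def dd_def)

lemma mult_add_left: "(F + G) \<odot> K = F \<odot> K + G \<odot> K"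
proof
  show "((F + G) \<odot> K) ws = (F \<odot> K + G \<odot> K) ws" for ws
    by (induction ws arbitrary: F G K) (auto simp: mult_nil mult_cons algebra_simps)
qed

lemma mult_add_right: "K \<odot> (F + G) = K \<odot> F + K \<odot> G"
proof
  show "(K \<odot> (F + G)) ws = (K \<odot> F + K \<odot> G) ws" for ws
    by (induction ws arbitrary: F G K) (auto simp: mult_nil mult_cons algebra_simps)
qed

lemma mult_sc_left: "sc c F \<odot> K = sc c (F \<odot> K)"
proof
  show "(sc c F \<odot> K) ws = sc c (F \<odot> K) ws" for ws
    by (induction ws arbitrary: F K) (auto simp: mult_nil mult_cons algebra_simps)
qed

lemma mult_sc_right: "F \<odot> sc c K = sc c (F \<odot> K)"
proof
  show "(F \<odot> sc c K) ws = sc c (F \<odot> K) ws" for ws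
    by (induction ws arbitrary: F K) (auto simp: mult_nil mult_cons algebra_simps)
qed

lemma mult_neg_left: "(- F) \<odot> K = - (F \<odot> K)" and mult_neg_right: "F \<odot> (- K) = - (F \<odot> K)"
  using mult_sc_left[of "-1" F K] mult_sc_right[of F "-1" K] by (auto simp: sc_neg1)

lemma mult_0_left [simp]: "0 \<odot> K = 0" and mult_0_right [simp]: "F \<odot> 0 = 0"
  using mult_sc_left[of 0 F K] mult_sc_right[of F 0 K] by auto

lemma mult_diff_left: "(F - G) \<odot> K = F \<odot> K - G \<odot> K"
  and mult_diff_right: "K \<odot> (F - G) = K \<odot> F - K \<odot> G"
  using mult_add_left[of F "- G" K] mult_add_right[of K F "- G"] by (simp_all add: mult_neg_left mult_neg_right)

lemmas mult_lin = mult_add_left mult_add_right mult_sc_left mult_sc_right mult_neg_left mult_neg_right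
  mult_diff_left mult_diff_right

lemma mult_sum_left: "(\<Sum>i\<in>A. f i) \<odot> K = (\<Sum>i\<in>A. f i \<odot> K)"
  using sum_comp_morphism[of "\<lambda>X. X \<odot> K" f A] by (simp add: mult_add_left comp_def)

lemma mult_sum_right: "K \<odot> (\<Sum>i\<in>A. f i) = (\<Sum>i\<in>A. K \<odot> f i)"
  using sum_comp_morphism[of "\<lambda>X. K \<odot> X" f A] by (simp add: mult_add_right comp_def)

lemma dd_mult_Ev: "w \<in> Ev W \<Longrightarrow> ff G \<Longrightarrow> dd w (F \<odot> G) = dd w F \<odot> G + F \<odot> dd w G"
  by (simp add: mult_dd dd_zero_vec)

lemma dd_mult_Od: "w \<in> Od W \<Longrightarrow> ff G \<Longrightarrow> dd w (F \<odot> G) = dd w F \<odot> G + gm F \<odot> dd w G"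
  by (simp add: mult_dd dd_zero_vec)

lemma gm_mult: "ff F \<Longrightarrow> ff G \<Longrightarrow> gm (F \<odot> G) = gm F \<odot> gm G"
proof
  show "ff F \<Longrightarrow> ff G \<Longrightarrow> gm (F \<odot> G) ws = (gm F \<odot> gm G) ws" for ws
  proof (induction ws arbitrary: F G)
    case Nil then show ?case by (simp add: gm_nil mult_nil)
  next
    case (Cons w ws)
    have "gm (F \<odot> G) (w # ws) = gm (dd (gr w) (F \<odot> G)) ws" by (simp add: gm_dd) (simp add: dd_def)
    also have "\<dots> = (gm (dd (gr w) F \<odot> G)) ws + (gm (F \<odot> dd (ev w) G)) ws - gm (gm F \<odot> dd (od w) G) ws"
      by (simp add: mult_dd dd_neg_vec Cons.prems mult_neg_right)
    also have "\<dots> = (gm (dd (gr w) F) \<odot> gm G) ws + (gm F \<odot> gm (dd (ev w) G)) ws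
        - (gm (gm F) \<odot> gm (dd (od w) G)) ws"
      using Cons by (simp add: ff_dd ff_gm)
    also have "\<dots> = (dd w (gm F) \<odot> gm G) ws + (gm F \<odot> dd (ev w) (gm G)) ws
        + (gm (gm F) \<odot> dd (od w) (gm G)) ws"
      by (simp add: gm_dd dd_neg_vec ff_gm Cons.prems mult_neg_right)
    finally show ?case by (simp add: mult_cons)
  qed
qed

text \<open>A derivative of a product is a sum of products. The additive span of products is
  therefore the class to which \<open>formal_bisim\<close> can be applied.\<close>

inductive mspan :: "'v ffun \<Rightarrow> bool" where
  mspan_mult: "ff F \<Longrightarrow> ff G \<Longrightarrow> mspan (F \<odot> G)"
| mspan_add: "mspan X \<Longrightarrow> mspan Y \<Longrightarrow> mspan (X + Y)"

lemma ff_mult: assumes "ff F" "ff G" shows "ff (F \<odot> G)"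
proof (rule formal_bisim[of mspan])
  show "mspan (F \<odot> G)" using assms by (rule mspan_mult)
next
  fix X w assume "mspan X" then show "mspan (dd w X)"
    by induction (simp_all only: mult_dd dd_simps, (intro mspan_add mspan_mult ff_dd ff_gm; assumption)+)
next
  fix X ys u v assume "mspan X" then show "X ((u + v) # ys) = X (u # ys) + X (v # ys)"
    by induction (simp_all add: mult_cons dd_add_vec ev_add od_add mult_lin algebra_simps)
next
  fix X ys u a assume "mspan X" then show "X ((a *\<^sub>R u) # ys) = fls_const a * X (u # ys)"
    by induction (simp_all add: mult_cons dd_scale_vec ev_scale od_scale mult_lin algebra_simps)
next
  fix X ys u v assume "mspan X" and u: "u \<in> Ev W"
  have *: "dd v (dd u X) = dd u (dd v X)" if "ff X" for X v
    unfolding dd_def using ff_swap_Ev[OF that u, of "[]" v] by (simp only: append_Nil)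
  have "dd v (dd u X) = dd u (dd v X)" using \<open>mspan X\<close>
  proof induction
    case (mspan_mult F G)
    have "dd v (dd u (F \<odot> G)) = (dd v (dd u F) \<odot> G + dd u F \<odot> dd (ev v) G + gm (dd u F) \<odot> dd (od v) G)
      + (dd v F \<odot> dd u G + F \<odot> dd (ev v) (dd u G) + gm F \<odot> dd (od v) (dd u G))"
      unfolding dd_mult_Ev[OF u mspan_mult(2)] dd_simps by (simp only: mult_dd[of v])
    also have "\<dots> = (dd u (dd v F) \<odot> G + dd v F \<odot> dd u G)
      + (dd u F \<odot> dd (ev v) G + F \<odot> dd u (dd (ev v) G)) + (dd u (gm F) \<odot> dd (od v) G + gm F \<odot> dd u (dd (od v) G))"
      unfolding *[OF mspan_mult(1)] *[OF mspan_mult(2)] gm_dd gr_Ev[OF u] by (simp only: ac_simps)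
    also have "\<dots> = dd u (dd v (F \<odot> G))"
      unfolding mult_dd[of v] dd_simps
      by (simp only: dd_mult_Ev[OF u] mspan_mult ff_dd)
    finally show ?case .
  qed (simp add: dd_def fun_eq_iff)
  then show "X (u # v # ys) = X (v # u # ys)" by (simp only: dd_def fun_eq_iff)
next
  fix X ys u v assume "mspan X" and u: "u \<in> Od W" and v: "v \<in> Od W"
  have *: "dd v (dd u X) = - dd u (dd v X)" if "ff X" for X
    unfolding dd_def fun_eq_iff uminus_apply using ff_swap_Od[OF that u v, of "[]"] unfolding append_Nil by blast
  have "dd v (dd u X) = - dd u (dd v X)" using \<open>mspan X\<close>
  proof induction
    case (mspan_mult F G)
    have "dd v (dd u (F \<odot> G)) = (dd v (dd u F) \<odot> G + gm (dd u F) \<odot> dd v G)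
      + (dd v (gm F) \<odot> dd u G + gm (gm F) \<odot> dd v (dd u G))"
      unfolding dd_mult_Od[OF u mspan_mult(2)] dd_simps
      by (simp only: dd_mult_Od[OF v] mspan_mult ff_dd)
    also have "\<dots> = - ((dd u (dd v F) \<odot> G + gm (dd v F) \<odot> dd u G)
      + (dd u (gm F) \<odot> dd v G + gm (gm F) \<odot> dd u (dd v G)))"
      unfolding *[OF mspan_mult(1)] *[OF mspan_mult(2)] gm_dd gr_Od[OF u] gr_Od[OF v]
        dd_neg_vec[OF ff_gm[OF mspan_mult(1)]] mult_lin by (simp only: minus_add_distrib minus_minus ac_simps)
    also have "\<dots> = - dd u (dd v (F \<odot> G))"
      unfolding dd_mult_Od[OF v mspan_mult(2)] dd_simps
      by (simp only: dd_mult_Od[OF u] mspan_mult ff_dd)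
    finally show ?case .
  qed (simp add: dd_def fun_eq_iff)
  then show "X (u # v # ys) = - X (v # u # ys)" unfolding dd_def fun_eq_iff uminus_apply by blast
qed

text \<open>As elsewhere, functions are compared through their constant terms and, by induction,
  their derivatives. Moving an odd derivative to \<open>K\<close> puts \<open>gm\<close> on
  \<open>F \<odot> G\<close>, which splits as \<open>gm F \<odot> gm G\<close>.\<close>

lemma mult_assoc: "ff F \<Longrightarrow> ff G \<Longrightarrow> ff K \<Longrightarrow> (F \<odot> G) \<odot> K = F \<odot> (G \<odot> K)"
proof
  show "ff F \<Longrightarrow> ff G \<Longrightarrow> ff K \<Longrightarrow> ((F \<odot> G) \<odot> K) ws = (F \<odot> (G \<odot> K)) ws" for ws
  proof (induction ws arbitrary: F G K)
    case (Cons w ws)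
    note f = Cons.prems
    note IH = Cons.IH[OF ff_dd f(2,3)] Cons.IH[OF f(1) ff_dd f(3)] Cons.IH[OF f(1,2) ff_dd]
      Cons.IH[OF ff_gm ff_dd f(3)] Cons.IH[OF ff_gm ff_gm ff_dd]
    have "((F \<odot> G) \<odot> K) (w # ws) = ((dd w F \<odot> G) \<odot> K) ws + ((F \<odot> dd (ev w) G) \<odot> K) ws
      + ((gm F \<odot> dd (od w) G) \<odot> K) ws + ((F \<odot> G) \<odot> dd (ev w) K) ws + ((gm F \<odot> gm G) \<odot> dd (od w) K) ws"
      unfolding mult_cons mult_dd[of w F G] gm_mult[OF f(1,2)] mult_add_left plus_fun_apply ..
    also have "\<dots> = (dd w F \<odot> (G \<odot> K)) ws + (F \<odot> (dd (ev w) G \<odot> K)) ws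
      + (gm F \<odot> (dd (od w) G \<odot> K)) ws + (F \<odot> (G \<odot> dd (ev w) K)) ws + (gm F \<odot> (gm G \<odot> dd (od w) K)) ws"
      by (simp only: IH f)
    also have "\<dots> = (F \<odot> (G \<odot> K)) (w # ws)"
      unfolding mult_cons[of F "G \<odot> K"] dd_mult_Ev[OF ev_in f(3)] dd_mult_Od[OF od_in f(3)] mult_add_right plus_fun_apply
      by (simp only: ac_simps)
    finally show ?case .
  qed (simp add: mult_nil)
qed

lemma split_cons: "ff F \<Longrightarrow> F (w # ws) = F (ev w # ws) + F (od w # ws)"
  using ff_add0[of F "ev w" "od w" ws] by (simp add: ev_plus_od)

text \<open>Only \<open>F\<close> is homogeneous; for odd \<open>F\<close> the sign is carried by
  \<open>gm G\<close>. Differentiating in an odd direction exchanges the two cases, so they are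
  proved in one induction.\<close>

lemma supercomm:
  assumes "ff F" "ff G"
  shows "gm F = F \<Longrightarrow> F \<odot> G = G \<odot> F" and "gm F = - F \<Longrightarrow> F \<odot> G = gm G \<odot> F"
proof -
  have "(gm F = F \<longrightarrow> (F \<odot> G) ws = (G \<odot> F) ws) \<and> (gm F = - F \<longrightarrow> (F \<odot> G) ws = (gm G \<odot> F) ws)"
    if "ff F" "ff G" for ws F G
    using that
  proof (induction ws arbitrary: F G)
    case Nil then show ?case by (simp add: mult_nil gm_nil)
  next
    case (Cons w ws)
    note ffs = Cons.prems
    have E: "gm (dd u F) = dd u (gm F)" if "u \<in> Ev W" for u F using that by (simp add: gm_dd)
    have O: "gm (dd u F) = - dd u (gm F)" if "u \<in> Od W" "ff F" for u F
      using that by (simp add: gm_dd dd_neg_vec ff_gm)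
    note IH = Cons.IH[OF ff_dd[OF ffs(1)] ffs(2)] Cons.IH[OF ffs(1) ff_dd[OF ffs(2)]]
      Cons.IH[OF ff_dd[OF ffs(1)] ff_gm[OF ffs(2)]]
    have hE1: "dd u (F \<odot> G) ws = dd u (G \<odot> F) ws" if u: "u \<in> Ev W" and F: "gm F = F" for u
    proof -
      have 1: "(dd u F \<odot> G) ws = (G \<odot> dd u F) ws" using IH(1)[of u] E[OF u, of F] F by metis
      have 2: "(F \<odot> dd u G) ws = (dd u G \<odot> F) ws" using IH(2)[of u] F by blast
      show ?thesis unfolding dd_mult_Ev[OF u ffs(2)] dd_mult_Ev[OF u ffs(1)] plus_fun_apply 1 2
        by (simp only: ac_simps)
    qed
    have hE2: "dd u (F \<odot> G) ws = dd u (gm G \<odot> F) ws" if u: "u \<in> Ev W" and F: "gm F = - F" for u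
    proof -
      have "gm (dd u F) = - dd u F" using E[OF u, of F] F by (metis dd_simps(3))
      then have 1: "(dd u F \<odot> G) ws = (gm G \<odot> dd u F) ws" using IH(1)[of u] by blast
      have 2: "(F \<odot> dd u G) ws = (dd u (gm G) \<odot> F) ws" using IH(2)[of u] F E[OF u, of G] by metis
      show ?thesis unfolding dd_mult_Ev[OF u ffs(2)] dd_mult_Ev[OF u ffs(1)] plus_fun_apply 1 2
        by (simp only: ac_simps)
    qed
    have hO1: "dd u (F \<odot> G) ws = dd u (G \<odot> F) ws" if u: "u \<in> Od W" and F: "gm F = F" for u
    proof -
      have "gm (dd u F) = - dd u F" using O[OF u ffs(1)] F by metis
      then have 1: "(dd u F \<odot> G) ws = (gm G \<odot> dd u F) ws" using IH(1)[of u] by blast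
      have 2: "(F \<odot> dd u G) ws = (dd u G \<odot> F) ws" using IH(2)[of u] F by blast
      show ?thesis unfolding dd_mult_Od[OF u ffs(2)] dd_mult_Od[OF u ffs(1)] plus_fun_apply 1 F 2
        by (simp only: ac_simps)
    qed
    have hO2: "dd u (F \<odot> G) ws = dd u (gm G \<odot> F) ws" if u: "u \<in> Od W" and F: "gm F = - F" for u
    proof -
      have "gm (dd u F) = dd u F" using O[OF u ffs(1)] F by (metis dd_simps(3) minus_minus)
      then have 1: "(dd u F \<odot> G) ws = (G \<odot> dd u F) ws" using IH(1)[of u] by blast
      have 2: "(F \<odot> dd u G) ws = (gm (dd u G) \<odot> F) ws" using IH(2)[of u] F by blast
      show ?thesis unfolding dd_mult_Od[OF u ffs(2)] dd_mult_Od[OF u ffs(1)] plus_fun_apply 1 F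
          mult_neg_left uminus_apply 2 O[OF u ffs(2)] gm_gm
        by (simp only: ac_simps minus_minus)
    qed
    have s: "X (w # ws) = dd (ev w) X ws + dd (od w) X ws" if "ff X" for X
      unfolding dd_def by (rule split_cons[OF that])
    show ?case
    proof (intro conjI impI)
      assume F: "gm F = F"
      show "(F \<odot> G) (w # ws) = (G \<odot> F) (w # ws)"
        unfolding s[OF ff_mult[OF ffs]] s[OF ff_mult[OF ffs(2) ffs(1)]] hE1[OF ev_in F] hO1[OF od_in F] ..
    next
      assume F: "gm F = - F"
      show "(F \<odot> G) (w # ws) = (gm G \<odot> F) (w # ws)"
        unfolding s[OF ff_mult[OF ffs]] s[OF ff_mult[OF ff_gm[OF ffs(2)] ffs(1)]] hE2[OF ev_in F] hO2[OF od_in F] ..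
    qed
  qed
  then show "gm F = F \<Longrightarrow> F \<odot> G = G \<odot> F" "gm F = - F \<Longrightarrow> F \<odot> G = gm G \<odot> F"
    using assms by blast+
qed

lemma ffone_dd [simp]: "dd w ffone = 0"
  by (auto simp: dd_def ffone_def)

lemma ff_one: "ff ffone"
  by (rule ffI) (auto simp: ffone_def)

lemma gm_one [simp]: "gm ffone = ffone"
  by (auto simp: ffgrade_def ffone_def)

lemma one_mult [simp]: "ff F \<Longrightarrow> ffone \<odot> F = F"
proof
  show "ff F \<Longrightarrow> (ffone \<odot> F) ws = F ws" for ws
  proof (induction ws arbitrary: F)
    case (Cons w ws)
    have "(ffone \<odot> F) (w # ws) = dd (ev w) F ws + dd (od w) F ws"
      unfolding mult_cons ffone_dd mult_0_left gm_one Cons.IH[OF ff_dd[OF Cons.prems]] by simp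
    then show ?case unfolding split_cons[OF Cons.prems, of w] dd_def .
  next
    case Nil show ?case by (simp add: mult_nil ffone_def)
  qed
qed

lemma mult_one [simp]: "ff F \<Longrightarrow> F \<odot> ffone = F"
  using supercomm(1)[OF ff_one, of F] by simp

end

section \<open>Substitution into power series\<close>

text \<open>By \<open>bd\<close> only finitely many terms reach a given power of \<hbar>. The series
  therefore converges \<hbar>-adically, and each coefficient of its sum is a finite sum over any
  sufficiently long range.\<close>

lemma fls_suminf_nth:
  fixes f :: "nat \<Rightarrow> real fls"
  assumes bd: "\<And>k g. fls_nth (f k) g \<noteq> 0 \<Longrightarrow> int k \<le> a + b * g" and b: "b > 0"
    and K: "int K > a + b * g"
  shows "fls_nth (\<Sum>k. f k) g = (\<Sum>k<K. fls_nth (f k) g)"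
proof -
  define B where "B g = nat (a + b * g + 1)" for g
  define h where "h g = (\<Sum>k<B g. fls_nth (f k) g)" for g
  have B: "fls_nth (f k) g' = 0" if "k \<ge> B g" "g' \<le> g" for k g g'
  proof (rule ccontr)
    assume "fls_nth (f k) g' \<noteq> 0"
    from bd[OF this] have "int k \<le> a + b * g'" .
    moreover have "b * g' \<le> b * g" using that(2) b by (intro mult_left_mono) simp_all
    ultimately show False using that(1) unfolding B_def by linarith
  qed
  have hK: "h g = (\<Sum>k<M. fls_nth (f k) g)" if "int M > a + b * g" for M g
  proof -
    have "B g \<le> M" using that unfolding B_def by linarith
    then show ?thesis unfolding h_def
      by (intro sum.mono_neutral_left) (use B[of g _ g] in auto)
  qed
  \<comment> \<open>Since \<open>b \<ge> 1\<close>, the bound \<open>a + b * g\<close> is negative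
    below \<open>- \<bar>a\<bar>\<close>; this makes \<open>h\<close> the coefficient function of a
    Laurent series.\<close>
  have low: "h g = 0" if "g < - \<bar>a\<bar>" for g
  proof -
    have "b * g \<le> 1 * g" using that b by (intro mult_right_mono_neg) simp_all
    then have "B g = 0" using that unfolding B_def by linarith
    then show ?thesis by (simp add: h_def)
  qed
  define L where "L = Abs_fls h"
  have L: "fls_nth L g = h g" for g
    unfolding L_def by (rule nth_Abs_fls_lower_bound[of "- \<bar>a\<bar>"]) (simp add: low)
  have "f sums L"
    unfolding sums_def
  proof (rule metric_LIMSEQ_I)
    fix r :: real assume "r > 0"
    then obtain m where "(1 / 2) ^ m < r" using real_arch_pow_inv[of r "1 / 2"] by auto
    then have m: "inverse (2 ^ m) < r" by (simp add: power_one_over inverse_eq_divide)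
    show "\<exists>no. \<forall>n\<ge>no. dist (sum f {..<n}) L < r"
    proof (intro exI allI impI)
      fix n assume n: "n \<ge> B (int m)"
      show "dist (sum f {..<n}) L < r"
      proof (cases "sum f {..<n} = L")
        case True then show ?thesis using \<open>r > 0\<close> by simp
      next
        case False
        have "fls_nth (sum f {..<n} - L) g = 0" if "g \<le> int m" for g
        proof -
          have "int n > a + b * g"
          proof -
            have "b * g \<le> b * int m" using that b by (intro mult_left_mono) simp_all
            then show ?thesis using n unfolding B_def by linarith
          qed
          then show ?thesis using hK[of g n] by (simp add: L fls_nth_sum)
        qed
        then have "fls_subdegree (sum f {..<n} - L) > int m"
          using False by (intro fls_subdegree_greaterI) simp_all
        then have "dist (sum f {..<n}) L = inverse (2 ^ nat (fls_subdegree (sum f {..<n} - L)))"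
          and le: "m \<le> nat (fls_subdegree (sum f {..<n} - L))"
          using False by (simp_all add: dist_fls_def)
        moreover have "inverse (2 ^ nat (fls_subdegree (sum f {..<n} - L))) \<le> inverse ((2::real) ^ m)"
          using le by (intro le_imp_inverse_le power_increasing) simp_all
        ultimately show ?thesis using m by linarith
      qed
    qed
  qed
  then have "suminf f = L" by (rule sums_unique[symmetric])
  then show ?thesis using hK[OF K] by (simp add: L)
qed

text \<open>An operator \<open>\<hbar> \<partial>\<^sub>x \<partial>\<^sub>y\<close> preserves \<open>2 g + n\<close> and raises \<open>3 g + n\<close> by one; the second grading makes solutions of
  the heat equation unique. A function \<open>m/\<hbar>\<close> with \<open>m\<close> in \<open>h[W]\<close> has \<open>g \<ge> -1\<close> and \<open>2 g + n \<ge> 1\<close>, hence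
  \<open>3 g + n \<ge> 0\<close>.\<close>

abbreviation wt :: "int \<Rightarrow> 'v ffun \<Rightarrow> bool" where
  "wt k \<equiv> supp_in (\<lambda>g n. 2 * g + n \<ge> k)"

abbreviation bt :: "int \<Rightarrow> 'v ffun \<Rightarrow> bool" where
  "bt k \<equiv> supp_in (\<lambda>g n. 3 * g + n \<ge> k)"

lemma wtD: "wt k F \<Longrightarrow> 2 * g + int (length ws) < k \<Longrightarrow> fls_nth (F ws) g = 0"
  using supp_inD[of "\<lambda>g n. 2 * g + n \<ge> k" F ws g] by force

lemma wtI: "(\<And>ws g. 2 * g + int (length ws) < k \<Longrightarrow> fls_nth (F ws) g = 0) \<Longrightarrow> wt k F"
  unfolding supp_in_def by (meson not_le)

lemma wt_mono: "wt k F \<Longrightarrow> l \<le> k \<Longrightarrow> wt l F"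
  by (erule supp_in_mono) simp

text \<open>The weight filtration is separated. Identities between power series in a function are
  proved modulo every weight and concluded by this lemma.\<close>

lemma wt_ext: assumes "\<And>K::nat. wt (int K) (F - G)" shows "F = G"
proof
  fix ws show "F ws = G ws"
  proof (rule fls_eqI)
    fix g
    have "fls_nth ((F - G) ws) g = 0"
      by (rule wtD[OF assms[of "nat (2 * g + int (length ws) + 1)"]]) linarith
    then show "fls_nth (F ws) g = fls_nth (G ws) g" by simp
  qed
qed

lemma wt_const_mult: "wt k F \<Longrightarrow> wt k (sc (fls_const a) F)"
  by (rule supp_in_const)

text \<open>Functional calculus for power series in one variable: the exponential, its inverse and
  the logarithm become instances, and the identities between them are inherited from
  \<open>real fps\<close>.\<close>

definition fsub :: "'v::real_vector super \<Rightarrow> real fps \<Rightarrow> 'v ffun \<Rightarrow> 'v ffun" where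
  "fsub W f X = (\<lambda>ws. \<Sum>k. fls_const (fps_nth f k) * ffpow W X k ws)"

definition ftrunc :: "'v::real_vector super \<Rightarrow> nat \<Rightarrow> real fps \<Rightarrow> 'v ffun \<Rightarrow> 'v ffun" where
  "ftrunc W K f X = (\<Sum>k<K. sc (fls_const (fps_nth f k)) (ffpow W X k))"

context super_sp
begin

abbreviation "pw \<equiv> ffpow W"

text \<open>The functions into which power series may be substituted: \<open>wt 1\<close> gives
  convergence, evenness lets \<open>X\<close> commute with its own derivatives, and
  \<open>bt 0\<close> is the bound that the Gaussian integral and the heat equation rely on.\<close>

definition adm :: "'v ffun \<Rightarrow> bool" where
  "adm X \<longleftrightarrow> ff X \<and> gm X = X \<and> bt 0 X \<and> wt 1 X"

section \<open>Powers, truncations and substitution\<close>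

lemma wt_mult: "wt a F \<Longrightarrow> wt b G \<Longrightarrow> wt (a + b) (F \<odot> G)"
  by (erule supp_in_mult, assumption) simp

lemma bt_mult: "bt a F \<Longrightarrow> bt b G \<Longrightarrow> bt (a + b) (F \<odot> G)"
  by (erule supp_in_mult, assumption) simp

lemma wt_one: "wt 0 ffone" and bt_one: "bt 0 ffone"
  by (rule wtI; simp add: ffone_def)
     (simp add: supp_in_def ffone_def)

lemma ff_pw: "ff X \<Longrightarrow> ff (pw X k)"
  by (induction k) (simp_all add: ff_one ff_mult)

lemma gm_pw: "ff X \<Longrightarrow> gm X = X \<Longrightarrow> gm (pw X k) = pw X k"
  by (induction k) (simp_all add: gm_mult ff_pw)

lemma wt_pw: "wt 1 X \<Longrightarrow> wt (int k) (pw X k)"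
proof (induction k)
  case 0 then show ?case by (simp add: wt_one)
next
  case (Suc k) then show ?case using wt_mult[OF Suc.prems Suc.IH[OF Suc.prems]] by simp
qed

lemma bt_pw: "bt 0 X \<Longrightarrow> bt 0 (pw X k)"
proof (induction k)
  case 0 then show ?case by (simp add: bt_one)
next
  case (Suc k) then show ?case using bt_mult[OF Suc.prems Suc.IH[OF Suc.prems]] by simp
qed

lemma pw_add: "ff X \<Longrightarrow> pw X (i + j) = pw X i \<odot> pw X j"
  by (induction i) (simp_all add: ff_pw mult_assoc)

lemma pw_1: "ff X \<Longrightarrow> pw X 1 = X"
  by (simp add: ff_one)

text \<open>The \<open>k\<close>-th power has weight at least \<open>k\<close>, so a coefficient of
  weight \<open>2 g + n\<close> only sees the powers up to that number.\<close>

lemma fsub_nth: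
  assumes "adm X" "int K > 2 * g + int (length ws)"
  shows "fls_nth (fsub W f X ws) g = (\<Sum>k<K. fps_nth f k * fls_nth (pw X k ws) g)"
proof -
  have "fls_nth (\<Sum>k. fls_const (fps_nth f k) * pw X k ws) g
      = (\<Sum>k<K. fls_nth (fls_const (fps_nth f k) * pw X k ws) g)"
  proof (rule fls_suminf_nth[of _ "int (length ws)" 2])
    fix k g assume "fls_nth (fls_const (fps_nth f k) * pw X k ws) g \<noteq> 0"
    then have "fls_nth (pw X k ws) g \<noteq> 0" by auto
    from supp_inD[OF wt_pw this] show "int k \<le> int (length ws) + 2 * g"
      using assms(1) by (simp add: adm_def)
  qed (use assms in simp_all)
  then show ?thesis by (simp add: fsub_def)
qed

lemma wt_fsub_trunc: assumes "adm X" shows "wt (int K) (fsub W f X - ftrunc W K f X)"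
  by (rule wtI) (simp add: fsub_nth[OF assms] ftrunc_def sum_fun_apply fls_nth_sum)

lemma wt_ftrunc: "adm X \<Longrightarrow> wt 0 (ftrunc W K f X)"
  unfolding ftrunc_def
  by (intro supp_in_sum wt_const_mult wt_mono[OF wt_pw]) (simp_all add: adm_def)

lemma bt_ftrunc: "adm X \<Longrightarrow> bt 0 (ftrunc W K f X)"
  unfolding ftrunc_def
  by (intro supp_in_sum supp_in_const bt_pw) (simp_all add: adm_def)

text \<open>Each law compares finitely many Taylor coefficients at one power of \<hbar>, and a
  single \<open>G K\<close> agrees with \<open>F\<close> on all of them.\<close>

lemma ff_approx:
  assumes "\<And>K::nat. ff (G K)" "\<And>K. wt (int K) (F - G K)"
  shows "ff F"
proof -
  have eq: "\<exists>K. \<forall>ws\<in>set ls. fls_nth (F ws) g = fls_nth (G K ws) g" for ls g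
  proof -
    define M where "M = Max (insert 0 (length ` set ls))"
    have M: "length ws \<le> M" if "ws \<in> set ls" for ws unfolding M_def using that by (intro Max_ge) auto
    have "fls_nth (F ws) g = fls_nth (G (nat (2 * g + int M + 1)) ws) g" if "ws \<in> set ls" for ws
    proof -
      have "fls_nth ((F - G (nat (2 * g + int M + 1))) ws) g = 0"
        using M[OF that] by (intro wtD[OF assms(2)]) linarith
      then show ?thesis by simp
    qed
    then show ?thesis by blast
  qed
  show ?thesis
  proof (rule ffI; rule fls_eqI)
    fix xs ys u v g
    obtain K where K: "\<forall>ws\<in>set [xs @ (u + v) # ys, xs @ u # ys, xs @ v # ys]. fls_nth (F ws) g = fls_nth (G K ws) g"
      using eq by blast
    then show "fls_nth (F (xs @ (u + v) # ys)) g = fls_nth (F (xs @ u # ys) + F (xs @ v # ys)) g"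
      by (simp add: ff_add[OF assms(1)])
  next
    fix xs ys u a g
    obtain K where K: "\<forall>ws\<in>set [xs @ (a *\<^sub>R u) # ys, xs @ u # ys]. fls_nth (F ws) g = fls_nth (G K ws) g"
      using eq by blast
    then show "fls_nth (F (xs @ (a *\<^sub>R u) # ys)) g = fls_nth (fls_const a * F (xs @ u # ys)) g"
      by (simp add: ff_scale[OF assms(1)])
  next
    fix xs ys u v g assume u: "u \<in> Ev W"
    obtain K where K: "\<forall>ws\<in>set [xs @ u # v # ys, xs @ v # u # ys]. fls_nth (F ws) g = fls_nth (G K ws) g"
      using eq by blast
    then show "fls_nth (F (xs @ u # v # ys)) g = fls_nth (F (xs @ v # u # ys)) g"
      using ff_swap_Ev[OF assms(1) u, of K xs v ys] by simp
  next
    fix xs ys u v g assume u: "u \<in> Od W" "v \<in> Od W"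
    obtain K where K: "\<forall>ws\<in>set [xs @ u # v # ys, xs @ v # u # ys]. fls_nth (F ws) g = fls_nth (G K ws) g"
      using eq by blast
    then show "fls_nth (F (xs @ u # v # ys)) g = fls_nth (- F (xs @ v # u # ys)) g"
      using ff_swap_Od[OF assms(1) u, of K xs ys] by simp
  qed
qed

lemma ff_ftrunc: "adm X \<Longrightarrow> ff (ftrunc W K f X)"
  unfolding ftrunc_def by (intro ff_sum ff_sc ff_pw) (simp add: adm_def)

lemma gm_sum: "gm (\<Sum>i\<in>A. f i) = (\<Sum>i\<in>A. gm (f i))"
  using sum_comp_morphism[of gm f A] by (simp add: comp_def)

lemma gm_ftrunc: "adm X \<Longrightarrow> gm (ftrunc W K f X) = ftrunc W K f X"
  unfolding ftrunc_def by (simp add: gm_sum gm_pw adm_def)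

lemma ff_fsub: assumes "adm X" shows "ff (fsub W f X)"
  by (rule ff_approx[OF ff_ftrunc[OF assms] wt_fsub_trunc[OF assms]])

lemma wt_fsub: assumes "adm X" shows "wt 0 (fsub W f X)"
  using wt_fsub_trunc[OF assms, of 0 f] by (simp add: ftrunc_def)

lemma bt_fsub: assumes X: "adm X" shows "bt 0 (fsub W f X)"
  unfolding supp_in_def
proof (intro allI impI)
  fix ws g assume nz: "fls_nth (fsub W f X ws) g \<noteq> 0"
  define K where "K = nat (2 * g + int (length ws) + 1)"
  have "fls_nth ((fsub W f X - ftrunc W K f X) ws) g = 0"
    by (rule wtD[OF wt_fsub_trunc[OF X]]) (simp add: K_def, linarith?)
  with nz have "fls_nth (ftrunc W K f X ws) g \<noteq> 0" by simp
  from supp_inD[OF bt_ftrunc[OF X] this] show "0 \<le> 3 * g + int (length ws)" .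
qed

lemma gm_fsub: assumes X: "adm X" shows "gm (fsub W f X) = fsub W f X"
proof (rule wt_ext)
  fix K
  have "wt (int K) (gm (fsub W f X - ftrunc W K f X) - (fsub W f X - ftrunc W K f X))"
    by (intro supp_in_diff supp_in_ffgrade wt_fsub_trunc X)
  then show "wt (int K) (gm (fsub W f X) - fsub W f X)" by (simp add: gm_ftrunc[OF X])
qed

lemma wt_fsub1: assumes X: "adm X" and "fps_nth f 0 = 0" shows "wt 1 (fsub W f X)"
  using wt_fsub_trunc[OF X, of 1 f] assms(2) by (simp add: ftrunc_def)

lemma adm_fsub: "adm X \<Longrightarrow> fps_nth f 0 = 0 \<Longrightarrow> adm (fsub W f X)"
  unfolding adm_def[of "fsub W f X"] by (simp add: ff_fsub gm_fsub bt_fsub wt_fsub1)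

lemma fsub_add: assumes X: "adm X" shows "fsub W (f + h) X = fsub W f X + fsub W h X"
proof (rule ext, rule fls_eqI)
  fix ws :: "'v list" and g :: int
  obtain K where K: "int K > 2 * g + int (length ws)" by (rule that[of "nat (2 * g + int (length ws) + 1)"]) linarith
  show "fls_nth (fsub W (f + h) X ws) g = fls_nth ((fsub W f X + fsub W h X) ws) g"
    by (simp add: fsub_nth[OF X K] distrib_right sum.distrib)
qed

lemma fsub_one: assumes X: "adm X" shows "fsub W 1 X = ffone"
proof (rule wt_ext)
  fix K
  have "ftrunc W (Suc K) 1 X = ffone"
    unfolding ftrunc_def by (subst sum.remove[of _ 0]) simp_all
  then show "wt (int K) (fsub W 1 X - ffone)" using wt_mono[OF wt_fsub_trunc[OF X, of "Suc K" 1], of "int K"] by simp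
qed

lemma fsub_X: assumes X: "adm X" shows "fsub W fps_X X = X"
proof (rule wt_ext)
  fix K
  have "ftrunc W (Suc (Suc K)) fps_X X = X"
    unfolding ftrunc_def using pw_1[of X] X by (subst sum.remove[of _ 1]) (simp_all add: adm_def)
  then show "wt (int K) (fsub W fps_X X - X)"
    using wt_mono[OF wt_fsub_trunc[OF X, of "Suc (Suc K)" fps_X], of "int K"] by simp
qed

text \<open>The product of the truncations differs from the truncation of the product by the terms
  with \<open>i + j \<ge> K\<close>, which have weight at least \<open>K\<close>; so have the
  products with a remainder.\<close>

lemma fsub_mult: assumes X: "adm X" shows "fsub W f X \<odot> fsub W h X = fsub W (f * h) X"
proof (rule wt_ext)
  fix K
  let ?F = "fsub W f X" and ?G = "fsub W h X" and ?f = "ftrunc W K f X" and ?g = "ftrunc W K h X"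
  have ffX: "ff X" using X by (simp add: adm_def)
  have 1: "wt (int K) ((?F - ?f) \<odot> ?G)"
    using wt_mult[OF wt_fsub_trunc[OF X, of K f] wt_fsub[OF X, of h]] by simp
  have 2: "wt (int K) (?f \<odot> (?G - ?g))"
    using wt_mult[OF wt_ftrunc[OF X, of K f] wt_fsub_trunc[OF X, of K h]] by simp
  let ?t = "\<lambda>i j. sc (fls_const (fps_nth f i * fps_nth h j)) (pw X (i + j))"
  have "?f \<odot> ?g = (\<Sum>i<K. \<Sum>j<K. ?t i j)"
    unfolding ftrunc_def mult_sum_left mult_sum_right
    by (subst sum.swap) (simp add: mult_lin pw_add[OF ffX] mult.commute)
  also have "\<dots> = (\<Sum>(i, j)\<in>{..<K} \<times> {..<K}. ?t i j)" by (simp add: sum.cartesian_product)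
  also have "\<dots> = (\<Sum>(i, j)\<in>{(i, j). i + j < K}. ?t i j) + (\<Sum>(i, j)\<in>{..<K} \<times> {..<K} - {(i, j). i + j < K}. ?t i j)"
    by (subst add.commute, rule sum.subset_diff) (auto simp del: sc_simps)
  also have "(\<Sum>(i, j)\<in>{(i, j). i + j < K}. ?t i j) = (\<Sum>k<K. \<Sum>i\<le>k. ?t i (k - i))"
    by (rule sum.triangle_reindex)
  also have "\<dots> = ftrunc W K (f * h) X"
  proof -
    have "(\<Sum>i\<le>k. ?t i (k - i)) = sc (fls_const (fps_nth (f * h) k)) (pw X k)" for k
    proof (rule ext, rule fls_eqI)
      fix ws g
      show "fls_nth ((\<Sum>i\<le>k. ?t i (k - i)) ws) g = fls_nth (sc (fls_const (fps_nth (f * h) k)) (pw X k) ws) g"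
        by (simp add: sum_fun_apply fls_nth_sum fps_mult_nth sum_distrib_right atLeast0AtMost
          del: fls_const_mult_const)
    qed
    then show ?thesis by (simp add: ftrunc_def)
  qed
  finally have e: "?f \<odot> ?g = ftrunc W K (f * h) X + (\<Sum>(i, j)\<in>{..<K} \<times> {..<K} - {(i, j). i + j < K}. ?t i j)" .
  have 3: "wt (int K) (\<Sum>(i, j)\<in>{..<K} \<times> {..<K} - {(i, j). i + j < K}. ?t i j)"
  proof (rule supp_in_sum)
    fix x assume x: "x \<in> {..<K} \<times> {..<K} - {(i, j). i + j < K}"
    obtain i j where ij: "x = (i, j)" by (cases x)
    then have "wt (int K) (?t i j)"
      using X x by (intro wt_const_mult wt_mono[OF wt_pw]) (simp_all add: adm_def)
    then show "wt (int K) (case x of (i, j) \<Rightarrow> ?t i j)" by (simp only: ij prod.case)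
  qed
  let ?S = "\<Sum>(i, j)\<in>{..<K} \<times> {..<K} - {(i, j). i + j < K}. ?t i j"
  have eq: "?F \<odot> ?G - fsub W (f * h) X = (?F - ?f) \<odot> ?G + ?f \<odot> (?G - ?g)
      + ?S - (fsub W (f * h) X - ftrunc W K (f * h) X)"
    using e by (simp add: mult_lin algebra_simps)
  show "wt (int K) (?F \<odot> ?G - fsub W (f * h) X)"
    unfolding eq by (intro supp_in_diff supp_in_add 1 2 3 wt_fsub_trunc X)
qed

lemma fsub_power: assumes X: "adm X" shows "pw (fsub W f X) n = fsub W (f ^ n) X"
  by (induction n) (simp_all add: fsub_one[OF X] fsub_mult[OF X])

text \<open>Since \<open>h\<close> has no constant term, \<open>h ^ n\<close> starts in degree
  \<open>n\<close>, and one bound \<open>K\<close> cuts off both the outer and the inner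
  sum.\<close>

lemma fsub_compose:
  assumes X: "adm X" and h: "fps_nth h 0 = 0"
  shows "fsub W f (fsub W h X) = fsub W (f oo h) X"
proof (rule ext, rule fls_eqI)
  fix ws :: "'v list" and g :: int
  obtain K where K: "int K > 2 * g + int (length ws)"
    by (rule that[of "nat (2 * g + int (length ws) + 1)"]) linarith
  have "fls_nth (fsub W f (fsub W h X) ws) g = (\<Sum>n<K. fps_nth f n * (\<Sum>k<K. fps_nth (h ^ n) k * fls_nth (pw X k ws) g))"
    by (simp add: fsub_nth[OF adm_fsub[OF X h] K] fsub_power[OF X] fsub_nth[OF X K])
  also have "\<dots> = (\<Sum>k<K. (\<Sum>n<K. fps_nth f n * fps_nth (h ^ n) k) * fls_nth (pw X k ws) g)"
    unfolding sum_distrib_left sum_distrib_right by (subst sum.swap) (simp only: mult.assoc)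
  also have "\<dots> = (\<Sum>k<K. fps_nth (f oo h) k * fls_nth (pw X k ws) g)"
  proof (intro sum.cong refl arg_cong2[where f=times])
    fix k assume "k \<in> {..<K}"
    then show "(\<Sum>n<K. fps_nth f n * fps_nth (h ^ n) k) = fps_nth (f oo h) k"
      unfolding fps_compose_nth using startsby_zero_power_prefix[OF h]
      by (intro sum.mono_neutral_right) auto
  qed
  finally show "fls_nth (fsub W f (fsub W h X) ws) g = fls_nth (fsub W (f oo h) X ws) g"
    by (simp add: fsub_nth[OF X K])
qed

text \<open>\<open>D\<close> is a derivation along a multiplicative map \<open>E\<close>. Partial
  derivatives are the case of the identity, derivations induced by linear maps that of a pullback.
  As \<open>E X\<close> is even it commutes with \<open>D X\<close>, and the \<open>k + 1\<close>
  terms can be collected.\<close>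

lemma derivation_pw:
  assumes X: "ff X" "gm X = X" and one: "D ffone = 0"
    and leib: "\<And>F G. ff F \<Longrightarrow> gm F = F \<Longrightarrow> ff G \<Longrightarrow> gm G = G \<Longrightarrow> D (F \<odot> G) = D F \<odot> E G + E F \<odot> D G"
    and DX: "ff (D X)" and E: "\<And>k. ff (E (pw X k))" "gm (E X) = E X" "ff (E X)"
    and Em: "\<And>k. E (pw X (Suc k)) = E X \<odot> E (pw X k)" and E1: "E ffone = ffone"
  shows "D (pw X (Suc k)) = sc (of_nat (Suc k)) (D X \<odot> E (pw X k))"
proof (induction k)
  case 0
  have "D (pw X (Suc 0)) = D X \<odot> E ffone + E X \<odot> D ffone"
    using leib[OF X ff_one gm_one] by simp
  then show ?case by (simp add: one E1)
next
  case (Suc k)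
  have "D (pw X (Suc (Suc k))) = D X \<odot> E (pw X (Suc k)) + E X \<odot> D (pw X (Suc k))"
    using leib[OF X ff_pw[OF X(1)] gm_pw[OF X], of "Suc k"] by simp
  also have "E X \<odot> D (pw X (Suc k)) = sc (of_nat (Suc k)) (E X \<odot> (D X \<odot> E (pw X k)))"
    unfolding Suc mult_sc_right ..
  also have "E X \<odot> (D X \<odot> E (pw X k)) = (E X \<odot> D X) \<odot> E (pw X k)"
    by (rule mult_assoc[symmetric]) (rule E DX)+
  also have "E X \<odot> D X = D X \<odot> E X" by (rule supercomm(1)[OF E(3) DX E(2)])
  also have "(D X \<odot> E X) \<odot> E (pw X k) = D X \<odot> E (pw X (Suc k))"
    unfolding Em by (rule mult_assoc) (rule E DX)+
  also have "D X \<odot> E (pw X (Suc k)) + sc (of_nat (Suc k)) (D X \<odot> E (pw X (Suc k)))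
      = sc (of_nat (Suc (Suc k))) (D X \<odot> E (pw X (Suc k)))"
    by (simp only: of_nat_Suc[of "Suc k"] sc_add_left sc_simps)
  finally show ?case .
qed

text \<open>Truncation reduces the chain rule to powers. The constant \<open>c\<close> is the weight
  that \<open>D\<close> may lose; continuity in this sense carries the identity to the
  limit.\<close>

lemma derivation_fsub:
  assumes X: "adm X" and one: "D ffone = 0"
    and leib: "\<And>F G. ff F \<Longrightarrow> gm F = F \<Longrightarrow> ff G \<Longrightarrow> gm G = G \<Longrightarrow> D (F \<odot> G) = D F \<odot> E G + E F \<odot> D G"
    and DX: "ff (D X)" and E: "\<And>k. ff (E (pw X k))" "gm (E X) = E X" "ff (E X)"
    and Em: "\<And>k. E (pw X (Suc k)) = E X \<odot> E (pw X k)" and E1: "E ffone = ffone"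
    and Dlin: "\<And>F G. D (F + G) = D F + D G" "\<And>a F. D (sc (fls_const a) F) = sc (fls_const a) (D F)"
    and Elin: "\<And>F G. E (F + G) = E F + E G" "\<And>a F. E (sc (fls_const a) F) = sc (fls_const a) (E F)"
    and Dwt: "\<And>k F. wt k F \<Longrightarrow> wt (k - c) (D F)" and Ewt: "\<And>k F. wt k F \<Longrightarrow> wt k (E F)"
  shows "D (fsub W f X) = D X \<odot> E (fsub W (fps_deriv f) X)"
proof (rule wt_ext)
  fix K :: nat
  have X': "ff X" "gm X = X" "wt 1 X" using X by (simp_all add: adm_def)
  have D0: "D 0 = 0" using Dlin(2)[of 0 0] by simp
  have E0: "E 0 = 0" using Elin(2)[of 0 0] by simp
  have Dsum: "D (\<Sum>i\<in>A. g i) = (\<Sum>i\<in>A. D (g i))" for A and g :: "nat \<Rightarrow> 'v ffun"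
    using sum_comp_morphism[of D g A] by (simp add: comp_def Dlin D0)
  have Esum: "E (\<Sum>i\<in>A. g i) = (\<Sum>i\<in>A. E (g i))" for A and g :: "nat \<Rightarrow> 'v ffun"
    using sum_comp_morphism[of E g A] by (simp add: comp_def Elin E0)
  \<comment> \<open>The loss of \<open>c\<close> in weight is compensated by truncating that much
    later.\<close>
  define M where "M = K + nat \<bar>c\<bar>"
  have DM: "D (ftrunc W (Suc M) f X) = D X \<odot> E (ftrunc W M (fps_deriv f) X)"
  proof -
    have "D (ftrunc W (Suc M) f X) = (\<Sum>k<Suc M. sc (fls_const (fps_nth f k)) (D (pw X k)))"
      unfolding ftrunc_def Dsum Dlin ..
    also have "\<dots> = (\<Sum>k<M. sc (fls_const (fps_nth f (Suc k))) (D (pw X (Suc k))))"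
      unfolding sum.lessThan_Suc_shift by (simp add: one)
    also have "\<dots> = (\<Sum>k<M. sc (fls_const (fps_nth f (Suc k))) (sc (of_nat (Suc k)) (D X \<odot> E (pw X k))))"
      by (simp only: derivation_pw[OF X'(1,2) one leib DX E Em E1])
    also have "\<dots> = (\<Sum>k<M. sc (fls_const (fps_nth (fps_deriv f) k)) (D X \<odot> E (pw X k)))"
      by (intro sum.cong refl) (simp add: fls_of_nat fls_const_mult_const mult.commute del: of_nat_Suc)
    also have "\<dots> = D X \<odot> E (ftrunc W M (fps_deriv f) X)"
      unfolding ftrunc_def Esum Elin mult_sum_right mult_lin ..
    finally show ?thesis .
  qed
  have 1: "wt (int K) (D (fsub W f X - ftrunc W (Suc M) f X))"
    by (rule wt_mono[OF Dwt[OF wt_fsub_trunc[OF X]]]) (simp add: M_def)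
  have 2: "wt (int K) (D X \<odot> E (fsub W (fps_deriv f) X - ftrunc W M (fps_deriv f) X))"
    by (rule wt_mono[OF wt_mult[OF Dwt[OF wt_mono[OF X'(3), of 0]] Ewt[OF wt_fsub_trunc[OF X]]]]) (simp_all add: M_def)
  have Dd: "D (F - G) = D F - D G" for F G
    using Dlin(1)[of "F - G" G] by simp
  have Ed: "E (F - G) = E F - E G" for F G
    using Elin(1)[of "F - G" G] by simp
  have "D (fsub W f X) - D X \<odot> E (fsub W (fps_deriv f) X) =
    D (fsub W f X - ftrunc W (Suc M) f X) - D X \<odot> E (fsub W (fps_deriv f) X - ftrunc W M (fps_deriv f) X)"
    by (simp add: Dd Ed mult_lin DM)
  then show "wt (int K) (D (fsub W f X) - D X \<odot> E (fsub W (fps_deriv f) X))"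
    using supp_in_diff[OF 1 2] by simp
qed

lemma dd_fsub:
  assumes X: "adm X"
  shows "w \<in> Ev W \<or> w \<in> Od W \<Longrightarrow> dd w (fsub W f X) = dd w X \<odot> fsub W (fps_deriv f) X"
proof (rule derivation_fsub[OF X, of "dd w" "\<lambda>F. F" 1, simplified])
  assume w: "w \<in> Ev W \<or> w \<in> Od W"
  show "dd w (F \<odot> G) = dd w F \<odot> G + F \<odot> dd w G" if "ff F" "gm F = F" "ff G" "gm G = G" for F G
    using w that by (metis dd_mult_Ev dd_mult_Od)
  show "wt (k - 1) (dd w F)" if "wt k F" for k F
    by (rule supp_in_mono[OF supp_in_dd[OF that]]) simp
qed (use X in \<open>simp_all add: adm_def ff_dd ff_pw\<close>)

section \<open>Exponential and logarithm\<close>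

lemma ffexp_fsub: "ffexp W X = fsub W (fps_exp 1) X"
  by (simp add: ffexp_def fsub_def)

lemma ffln_fsub:
  assumes "adm (F - ffone)"
  shows "ffln W F = fsub W (fps_ln 1) (F - ffone)"
proof (rule ext, rule fls_eqI)
  fix ws :: "'v list" and g :: int
  let ?X = "F - ffone"
  have X: "(\<lambda>us. F us - ffone us) = ?X" by (simp add: fun_diff_def)
  obtain K where K: "int K > 2 * g + int (length ws)"
    by (rule that[of "nat (2 * g + int (length ws) + 1)"]) linarith
  have "fls_nth (\<Sum>k. fls_const ((-1) ^ k / real (Suc k)) * pw ?X (Suc k) ws) g
      = (\<Sum>k<K. fls_nth (fls_const ((-1) ^ k / real (Suc k)) * pw ?X (Suc k) ws) g)"
  proof (rule fls_suminf_nth[of _ "int (length ws)" 2])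
    fix k g assume "fls_nth (fls_const ((-1) ^ k / real (Suc k)) * pw ?X (Suc k) ws) g \<noteq> 0"
    then have nz: "fls_nth (pw ?X (Suc k) ws) g \<noteq> 0" by auto
    have "wt 1 ?X" using assms by (simp add: adm_def)
    from supp_inD[OF wt_pw[OF this] nz] show "int k \<le> int (length ws) + 2 * g" by simp
  qed (use K in simp_all)
  also have "\<dots> = (\<Sum>k<K. fps_nth (fps_ln 1) (Suc k) * fls_nth (pw ?X (Suc k) ws) g)"
    by (simp add: fps_ln_nth)
  also have "\<dots> = (\<Sum>k<Suc K. fps_nth (fps_ln 1) k * fls_nth (pw ?X k ws) g)"
    by (simp add: sum.lessThan_Suc_shift del: sum.lessThan_Suc)
  also have "\<dots> = fls_nth (fsub W (fps_ln 1) ?X ws) g"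
    by (rule fsub_nth[symmetric]) (use assms K in simp_all)
  finally show "fls_nth (ffln W F ws) g = fls_nth (fsub W (fps_ln 1) ?X ws) g"
    unfolding ffln_def X .
qed

lemma exp_minus_one: assumes "adm X" shows "ffexp W X - ffone = fsub W (fps_exp 1 - 1) X"
  using fsub_add[OF assms, of "fps_exp 1 - 1" 1] by (simp add: ffexp_fsub fsub_one[OF assms])

lemma adm_exp: "adm X \<Longrightarrow> adm (ffexp W X - ffone)"
  by (simp add: exp_minus_one adm_fsub)

text \<open>\<open>fps_ln 1\<close> is the compositional inverse of \<open>fps_exp 1 - 1\<close>,
  and substitution respects composition.\<close>

lemma ln_exp: assumes "adm X" shows "ffln W (ffexp W X) = X"
proof -
  have "fps_ln 1 oo (fps_exp 1 - 1) = (fps_X :: real fps)"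
    using fps_inv[of "fps_exp 1 - 1 :: real fps"] by (simp add: fps_ln_fps_exp_inv)
  then show ?thesis
    unfolding ffln_fsub[OF adm_exp[OF assms]] exp_minus_one[OF assms]
    by (simp add: fsub_compose[OF assms] fsub_X[OF assms])
qed

lemma exp_ln: assumes "adm (F - ffone)" shows "ffexp W (ffln W F) = F"
proof -
  let ?X = "F - ffone"
  have e: "(fps_exp 1 - 1) oo fps_ln 1 = (fps_X :: real fps)"
    using fps_inv_right[of "fps_exp 1 - 1 :: real fps"] by (simp add: fps_ln_fps_exp_inv)
  have L: "adm (fsub W (fps_ln 1) ?X)" by (simp add: adm_fsub assms)
  have "ffexp W (ffln W F) - ffone = fsub W (fps_exp 1 - 1) (fsub W (fps_ln 1) ?X)"
    unfolding ffln_fsub[OF assms] exp_minus_one[OF L] ..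
  also have "\<dots> = ?X" by (simp add: fsub_compose[OF assms] e fsub_X[OF assms])
  finally show ?thesis by simp
qed

lemma exp_inverse: assumes "adm X" shows "ffexp W X \<odot> fsub W (fps_exp (-1)) X = ffone"
  using fsub_mult[OF assms, of "fps_exp 1" "fps_exp (-1)"]
  by (simp add: ffexp_fsub fps_exp_add_mult[symmetric] fsub_one[OF assms])

text \<open>This is the division that turns linear equations for an exponential into equations for
  the exponent.\<close>

lemma mult_exp_cancel:
  assumes X: "adm X" and F: "ff F" and z: "F \<odot> ffexp W X = 0" shows "F = 0"
proof -
  have "F = F \<odot> (ffexp W X \<odot> fsub W (fps_exp (-1)) X)" by (simp add: exp_inverse[OF X] F)
  also have "\<dots> = (F \<odot> ffexp W X) \<odot> fsub W (fps_exp (-1)) X"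
    by (rule mult_assoc[symmetric]) (simp_all add: F ffexp_fsub ff_fsub X)
  finally show ?thesis by (simp add: z)
qed

lemma dd_exp: "adm X \<Longrightarrow> w \<in> Ev W \<or> w \<in> Od W \<Longrightarrow> dd w (ffexp W X) = dd w X \<odot> ffexp W X"
  by (simp add: ffexp_fsub dd_fsub)

end

section \<open>Polynomial paths of functions\<close>

text \<open>A path is carried together with its derivative, one polynomial for each power of
  \<hbar>. Calculus rules are then statements about pairs, and the derivative is unique because a
  polynomial is determined by its values.\<close>

definition fpath :: "(real \<Rightarrow> real fls) \<Rightarrow> (real \<Rightarrow> real fls) \<Rightarrow> bool" where
  "fpath a a' \<longleftrightarrow> (\<forall>g. \<exists>q. \<forall>t. fls_nth (a t) g = poly q t \<and> fls_nth (a' t) g = poly (pderiv q) t)"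

definition dpath :: "(real \<Rightarrow> 'v ffun) \<Rightarrow> (real \<Rightarrow> 'v ffun) \<Rightarrow> bool" where
  "dpath A A' \<longleftrightarrow> (\<forall>ws. fpath (\<lambda>t. A t ws) (\<lambda>t. A' t ws))"

lemma fpathE:
  assumes "fpath a a'"
  obtains q where "\<And>t. fls_nth (a t) g = poly q t" "\<And>t. fls_nth (a' t) g = poly (pderiv q) t"
  using assms unfolding fpath_def by blast

lemma fpathI:
  assumes "\<And>g. \<exists>q. \<forall>t. fls_nth (a t) g = poly q t \<and> fls_nth (a' t) g = poly (pderiv q) t"
  shows "fpath a a'"
  using assms unfolding fpath_def by blast

lemma fpath_const: "fpath (\<lambda>_. c) (\<lambda>_. 0)"
  by (rule fpathI, rule_tac x="[:fls_nth c g:]" in exI) simp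

lemma fpath_add: assumes "fpath a a'" "fpath b b'" shows "fpath (\<lambda>t. a t + b t) (\<lambda>t. a' t + b' t)"
proof (rule fpathI)
  fix g
  obtain q where "\<And>t. fls_nth (a t) g = poly q t" "\<And>t. fls_nth (a' t) g = poly (pderiv q) t"
    by (rule fpathE[OF assms(1), where g=g]) blast
  moreover obtain r where "\<And>t. fls_nth (b t) g = poly r t" "\<And>t. fls_nth (b' t) g = poly (pderiv r) t"
    by (rule fpathE[OF assms(2), where g=g]) blast
  ultimately show "\<exists>q. \<forall>t. fls_nth (a t + b t) g = poly q t \<and> fls_nth (a' t + b' t) g = poly (pderiv q) t"
    by (intro exI[of _ "q + r"]) (simp add: pderiv_add)
qed

lemma fpath_poly_mult:
  assumes "fpath a a'"
  shows "fpath (\<lambda>t. fls_const (poly r t) * a t)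
    (\<lambda>t. fls_const (poly (pderiv r) t) * a t + fls_const (poly r t) * a' t)"
proof (rule fpathI)
  fix g
  obtain q where "\<And>t. fls_nth (a t) g = poly q t" "\<And>t. fls_nth (a' t) g = poly (pderiv q) t"
    by (rule fpathE[OF assms(1), where g=g]) blast
  then show "\<exists>q. \<forall>t. fls_nth (fls_const (poly r t) * a t) g = poly q t \<and>
      fls_nth (fls_const (poly (pderiv r) t) * a t + fls_const (poly r t) * a' t) g = poly (pderiv q) t"
    by (intro exI[of _ "r * q"]) (simp add: pderiv_mult algebra_simps)
qed

lemma fpath_const_mult: "fpath a a' \<Longrightarrow> fpath (\<lambda>t. fls_const c * a t) (\<lambda>t. fls_const c * a' t)"
  using fpath_poly_mult[of a a' "[:c:]"] by simp

lemma fpath_uminus: "fpath a a' \<Longrightarrow> fpath (\<lambda>t. - a t) (\<lambda>t. - a' t)"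
  using fpath_const_mult[of a a' "-1"] by simp

lemma fpath_shift: assumes "fpath a a'" shows "fpath (\<lambda>t. fls_shift k (a t)) (\<lambda>t. fls_shift k (a' t))"
  using assms unfolding fpath_def by simp

lemma fpath_X: "fpath a a' \<Longrightarrow> fpath (\<lambda>t. fls_X * a t) (\<lambda>t. fls_X * a' t)"
  using fpath_shift[of a a' "-1"] by (simp add: fls_X_times_conv_shift)

lemma fpath_sum: "(\<And>i. i \<in> I \<Longrightarrow> fpath (a i) (a' i)) \<Longrightarrow> fpath (\<lambda>t. \<Sum>i\<in>I. a i t) (\<lambda>t. \<Sum>i\<in>I. a' i t)"
  by (induction I rule: infinite_finite_induct) (simp_all add: fpath_const fpath_add)

lemma fpath_nth_zero: assumes "fpath a a'" "\<And>t. fls_nth (a t) g = 0" shows "fls_nth (a' t) g = 0"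
proof -
  obtain q where q: "\<And>t. fls_nth (a t) g = poly q t" "\<And>t. fls_nth (a' t) g = poly (pderiv q) t"
    by (rule fpathE[OF assms(1), where g=g]) blast
  have "q = 0" using assms(2) q(1) by (metis poly_all_0_iff_0)
  then show ?thesis by (simp add: q)
qed

lemma fpath_unique: assumes "fpath a a'" "fpath a b'" shows "a' t = b' t"
proof (rule fls_eqI)
  fix g
  obtain q where q: "\<And>t. fls_nth (a t) g = poly q t" "\<And>t. fls_nth (a' t) g = poly (pderiv q) t"
    by (rule fpathE[OF assms(1), where g=g]) blast
  obtain r where r: "\<And>t. fls_nth (a t) g = poly r t" "\<And>t. fls_nth (b' t) g = poly (pderiv r) t"
    by (rule fpathE[OF assms(2), where g=g]) blast
  have "poly q = poly r" using q(1) r(1) by (simp add: fun_eq_iff)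
  then have "q = r" by (simp add: poly_eq_poly_eq_iff)
  then show "fls_nth (a' t) g = fls_nth (b' t) g" by (simp add: q r)
qed

lemma fpath_nth_const:
  assumes "fpath a a'" "\<And>t. fls_nth (a' t) g = 0" shows "fls_nth (a t) g = fls_nth (a 0) g"
proof -
  obtain q where q: "\<And>t. fls_nth (a t) g = poly q t" "\<And>t. fls_nth (a' t) g = poly (pderiv q) t"
    by (rule fpathE[OF assms(1), where g=g]) blast
  have "pderiv q = 0" using assms(2) q(2) by (metis poly_all_0_iff_0)
  then have "degree q = 0" by (simp add: pderiv_eq_0_iff)
  then obtain c where "q = [:c:]" by (rule degree_eq_zeroE)
  then show ?thesis by (simp add: q)
qed

text \<open>The range of summation depends on the lower bounds alone. The subdegrees would vary
  along a path, and the coefficient would no longer be a fixed finite sum of products of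
  polynomials.\<close>

lemma fls_mult_nth_bound:
  fixes f h :: "real fls"
  assumes "\<And>i. i < a \<Longrightarrow> fls_nth f i = 0" "\<And>i. i < b \<Longrightarrow> fls_nth h i = 0"
  shows "fls_nth (f * h) n = (\<Sum>i\<in>{a..n-b}. fls_nth f i * fls_nth h (n - i))"
proof (cases "f = 0 \<or> h = 0")
  case True then show ?thesis by auto
next
  case False
  then have "a \<le> fls_subdegree f" "b \<le> fls_subdegree h"
    using assms by (meson fls_subdegree_geI)+
  then show ?thesis unfolding fls_times_nth(2)
    by (intro sum.mono_neutral_left) (auto simp: not_le)
qed

lemma fpath_mult:
  assumes "fpath a a'" "fpath b b'"
    and la: "\<And>t i. i < l \<Longrightarrow> fls_nth (a t) i = 0" and lb: "\<And>t i. i < m \<Longrightarrow> fls_nth (b t) i = 0"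
  shows "fpath (\<lambda>t. a t * b t) (\<lambda>t. a' t * b t + a t * b' t)"
proof (rule fpathI)
  fix g
  have la': "fls_nth (a' t) i = 0" if "i < l" for t i
    using fpath_nth_zero[OF assms(1)] la[OF that] by blast
  have lb': "fls_nth (b' t) i = 0" if "i < m" for t i
    using fpath_nth_zero[OF assms(2)] lb[OF that] by blast
  obtain q where q: "\<And>i t. fls_nth (a t) i = poly (q i) t" "\<And>i t. fls_nth (a' t) i = poly (pderiv (q i)) t"
    using assms(1) unfolding fpath_def by metis
  obtain r where r: "\<And>i t. fls_nth (b t) i = poly (r i) t" "\<And>i t. fls_nth (b' t) i = poly (pderiv (r i)) t"
    using assms(2) unfolding fpath_def by metis
  have pd: "pderiv (\<Sum>i\<in>I. q i * r (g - i)) = (\<Sum>i\<in>I. pderiv (q i * r (g - i)))" for I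
    by (induction I rule: infinite_finite_induct) (simp_all add: pderiv_add)
  show "\<exists>q. \<forall>t. fls_nth (a t * b t) g = poly q t \<and> fls_nth (a' t * b t + a t * b' t) g = poly (pderiv q) t"
  proof (intro exI[of _ "\<Sum>i\<in>{l..g - m}. q i * r (g - i)"] allI conjI)
    fix t
    show "fls_nth (a t * b t) g = poly (\<Sum>i\<in>{l..g - m}. q i * r (g - i)) t"
      by (subst fls_mult_nth_bound[of l "a t" m "b t", OF la lb]) (simp_all add: poly_sum q r)
    show "fls_nth (a' t * b t + a t * b' t) g = poly (pderiv (\<Sum>i\<in>{l..g - m}. q i * r (g - i))) t"
    proof -
      have 1: "fls_nth (a' t * b t) g = (\<Sum>i\<in>{l..g - m}. fls_nth (a' t) i * fls_nth (b t) (g - i))"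
        by (rule fls_mult_nth_bound) (simp_all add: la' lb)
      have 2: "fls_nth (a t * b' t) g = (\<Sum>i\<in>{l..g - m}. fls_nth (a t) i * fls_nth (b' t) (g - i))"
        by (rule fls_mult_nth_bound) (simp_all add: la lb')
      show ?thesis
        unfolding pd fls_plus_nth 1 2
        by (simp add: poly_sum q r pderiv_mult sum.distrib[symmetric] algebra_simps)
    qed
  qed
qed

lemma fpath_reparam:
  assumes "fpath a a'"
  shows "fpath (\<lambda>t. a (poly r t)) (\<lambda>t. fls_const (poly (pderiv r) t) * a' (poly r t))"
proof (rule fpathI)
  fix g
  obtain q where q: "\<And>t. fls_nth (a t) g = poly q t" "\<And>t. fls_nth (a' t) g = poly (pderiv q) t"
    by (rule fpathE[OF assms(1), where g=g]) blast
  show "\<exists>q. \<forall>t. fls_nth (a (poly r t)) g = poly q t \<and>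
      fls_nth (fls_const (poly (pderiv r) t) * a' (poly r t)) g = poly (pderiv q) t"
    by (intro exI[of _ "pcompose q r"]) (simp add: q poly_pcompose pderiv_pcompose mult.commute)
qed

lemma dpathD: "dpath A A' \<Longrightarrow> fpath (\<lambda>t. A t ws) (\<lambda>t. A' t ws)"
  by (simp add: dpath_def)

lemma dpath_const: "dpath (\<lambda>_. F) (\<lambda>_. 0)"
  by (simp add: dpath_def fpath_const)

lemma dpath_add: "dpath A A' \<Longrightarrow> dpath B B' \<Longrightarrow> dpath (\<lambda>t. A t + B t) (\<lambda>t. A' t + B' t)"
  by (simp add: dpath_def fpath_add)

lemma dpath_uminus: "dpath A A' \<Longrightarrow> dpath (\<lambda>t. - A t) (\<lambda>t. - A' t)"
  by (simp add: dpath_def fpath_uminus)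

lemma dpath_diff: "dpath A A' \<Longrightarrow> dpath B B' \<Longrightarrow> dpath (\<lambda>t. A t - B t) (\<lambda>t. A' t - B' t)"
  using dpath_add[OF _ dpath_uminus, of A A' B B'] by simp

lemma dpath_sc_const: "dpath A A' \<Longrightarrow> dpath (\<lambda>t. sc (fls_const c) (A t)) (\<lambda>t. sc (fls_const c) (A' t))"
  by (simp add: dpath_def fpath_const_mult)

lemma dpath_sc_poly: "dpath A A' \<Longrightarrow> dpath (\<lambda>t. sc (fls_const (poly r t)) (A t))
    (\<lambda>t. sc (fls_const (poly (pderiv r) t)) (A t) + sc (fls_const (poly r t)) (A' t))"
  by (simp add: dpath_def fpath_poly_mult)

lemma dpath_sc_X: "dpath A A' \<Longrightarrow> dpath (\<lambda>t. sc fls_X (A t)) (\<lambda>t. sc fls_X (A' t))"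
  by (simp add: dpath_def fpath_X)

lemma dpath_dd: "dpath A A' \<Longrightarrow> dpath (\<lambda>t. dd w (A t)) (\<lambda>t. dd w (A' t))"
  by (simp add: dpath_def dd_def)

lemma dpath_ffgrade: "dpath A A' \<Longrightarrow> dpath (\<lambda>t. ffgrade W (A t)) (\<lambda>t. ffgrade W (A' t))"
  by (simp add: dpath_def ffgrade_def)

lemma dpath_unique: assumes "dpath A A'" "dpath A B'" shows "A' t = B' t"
  by (rule ext, rule fpath_unique[OF dpathD[OF assms(1)] dpathD[OF assms(2)]])

lemma dpath_reparam:
  assumes "dpath A A'" shows "dpath (\<lambda>t. A (poly r t)) (\<lambda>t. sc (fls_const (poly (pderiv r) t)) (A' (poly r t)))"
  unfolding dpath_def sc_apply
proof
  fix ws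
  show "fpath (\<lambda>t. A (poly r t) ws) (\<lambda>t. fls_const (poly (pderiv r) t) * A' (poly r t) ws)"
    by (rule fpath_reparam[OF dpathD[OF assms]])
qed

text \<open>A coefficient that vanishes for all times is given by the zero polynomial, and so is its
  derivative.\<close>

lemma dpath_supp: assumes "dpath A A'" "\<And>t. supp_in R (A t)" shows "supp_in R (A' t)"
  unfolding supp_in_def
proof (intro allI impI)
  fix ws g assume nz: "fls_nth (A' t ws) g \<noteq> 0"
  show "R g (int (length ws))"
  proof (rule ccontr)
    assume "\<not> ?thesis"
    then have "fls_nth (A t ws) g = 0" for t using supp_inD[OF assms(2)] by blast
    from fpath_nth_zero[OF dpathD[OF assms(1)] this] show False using nz by simp
  qed
qed

lemma tderiv_dpath: assumes "dpath A A'" shows "tderiv A t = A' t"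
proof
  fix ws
  have "deriv (\<lambda>u. fls_nth (A u ws) g) t = fls_nth (A' t ws) g" for g
  proof -
    obtain q where q: "\<And>t. fls_nth (A t ws) g = poly q t" "\<And>t. fls_nth (A' t ws) g = poly (pderiv q) t"
      by (rule fpathE[OF dpathD[OF assms], where g=g]) blast
    show ?thesis unfolding q by (rule DERIV_imp_deriv[OF poly_DERIV])
  qed
  then show "tderiv A t ws = A' t ws" by (simp add: tderiv_def fls_nth_inverse)
qed

section \<open>Paths in the algebra of formal functions\<close>

context super_sp
begin

text \<open>The bounds on \<open>3 g + n\<close> hold for all \<open>t\<close>, hence bound the
  poles of each Taylor coefficient uniformly, as the product of paths of Laurent series
  requires.\<close>

lemma dpath_mult:
  assumes "dpath A A'" "dpath B B'" "\<And>t. bt a (A t)" "\<And>t. bt b (B t)"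
  shows "dpath (\<lambda>t. A t \<odot> B t) (\<lambda>t. A' t \<odot> B t + A t \<odot> B' t)"
  unfolding dpath_def
proof
  fix ws show "fpath (\<lambda>t. (A t \<odot> B t) ws) (\<lambda>t. (A' t \<odot> B t + A t \<odot> B' t) ws)"
    using assms
  proof (induction ws arbitrary: A A' B B' a b)
    case Nil
    have a: "fls_nth (A t []) i = 0" if "i < - \<bar>a\<bar>" for i t
      using supp_inD[OF Nil(3), of t "[]" i] that by force
    have b: "fls_nth (B t []) i = 0" if "i < - \<bar>b\<bar>" for i t
      using supp_inD[OF Nil(4), of t "[]" i] that by force
    show ?case using fpath_mult[OF dpathD[OF Nil(1)] dpathD[OF Nil(2)] a b] by (simp add: mult_nil)
  next
    case (Cons w ws)
    have s: "bt (k - 1) (dd u F)" if "bt k F" for u k F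
      by (rule supp_in_mono[OF supp_in_dd[OF that]]) simp
    note p = Cons.prems
    note 1 = Cons.IH[OF dpath_dd[OF p(1), of w] p(2) s[OF p(3)] p(4)]
    note 2 = Cons.IH[OF p(1) dpath_dd[OF p(2), of "ev w"] p(3) s[OF p(4)]]
    note 3 = Cons.IH[OF dpath_ffgrade[OF p(1), of W] dpath_dd[OF p(2), of "od w"] supp_in_ffgrade[OF p(3)] s[OF p(4)]]
    show ?case using fpath_add[OF fpath_add[OF 1 2] 3]
      by (simp add: mult_cons algebra_simps)
  qed
qed

text \<open>The laws are linear, so both sides can be differentiated in \<open>t\<close>; uniqueness
  of the derivative transfers them to \<open>A'\<close>.\<close>

lemma dpath_ff:
  assumes A: "dpath A A'" and ff: "\<And>t. ff (A t)" shows "ff (A' t)"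
proof (rule ffI)
  fix xs ys u v
  show "A' t (xs @ (u + v) # ys) = A' t (xs @ u # ys) + A' t (xs @ v # ys)"
    by (rule fpath_unique[OF dpathD[OF A]]) (simp only: ff_add[OF ff], intro fpath_add dpathD[OF A])
  show "A' t (xs @ (a *\<^sub>R u) # ys) = fls_const a * A' t (xs @ u # ys)" for a
    by (rule fpath_unique[OF dpathD[OF A]]) (simp only: ff_scale[OF ff], intro fpath_const_mult dpathD[OF A])
  show "A' t (xs @ u # v # ys) = A' t (xs @ v # u # ys)" if u: "u \<in> Ev W"
    by (rule fpath_unique[OF dpathD[OF A]]) (subst ff_swap_Ev[OF ff u], rule dpathD[OF A])
  show "A' t (xs @ u # v # ys) = - A' t (xs @ v # u # ys)" if u: "u \<in> Od W" "v \<in> Od W"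
    by (rule fpath_unique[OF dpathD[OF A]]) (subst ff_swap_Od[OF ff u], rule fpath_uminus[OF dpathD[OF A]])
qed

lemma dpath_pw:
  assumes X: "\<And>t. adm (X t)" and d: "dpath X X'"
  shows "dpath (\<lambda>t. pw (X t) (Suc k)) (\<lambda>t. sc (of_nat (Suc k)) (X' t \<odot> pw (X t) k))"
proof (induction k)
  case 0
  have e: "(\<lambda>t. pw (X t) (Suc 0)) = X" using X by (auto simp: adm_def fun_eq_iff)
  have "ff (X' t)" for t by (rule dpath_ff[OF d]) (use X in \<open>simp add: adm_def\<close>)
  then show ?case unfolding e using d by simp
next
  case (Suc k)
  have ffX: "ff (X t)" and gX: "gm (X t) = X t" and bX: "bt 0 (X t)" for t using X[of t] by (simp_all add: adm_def)
  have ffX': "ff (X' t)" for t by (rule dpath_ff[OF d ffX])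
  have e: "X' t \<odot> pw (X t) (Suc k) + X t \<odot> sc (of_nat (Suc k)) (X' t \<odot> pw (X t) k)
      = sc (of_nat (Suc (Suc k))) (X' t \<odot> pw (X t) (Suc k))" for t
  proof -
    have "X t \<odot> (X' t \<odot> pw (X t) k) = (X t \<odot> X' t) \<odot> pw (X t) k"
      by (rule mult_assoc[symmetric]) (intro ffX ffX' ff_pw)+
    also have "\<dots> = X' t \<odot> pw (X t) (Suc k)"
      unfolding supercomm(1)[OF ffX ffX' gX] by (simp add: mult_assoc ffX ffX' ff_pw)
    finally show ?thesis unfolding mult_sc_right
      by (simp only: of_nat_Suc[of "Suc k"] sc_add_left sc_simps)
  qed
  show ?case using dpath_mult[OF d Suc bX bt_pw[OF bX]] unfolding e ffpow.simps(2)[symmetric] .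
qed

text \<open>For fixed arguments and a fixed power of \<hbar> one truncation serves all
  \<open>t\<close>, which leaves a finite sum of powers to be differentiated.\<close>

lemma dpath_fsub:
  assumes X: "\<And>t. adm (X t)" and d: "dpath X X'"
  shows "dpath (\<lambda>t. fsub W f (X t)) (\<lambda>t. X' t \<odot> fsub W (fps_deriv f) (X t))"
  unfolding dpath_def
proof
  fix ws
  have ffX: "ff (X t)" and wX: "wt 1 (X t)" for t using X[of t] by (simp_all add: adm_def)
  have ffX': "ff (X' t)" for t by (rule dpath_ff[OF d ffX])
  have wX': "wt 1 (X' t)" for t by (rule dpath_supp[OF d wX])
  show "fpath (\<lambda>t. fsub W f (X t) ws) (\<lambda>t. (X' t \<odot> fsub W (fps_deriv f) (X t)) ws)"
  proof (rule fpathI)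
    fix g
    obtain K where K: "int K > 2 * g + int (length ws)"
      by (rule that[of "nat (2 * g + int (length ws) + 1)"]) linarith
    \<comment> \<open>Differentiation lowers the power by one, so \<open>K\<close> terms of the
      derived series correspond to \<open>Suc K\<close> terms of \<open>f\<close>.\<close>
    then have K': "int (Suc K) > 2 * g + int (length ws)" by simp
    define a where "a t = (\<Sum>k<Suc K. fls_const (fps_nth f k) * pw (X t) k ws)" for t
    define a' where "a' t = (\<Sum>k<Suc K. fls_const (fps_nth f k) *
      (case k of 0 \<Rightarrow> 0 | Suc j \<Rightarrow> sc (of_nat (Suc j)) (X' t \<odot> pw (X t) j) ws))" for t
    have "fpath a a'" unfolding a_def a'_def
    proof (intro fpath_sum fpath_const_mult)
      fix k
      show "fpath (\<lambda>t. pw (X t) k ws) (\<lambda>t. case k of 0 \<Rightarrow> 0 | Suc j \<Rightarrow> sc (of_nat (Suc j)) (X' t \<odot> pw (X t) j) ws)"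
      proof (cases k)
        case 0 then show ?thesis by (simp add: fpath_const)
      next
        case (Suc j) then show ?thesis using dpathD[OF dpath_pw[OF X d, of j]] by simp
      qed
    qed
    moreover have "fls_nth (fsub W f (X t) ws) g = fls_nth (a t) g" for t
      unfolding fsub_nth[OF X K'] a_def fls_nth_sum by simp
    moreover have "fls_nth ((X' t \<odot> fsub W (fps_deriv f) (X t)) ws) g = fls_nth (a' t) g" for t
    proof -
      have "wt (int K) (X' t \<odot> (fsub W (fps_deriv f) (X t) - ftrunc W K (fps_deriv f) (X t)))"
        using wt_mult[OF wX'[of t] wt_fsub_trunc[OF X[of t], of K]] by (rule wt_mono) simp
      from wtD[OF this K]
      have "fls_nth ((X' t \<odot> fsub W (fps_deriv f) (X t)) ws) g = fls_nth ((X' t \<odot> ftrunc W K (fps_deriv f) (X t)) ws) g"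
        by (simp add: mult_lin)
      also have "(X' t \<odot> ftrunc W K (fps_deriv f) (X t)) ws
          = (\<Sum>k<K. fls_const (fps_nth (fps_deriv f) k) * (X' t \<odot> pw (X t) k) ws)"
        unfolding ftrunc_def mult_sum_right mult_sc_right by (simp add: sum_fun_apply)
      also have "\<dots> = a' t"
        unfolding a'_def sum.lessThan_Suc_shift
        by (simp add: mult.assoc[symmetric] fls_of_nat fls_const_mult_const mult.commute del: of_nat_Suc)
      finally show ?thesis .
    qed
    ultimately show "\<exists>q. \<forall>t. fls_nth (fsub W f (X t) ws) g = poly q t \<and>
        fls_nth ((X' t \<odot> fsub W (fps_deriv f) (X t)) ws) g = poly (pderiv q) t"
      unfolding fpath_def by simp
  qed
qed

lemma dpath_exp:
  "(\<And>t. adm (X t)) \<Longrightarrow> dpath X X' \<Longrightarrow> dpath (\<lambda>t. ffexp W (X t)) (\<lambda>t. X' t \<odot> ffexp W (X t))"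
  unfolding ffexp_fsub by (drule (1) dpath_fsub[where f="fps_exp 1"]) simp

text \<open>The logarithmic derivative is described implicitly by \<open>L' \<odot> G = G'\<close>,
  the form in which it can be compared with the heat equation for \<open>G\<close>.\<close>

lemma dpath_ln:
  assumes G: "\<And>t. adm (G t - ffone)" and d: "dpath G G'"
  obtains L' where "dpath (\<lambda>t. ffln W (G t)) L'" "\<And>t. L' t \<odot> G t = G' t"
proof
  have d': "dpath (\<lambda>t. G t - ffone) G'" using dpath_diff[OF d dpath_const[of ffone]] by simp
  let ?L = "\<lambda>t. G' t \<odot> fsub W (fps_deriv (fps_ln 1)) (G t - ffone)"
  show "dpath (\<lambda>t. ffln W (G t)) ?L"
    unfolding ffln_fsub[OF G] by (rule dpath_fsub[OF G d'])
  fix t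
  have ffG': "ff (G' t)" by (rule dpath_ff[OF d']) (use G in \<open>simp add: adm_def\<close>)
  have Gt: "G t = fsub W (1 + fps_X) (G t - ffone)"
    by (simp add: fsub_add[OF G] fsub_one[OF G] fsub_X[OF G])
  have one: "fps_deriv (fps_ln 1) * (1 + fps_X) = (1 :: real fps)"
    by (simp add: fps_ln_deriv inverse_mult_eq_1)
  have "?L t \<odot> G t = (G' t \<odot> fsub W (fps_deriv (fps_ln 1)) (G t - ffone)) \<odot> fsub W (1 + fps_X) (G t - ffone)"
    using Gt by (rule arg_cong[where f="\<lambda>Y. (G' t \<odot> fsub W (fps_deriv (fps_ln 1)) (G t - ffone)) \<odot> Y"])
  also have "\<dots> = G' t \<odot> (fsub W (fps_deriv (fps_ln 1)) (G t - ffone) \<odot> fsub W (1 + fps_X) (G t - ffone))"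
    by (rule mult_assoc) (intro ffG' ff_fsub G)+
  also have "\<dots> = G' t" unfolding fsub_mult[OF G] one fsub_one[OF G] by (rule mult_one[OF ffG'])
  finally show "?L t \<odot> G t = G' t" .
qed

end

section \<open>Pullbacks, derivations and operators of order two\<close>

declare plus_fun_apply [simp del] zero_fun_apply [simp del] sc_apply [simp del]
  minus_apply [simp del] uminus_apply [simp del]

lemmas pt = plus_fun_apply minus_apply uminus_apply zero_fun_apply sc_apply

section \<open>Pullbacks and derivations along them\<close>

lemma pullback_apply: "pullback f F ws = F (map f ws)"
  by (simp add: pullback_def)

lemma dd_pullback: "dd w (pullback f F) = pullback f (dd (f w) F)"
  by (rule ext) (simp add: dd_apply pullback_apply)

lemma pullback_lin: "pullback f (F + G) = pullback f F + pullback f G"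
  "pullback f (F - G) = pullback f F - pullback f G" "pullback f (- F) = - pullback f F"
  "pullback f 0 = 0" "pullback f (sc c F) = sc c (pullback f F)"
  by (rule ext, simp add: pullback_apply pt)+

lemma pullback_supp: "supp_in R F \<Longrightarrow> supp_in R (pullback f F)"
  unfolding supp_in_def pullback_apply by (metis length_map)

lemma pullback_one: "pullback f ffone = ffone"
  by (rule ext) (simp add: pullback_apply ffone_def)

lemma pullback_id: "pullback (\<lambda>w. w) F = F"
  by (rule ext) (simp add: pullback_apply)

text \<open>The operator has to pass the arguments in front of the one hit by \<open>S\<close>, and
  that argument itself, whence \<open>\<kappa>\<close> on them; the later arguments only undergo
  \<open>f\<close>.\<close>

primrec DVl :: "('v \<Rightarrow> 'w) \<Rightarrow> ('w \<Rightarrow> 'u) \<Rightarrow> ('w \<Rightarrow> 'u) \<Rightarrow> ('v \<Rightarrow> 'u) \<Rightarrow> 'v list \<Rightarrow> 'u ffun \<Rightarrow> real fls" where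
  "DVl \<kappa> \<phi> S f [] F = 0"
| "DVl \<kappa> \<phi> S f (w # ws) F = F (S (\<kappa> w) # map f ws) + DVl \<kappa> \<phi> S f ws (dd (\<phi> (\<kappa> w)) F)"

text \<open>The derivation along \<open>\<phi>\<^sup>*\<close> induced by \<open>S\<close>, with \<open>\<kappa>\<close> the grading involution if \<open>S\<close> is odd and the
  identity if \<open>S\<close> is even.\<close>

definition DV :: "('v \<Rightarrow> 'v) \<Rightarrow> ('v \<Rightarrow> 'v) \<Rightarrow> ('v \<Rightarrow> 'v) \<Rightarrow> 'v ffun \<Rightarrow> 'v ffun" where
  "DV \<kappa> \<phi> S F = (\<lambda>ws. DVl \<kappa> \<phi> S \<phi> ws F)"

lemma DV_nil: "DV \<kappa> \<phi> S F [] = 0"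
  by (simp add: DV_def)

lemma DV_cons: "DV \<kappa> \<phi> S F (w # ws) = pullback \<phi> (dd (S (\<kappa> w)) F) ws + DV \<kappa> \<phi> S (dd (\<phi> (\<kappa> w)) F) ws"
  by (simp add: DV_def pullback_apply dd_apply)

lemma dd_DV: "dd w (DV \<kappa> \<phi> S F) = pullback \<phi> (dd (S (\<kappa> w)) F) + DV \<kappa> \<phi> S (dd (\<phi> (\<kappa> w)) F)"
  by (rule ext) (simp add: dd_apply[of w] DV_cons pt)

lemma DV_add: "DV \<kappa> \<phi> S (F + G) = DV \<kappa> \<phi> S F + DV \<kappa> \<phi> S G"
proof
  show "DV \<kappa> \<phi> S (F + G) ws = (DV \<kappa> \<phi> S F + DV \<kappa> \<phi> S G) ws" for ws
    by (induction ws arbitrary: F G) (simp_all add: DV_nil DV_cons pullback_lin pt)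
qed

lemma DV_sc: "DV \<kappa> \<phi> S (sc c F) = sc c (DV \<kappa> \<phi> S F)"
proof
  show "DV \<kappa> \<phi> S (sc c F) ws = sc c (DV \<kappa> \<phi> S F) ws" for ws
    by (induction ws arbitrary: F) (simp_all add: DV_nil DV_cons pullback_lin distrib_left pt)
qed

lemma DV_neg: "DV \<kappa> \<phi> S (- F) = - DV \<kappa> \<phi> S F"
  using DV_sc[of \<kappa> \<phi> S "-1" F] by (simp add: sc_neg1)

lemma DV_0: "DV \<kappa> \<phi> S 0 = 0"
  using DV_sc[of \<kappa> \<phi> S 0 0] by simp

lemma DV_diff: "DV \<kappa> \<phi> S (F - G) = DV \<kappa> \<phi> S F - DV \<kappa> \<phi> S G"
  using DV_add[of \<kappa> \<phi> S F "- G"] by (simp add: DV_neg)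

lemmas DV_lin = DV_add DV_sc DV_neg DV_0 DV_diff

lemma DV_one: "DV \<kappa> \<phi> S ffone = 0"
proof
  show "DV \<kappa> \<phi> S ffone ws = 0 ws" for ws :: "'a list"
  proof (cases ws)
    case (Cons w us)
    have "dd u ffone = 0" for u :: 'a by (rule ext) (simp add: dd_def ffone_def pt)
    then show ?thesis by (simp add: Cons DV_cons pullback_lin DV_0 pt)
  qed (simp add: DV_nil pt)
qed

lemma DV_supp:
  assumes "supp_in R F"
  shows "supp_in R (DV \<kappa> \<phi> S F)"
proof -
  have "R g (int (length ws))" if "fls_nth (DV \<kappa> \<phi> S F ws) g \<noteq> 0" "supp_in R F" for ws g F R
    using that
  proof (induction ws arbitrary: F R)
    case Nil then show ?case by (simp add: DV_nil)
  next
    case (Cons w ws)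
    have "fls_nth (pullback \<phi> (dd (S (\<kappa> w)) F) ws) g \<noteq> 0 \<or> fls_nth (DV \<kappa> \<phi> S (dd (\<phi> (\<kappa> w)) F) ws) g \<noteq> 0"
      using Cons.prems(1) by (auto simp: DV_cons)
    then show ?case
    proof
      assume "fls_nth (pullback \<phi> (dd (S (\<kappa> w)) F) ws) g \<noteq> 0"
      from supp_inD[OF pullback_supp[OF supp_in_dd[OF Cons.prems(2)]] this]
      show ?thesis by (simp add: add.commute)
    next
      assume "fls_nth (DV \<kappa> \<phi> S (dd (\<phi> (\<kappa> w)) F) ws) g \<noteq> 0"
      from Cons.IH[OF this supp_in_dd[OF Cons.prems(2)]] show ?thesis by (simp add: add.commute)
    qed
  qed
  then show ?thesis using assms unfolding supp_in_def by blast
qed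

text \<open>This makes the differential a derivation along the identity, so that the Leibniz rule
  and the chain rule for \<open>DV\<close> apply to it.\<close>

lemma ffdif_DV: "ffdif W F = DV (grade W) (\<lambda>w. w) (dif W) F"
proof
  show "ffdif W F ws = DV (grade W) (\<lambda>w. w) (dif W) F ws" for ws
  proof (induction ws arbitrary: F)
    case Nil then show ?case by (simp add: ffdif_def DV_nil)
  next
    case (Cons w ws)
    have "ffdif W F (w # ws) = F (dif W (grade W w) # ws) + ffdif W (dd (grade W w) F) ws"
      unfolding ffdif_def dd_apply by (simp add: sum.lessThan_Suc_shift del: sum.lessThan_Suc)
    then show ?case by (simp add: Cons DV_cons pullback_id) (simp add: dd_apply)
  qed
qed

text \<open>A list of triples \<open>(c, x, y)\<close> stands for the tensor \<open>\<Sum> c x \<otimes> y\<close>.\<close>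

definition L2 :: "(real \<times> 'v \<times> 'v) list \<Rightarrow> 'v ffun \<Rightarrow> 'v ffun" where
  "L2 T F = (\<lambda>ws. \<Sum>c\<leftarrow>T. fls_const (fst c) * F (fst (snd c) # snd (snd c) # ws))"

lemma L2_Nil [simp]: "L2 [] F = 0"
  by (rule ext) (simp add: L2_def pt)

lemma L2_Cons [simp]: "L2 (c # T) F = sc (fls_const (fst c)) (dd (snd (snd c)) (dd (fst (snd c)) F)) + L2 T F"
  by (rule ext) (simp add: L2_def dd_def pt)

lemma L2_append: "L2 (S @ T) F = L2 S F + L2 T F"
proof
  show "L2 (S @ T) F ws = (L2 S F + L2 T F) ws" for ws
    by (induction S) (simp_all add: pt)
qed

lemma L2_lin: "L2 T (F + G) = L2 T F + L2 T G" "L2 T (sc c F) = sc c (L2 T F)" "L2 T (- F) = - L2 T F"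
  "L2 T 0 = 0" "L2 T (F - G) = L2 T F - L2 T G"
proof -
  show 1: "L2 T (F + G) = L2 T F + L2 T G" for F G
  proof
    show "L2 T (F + G) ws = (L2 T F + L2 T G) ws" for ws
      by (induction T) (simp_all add: dd_apply algebra_simps pt)
  qed
  show 2: "L2 T (sc c F) = sc c (L2 T F)" for c F
  proof
    show "L2 T (sc c F) ws = sc c (L2 T F) ws" for ws
      by (induction T) (simp_all add: dd_apply algebra_simps pt)
  qed
  show 3: "L2 T (- F) = - L2 T F" for F using 2[of "-1" F] by (simp add: sc_neg1)
  show "L2 T 0 = 0" using 2[of 0 F] by simp
  show "L2 T (F - G) = L2 T F - L2 T G" using 1[of F "- G"] 3[of G] by simp
qed

lemma L2_supp: assumes "supp_in R F" shows "supp_in (\<lambda>g n. R g (n + 2)) (L2 T F)"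
proof (induction T)
  case (Cons c T)
  have "supp_in (\<lambda>g n. R g (n + 2)) (dd y (dd x F))" for x y
    by (rule supp_in_mono[OF supp_in_dd[OF supp_in_dd[OF assms]]]) (simp add: add.commute)
  from supp_in_add[OF supp_in_const[OF this] Cons] show ?case by simp
qed simp

lemma dpath_L2: "dpath A A' \<Longrightarrow> dpath (\<lambda>t. L2 T (A t)) (\<lambda>t. L2 T (A' t))"
proof (induction T)
  case (Cons c T)
  show ?case unfolding L2_Cons
    by (intro dpath_add dpath_sc_const dpath_dd Cons.prems Cons.IH)
qed (simp add: dpath_const[of 0])

lemma dpath_DV: assumes "dpath A A'" shows "dpath (\<lambda>t. DV \<kappa> \<phi> S (A t)) (\<lambda>t. DV \<kappa> \<phi> S (A' t))"
  unfolding dpath_def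
proof
  fix ws show "fpath (\<lambda>t. DV \<kappa> \<phi> S (A t) ws) (\<lambda>t. DV \<kappa> \<phi> S (A' t) ws)"
    using assms
  proof (induction ws arbitrary: A A')
    case Nil show ?case by (simp add: DV_nil fpath_const)
  next
    case (Cons w ws)
    show ?case unfolding DV_cons pullback_apply
      by (intro fpath_add Cons.IH dpath_dd Cons.prems dpathD)
  qed
qed

abbreviation tmap :: "('v \<Rightarrow> 'u) \<Rightarrow> ('v \<Rightarrow> 'u) \<Rightarrow> (real \<times> 'v \<times> 'v) list \<Rightarrow> (real \<times> 'u \<times> 'u) list" where
  "tmap f h \<equiv> map (\<lambda>c. (fst c, f (fst (snd c)), h (snd (snd c))))"

lemma L2_pullback: "L2 T (pullback f F) = pullback f (L2 (tmap f f T) F)"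
proof (induction T)
  case (Cons c T)
  have "L2 (c # T) (pullback f F) = sc (fls_const (fst c)) (dd (snd (snd c)) (dd (fst (snd c)) (pullback f F)))
      + pullback f (L2 (tmap f f T) F)"
    unfolding L2_Cons using Cons.IH by (metis (no_types))
  then show ?case by (simp add: pullback_lin dd_pullback)
qed (simp add: pullback_lin)

lemma pullback_mult:
  assumes e: "\<And>x. ev_proj W (f x) = f (ev_proj W' x)" and o: "\<And>x. od_proj W (f x) = f (od_proj W' x)"
    and gr: "\<And>x. grade W (f x) = f (grade W' x)"
  shows "ffmult W' (pullback f F) (pullback f G) = pullback f (ffmult W F G)"
proof
  have g: "ffgrade W' (pullback f F) = pullback f (ffgrade W F)" for F
    by (rule ext) (simp add: ffgrade_def pullback_apply comp_def gr)
  fix ws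
  have "taylor_mult W' ws (pullback f F) (pullback f G) = taylor_mult W (map f ws) F G"
  proof (induction ws arbitrary: F G)
    case Nil show ?case by (simp add: pullback_apply)
  next
    case (Cons w ws)
    have c: "(\<lambda>us. pullback f F (x # us)) = pullback f (\<lambda>us. F (f x # us))" for F and x
      by (rule ext) (simp add: pullback_apply)
    show ?case unfolding taylor_mult.simps list.map c g Cons e o ..
  qed
  then show "ffmult W' (pullback f F) (pullback f G) ws = pullback f (ffmult W F G) ws"
    by (simp add: ffmult_def pullback_apply)
qed

lemma pullback_fsub:
  assumes "\<And>x. ev_proj W (f x) = f (ev_proj W' x)" and "\<And>x. od_proj W (f x) = f (od_proj W' x)"
    and "\<And>x. grade W (f x) = f (grade W' x)"
  shows "fsub W' h (pullback f X) = pullback f (fsub W h X)"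
proof -
  have "ffpow W' (pullback f X) k = pullback f (ffpow W X k)" for k
  proof (induction k)
    case 0 show ?case unfolding ffpow.simps pullback_one ..
  next
    case (Suc k) show ?case unfolding ffpow.simps Suc pullback_mult[OF assms] ..
  qed
  then show ?thesis unfolding fsub_def by (simp add: pullback_def)
qed

context super_sp
begin

lemma ff_pullback:
  assumes F: "formal_fun W' F" and lin: "linear f"
    and e: "\<And>x. x \<in> Ev W \<Longrightarrow> f x \<in> Ev W'" and o: "\<And>x. x \<in> Od W \<Longrightarrow> f x \<in> Od W'"
    and W': "super_sp W'"
  shows "ff (pullback f F)"
proof (rule ffI; unfold pullback_apply map_append list.map)
  interpret W': super_sp W' by (rule W')
  fix xs ys u v
  let ?x = "map f xs" and ?y = "map f ys"
  show "F (?x @ f (u + v) # ?y) = F (?x @ f u # ?y) + F (?x @ f v # ?y)"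
    unfolding linear_add[OF lin] by (rule W'.ff_add[OF F])
  show "F (?x @ f (a *\<^sub>R u) # ?y) = fls_const a * F (?x @ f u # ?y)" for a
    unfolding linear_scale[OF lin] by (rule W'.ff_scale[OF F])
  show "F (?x @ f u # f v # ?y) = F (?x @ f v # f u # ?y)" if "u \<in> Ev W"
    by (rule W'.ff_swap_Ev[OF F e[OF that]])
  show "F (?x @ f u # f v # ?y) = - F (?x @ f v # f u # ?y)" if "u \<in> Od W" "v \<in> Od W"
    by (rule W'.ff_swap_Od[OF F o[OF that(1)] o[OF that(2)]])
qed

section \<open>Parity and commutation of second order operators\<close>

lemma ff_L2: "ff F \<Longrightarrow> ff (L2 T F)"
  by (induction T) (simp_all add: ff_0 ff_plus ff_sc ff_dd)

definition teven :: "(real \<times> 'v \<times> 'v) list \<Rightarrow> bool" where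
  "teven T \<longleftrightarrow> (\<forall>c\<in>set T. (fst (snd c) \<in> Ev W \<and> snd (snd c) \<in> Ev W) \<or> (fst (snd c) \<in> Od W \<and> snd (snd c) \<in> Od W))"

text \<open>The order, odd leg first, is the one in which \<open>lap\<close> differentiates.\<close>

definition todd :: "(real \<times> 'v \<times> 'v) list \<Rightarrow> bool" where
  "todd T \<longleftrightarrow> (\<forall>c\<in>set T. fst (snd c) \<in> Od W \<and> snd (snd c) \<in> Ev W)"

lemma dd_commute_Ev: "ff F \<Longrightarrow> u \<in> Ev W \<Longrightarrow> dd v (dd u F) = dd u (dd v F)"
  unfolding dd_def by (rule ext) (rule ff_swap_Ev[where xs="[]", unfolded append_Nil])

lemma dd_commute_Od: "ff F \<Longrightarrow> u \<in> Od W \<Longrightarrow> v \<in> Od W \<Longrightarrow> dd v (dd u F) = - dd u (dd v F)"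
  unfolding dd_def by (rule ext, unfold uminus_apply) (rule ff_swap_Od[where xs="[]", unfolded append_Nil])

text \<open>For a vector that is not homogeneous, the sign of passing an odd derivative becomes the
  grading involution.\<close>

lemma dd_gr_commute_Od:
  assumes F: "ff F" and u: "u \<in> Od W" shows "dd v (dd u F) = dd u (dd (gr v) F)"
proof -
  have "dd v (dd u F) = dd (ev v) (dd u F) + dd (od v) (dd u F)"
    using dd_add_vec[OF ff_dd[OF F], of "ev v" "od v" u] by (simp add: ev_plus_od)
  also have "\<dots> = dd u (dd (ev v) F) - dd u (dd (od v) F)"
    unfolding dd_commute_Ev[OF F ev_in, of u v, symmetric] dd_commute_Od[OF F u od_in] by simp
  also have "\<dots> = dd u (dd (gr v) F)"
    unfolding gr_split dd_diff_vec[OF F] by simp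
  finally show ?thesis .
qed

text \<open>Passing two odd derivatives applies the grading involution to \<open>v\<close> twice,
  which cancels.\<close>

lemma dd_pair_even:
  assumes F: "ff F" and xy: "(x \<in> Ev W \<and> y \<in> Ev W) \<or> (x \<in> Od W \<and> y \<in> Od W)"
  shows "dd y (dd x (dd v F)) = dd v (dd y (dd x F))"
  using xy
proof (elim disjE conjE)
  assume h: "x \<in> Ev W" "y \<in> Ev W"
  show ?thesis
    by (subst dd_commute_Ev[OF F h(1), symmetric], subst dd_commute_Ev[OF ff_dd[OF F] h(2), symmetric]) (rule refl)
next
  assume h: "x \<in> Od W" "y \<in> Od W"
  have 1: "dd v (dd y (dd x F)) = dd y (dd (gr v) (dd x F))" by (rule dd_gr_commute_Od[OF ff_dd[OF F] h(2)])
  have 2: "dd (gr v) (dd x F) = dd x (dd v F)" using dd_gr_commute_Od[OF F h(1), of "gr v"] unfolding gr_gr .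
  show ?thesis unfolding 1 2 ..
qed

lemma L2_dd: "ff F \<Longrightarrow> teven T \<Longrightarrow> L2 T (dd v F) = dd v (L2 T F)"
proof (induction T)
  case (Cons c T)
  have T: "teven T" using Cons.prems(2) by (simp add: teven_def)
  have c: "dd (snd (snd c)) (dd (fst (snd c)) (dd v F)) = dd v (dd (snd (snd c)) (dd (fst (snd c)) F))"
    using Cons.prems(2) by (intro dd_pair_even Cons.prems(1)) (simp add: teven_def)
  show ?case unfolding L2_Cons c Cons.IH[OF Cons.prems(1) T] dd_simps ..
qed simp

text \<open>An even operator commutes with each single derivative, hence with every composite of
  derivatives.\<close>

lemma L2_commute: "ff F \<Longrightarrow> teven T \<Longrightarrow> L2 T (L2 S F) = L2 S (L2 T F)"
proof (induction S)
  case (Cons c S)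
  show ?case unfolding L2_Cons L2_lin Cons.IH[OF Cons.prems]
    by (simp only: L2_dd[OF _ Cons.prems(2)] ff_dd Cons.prems(1))
qed (simp add: L2_lin)

lemma gm_L2_even: "ff F \<Longrightarrow> teven T \<Longrightarrow> gm (L2 T F) = L2 T (gm F)"
proof (induction T)
  case (Cons c T)
  have T: "teven T" using Cons.prems(2) by (simp add: teven_def)
  have c: "gm (dd (snd (snd c)) (dd (fst (snd c)) F)) = dd (snd (snd c)) (dd (fst (snd c)) (gm F))"
    using Cons.prems unfolding teven_def
    by (auto simp: gm_dd dd_neg_vec ff_gm ff_dd)
  show ?case unfolding L2_Cons gm_simps c Cons.IH[OF Cons.prems(1) T] ..
qed simp

lemma gm_L2_odd: "ff F \<Longrightarrow> todd T \<Longrightarrow> gm (L2 T F) = - L2 T (gm F)"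
proof (induction T)
  case (Cons c T)
  have T: "todd T" using Cons.prems(2) by (simp add: todd_def)
  have c: "gm (dd (snd (snd c)) (dd (fst (snd c)) F)) = - dd (snd (snd c)) (dd (fst (snd c)) (gm F))"
    using Cons.prems unfolding todd_def
    by (simp add: gm_dd dd_neg_vec ff_gm ff_dd)
  show ?case unfolding L2_Cons gm_simps c Cons.IH[OF Cons.prems(1) T] sc_simps by simp
qed simp

section \<open>Homogeneous linear maps and the derivations they induce\<close>

definition evlin :: "('v \<Rightarrow> 'v) \<Rightarrow> bool" where
  "evlin f \<longleftrightarrow> linear f \<and> (\<forall>x\<in>Ev W. f x \<in> Ev W) \<and> (\<forall>x\<in>Od W. f x \<in> Od W)"

definition odlin :: "('v \<Rightarrow> 'v) \<Rightarrow> bool" where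
  "odlin f \<longleftrightarrow> linear f \<and> (\<forall>x\<in>Ev W. f x \<in> Od W) \<and> (\<forall>x\<in>Od W. f x \<in> Ev W)"

lemma evlin_proj: assumes "evlin f"
  shows "ev (f x) = f (ev x)" "od (f x) = f (od x)" "gr (f x) = f (gr x)"
proof -
  have lin: "linear f" using assms by (simp add: evlin_def)
  have s: "f x = f (ev x) + f (od x)" unfolding linear_add[OF lin, symmetric] ev_plus_od ..
  show 1: "ev (f x) = f (ev x)" unfolding s by (rule ev_eqI) (use assms in \<open>simp_all add: evlin_def\<close>)
  show 2: "od (f x) = f (od x)" unfolding s by (rule od_eqI) (use assms in \<open>simp_all add: evlin_def\<close>)
  show "gr (f x) = f (gr x)" unfolding gr_split 1 2 linear_diff[OF lin] ..
qed

lemma odlin_gr: assumes "odlin f" shows "gr (f x) = - f (gr x)"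
proof -
  have lin: "linear f" using assms by (simp add: odlin_def)
  have s: "f x = f (od x) + f (ev x)" unfolding linear_add[OF lin, symmetric] by (simp add: add.commute ev_plus_od)
  have 1: "ev (f x) = f (od x)" unfolding s by (rule ev_eqI) (use assms in \<open>simp_all add: odlin_def\<close>)
  have 2: "od (f x) = f (ev x)" unfolding s by (rule od_eqI) (use assms in \<open>simp_all add: odlin_def\<close>)
  show ?thesis unfolding gr_split 1 2 linear_diff[OF lin] by simp
qed

lemma odlin_dif: "odlin (dif W)"
  by (simp add: odlin_def lin_dif dif_Ev dif_Od)

lemma evlin_id: "evlin (\<lambda>w. w)"
  by (simp add: evlin_def linear_ident)

lemma ff_pullback_ev: "evlin f \<Longrightarrow> ff F \<Longrightarrow> ff (pullback f F)"
  by (rule ff_pullback[where W'=W]) (use super_sp_axioms in \<open>auto simp: evlin_def\<close>)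

lemma gm_pullback: "evlin f \<Longrightarrow> gm (pullback f F) = pullback f (gm F)"
  by (rule ext) (simp add: ffgrade_def pullback_apply comp_def evlin_proj)

lemma pullback_mult_ev: "evlin f \<Longrightarrow> pullback f F \<odot> pullback f G = pullback f (F \<odot> G)"
  by (rule pullback_mult) (simp_all add: evlin_proj)

lemma pullback_fsub_ev: "evlin f \<Longrightarrow> fsub W h (pullback f X) = pullback f (fsub W h X)"
  by (rule pullback_fsub) (simp_all add: evlin_proj)

lemma gm_DV: assumes \<phi>: "evlin \<phi>" and S: "odlin S" and F: "ff F"
  shows "gm (DV gr \<phi> S F) = - DV gr \<phi> S (gm F)"
proof
  show "gm (DV gr \<phi> S F) ws = (- DV gr \<phi> S (gm F)) ws" for ws using F
  proof (induction ws arbitrary: F)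
    case Nil show ?case by (simp add: gm_nil DV_nil pt)
  next
    case (Cons w ws)
    have "gm (DV gr \<phi> S F) (w # ws) = gm (dd (gr w) (DV gr \<phi> S F)) ws"
      unfolding gm_dd gr_gr by (simp add: dd_apply pt)
    also have "\<dots> = pullback \<phi> (gm (dd (S w) F)) ws - DV gr \<phi> S (gm (dd (\<phi> w) F)) ws"
      unfolding dd_DV gr_gr gm_simps gm_pullback[OF \<phi>] plus_fun_apply Cons.IH[OF ff_dd[OF Cons.prems]] by (simp add: pt)
    also have "\<dots> = - (pullback \<phi> (dd (S (gr w)) (gm F)) ws + DV gr \<phi> S (dd (\<phi> (gr w)) (gm F)) ws)"
      unfolding gm_dd odlin_gr[OF S] evlin_proj[OF \<phi>] dd_neg_vec[OF ff_gm[OF Cons.prems]] pullback_lin by (simp add: pt)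
    finally show ?case by (simp add: DV_cons pt)
  qed
qed

text \<open>A derivative of \<open>DV gr \<phi> S F\<close> is again of this form plus a pullback.
  Sums of both kinds form the class for \<open>formal_bisim\<close>.\<close>

lemma ff_DV: assumes \<phi>: "evlin \<phi>" and S: "odlin S" and F: "ff F" shows "ff (DV gr \<phi> S F)"
proof (rule formal_bisim[of "\<lambda>X. \<exists>F G. ff F \<and> ff G \<and> X = pullback \<phi> F + DV gr \<phi> S G"])
  show "\<exists>F' G. ff F' \<and> ff G \<and> DV gr \<phi> S F = pullback \<phi> F' + DV gr \<phi> S G"
    using F by (intro exI[of _ 0] exI[of _ F]) (simp add: ff_0 pullback_lin)
next
  fix X w assume "\<exists>F G. ff F \<and> ff G \<and> X = pullback \<phi> F + DV gr \<phi> S G"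
  then obtain F G where X: "ff F" "ff G" "X = pullback \<phi> F + DV gr \<phi> S G" by blast
  show "\<exists>F G. ff F \<and> ff G \<and> dd w X = pullback \<phi> F + DV gr \<phi> S G"
    by (rule exI[of _ "dd (\<phi> w) F + dd (S (gr w)) G"], rule exI[of _ "dd (\<phi> (gr w)) G"])
       (simp add: X(3) dd_pullback dd_DV pullback_lin ff_dd ff_plus X(1,2) add.assoc)
next
  have lin\<phi>: "linear \<phi>" and linS: "linear S" using \<phi> S by (simp_all add: evlin_def odlin_def)
  {
    fix X ys u v assume "\<exists>F G. ff F \<and> ff G \<and> X = pullback \<phi> F + DV gr \<phi> S G"
    then obtain F G where X: "ff F" "ff G" "X = pullback \<phi> F + DV gr \<phi> S G" by blast
    have p: "ff (pullback \<phi> F)" by (rule ff_pullback_ev[OF \<phi> X(1)])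
    show "X ((u + v) # ys) = X (u # ys) + X (v # ys)"
      unfolding X(3) plus_fun_apply DV_cons ff_add0[OF p] gr_add linear_add[OF lin\<phi>] linear_add[OF linS]
        dd_add_vec[OF X(2)] pullback_lin DV_lin by (simp add: algebra_simps)
    show "X ((a *\<^sub>R u) # ys) = fls_const a * X (u # ys)" for a
      unfolding X(3) plus_fun_apply DV_cons ff_scale0[OF p] gr_scale linear_scale[OF lin\<phi>] linear_scale[OF linS]
        dd_scale_vec[OF X(2)] pullback_lin DV_lin by (simp add: algebra_simps pt)
    have exp: "DV gr \<phi> S G (u # v # ys) = pullback \<phi> (dd (\<phi> v) (dd (S (gr u)) G)) ys
        + pullback \<phi> (dd (S (gr v)) (dd (\<phi> (gr u)) G)) ys + DV gr \<phi> S (dd (\<phi> (gr v)) (dd (\<phi> (gr u)) G)) ys" for u v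
      unfolding DV_cons by (simp add: pullback_apply dd_apply)
    have e: "\<phi> x \<in> Ev W" "S x \<in> Od W" if "x \<in> Ev W" for x using that \<phi> S by (simp_all add: evlin_def odlin_def)
    have o: "\<phi> x \<in> Od W" "S x \<in> Ev W" if "x \<in> Od W" for x using that \<phi> S by (simp_all add: evlin_def odlin_def)
    show "X (u # v # ys) = X (v # u # ys)" if u: "u \<in> Ev W"
    proof -
      have "DV gr \<phi> S G (u # v # ys) = DV gr \<phi> S G (v # u # ys)"
      proof -
        have 1: "dd (\<phi> v) (dd (S u) G) = dd (S u) (dd (\<phi> (gr v)) G)"
          using dd_gr_commute_Od[OF X(2) e(2)[OF u], of "\<phi> v"] unfolding evlin_proj[OF \<phi>] .
        show ?thesis
          unfolding exp gr_Ev[OF u] 1 dd_commute_Ev[OF X(2) e(1)[OF u]] by simp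
      qed
      then show ?thesis unfolding X(3) plus_fun_apply
        using ff_swap_Ev[OF p u, of "[]" v ys] by simp
    qed
    show "X (u # v # ys) = - X (v # u # ys)" if u: "u \<in> Od W" "v \<in> Od W"
    proof -
      have "DV gr \<phi> S G (u # v # ys) = - DV gr \<phi> S G (v # u # ys)"
      proof -
        have n: "S (- x) = - S x" "\<phi> (- x) = - \<phi> x" for x by (simp_all add: linear_neg linS lin\<phi>)
        have 1: "dd (\<phi> v) (dd (S u) G) = dd (S u) (dd (\<phi> v) G)" if "u \<in> Od W" for u v
          using dd_commute_Ev[OF X(2) o(2)[OF that]] .
        show ?thesis
          unfolding exp gr_Od[OF u(1)] gr_Od[OF u(2)] n dd_neg_vec[OF X(2)] dd_neg_vec[OF ff_dd[OF X(2)]]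
            dd_simps 1[OF u(1)] 1[OF u(2)] dd_commute_Od[OF X(2) o(1)[OF u(1)] o(1)[OF u(2)]] pullback_lin DV_lin
          by (simp add: pt)
      qed
      then show ?thesis unfolding X(3) plus_fun_apply
        using ff_swap_Od[OF p u, of "[]" ys] by simp
    qed
  }
qed

text \<open>The next argument is split by parity, since in a homogeneous direction the Leibniz rule
  of the product has only two terms. The sign \<open>gm F\<close> is the cost of moving the odd
  derivation past \<open>F\<close>.\<close>

lemma DV_mult: assumes \<phi>: "evlin \<phi>" and S: "odlin S" and F: "ff F" and G: "ff G"
  shows "DV gr \<phi> S (F \<odot> G) = DV gr \<phi> S F \<odot> pullback \<phi> G + pullback \<phi> (gm F) \<odot> DV gr \<phi> S G"
proof
  have e: "\<phi> x \<in> Ev W" "S x \<in> Od W" if "x \<in> Ev W" for x using that \<phi> S by (simp_all add: evlin_def odlin_def)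
  have o: "\<phi> x \<in> Od W" "S x \<in> Ev W" if "x \<in> Od W" for x using that \<phi> S by (simp_all add: evlin_def odlin_def)
  have n: "S (- x) = - S x" "\<phi> (- x) = - \<phi> x" for x
    using \<phi> S by (simp_all add: linear_neg evlin_def odlin_def)
  show "DV gr \<phi> S (F \<odot> G) ws = (DV gr \<phi> S F \<odot> pullback \<phi> G + pullback \<phi> (gm F) \<odot> DV gr \<phi> S G) ws" for ws
    using F G
  proof (induction ws arbitrary: F G)
    case Nil show ?case by (simp add: DV_nil mult_nil pt)
  next
    case (Cons w ws)
    let ?D = "DV gr \<phi> S" and ?p = "pullback \<phi>"
    note F = Cons.prems(1) and G = Cons.prems(2)
    note fF = ff_DV[OF \<phi> S F] and fG = ff_DV[OF \<phi> S G] and pF = ff_pullback_ev[OF \<phi> F] and pG = ff_pullback_ev[OF \<phi> G]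
    note pgF = ff_pullback_ev[OF \<phi> ff_gm[OF F]]
    have hE: "dd w (?D (F \<odot> G)) ws = dd w (?D F \<odot> ?p G + ?p (gm F) \<odot> ?D G) ws" if w: "w \<in> Ev W" for w
    proof -
      have "dd w (?D (F \<odot> G)) ws = (?p (dd (S w) F) \<odot> ?p G) ws + (?p (gm F) \<odot> ?p (dd (S w) G)) ws
        + ((?D (dd (\<phi> w) F) \<odot> ?p G) ws + (?p (gm (dd (\<phi> w) F)) \<odot> ?D G) ws)
        + ((?D F \<odot> ?p (dd (\<phi> w) G)) ws + (?p (gm F) \<odot> ?D (dd (\<phi> w) G)) ws)"
        unfolding dd_DV gr_Ev[OF w] dd_mult_Od[OF e(2)[OF w] G] dd_mult_Ev[OF e(1)[OF w] G] DV_lin pullback_lin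
          plus_fun_apply Cons.IH[OF F ff_dd[OF G]] Cons.IH[OF ff_dd[OF F] G] pullback_mult_ev[OF \<phi>]
        by (simp only: ac_simps)
      also have "\<dots> = dd w (?D F \<odot> ?p G + ?p (gm F) \<odot> ?D G) ws"
        unfolding dd_simps dd_mult_Ev[OF w pG] dd_mult_Ev[OF w fG] dd_DV dd_pullback gr_Ev[OF w]
          mult_lin plus_fun_apply gm_dd evlin_proj[OF \<phi>] by (simp only: ac_simps)
      finally show ?thesis .
    qed
    have hO: "dd w (?D (F \<odot> G)) ws = dd w (?D F \<odot> ?p G + ?p (gm F) \<odot> ?D G) ws" if w: "w \<in> Od W" for w
    proof -
      have "dd w (?D (F \<odot> G)) ws = - ((?p (dd (S w) F) \<odot> ?p G) ws + (?p F \<odot> ?p (dd (S w) G)) ws)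
        - ((?D (dd (\<phi> w) F) \<odot> ?p G) ws + (?p (gm (dd (\<phi> w) F)) \<odot> ?D G) ws)
        - ((?D (gm F) \<odot> ?p (dd (\<phi> w) G)) ws + (?p F \<odot> ?D (dd (\<phi> w) G)) ws)"
        unfolding dd_DV gr_Od[OF w] n dd_neg_vec[OF ff_mult[OF F G]] dd_mult_Ev[OF o(2)[OF w] G]
          dd_mult_Od[OF o(1)[OF w] G] DV_lin pullback_lin
          plus_fun_apply uminus_apply Cons.IH[OF ff_gm[OF F] ff_dd[OF G]] Cons.IH[OF ff_dd[OF F] G]
          pullback_mult_ev[OF \<phi>] gm_gm
        by (simp only: ac_simps minus_add_distrib diff_conv_add_uminus)
      also have "\<dots> = dd w (?D F \<odot> ?p G + ?p (gm F) \<odot> ?D G) ws"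
        unfolding dd_simps dd_mult_Od[OF w pG] dd_mult_Od[OF w fG] dd_DV dd_pullback gr_Od[OF w] n
          gm_DV[OF \<phi> S F] gm_pullback[OF \<phi>] gm_gm gm_dd evlin_proj[OF \<phi>] gr_Od[OF o(1)[OF w]]
          dd_neg_vec[OF F] dd_neg_vec[OF G] dd_neg_vec[OF ff_gm[OF F]] DV_lin pullback_lin
          mult_lin plus_fun_apply uminus_apply
        by (simp only: ac_simps minus_add_distrib diff_conv_add_uminus minus_minus)
      finally show ?thesis .
    qed
    have "?D (F \<odot> G) (w # ws) = dd (ev w) (?D (F \<odot> G)) ws + dd (od w) (?D (F \<odot> G)) ws"
      unfolding dd_apply by (rule split_cons[OF ff_DV[OF \<phi> S ff_mult[OF F G]]])
    also have "\<dots> = dd (ev w) (?D F \<odot> ?p G + ?p (gm F) \<odot> ?D G) ws + dd (od w) (?D F \<odot> ?p G + ?p (gm F) \<odot> ?D G) ws"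
      unfolding hE[OF ev_in] hO[OF od_in] ..
    also have "\<dots> = (?D F \<odot> ?p G + ?p (gm F) \<odot> ?D G) (w # ws)"
      unfolding dd_apply by (rule split_cons[symmetric]) (intro ff_plus ff_mult fF fG pG pgF)
    finally show ?case .
  qed
qed

lemma ffdif_pullback:
  assumes \<phi>: "evlin \<phi>" and c: "\<And>x. dif W (\<phi> x) = \<phi> (dif W x)"
  shows "ffdif W (pullback \<phi> F) = pullback \<phi> (ffdif W F)"
proof
  show "ffdif W (pullback \<phi> F) ws = pullback \<phi> (ffdif W F) ws" for ws
    unfolding ffdif_DV
  proof (induction ws arbitrary: F)
    case Nil show ?case by (simp add: DV_nil pullback_apply)
  next
    case (Cons w ws)
    show ?case unfolding DV_cons dd_pullback pullback_id Cons c[symmetric] evlin_proj(3)[OF \<phi>, symmetric]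
      by (simp add: pullback_apply DV_cons dd_apply)
  qed
qed

text \<open>A Cartan formula: two odd derivations anticommute to the derivation induced by the
  anticommutator of the linear maps. For \<open>S = s\<close> the retract identity gives
  \<open>R = 1 - pr\<close>.\<close>

lemma DV_anticommute:
  assumes \<phi>: "evlin \<phi>" and S: "odlin S" and c: "\<And>x. dif W (\<phi> x) = \<phi> (dif W x)" and F: "ff F"
    and R: "\<And>x. dif W (S x) + S (dif W x) = R x"
  shows "ffdif W (DV gr \<phi> S F) + DV gr \<phi> S (ffdif W F) = - DV (\<lambda>w. w) \<phi> R F"
proof
  show "(ffdif W (DV gr \<phi> S F) + DV gr \<phi> S (ffdif W F)) ws = (- DV (\<lambda>w. w) \<phi> R F) ws" for ws using F
  proof (induction ws arbitrary: F)
    case Nil show ?case by (simp add: ffdif_DV DV_nil pt)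
  next
    case (Cons w ws)
    let ?D = "DV gr \<phi> S" and ?d = "ffdif W" and ?p = "pullback \<phi>"
    note F = Cons.prems
    have n: "S (- x) = - S x" "\<phi> (- x) = - \<phi> x" "dif W (- x) = - dif W x" for x
      using \<phi> S lin_dif by (simp_all add: linear_neg evlin_def odlin_def)
    have d: "dd w (?d F) = dd (dif W (gr w)) F + ?d (dd (gr w) F)" for w F
      unfolding ffdif_DV dd_DV pullback_id ..
    have gd: "gr (dif W x) = - dif W (gr x)" for x by (rule odlin_gr[OF odlin_dif])
    have dlin: "?d (F + G) = ?d F + ?d G" for F G unfolding ffdif_DV DV_lin ..
    have gS: "gr (S x) = - S (gr x)" for x by (rule odlin_gr[OF S])
    have g\<phi>: "gr (\<phi> x) = \<phi> (gr x)" for x by (rule evlin_proj[OF \<phi>])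
    have 1: "dd w (?d (?D F)) = - ?p (dd (S (dif W w)) F) - ?D (dd (\<phi> (dif W w)) F)
        + ?p (?d (dd (S w) F)) + ?d (?D (dd (\<phi> w) F))"
      unfolding d dd_DV gr_gr dlin ffdif_pullback[OF \<phi> c] gd n dd_neg_vec[OF F] pullback_lin DV_lin
      by (simp only: ac_simps diff_conv_add_uminus)
    have 2: "dd w (?D (?d F)) = - ?p (dd (dif W (S w)) F) - ?p (?d (dd (S w) F))
        + ?D (dd (\<phi> (dif W w)) F) + ?D (?d (dd (\<phi> w) F))"
      unfolding dd_DV d gS g\<phi> gr_gr gd n dd_neg_vec[OF F] pullback_lin DV_lin c[symmetric]
      using gS[of "gr w"] by (simp add: n dd_neg_vec[OF F] pullback_lin DV_lin ffdif_DV)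
    have R': "dd (R w) F = dd (dif W (S w)) F + dd (S (dif W w)) F"
      unfolding R[symmetric] dd_add_vec[OF F] ..
    have "(?d (?D F) + ?D (?d F)) (w # ws) = dd w (?d (?D F)) ws + dd w (?D (?d F)) ws" by (simp add: dd_apply pt)
    also have "\<dots> = - ?p (dd (R w) F) ws + (?d (?D (dd (\<phi> w) F)) + ?D (?d (dd (\<phi> w) F))) ws"
      unfolding 1 2 R' pullback_lin by (simp add: pt)
    also have "\<dots> = (- DV (\<lambda>w. w) \<phi> R F) (w # ws)"
      unfolding Cons.IH[OF ff_dd[OF F]] uminus_apply DV_cons by simp
    finally show ?case .
  qed
qed

section \<open>Commutators of second order operators with derivations; moving pullbacks\<close>

lemma dd_dd_DV:
  "dd y (dd x (DV \<kappa> \<phi> S F)) = pullback \<phi> (dd (\<phi> y) (dd (S (\<kappa> x)) F)) + pullback \<phi> (dd (S (\<kappa> y)) (dd (\<phi> (\<kappa> x)) F))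
    + DV \<kappa> \<phi> S (dd (\<phi> (\<kappa> y)) (dd (\<phi> (\<kappa> x)) F))"
  unfolding dd_DV dd_simps dd_pullback by (simp only: ac_simps)

text \<open>Moving the derivation past two derivatives leaves, besides the composite with the legs
  transported by \<open>\<phi>\<close>, the terms in which \<open>S\<close> has hit exactly one
  leg.\<close>

lemma L2_DV_odd:
  assumes \<phi>: "evlin \<phi>" and S: "odlin S" and F: "ff F"
  shows "todd T \<Longrightarrow> L2 T (DV gr \<phi> S F) = - pullback \<phi> (L2 (tmap S \<phi> T) F + L2 (tmap \<phi> S T) F) - DV gr \<phi> S (L2 (tmap \<phi> \<phi> T) F)"
proof (induction T)
  case Nil show ?case by (simp add: pullback_lin DV_lin)
next
  case (Cons c T)
  obtain k x y where c: "c = (k, x, y)" by (cases c)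
  have x: "x \<in> Od W" and y: "y \<in> Ev W" and T: "todd T" using Cons.prems by (simp_all add: todd_def c)
  have n: "S (- x) = - S x" "\<phi> (- x) = - \<phi> x" for x
    using \<phi> S by (simp_all add: linear_neg evlin_def odlin_def)
  have e: "dd y (dd x (DV gr \<phi> S F)) = - pullback \<phi> (dd (\<phi> y) (dd (S x) F)) - pullback \<phi> (dd (S y) (dd (\<phi> x) F))
    - DV gr \<phi> S (dd (\<phi> y) (dd (\<phi> x) F))"
    unfolding dd_dd_DV gr_Ev[OF y] gr_Od[OF x] n dd_neg_vec[OF F] dd_simps pullback_lin DV_lin by simp
  show ?case
    unfolding L2_Cons list.map c fst_conv snd_conv e Cons.IH[OF T] pullback_lin DV_lin sc_simps
    by (simp add: algebra_simps)
qed

lemma L2_ffdif_even: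
  assumes F: "ff F"
  shows "teven T \<Longrightarrow> L2 T (ffdif W F) = L2 (tmap (\<lambda>x. dif W (gr x)) (\<lambda>x. x) T) F
    + L2 (tmap gr (\<lambda>x. dif W (gr x)) T) F + ffdif W (L2 T F)"
proof (induction T)
  case Nil show ?case by (simp add: ffdif_DV DV_lin)
next
  case (Cons c T)
  obtain k x y where c: "c = (k, x, y)" by (cases c)
  have T: "teven T" using Cons.prems by (simp_all add: teven_def)
  \<comment> \<open>Both legs have the same parity, so their two signs cancel.\<close>
  have g: "dd (gr y) (dd (gr x) F) = dd y (dd x F)"
    using Cons.prems by (auto simp: teven_def c dd_neg_vec F ff_dd)
  show ?case
    unfolding L2_Cons list.map c fst_conv snd_conv Cons.IH[OF T] unfolding ffdif_DV dd_dd_DV g pullback_id DV_lin sc_simps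
    by (simp only: ac_simps)
qed

text \<open>The product rule for a moving function pulled back along a moving map: the velocity
  \<open>r\<close> of the map contributes the even derivation that it induces.\<close>

lemma dpath_pullback:
  assumes a: "linear a" and r: "linear r" and A: "dpath A A'" and ffA: "\<And>t. ff (A t)"
  shows "dpath (\<lambda>t. pullback (\<lambda>w. a w + t *\<^sub>R r w) (A t))
    (\<lambda>t. pullback (\<lambda>w. a w + t *\<^sub>R r w) (A' t) + DV (\<lambda>w. w) (\<lambda>w. a w + t *\<^sub>R r w) r (A t))"
  unfolding dpath_def
proof
  fix ws
  show "fpath (\<lambda>t. pullback (\<lambda>w. a w + t *\<^sub>R r w) (A t) ws)
    (\<lambda>t. (pullback (\<lambda>w. a w + t *\<^sub>R r w) (A' t) + DV (\<lambda>w. w) (\<lambda>w. a w + t *\<^sub>R r w) r (A t)) ws)"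
    using A ffA
  proof (induction ws arbitrary: A A')
    case Nil show ?case using dpathD[OF Nil(1), of "[]"] unfolding plus_fun_apply pullback_apply DV_nil by simp
  next
    case (Cons w ws)
    note A = Cons.prems(1) and ffA = Cons.prems(2)
    have ffA': "ff (A' t)" for t by (rule dpath_ff[OF A ffA])
    let ?p = "\<lambda>t. pullback (\<lambda>w. a w + t *\<^sub>R r w)" and ?D = "\<lambda>t. DV (\<lambda>w. w) (\<lambda>w. a w + t *\<^sub>R r w) r"
    note 1 = Cons.IH[OF dpath_dd[OF A, of "a w"] ff_dd[OF ffA]]
    note 2 = fpath_poly_mult[OF Cons.IH[OF dpath_dd[OF A, of "r w"] ff_dd[OF ffA]], of "[:0, 1:]"]
    have s: "?p t (A t) (w # ws) = ?p t (dd (a w) (A t)) ws + fls_const (poly [:0, 1:] t) * ?p t (dd (r w) (A t)) ws" for t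
      using ff_add0[OF ffA, of t "a w" "t *\<^sub>R r w" "map (\<lambda>w. a w + t *\<^sub>R r w) ws"]
        ff_scale0[OF ffA, of t t "r w" "map (\<lambda>w. a w + t *\<^sub>R r w) ws"]
      by (simp add: pullback_apply dd_apply)
    have v: "dd (a w + t *\<^sub>R r w) F = dd (a w) F + sc (fls_const t) (dd (r w) F)" if "ff F" for t F
      unfolding dd_add_vec[OF that] dd_scale_vec[OF that] ..
    have s': "(?p t (A' t) + ?D t (A t)) (w # ws) = (?p t (dd (a w) (A' t)) + ?D t (dd (a w) (A t))) ws +
      (fls_const (poly (pderiv [:0, 1:]) t) * ?p t (dd (r w) (A t)) ws
        + fls_const (poly [:0, 1:] t) * (?p t (dd (r w) (A' t)) + ?D t (dd (r w) (A t))) ws)" for t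
    proof -
      have "(?p t (A' t) + ?D t (A t)) (w # ws) = ?p t (dd (a w + t *\<^sub>R r w) (A' t)) ws
          + (?p t (dd (r w) (A t)) ws + ?D t (dd (a w + t *\<^sub>R r w) (A t)) ws)"
        unfolding plus_fun_apply DV_cons by (simp add: pullback_apply dd_apply)
      then show ?thesis
        unfolding v[OF ffA] v[OF ffA'] pullback_lin DV_lin
        by (simp add: pderiv_pCons algebra_simps pt)
    qed
    show ?case unfolding s s' by (rule fpath_add[OF 1 2])
  qed
qed

end

section \<open>Master equation, heat equation and logarithm\<close>

text \<open>The bilinear operator of mixed derivatives by which \<open>L2\<close> of a product
  exceeds the Leibniz terms. The product \<open>m\<close> is a parameter because the sign rule
  differs for even and odd tensors.\<close>

definition tsum :: "('v ffun \<Rightarrow> 'v ffun \<Rightarrow> 'v ffun) \<Rightarrow> (real \<times> 'v \<times> 'v) list \<Rightarrow> 'v ffun \<Rightarrow> 'v ffun \<Rightarrow> 'v ffun" where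
  "tsum m T F G = (\<lambda>ws. \<Sum>c\<leftarrow>T. fls_const (fst c) * m (dd (fst (snd c)) F) (dd (snd (snd c)) G) ws)"

lemma tsum_Nil [simp]: "tsum m [] F G = 0"
  by (rule ext) (simp add: tsum_def pt)

lemma tsum_Cons [simp]:
  "tsum m (c # T) F G = sc (fls_const (fst c)) (m (dd (fst (snd c)) F) (dd (snd (snd c)) G)) + tsum m T F G"
  by (rule ext) (simp add: tsum_def pt)

lemma tsum_supp:
  assumes "\<And>x y. supp_in R (m (dd x F) (dd y G))" shows "supp_in R (tsum m T F G)"
proof (induction T)
  case (Cons c T)
  show ?case unfolding tsum_Cons by (intro supp_in_add supp_in_const assms Cons)
qed simp

context super_sp
begin

abbreviation "tmult \<equiv> tsum (\<lambda>F G. F \<odot> G)"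
text \<open>For an even tensor the second derivative may be odd and has to pass the derivative of
  \<open>F\<close>, whence \<open>gm\<close>. For an odd tensor it is in an even direction and
  \<open>tmult\<close> suffices.\<close>

abbreviation "tgmult \<equiv> tsum (\<lambda>F G. gm F \<odot> G)"
abbreviation "tswap \<equiv> map (\<lambda>c. (fst c, snd (snd c), fst (snd c)))"

lemma ff_tmult: "ff F \<Longrightarrow> ff G \<Longrightarrow> ff (tmult T F G)"
  by (induction T) (simp_all add: ff_0 ff_plus ff_sc ff_mult ff_dd)

lemma ff_tgmult: "ff F \<Longrightarrow> ff G \<Longrightarrow> ff (tgmult T F G)"
  by (induction T) (simp_all add: ff_0 ff_plus ff_sc ff_mult ff_dd ff_gm)

lemma tmult_sc: "tmult T (sc c F) G = sc c (tmult T F G)" "tmult T F (sc c G) = sc c (tmult T F G)"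
proof (induction T)
  case (Cons d T)
  { case 1 show ?case by (simp add: mult_lin Cons mult.commute) }
  { case 2 show ?case by (simp add: mult_lin Cons mult.commute) }
qed simp_all

lemma tgmult_sc: "tgmult T (sc c F) (sc c G) = sc (c * c) (tgmult T F G)"
  by (induction T) (simp_all add: mult_lin ac_simps)

text \<open>The defect of the odd operator from being a derivation consists of the mixed derivatives
  with the legs in either order; this is what the bracket measures.\<close>

lemma L2_mult_even:
  assumes F: "ff F" "gm F = F" and G: "ff G"
  shows "todd T \<Longrightarrow> L2 T (F \<odot> G) = L2 T F \<odot> G + F \<odot> L2 T G + (tmult T F G + tmult (tswap T) F G)"
proof (induction T)
  case (Cons c T)
  obtain k x y where c: "c = (k, x, y)" by (cases c)
  have x: "x \<in> Od W" and y: "y \<in> Ev W" and T: "todd T" using Cons.prems by (simp_all add: todd_def c)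
  have "dd y (dd x (F \<odot> G)) = dd y (dd x F) \<odot> G + dd x F \<odot> dd y G + dd y F \<odot> dd x G + F \<odot> dd y (dd x G)"
    by (simp add: dd_mult_Od[OF x G] F dd_mult_Ev[OF y G] dd_mult_Ev[OF y ff_dd[OF G]] add.assoc)
  then show ?case by (simp add: c Cons.IH[OF T] mult_lin ac_simps)
qed simp

lemma gm_dd_par: "gm F = F \<Longrightarrow> w \<in> Ev W \<Longrightarrow> gm (dd w F) = dd w F"
  "gm F = F \<Longrightarrow> ff F \<Longrightarrow> w \<in> Od W \<Longrightarrow> gm (dd w F) = - dd w F"
  by (simp_all add: gm_dd dd_neg_vec)

lemma admD: assumes "adm a" shows "ff a" "gm a = a" "bt 0 a" "wt 1 a"
  using assms by (simp_all add: adm_def)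

lemma ff_exp: "adm a \<Longrightarrow> ff (ffexp W a)" and gm_exp: "adm a \<Longrightarrow> gm (ffexp W a) = ffexp W a"
  and bt_exp: "adm a \<Longrightarrow> bt 0 (ffexp W a)"
  by (simp_all add: ffexp_fsub ff_fsub gm_fsub bt_fsub)

lemma exp_commute: "adm a \<Longrightarrow> ff F \<Longrightarrow> F \<odot> ffexp W a = ffexp W a \<odot> F"
  by (rule supercomm(1)[symmetric]) (simp_all add: ff_exp gm_exp)

lemma tmult_exp:
  assumes a: "adm a" and B: "ff B"
  shows "(\<forall>c\<in>set T. fst (snd c) \<in> Ev W \<or> fst (snd c) \<in> Od W) \<Longrightarrow> tmult T (ffexp W a) B = ffexp W a \<odot> tmult T a B"
proof (induction T)
  case (Cons c T)
  have "dd (fst (snd c)) (ffexp W a) \<odot> dd (snd (snd c)) B = ffexp W a \<odot> (dd (fst (snd c)) a \<odot> dd (snd (snd c)) B)"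
    using Cons.prems by (simp add: dd_exp[OF a] exp_commute[OF a] mult_assoc ff_exp a ff_dd admD(1)[OF a] B)
  then show ?case using Cons by (simp add: mult_lin)
qed simp

text \<open>The formula \<open>\<Delta> e^a = (\<Delta> a + 1/2 [a, a]) e^a\<close>: on an even
  function the two orders of the legs agree, so \<open>tmult T a a\<close> is half the
  bracket.\<close>

lemma L2_exp_odd:
  assumes a: "adm a"
  shows "todd T \<Longrightarrow> L2 T (ffexp W a) = (L2 T a + tmult T a a) \<odot> ffexp W a"
proof (induction T)
  case (Cons c T)
  obtain k x y where c: "c = (k, x, y)" by (cases c)
  have x: "x \<in> Od W" and y: "y \<in> Ev W" and T: "todd T" using Cons.prems by (simp_all add: todd_def c)
  have "dd y (dd x (ffexp W a)) = (dd y (dd x a) + dd x a \<odot> dd y a) \<odot> ffexp W a"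
    using x y by (simp add: dd_exp[OF a] dd_mult_Ev[OF y ff_exp[OF a]] mult_lin mult_assoc ff_exp a ff_dd admD(1)[OF a])
  then show ?case by (simp add: c Cons.IH[OF T] mult_lin ac_simps)
qed simp

lemma L2_exp_even:
  assumes a: "adm a"
  shows "teven T \<Longrightarrow> L2 T (ffexp W a) = (L2 T a + tgmult T a a) \<odot> ffexp W a"
proof (induction T)
  case (Cons c T)
  obtain k x y where c: "c = (k, x, y)" by (cases c)
  have T: "teven T" using Cons.prems by (simp_all add: teven_def c)
  have xy: "(x \<in> Ev W \<and> y \<in> Ev W) \<or> (x \<in> Od W \<and> y \<in> Od W)" using Cons.prems by (simp add: teven_def c)
  have "dd y (dd x (ffexp W a)) = (dd y (dd x a) + gm (dd x a) \<odot> dd y a) \<odot> ffexp W a"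
    using xy
  proof (elim disjE conjE)
    assume h: "x \<in> Ev W" "y \<in> Ev W"
    show ?thesis using h gm_dd_par(1)[OF admD(2)[OF a] h(1)]
      by (simp add: dd_exp[OF a] dd_mult_Ev[OF h(2) ff_exp[OF a]] mult_lin mult_assoc ff_exp a ff_dd admD(1)[OF a])
  next
    assume h: "x \<in> Od W" "y \<in> Od W"
    have gd: "gm (dd x a) = - dd x a" using gm_dd_par(2)[OF admD(2)[OF a] admD(1)[OF a] h(1)] .
    show ?thesis unfolding gd using h
      by (simp add: dd_exp[OF a] dd_mult_Od[OF h(2) ff_exp[OF a]] gd mult_lin mult_assoc ff_exp a ff_dd admD(1)[OF a])
  qed
  then show ?case by (simp add: c Cons.IH[OF T] mult_lin ac_simps)
qed simp

lemma tmult_swap_self: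
  assumes F: "ff F" "gm F = F"
  shows "todd T \<Longrightarrow> tmult (tswap T) F F = tmult T F F"
proof (induction T)
  case (Cons c T)
  obtain k x y where c: "c = (k, x, y)" by (cases c)
  have y: "y \<in> Ev W" and T: "todd T" using Cons.prems by (simp_all add: todd_def c)
  have "dd y F \<odot> dd x F = dd x F \<odot> dd y F"
    by (rule supercomm(1)) (simp_all add: ff_dd F gm_dd_par(1)[OF F(2) y])
  then show ?case by (simp add: c Cons.IH[OF T])
qed simp

lemma ff_ffdif: "ff F \<Longrightarrow> ff (ffdif W F)"
  unfolding ffdif_DV by (rule ff_DV[OF evlin_id odlin_dif])

lemma ffdif_lin: "ffdif W (F + G) = ffdif W F + ffdif W G" "ffdif W (sc c F) = sc c (ffdif W F)"
  "ffdif W (- F) = - ffdif W F" "ffdif W 0 = 0" "ffdif W (F - G) = ffdif W F - ffdif W G"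
  unfolding ffdif_DV by (rule DV_lin)+

lemma ffdif_mult: "ff F \<Longrightarrow> ff G \<Longrightarrow> ffdif W (F \<odot> G) = ffdif W F \<odot> G + gm F \<odot> ffdif W G"
  unfolding ffdif_DV using DV_mult[OF evlin_id odlin_dif, of F G] by (simp only: pullback_id)

lemma DV_exp:
  assumes a: "adm a" and \<phi>: "evlin \<phi>" and S: "odlin S"
  shows "DV gr \<phi> S (ffexp W a) = DV gr \<phi> S a \<odot> pullback \<phi> (ffexp W a)"
proof -
  note a' = admD[OF a]
  have "DV gr \<phi> S (fsub W (fps_exp 1) a) = DV gr \<phi> S a \<odot> pullback \<phi> (fsub W (fps_deriv (fps_exp 1)) a)"
  proof (rule derivation_fsub[where E="pullback \<phi>" and c=0])
    show "adm a" by (rule a)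
    show "DV gr \<phi> S ffone = 0" by (rule DV_one)
    show "DV gr \<phi> S (F \<odot> G) = DV gr \<phi> S F \<odot> pullback \<phi> G + pullback \<phi> F \<odot> DV gr \<phi> S G"
      if "ff F" "gm F = F" "ff G" "gm G = G" for F G
      using DV_mult[OF \<phi> S that(1,3)] that(2) by simp
    show "ff (DV gr \<phi> S a)" by (rule ff_DV[OF \<phi> S a'(1)])
    show "ff (pullback \<phi> (pw a k))" for k by (rule ff_pullback_ev[OF \<phi> ff_pw[OF a'(1)]])
    show "gm (pullback \<phi> a) = pullback \<phi> a" unfolding gm_pullback[OF \<phi>] a'(2) ..
    show "ff (pullback \<phi> a)" by (rule ff_pullback_ev[OF \<phi> a'(1)])
    show "pullback \<phi> (pw a (Suc k)) = pullback \<phi> a \<odot> pullback \<phi> (pw a k)" for k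
      unfolding pullback_mult_ev[OF \<phi>] ffpow.simps ..
    show "pullback \<phi> ffone = ffone" by (rule pullback_one)
    show "wt (k - 0) (DV gr \<phi> S F)" if "wt k F" for k F using DV_supp[OF that] by simp
    show "wt k (pullback \<phi> F)" if "wt k F" for k F by (rule pullback_supp[OF that])
  qed (simp_all only: DV_lin pullback_lin)
  then show ?thesis by (simp add: ffexp_fsub)
qed

lemma ffdif_exp: "adm a \<Longrightarrow> ffdif W (ffexp W a) = ffdif W a \<odot> ffexp W a"
  unfolding ffdif_DV using DV_exp[OF _ evlin_id odlin_dif, of a] by (simp only: pullback_id)

text \<open>\<open>hdif\<close> and, below, \<open>bracket\<close> for an explicit tensor in place
  of a chosen Darboux basis, so that the Laplacian can be split and its legs can be
  transformed.\<close>

definition hd2 :: "(real \<times> 'v \<times> 'v) list \<Rightarrow> 'v ffun \<Rightarrow> 'v ffun" where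
  "hd2 T F = ffdif W F + sc fls_X (L2 T F)"

definition br2 :: "(real \<times> 'v \<times> 'v) list \<Rightarrow> 'v ffun \<Rightarrow> 'v ffun \<Rightarrow> 'v ffun" where
  "br2 T F G = L2 T (gm F \<odot> G) - L2 T (gm F) \<odot> G - F \<odot> L2 T G"

lemma ff_hd2: "ff F \<Longrightarrow> ff (hd2 T F)"
  unfolding hd2_def by (intro ff_plus ff_sc ff_ffdif ff_L2)

lemma ff_br2: "ff F \<Longrightarrow> ff G \<Longrightarrow> ff (br2 T F G)"
  unfolding br2_def by (intro ff_minus ff_L2 ff_mult ff_gm)

lemma todd_parts: "todd T \<Longrightarrow> \<forall>c\<in>set T. fst (snd c) \<in> Ev W \<or> fst (snd c) \<in> Od W"
  "todd T \<Longrightarrow> \<forall>c\<in>set (tswap T). fst (snd c) \<in> Ev W \<or> fst (snd c) \<in> Od W"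
  by (auto simp: todd_def)

text \<open>The Maurer-Cartan expression of \<open>\<hbar> a\<close> is \<hbar> times the factor
  that \<open>d + \<hbar>\<Delta>\<close> puts in front of \<open>e^a\<close>, and the exponential
  can be cancelled.\<close>

lemma master_of_exp:
  assumes a: "adm a" and T: "todd T" and q: "hd2 T (ffexp W a) = 0"
  defines "A \<equiv> sc fls_X a"
  shows "hd2 T A + sc (fls_const (1/2)) (br2 T A A) = 0"
proof -
  note a' = admD[OF a]
  have gA: "gm (sc fls_X a) = sc fls_X a" by (simp add: a'(2))
  have br: "br2 T A A = sc (fls_X * fls_X) (tmult T a a + tmult T a a)"
    unfolding br2_def A_def gA L2_mult_even[OF ff_sc[OF a'(1)] gA ff_sc[OF a'(1)] T]
      tmult_sc tmult_swap_self[OF a'(1,2) T] sc_simps by (simp only: add_diff_cancel_left' add_diff_cancel_right' add.assoc)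
  have half: "sc (fls_const (1/2)) (sc c (F + F)) = sc c F" for c and F :: "'v ffun"
  proof -
    have "sc (fls_const (1/2)) (sc c (F + F)) = sc (fls_const (1/2) * c + fls_const (1/2) * c) F"
      by (simp only: sc_add_left sc_simps)
    also have "fls_const (1/2) * c + fls_const (1/2) * c = c"
      by (rule fls_eqI) simp
    finally show ?thesis .
  qed
  have "(ffdif W a + sc fls_X (L2 T a + tmult T a a)) \<odot> ffexp W a = 0"
    using q unfolding hd2_def ffdif_exp[OF a] L2_exp_odd[OF a T] by (simp add: mult_lin)
  then have z: "ffdif W a + sc fls_X (L2 T a + tmult T a a) = 0"
    by (rule mult_exp_cancel[OF a, rotated]) (intro ff_plus ff_sc ff_ffdif ff_L2 ff_tmult a')
  have "hd2 T A + sc (fls_const (1/2)) (br2 T A A) = sc fls_X (ffdif W a + sc fls_X (L2 T a + tmult T a a))"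
    unfolding br half unfolding hd2_def A_def ffdif_lin L2_lin by (simp add: add.assoc)
  then show ?thesis unfolding z by simp
qed

text \<open>Conjugating \<open>d + \<hbar>\<Delta>\<close> by a closed exponential gives the twisted
  differential \<open>d + \<hbar>\<Delta> + [A, -]\<close>. With \<open>Y\<close> minus the velocity
  of \<open>A\<close> this is the \<open>dt\<close>-part of the homotopy equation.\<close>

lemma master_linear:
  assumes a: "adm a" and T: "todd T" and q: "hd2 T (ffexp W a) = 0" and B: "ff B" and Y: "ff Y"
    and h: "hd2 T (ffexp W a \<odot> B) = Y \<odot> ffexp W a"
  defines "A \<equiv> sc fls_X a"
  shows "hd2 T B + br2 T A B = Y"
proof -
  note a' = admD[OF a]
  let ?E = "ffexp W a"
  have br: "br2 T A B = sc fls_X (tmult T a B + tmult (tswap T) a B)"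
    unfolding br2_def A_def gm_simps a'(2)
    using L2_mult_even[OF ff_sc[OF a'(1)] _ B T, of fls_X]
    by (simp add: a'(2) tmult_sc)
  have "hd2 T (?E \<odot> B) = hd2 T ?E \<odot> B + ?E \<odot> hd2 T B + sc fls_X (tmult T ?E B + tmult (tswap T) ?E B)"
    unfolding hd2_def ffdif_mult[OF ff_exp[OF a] B] L2_mult_even[OF ff_exp[OF a] gm_exp[OF a] B T] gm_exp[OF a]
    by (simp add: mult_lin ac_simps)
  also have "\<dots> = ?E \<odot> (hd2 T B + br2 T A B)"
    unfolding q br tmult_exp[OF a B todd_parts(1)[OF T]] tmult_exp[OF a B todd_parts(2)[OF T]]
    by (simp add: mult_lin)
  also have "\<dots> = (hd2 T B + br2 T A B) \<odot> ?E"
    by (rule exp_commute[OF a, symmetric]) (intro ff_plus ff_hd2 ff_br2 B ff_sc a'(1), unfold A_def, rule ff_sc[OF a'(1)])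
  finally have "(hd2 T B + br2 T A B - Y) \<odot> ?E = 0"
    using h by (simp add: mult_lin)
  then have "hd2 T B + br2 T A B - Y = 0"
    by (rule mult_exp_cancel[OF a, rotated])
       (intro ff_minus ff_plus ff_hd2 ff_br2 B Y, unfold A_def, rule ff_sc[OF a'(1)])
  then show ?thesis by simp
qed

text \<open>Graded symmetry of the bracket: it makes the two mixed terms of
  \<open>tdt_bracket\<close> coincide.\<close>

lemma br2_swap:
  assumes A: "ff A" "gm A = A" and B: "ff B" "gm B = - B" and T: "todd T"
  shows "br2 T B (gm A) = - br2 T A B"
proof -
  have 1: "B \<odot> A = A \<odot> B" using supercomm(1)[OF A(1) B(1) A(2)] by simp
  have 2: "L2 T B \<odot> A = A \<odot> L2 T B" using supercomm(1)[OF A(1) ff_L2[OF B(1)] A(2)] by simp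
  have 3: "B \<odot> L2 T A = - (L2 T A \<odot> B)"
    using supercomm(2)[OF B(1) ff_L2[OF A(1)] B(2)] gm_L2_odd[OF A(1) T] A(2) by (simp add: mult_lin)
  show ?thesis unfolding br2_def A B(2) mult_lin L2_lin 1 2 3 by simp
qed

section \<open>Uniqueness for the heat equation and the logarithm of its solution\<close>

lemma bt_mono: "bt k F \<Longrightarrow> l \<le> k \<Longrightarrow> bt l F"
  by (erule supp_in_mono) simp

lemma bt_X_L2: "bt k F \<Longrightarrow> bt (k + 1) (sc fls_X (L2 T F))"
  by (rule supp_in_mono[OF supp_in_X[OF L2_supp[of "\<lambda>g n. 3 * g + n \<ge> k"]]]) simp_all

text \<open>The operator raises the order \<open>3 g + n\<close> by one. The lowest coefficients of
  \<open>R\<close> thus have zero derivative in \<open>t\<close> and vanish with the initial value,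
  which raises the lower bound; induction removes all of them.\<close>

lemma heat_unique:
  assumes R: "dpath R R'" and eq: "\<And>t. R' t = sc fls_X (L2 T (R t))" and init: "R 0 = 0" and b: "\<And>t. bt c (R t)"
  shows "R t = 0"
proof -
  have b': "bt (c + int n) (R t)" for n t
  proof (induction n arbitrary: t)
    case 0 then show ?case using b by simp
  next
    case (Suc n)
    show ?case unfolding supp_in_def
    proof (intro allI impI, rule ccontr)
      fix ws g assume nz: "fls_nth (R t ws) g \<noteq> 0" and lt: "\<not> c + int (Suc n) \<le> 3 * g + int (length ws)"
      have "fls_nth (R' t ws) g = 0" for t
        using supp_inD[OF bt_X_L2[OF Suc[of t]], of T ws g] lt unfolding eq by force
      from fpath_nth_const[OF dpathD[OF R] this] show False using nz by (simp add: init pt)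
    qed
  qed
  show ?thesis
  proof (rule ext, rule fls_eqI, rule ccontr)
    fix ws g assume "fls_nth (R t ws) g \<noteq> fls_nth (0 ws) g"
    then have nz: "fls_nth (R t ws) g \<noteq> 0" by (simp add: pt)
    from supp_inD[OF b'[of "nat (3 * g + int (length ws) - c + 1)"] this] show False by linarith
  qed
qed

text \<open>In terms of diagrams the logarithm keeps the connected ones, whose power of \<hbar> is a
  loop number plus the powers at the vertices. Here negative powers are excluded analytically, by
  induction along \<open>3 g + n\<close>.\<close>

lemma linked_cluster:
  assumes N: "dpath N N'" and eq: "\<And>t. N' t = sc fls_X (L2 T (N t)) + tgmult T (N t) (N t)"
    and init: "supp_in (\<lambda>g n. g \<ge> 0) (N 0)" and b: "\<And>t. bt 3 (N t)"
  shows "supp_in (\<lambda>g n. g \<ge> 0) (N t)"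
proof -
  have b': "supp_in (\<lambda>g n. g \<ge> 0 \<or> 3 * g + n \<ge> 3 + int k) (N t)" for k t
  proof (induction k arbitrary: t)
    case 0
    show ?case by (rule supp_in_mono[OF b]) simp
  next
    case (Suc k)
    define B where "B = 3 + int k"
    define R where "R \<equiv> \<lambda>g n. g \<ge> 0 \<or> 3 * g + n \<ge> B + 1"
    \<comment> \<open>In the quadratic term a factor with a negative power contributes at least
      \<open>B\<close> and the other factor at least 3, while the two derivatives cost 2. The net
      gain of one over \<open>B\<close> is why the bound \<open>bt 3\<close> is used.\<close>
    define C where "C \<equiv> \<lambda>g n. (g \<ge> 0 \<or> 3 * g + n \<ge> B) \<and> 3 * g + n \<ge> 3"
    have C: "supp_in C (N t)" for t
      using supp_inD[OF Suc[of t]] supp_inD[OF b[of t]] unfolding supp_in_def[of C "N t"] unfolding C_def B_def by simp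
    have N': "supp_in R (N' t)" for t
      unfolding eq
    proof (rule supp_in_add)
      show "supp_in R (sc fls_X (L2 T (N t)))"
        by (rule supp_in_mono[OF supp_in_X[OF L2_supp[OF C]]]) (unfold C_def R_def, presburger)
      show "supp_in R (tgmult T (N t) (N t))"
      proof (rule tsum_supp)
        fix x y
        show "supp_in R (gm (dd x (N t)) \<odot> dd y (N t))"
          by (rule supp_in_mult[OF supp_in_ffgrade[OF supp_in_dd[OF C]] supp_in_dd[OF C]])
             (unfold C_def R_def, presburger)
      qed
    qed
    show ?case unfolding supp_in_def
    proof (intro allI impI, rule ccontr)
      fix ws g assume nz: "fls_nth (N t ws) g \<noteq> 0" and lt: "\<not> (0 \<le> g \<or> 3 + int (Suc k) \<le> 3 * g + int (length ws))"
      have "fls_nth (N' t ws) g = 0" for t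
        using supp_inD[OF N', of t ws g] lt unfolding R_def B_def by force
      from fpath_nth_const[OF dpathD[OF N] this, of t] have "fls_nth (N 0 ws) g \<noteq> 0" using nz by metis
      from supp_inD[OF init this] lt show False by simp
    qed
  qed
  show ?thesis unfolding supp_in_def
  proof (intro allI impI)
    fix ws g assume nz: "fls_nth (N t ws) g \<noteq> 0"
    from supp_inD[OF b'[of "nat (3 * g + int (length ws))"] this] show "g \<ge> 0" by linarith
  qed
qed

end

section \<open>Gaussian integrals as heat flows\<close>

text \<open>The coefficient of \<open>(\<epsilon> \<hbar> \<partial>\<^sub>x\<^sup>2)\<^sup>r\<close> in \<open>exp (\<epsilon> \<hbar> \<partial>\<^sub>x\<^sup>2 / 2)\<close>.\<close>

definition gcoef :: "nat \<Rightarrow> real" where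
  "gcoef r = 1 / (2 ^ r * fact r)"

lemma gcoef_0 [simp]: "gcoef 0 = 1"
  by (simp add: gcoef_def)

lemma gcoef_Suc: "real (Suc r) * gcoef (Suc r) = gcoef r / 2"
  by (simp add: gcoef_def divide_simps del: of_nat_Suc)

section \<open>Moments and integration over one even coordinate\<close>

lemma gauss_moment_odd: "gauss_moment e (Suc (2 * r)) = 0"
  by (induction r) simp_all

text \<open>The even moments are \<open>(2r-1)!! (e \<hbar>)^r\<close>, and
  \<open>(2r-1)!! = (2r)! / (2^r r!)\<close>.\<close>

lemma gauss_moment_even:
  "fls_const (1 / fact (2 * r)) * gauss_moment e (2 * r) = fls_const (gcoef r * e ^ r) * fls_X ^ r"
proof -
  have "gauss_moment e (2 * r) = fls_const (fact (2 * r) * gcoef r * e ^ r) * fls_X ^ r"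
  proof (induction r)
    case (Suc r)
    have "fact (2 * Suc r) * gcoef (Suc r) = real (2 * r + 1) * (fact (2 * r) * (2 * (real (Suc r) * gcoef (Suc r))))"
      by (simp add: algebra_simps)
    then have c: "fact (2 * Suc r) * gcoef (Suc r) = real (2 * r + 1) * (fact (2 * r) * gcoef r)"
      unfolding gcoef_Suc by simp
    have "gauss_moment e (2 * Suc r) = fls_const (e * real (2 * r + 1)) * fls_X * gauss_moment e (2 * r)" by simp
    also have "\<dots> = fls_const (e * real (2 * r + 1) * (fact (2 * r) * gcoef r * e ^ r)) * fls_X ^ Suc r"
      unfolding Suc by (simp add: fls_const_mult_const[symmetric] ac_simps del: fls_const_mult_const of_nat_add)
    also have "e * real (2 * r + 1) * (fact (2 * r) * gcoef r * e ^ r) = fact (2 * Suc r) * gcoef (Suc r) * e ^ Suc r"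
      unfolding c by simp
    finally show ?case .
  qed simp
  then show ?thesis by (simp add: mult.assoc[symmetric])
qed

lemma sum_even_terms:
  fixes f :: "nat \<Rightarrow> real"
  shows "(\<And>r. f (Suc (2 * r)) = 0) \<Longrightarrow> (\<Sum>n<2 * K. f n) = (\<Sum>r<K. f (2 * r))"
  by (induction K) simp_all

lemma fls_X_power_mult_nth: "fls_nth (fls_X ^ r * f) g = fls_nth f (g - int r)" for f :: "real fls"
  by (simp add: fls_X_power_times_conv_shift)

text \<open>Wick's theorem in one variable: as odd moments vanish, the integral is
  \<open>exp (e \<hbar> \<partial>_u^2 / 2)\<close>. Its term with \<open>2 r\<close> derivatives
  samples \<open>G\<close> at power \<open>g - r\<close> and order \<open>n + 2 r\<close>, where
  \<open>bt c\<close> forces \<open>r \<le> 3 g + n - c\<close>.\<close>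

lemma int_even_nth:
  assumes G: "bt c G" and K: "int K > 3 * g + int (length ws) - c"
  shows "fls_nth (int_even (u, e) G ws) g
    = (\<Sum>r<K. gcoef r * e ^ r * fls_nth (G (replicate (2 * r) u @ ws)) (g - int r))"
proof -
  let ?f = "\<lambda>n. fls_const (1 / fact n) * gauss_moment e n * G (replicate n u @ ws)"
  have ev: "fls_nth (?f (2 * r)) g = gcoef r * e ^ r * fls_nth (G (replicate (2 * r) u @ ws)) (g - int r)" for r g
    unfolding gauss_moment_even by (simp only: mult.assoc fls_const_mult_nth fls_X_power_mult_nth)
  have od: "?f (Suc (2 * r)) = 0" for r
    by (simp only: gauss_moment_odd mult_zero_right mult_zero_left)
  have "fls_nth (\<Sum>n. ?f n) g = (\<Sum>n<2*K. fls_nth (?f n) g)"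
  \<comment> \<open>The bound on \<open>r\<close>, doubled because \<open>n = 2 r\<close>.\<close>
  proof (rule fls_suminf_nth[of _ "2 * int (length ws) - 2 * c" 6])
    fix n g assume nz: "fls_nth (?f n) g \<noteq> 0"
    have "even n"
    proof (rule ccontr)
      assume "odd n"
      then obtain r where "n = Suc (2 * r)" by (elim oddE) simp
      from nz[unfolded this od] show False by simp
    qed
    then obtain r where r: "n = 2 * r" by (elim evenE)
    from nz have "fls_nth (G (replicate (2 * r) u @ ws)) (g - int r) \<noteq> 0" unfolding r ev by auto
    from supp_inD[OF G this] show "int n \<le> 2 * int (length ws) - 2 * c + 6 * g" unfolding r by simp
  qed (use K in simp_all)
  also have "\<dots> = (\<Sum>r<K. fls_nth (?f (2 * r)) g)"
    by (rule sum_even_terms) (simp only: od fls_zero_nth)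
  finally show ?thesis unfolding int_even_def ev by simp
qed

lemma obtain_bound: obtains K :: nat where "int K > x"
  by (rule that[of "nat (x + 1)"]) linarith

text \<open>With variance zero the moments of positive order vanish, so the flow
  \<open>int_even (u, t * e)\<close> starts at the identity.\<close>

lemma int_even_0: fixes G :: "'v ffun" assumes "bt c G" shows "int_even (u, 0) G = G"
proof (rule ext, rule fls_eqI)
  fix ws :: "'v list" and g :: int
  obtain K where K: "int K > 3 * g + int (length ws) - c" by (rule obtain_bound)
  then have "int (Suc K) > 3 * g + int (length ws) - c" by simp
  from int_even_nth[OF assms this, of u 0] show "fls_nth (int_even (u, 0) G ws) g = fls_nth (G ws) g"
    by (simp add: sum.lessThan_Suc_shift del: sum.lessThan_Suc)
qed

lemma int_even_supp:
  assumes G: "bt c G" and R: "supp_in R G" and cl: "\<And>g n r. R g (n + 2 * int r) \<Longrightarrow> R (g + int r) n"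
  shows "supp_in R (int_even (u, e) G)"
  unfolding supp_in_def
proof (intro allI impI, rule ccontr)
  fix ws g assume nz: "fls_nth (int_even (u, e) G ws) g \<noteq> 0" and n: "\<not> R g (int (length ws))"
  obtain K where K: "int K > 3 * g + int (length ws) - c" by (rule obtain_bound)
  have "fls_nth (G (replicate (2 * r) u @ ws)) (g - int r) = 0" for r
  proof (rule ccontr)
    assume "\<not> ?thesis"
    from supp_inD[OF R this] have "R (g - int r) (int (length ws) + 2 * int r)" by (simp add: add.commute)
    from cl[OF this] n show False by simp
  qed
  then have "fls_nth (int_even (u, e) G ws) g = 0" unfolding int_even_nth[OF G K] by simp
  with nz show False by simp
qed

lemma bt_int_even: "bt c G \<Longrightarrow> bt c (int_even (u, e) G)"
  by (rule int_even_supp) simp_all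

lemma int_even_add:
  fixes F G :: "'v ffun"
  assumes "bt c F" "bt c G" shows "int_even (u, e) (F + G) = int_even (u, e) F + int_even (u, e) G"
proof (rule ext, rule fls_eqI)
  fix ws :: "'v list" and g :: int
  obtain K where K: "int K > 3 * g + int (length ws) - c" by (rule obtain_bound)
  show "fls_nth (int_even (u, e) (F + G) ws) g = fls_nth ((int_even (u, e) F + int_even (u, e) G) ws) g"
    unfolding plus_fun_apply fls_plus_nth int_even_nth[OF assms(1) K] int_even_nth[OF assms(2) K]
      int_even_nth[OF supp_in_add[OF assms] K]
    by (simp add: distrib_left sum.distrib)
qed

lemma int_even_const:
  fixes F :: "'v ffun"
  assumes "bt c F" shows "int_even (u, e) (sc (fls_const a) F) = sc (fls_const a) (int_even (u, e) F)"
proof (rule ext, rule fls_eqI)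
  fix ws :: "'v list" and g :: int
  obtain K where K: "int K > 3 * g + int (length ws) - c" by (rule obtain_bound)
  show "fls_nth (int_even (u, e) (sc (fls_const a) F) ws) g = fls_nth (sc (fls_const a) (int_even (u, e) F) ws) g"
    unfolding sc_apply fls_const_mult_nth int_even_nth[OF assms(1) K] int_even_nth[OF supp_in_const[OF assms] K]
    by (simp add: sum_distrib_left ac_simps)
qed

lemma int_even_X:
  fixes F :: "'v ffun"
  assumes F: "bt c F" shows "int_even (u, e) (sc fls_X F) = sc fls_X (int_even (u, e) F)"
proof (rule ext, rule fls_eqI)
  fix ws :: "'v list" and g :: int
  obtain K where K: "int K > 3 * g + int (length ws) - c" by (rule obtain_bound)
  have F': "bt (c + 3) (sc fls_X F)" by (rule supp_in_mono[OF supp_in_X[OF F]]) simp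
  have 1: "fls_nth (int_even (u, e) F ws) (g - 1)
      = (\<Sum>r<K. gcoef r * e ^ r * fls_nth (F (replicate (2 * r) u @ ws)) (g - 1 - int r))"
    by (rule int_even_nth[OF F]) (use K in simp)
  have 2: "fls_nth (int_even (u, e) (sc fls_X F) ws) g
      = (\<Sum>r<K. gcoef r * e ^ r * fls_nth (sc fls_X F (replicate (2 * r) u @ ws)) (g - int r))"
    by (rule int_even_nth[OF F']) (use K in simp)
  show "fls_nth (int_even (u, e) (sc fls_X F) ws) g = fls_nth (sc fls_X (int_even (u, e) F) ws) g"
    unfolding 2 unfolding sc_apply fls_X_mult_nth 1 by (simp add: algebra_simps)
qed

section \<open>Each integration as a heat flow, and their composition\<close>

context super_sp
begin

lemma replicate_swap: "ff G \<Longrightarrow> u \<in> Ev W \<Longrightarrow> G (replicate n u @ x # ws) = G (x # replicate n u @ ws)"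
proof (induction n arbitrary: G)
  case (Suc n)
  have "G (replicate (Suc n) u @ x # ws) = dd u G (replicate n u @ x # ws)" by (simp add: dd_apply)
  also have "\<dots> = dd u G (x # replicate n u @ ws)" by (rule Suc.IH[OF ff_dd[OF Suc.prems(1)] Suc.prems(2)])
  also have "\<dots> = G (x # u # replicate n u @ ws)"
    unfolding dd_apply by (rule ff_swap_Ev[OF Suc.prems, of "[]", unfolded append_Nil])
  finally show ?case by simp
qed simp

lemma dd_int_even: "ff G \<Longrightarrow> u \<in> Ev W \<Longrightarrow> dd x (int_even (u, e) G) = int_even (u, e) (dd x G)"
  by (rule ext) (simp add: int_even_def dd_apply replicate_swap)

lemma ff_int_even: assumes G: "ff G" and b: "bt c G" and u: "u \<in> Ev W" shows "ff (int_even (u, e) G)"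
proof (rule ffI; rule fls_eqI)
  fix xs ys :: "'v list" and x y :: 'v and g :: int
  obtain K where K: "int K > 3 * g + int (length (xs @ x # ys)) - c" by (rule obtain_bound)
  have K': "int K > 3 * g + int (length (xs @ y # ys)) - c" "int K > 3 * g + int (length (xs @ (x + y) # ys)) - c"
    using K by simp_all
  show "fls_nth (int_even (u, e) G (xs @ (x + y) # ys)) g
      = fls_nth (int_even (u, e) G (xs @ x # ys) + int_even (u, e) G (xs @ y # ys)) g"
    unfolding fls_plus_nth int_even_nth[OF b K] int_even_nth[OF b K'(1)] int_even_nth[OF b K'(2)]
      append_assoc[symmetric] ff_add[OF G] by (simp add: distrib_left sum.distrib)
next
  fix xs ys :: "'v list" and x :: 'v and a :: real and g :: int
  obtain K where K: "int K > 3 * g + int (length (xs @ x # ys)) - c" by (rule obtain_bound)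
  have K': "int K > 3 * g + int (length (xs @ (a *\<^sub>R x) # ys)) - c" using K by simp
  show "fls_nth (int_even (u, e) G (xs @ (a *\<^sub>R x) # ys)) g = fls_nth (fls_const a * int_even (u, e) G (xs @ x # ys)) g"
    unfolding fls_const_mult_nth int_even_nth[OF b K] int_even_nth[OF b K']
      append_assoc[symmetric] ff_scale[OF G] by (simp add: sum_distrib_left ac_simps)
next
  fix xs ys :: "'v list" and x y :: 'v and g :: int assume x: "x \<in> Ev W"
  show "fls_nth (int_even (u, e) G (xs @ x # y # ys)) g = fls_nth (int_even (u, e) G (xs @ y # x # ys)) g"
    unfolding int_even_def append_assoc[symmetric] ff_swap_Ev[OF G x, of "_ @ xs" y] ..
next
  fix xs ys :: "'v list" and x y :: 'v and g :: int assume x: "x \<in> Od W" "y \<in> Od W"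
  obtain K where K: "int K > 3 * g + int (length (xs @ x # y # ys)) - c" by (rule obtain_bound)
  have K': "int K > 3 * g + int (length (xs @ y # x # ys)) - c" using K by simp
  show "fls_nth (int_even (u, e) G (xs @ x # y # ys)) g = fls_nth (- int_even (u, e) G (xs @ y # x # ys)) g"
    unfolding fls_uminus_nth int_even_nth[OF b K] int_even_nth[OF b K']
      append_assoc[symmetric] ff_swap_Od[OF G x, of "_ @ xs"] by (simp add: sum_negf)
qed

lemma L2_int_even:
  assumes G: "ff G" and b: "bt c G" and u: "u \<in> Ev W"
  shows "L2 T (int_even (u, e) G) = int_even (u, e) (L2 T G)"
proof (induction T)
  case Nil
  show ?case using int_even_const[of 0 "0::'v ffun" u e 0] by simp
next
  case (Cons k T)
  have b2: "bt (c - 2) (dd y (dd x G))" for x y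
    by (rule supp_in_mono[OF supp_in_dd[OF supp_in_dd[OF b]]]) simp
  have bL: "bt (c - 2) (L2 T G)" by (rule supp_in_mono[OF L2_supp[OF b]]) simp
  show ?case unfolding L2_Cons int_even_add[OF supp_in_const[OF b2] bL] int_even_const[OF b2] Cons
    by (simp only: dd_int_even[OF G u] dd_int_even[OF ff_dd[OF G] u])
qed

text \<open>Through \<open>dpath\<close> every coefficient of the solution is polynomial in
  \<open>t\<close>; \<open>bt 0\<close> is the bound used for uniqueness.\<close>

definition heatflow :: "(real \<times> 'v \<times> 'v) list \<Rightarrow> 'v ffun \<Rightarrow> (real \<Rightarrow> 'v ffun) \<Rightarrow> bool" where
  "heatflow T F G \<longleftrightarrow> dpath G (\<lambda>t. sc fls_X (L2 T (G t))) \<and> G 0 = F \<and> (\<forall>t. ff (G t) \<and> bt 0 (G t))"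

text \<open>The Gaussian of variance \<open>t e \<hbar>\<close> acts as
  \<open>exp (t e \<hbar> \<partial>_u^2 / 2)\<close>. It commutes with the operator of
  \<open>T\<close>, so by the product rule the generators add.\<close>

lemma heatflow_int_even:
  assumes h: "heatflow T F G" and u: "u \<in> Ev W"
  shows "heatflow ((e / 2, u, u) # T) F (\<lambda>t. int_even (u, t * e) (G t))"
  unfolding heatflow_def
proof (intro conjI allI)
  have G: "dpath G (\<lambda>t. sc fls_X (L2 T (G t)))" "G 0 = F" and ffG: "ff (G t)" and bG: "bt 0 (G t)" for t
    using h by (simp_all add: heatflow_def)
  show "int_even (u, 0 * e) (G 0) = F" using int_even_0[OF bG[of 0]] by (simp add: G(2))
  show "ff (int_even (u, t * e) (G t))" for t by (rule ff_int_even[OF ffG bG u])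
  show "bt 0 (int_even (u, t * e) (G t))" for t by (rule bt_int_even[OF bG])
  show "dpath (\<lambda>t. int_even (u, t * e) (G t)) (\<lambda>t. sc fls_X (L2 ((e / 2, u, u) # T) (int_even (u, t * e) (G t))))"
    unfolding dpath_def
  proof
    fix ws
    show "fpath (\<lambda>t. int_even (u, t * e) (G t) ws) (\<lambda>t. sc fls_X (L2 ((e / 2, u, u) # T) (int_even (u, t * e) (G t))) ws)"
    proof (rule fpathI)
      fix g
      let ?w = "\<lambda>r. replicate (2 * r) u @ ws"
      obtain M where M: "int M > 3 * g + int (length ws) - 0" by (rule obtain_bound)
      \<comment> \<open>The derivative of \<open>t^r\<close> shifts the summation by one:
        \<open>Suc M\<close> terms here match \<open>M\<close> terms after applying the
        generator.\<close>
      then have K: "int (Suc M) > 3 * g + int (length ws) - 0" by simp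
      define q where "q r = monom (gcoef r * e ^ r) r" for r
      define a where "a t = (\<Sum>r<Suc M. fls_const (poly (q r) t) * fls_shift (- int r) (G t (?w r)))" for t
      define a' where "a' t = (\<Sum>r<Suc M. fls_const (poly (pderiv (q r)) t) * fls_shift (- int r) (G t (?w r)) +
        fls_const (poly (q r) t) * fls_shift (- int r) (sc fls_X (L2 T (G t)) (?w r)))" for t
      have p: "fpath a a'" unfolding a_def a'_def
        by (intro fpath_sum fpath_poly_mult fpath_shift dpathD[OF G(1)])
      have pq: "poly (q r) t = gcoef r * (t * e) ^ r" for r t
        by (simp add: q_def poly_monom power_mult_distrib)
      have 1: "fls_nth (int_even (u, t * e) (G t) ws) g = fls_nth (a t) g" for t
        unfolding int_even_nth[OF bG K] a_def fls_nth_sum by (simp add: pq)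
      have LG: "bt 1 (sc fls_X (L2 T (G t)))" for t using bt_X_L2[OF bG, of T t] by simp
      have 2: "fls_nth (sc fls_X (L2 ((e / 2, u, u) # T) (int_even (u, t * e) (G t))) ws) g = fls_nth (a' t) g" for t
      proof -
        have bL: "bt (- 2) (L2 T (G t))" by (rule supp_in_mono[OF L2_supp[OF bG]]) simp
        have b2: "bt (- 2) (dd u (dd u (G t)))" by (rule supp_in_mono[OF supp_in_dd[OF supp_in_dd[OF bG]]]) simp
        have "fls_nth (sc fls_X (L2 ((e / 2, u, u) # T) (int_even (u, t * e) (G t))) ws) g
          = e / 2 * fls_nth (int_even (u, t * e) (dd u (dd u (G t))) ws) (g - 1)
            + fls_nth (int_even (u, t * e) (sc fls_X (L2 T (G t))) ws) g"
          unfolding L2_Cons fst_conv snd_conv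
          unfolding L2_int_even[OF ffG bG u] dd_int_even[OF ffG u]
            dd_int_even[OF ff_dd[OF ffG] u] int_even_X[OF bL] sc_simps
          by (simp add: pt distrib_left mult.assoc mult.left_commute[of fls_X])
        also have "fls_nth (int_even (u, t * e) (dd u (dd u (G t))) ws) (g - 1)
          = (\<Sum>r<M. gcoef r * (t * e) ^ r * fls_nth (G t (?w (Suc r))) (g - int (Suc r)))"
        proof -
          \<comment> \<open>Two derivatives lower the bound to \<open>-2\<close> and the factor
            \<hbar> moves the power to \<open>g - 1\<close>; together the range shrinks by
            one.\<close>
          have m: "3 * (g - 1) + int (length ws) - (- 2) < int M" using M by simp
          have "u # u # replicate (2 * r) u @ ws = replicate (2 * Suc r) u @ ws" for r by simp
          then show ?thesis unfolding int_even_nth[OF b2 m]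
            by (simp add: dd_apply algebra_simps)
        qed
        also have "e / 2 * \<dots> = (\<Sum>r<M. poly (pderiv (q (Suc r))) t * fls_nth (G t (?w (Suc r))) (g - int (Suc r)))"
        proof -
          have c: "poly (pderiv (q (Suc r))) t = e / 2 * (gcoef r * (t * e) ^ r)" for r
          proof -
            have "poly (pderiv (q (Suc r))) t = (real (Suc r) * gcoef (Suc r)) * e ^ Suc r * t ^ r"
              by (simp add: q_def pderiv_monom poly_monom del: of_nat_Suc)
            then show ?thesis unfolding gcoef_Suc by (simp add: power_mult_distrib)
          qed
          show ?thesis unfolding c sum_distrib_left by (simp only: mult.assoc)
        qed
        also have "\<dots> = (\<Sum>r<Suc M. poly (pderiv (q r)) t * fls_nth (G t (?w r)) (g - int r))"
          unfolding sum.lessThan_Suc_shift by (simp add: q_def monom_0 pderiv_pCons)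
        also have "fls_nth (int_even (u, t * e) (sc fls_X (L2 T (G t))) ws) g
          = (\<Sum>r<Suc M. poly (q r) t * fls_nth (sc fls_X (L2 T (G t)) (?w r)) (g - int r))"
        proof -
          have m: "3 * g + int (length ws) - 1 < int (Suc M)" using M by simp
          show ?thesis unfolding int_even_nth[OF LG m] by (simp only: pq)
        qed
        finally show ?thesis
          unfolding a'_def fls_nth_sum by (simp add: sum.distrib del: sum.lessThan_Suc)
      qed
      show "\<exists>q. \<forall>t. fls_nth (int_even (u, t * e) (G t) ws) g = poly q t \<and>
          fls_nth (sc fls_X (L2 ((e / 2, u, u) # T) (int_even (u, t * e) (G t))) ws) g = poly (pderiv q) t"
        unfolding 1 2 using p unfolding fpath_def by blast
    qed
  qed
qed

lemma dd_Od_twice: assumes F: "ff F" and x: "x \<in> Od W" shows "dd x (dd x F) = 0"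
proof -
  have "dd x (dd x F) ws = (- dd x (dd x F)) ws" for ws by (rule fun_cong[OF dd_commute_Od[OF F x x]])
  then have e: "fls_nth (dd x (dd x F) ws) g = - fls_nth (dd x (dd x F) ws) g" for ws g
    unfolding uminus_apply by (metis fls_uminus_nth)
  show ?thesis
  proof (rule ext, rule fls_eqI)
    fix ws g show "fls_nth (dd x (dd x F) ws) g = fls_nth (0 ws) g"
      using e[of ws g] by (simp add: pt)
  qed
qed

text \<open>For odd \<open>x\<close>, \<open>y\<close> the operator
  \<open>\<partial>_y \<partial>_x\<close> squares to zero, so its exponential stops after the
  linear term: this is \<open>int_odd\<close> with \<open>t\<close> inserted.\<close>

lemma heatflow_int_odd:
  assumes h: "heatflow T F G" and x: "x \<in> Od W" and y: "y \<in> Od W" and T: "teven T"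
  shows "heatflow ((2, x, y) # T) F (\<lambda>t ws. G t ws + fls_const t * (2 * fls_X * G t (x # y # ws)))"
proof -
  have G: "dpath G (\<lambda>t. sc fls_X (L2 T (G t)))" "G 0 = F" and ffG: "ff (G t)" and bG: "bt 0 (G t)" for t
    using h by (simp_all add: heatflow_def)
  let ?P = "\<lambda>F. sc (fls_const 2) (sc fls_X (dd y (dd x F)))"
  have e: "(\<lambda>t ws. G t ws + fls_const t * (2 * fls_X * G t (x # y # ws)))
      = (\<lambda>t. G t + sc (fls_const (poly [:0, 1:] t)) (?P (G t)))"
    by (intro ext) (simp add: pt dd_apply mult.assoc)
  have z: "dd y (dd x (dd y (dd x F))) = 0" if F: "ff F" for F
  proof -
    have "dd y (dd x (dd y (dd x F))) = dd y (dd y (dd x (dd x F)))"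
      by (rule dd_pair_even[OF ff_dd[OF F]]) (simp add: x y)
    then show ?thesis by (simp add: dd_Od_twice[OF F x])
  qed
  have T2: "dd y (dd x (L2 T F)) = L2 T (dd y (dd x F))" if "ff F" for F
    by (simp only: L2_dd[OF _ T] ff_dd that)
  have d: "sc fls_X (L2 ((2, x, y) # T) (G t + sc (fls_const (poly [:0, 1:] t)) (?P (G t))))
      = sc fls_X (L2 T (G t)) + (sc (fls_const (poly (pderiv [:0, 1:]) t)) (?P (G t))
        + sc (fls_const (poly [:0, 1:] t)) (?P (sc fls_X (L2 T (G t)))))" for t
    unfolding L2_Cons fst_conv snd_conv dd_simps L2_lin z[OF ffG] T2[OF ffG] sc_simps
    by (rule ext) (simp add: pt pderiv_pCons algebra_simps)
  show ?thesis unfolding heatflow_def e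
  proof (intro conjI allI)
    show "dpath (\<lambda>t. G t + sc (fls_const (poly [:0, 1:] t)) (?P (G t)))
      (\<lambda>t. sc fls_X (L2 ((2, x, y) # T) (G t + sc (fls_const (poly [:0, 1:] t)) (?P (G t)))))"
      unfolding d by (intro dpath_add dpath_sc_poly dpath_sc_const dpath_sc_X dpath_dd G(1))
    show "G 0 + sc (fls_const (poly [:0, 1:] 0)) (?P (G 0)) = F" using G(2) by simp
    show "ff (G t + sc (fls_const (poly [:0, 1:] t)) (?P (G t)))" for t
      by (intro ff_plus ff_sc ff_dd ffG)
    have b: "bt 0 (sc fls_X (dd y (dd x (G t))))" for t
      by (rule supp_in_mono[OF supp_in_X[OF supp_in_dd[OF supp_in_dd[OF bG]]]]) simp
    show "bt 0 (G t + sc (fls_const (poly [:0, 1:] t)) (?P (G t)))" for t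
      by (intro supp_in_add supp_in_const b bG)
  qed
qed

text \<open>The propagator of the Gaussian integral in the coordinates \<open>us\<close>, \<open>vs\<close>.\<close>

definition gtensor :: "('v \<times> real) list \<Rightarrow> ('v \<times> 'v) list \<Rightarrow> (real \<times> 'v \<times> 'v) list" where
  "gtensor us vs = map (\<lambda>c. (snd c / 2, fst c, fst c)) us @ map (\<lambda>c. (2, fst c, snd c)) vs"

text \<open>Wick's theorem for all coordinates: every single integration is run with its generator
  multiplied by \<open>t\<close>, and the resulting flow reaches the iterated integral at time
  one.\<close>

lemma gaussian_heatflow:
  assumes us: "fst ` set us \<subseteq> Ev W" and vs: "fst ` set vs \<subseteq> Od W" "snd ` set vs \<subseteq> Od W"
    and F: "ff F" "bt 0 F"
  obtains G where "heatflow (gtensor us vs) F G" "G 1 = foldr int_even us (foldr int_odd vs F)"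
proof -
  define Go where "Go vs = (\<lambda>t. foldr (\<lambda>c G ws. G ws + fls_const t * (2 * fls_X * G (fst c # snd c # ws))) vs F)" for vs :: "('v \<times> 'v) list"
  define Ge where "Ge us = (\<lambda>t. foldr (\<lambda>c. int_even (fst c, t * snd c)) us (Go vs t))" for us
  have "heatflow (map (\<lambda>c. (2, fst c, snd c)) vs) F (Go vs) \<and> teven (map (\<lambda>c. (2, fst c, snd c)) vs)"
    using vs
  proof (induction vs)
    case Nil
    have "dpath (\<lambda>t. F) (\<lambda>t. sc fls_X (L2 [] F))" using dpath_const[of F] by simp
    moreover have "Go [] = (\<lambda>t. F)" unfolding Go_def foldr.simps id_def ..
    ultimately show ?case using F unfolding heatflow_def teven_def list.map by simp
  next
    case (Cons c vs)
    then have IH: "heatflow (map (\<lambda>c. (2, fst c, snd c)) vs) F (Go vs)" "teven (map (\<lambda>c. (2, fst c, snd c)) vs)"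
      and c: "fst c \<in> Od W" "snd c \<in> Od W" by simp_all
    have "teven (map (\<lambda>c. (2, fst c, snd c)) (c # vs))" using IH(2) c by (simp add: teven_def)
    moreover have "heatflow (map (\<lambda>c. (2, fst c, snd c)) (c # vs)) F (Go (c # vs))"
    proof -
      have g: "Go (c # vs) = (\<lambda>t ws. Go vs t ws + fls_const t * (2 * fls_X * Go vs t (fst c # snd c # ws)))"
        unfolding Go_def foldr.simps comp_apply ..
      show ?thesis unfolding g list.map by (rule heatflow_int_odd[OF IH(1) c IH(2)])
    qed
    ultimately show ?case by simp
  qed
  then have o: "heatflow (map (\<lambda>c. (2, fst c, snd c)) vs) F (Go vs)" ..
  have "heatflow (gtensor us vs) F (Ge us)"
    using us
  proof (induction us)
    case Nil
    have "Ge [] = Go vs" unfolding Ge_def foldr.simps id_def ..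
    then show ?case using o unfolding gtensor_def list.map append_Nil by (simp only:)
  next
    case (Cons c us)
    then have IH: "heatflow (gtensor us vs) F (Ge us)" and c: "fst c \<in> Ev W" by simp_all
    have g: "Ge (c # us) = (\<lambda>t. int_even (fst c, t * snd c) (Ge us t))"
      unfolding Ge_def foldr.simps comp_apply ..
    show ?case unfolding g using heatflow_int_even[OF IH c, of "snd c"]
      unfolding gtensor_def list.map append_Cons .
  qed
  moreover have "Ge us 1 = foldr int_even us (foldr int_odd vs F)"
  proof -
    have "(\<lambda>c (G :: 'v ffun) ws. G ws + fls_const 1 * (2 * fls_X * G (fst c # snd c # ws))) = int_odd"
      by (intro ext) (simp add: int_odd_def)
    then show ?thesis unfolding Ge_def Go_def by (simp only: mult_1 prod.collapse)
  qed
  ultimately show ?thesis by (rule that)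
qed

text \<open>By \<open>cl\<close> the operator \<hbar> times a second derivative preserves
  \<open>R\<close>. It also raises \<open>3 g + n\<close>, so violations of \<open>R\<close> are
  pushed to ever higher order and cannot exist.\<close>

lemma heatflow_supp:
  assumes h: "heatflow T F G" and R: "supp_in R F" and cl: "\<And>g n. R (g - 1) (n + 2) \<Longrightarrow> R g n"
  shows "supp_in R (G t)"
proof -
  have G: "dpath G (\<lambda>t. sc fls_X (L2 T (G t)))" "G 0 = F" and bG: "bt 0 (G t)" for t
    using h by (simp_all add: heatflow_def)
  have b': "supp_in (\<lambda>g n. R g n \<or> 3 * g + n \<ge> int k) (G t)" for k t
  proof (induction k arbitrary: t)
    case 0 show ?case by (rule supp_in_mono[OF bG]) simp
  next
    case (Suc k)
    have s: "supp_in (\<lambda>g n. R g n \<or> 3 * g + n \<ge> int (Suc k)) (sc fls_X (L2 T (G t)))" for t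
    proof (rule supp_in_mono[OF supp_in_X[OF L2_supp[OF Suc[of t]]]])
      fix g n assume "R (g - 1) (n + 2) \<or> int k \<le> 3 * (g - 1) + (n + 2)"
      then show "R g n \<or> int (Suc k) \<le> 3 * g + n" using cl by force
    qed
    show ?case unfolding supp_in_def
    proof (intro allI impI, rule ccontr)
      fix ws g assume nz: "fls_nth (G t ws) g \<noteq> 0" and n: "\<not> (R g (int (length ws)) \<or> int (Suc k) \<le> 3 * g + int (length ws))"
      have "fls_nth (sc fls_X (L2 T (G t)) ws) g = 0" for t
        using supp_inD[OF s, of t ws g] n by blast
      from fpath_nth_const[OF dpathD[OF G(1)] this, of t] have "fls_nth (F ws) g \<noteq> 0" using nz G(2) by metis
      from supp_inD[OF R this] n show False by blast
    qed
  qed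
  show ?thesis unfolding supp_in_def
  proof (intro allI impI)
    fix ws g assume nz: "fls_nth (G t ws) g \<noteq> 0"
    from supp_inD[OF b'[of "nat (3 * g + int (length ws)) + 1"] this] show "R g (int (length ws))" by linarith
  qed
qed

lemma heatflow_gm:
  assumes h: "heatflow T F G" and F: "gm F = F" and T: "teven T" shows "gm (G t) = G t"
proof -
  have G: "dpath G (\<lambda>t. sc fls_X (L2 T (G t)))" "G 0 = F" and ffG: "ff (G t)" and bG: "bt 0 (G t)" for t
    using h by (simp_all add: heatflow_def)
  have "gm (G t) - G t = 0"
  proof (rule heat_unique[of "\<lambda>t. gm (G t) - G t" _ T])
    show "dpath (\<lambda>t. gm (G t) - G t) (\<lambda>t. gm (sc fls_X (L2 T (G t))) - sc fls_X (L2 T (G t)))"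
      by (intro dpath_diff dpath_ffgrade G(1))
    show "gm (sc fls_X (L2 T (G t))) - sc fls_X (L2 T (G t)) = sc fls_X (L2 T (gm (G t) - G t))" for t
      by (simp add: gm_L2_even[OF ffG T] L2_lin)
    show "gm (G 0) - G 0 = 0" by (simp add: G(2) F)
    show "bt 0 (gm (G t) - G t)" for t by (intro supp_in_diff supp_in_ffgrade bG)
  qed
  then show ?thesis by simp
qed

end

section \<open>The homotopy\<close>

context super_sp
begin

text \<open>For \<open>poly_path\<close> of the \<open>dt\<close>-component it is enough that some
  derivative exists, so none is computed.\<close>

lemma DV_path_exists:
  assumes a: "linear a" and r: "linear r" and A: "dpath A A'" and ffA: "\<And>t. ff (A t)"
  shows "\<exists>b'. fpath (\<lambda>t. DV \<kappa> (\<lambda>w. a w + t *\<^sub>R r w) S (A t) ws) b'"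
  using A ffA
proof (induction ws arbitrary: A A')
  case Nil show ?case unfolding DV_nil using fpath_const by blast
next
  case (Cons w ws)
  note A = Cons.prems(1) and ffA = Cons.prems(2)
  let ?\<phi> = "\<lambda>t w. a w + t *\<^sub>R r w"
  obtain b1 where b1: "fpath (\<lambda>t. DV \<kappa> (?\<phi> t) S (dd (a (\<kappa> w)) (A t)) ws) b1"
    using Cons.IH[OF dpath_dd[OF A] ff_dd[OF ffA]] by blast
  obtain b2 where b2: "fpath (\<lambda>t. DV \<kappa> (?\<phi> t) S (dd (r (\<kappa> w)) (A t)) ws) b2"
    using Cons.IH[OF dpath_dd[OF A] ff_dd[OF ffA]] by blast
  have e: "DV \<kappa> (?\<phi> t) S (A t) (w # ws) = pullback (?\<phi> t) (dd (S (\<kappa> w)) (A t)) ws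
    + (DV \<kappa> (?\<phi> t) S (dd (a (\<kappa> w)) (A t)) ws + fls_const (poly [:0, 1:] t) * DV \<kappa> (?\<phi> t) S (dd (r (\<kappa> w)) (A t)) ws)" for t
    unfolding DV_cons dd_add_vec[OF ffA] dd_scale_vec[OF ffA] DV_lin by (simp add: pt)
  show ?case unfolding e
    using fpath_add[OF dpathD[OF dpath_pullback[OF a r dpath_dd[OF A] ff_dd[OF ffA]]] fpath_add[OF b1 fpath_poly_mult[OF b2]]]
    by blast
qed

lemma hd2_lin: "hd2 T (sc c F) = sc c (hd2 T F)" "hd2 T (F + G) = hd2 T F + hd2 T G"
  by (simp_all add: hd2_def ffdif_lin L2_lin mult.commute)

end

text \<open>The linear algebra behind the homotopy, with \<open>pr\<close> in the role of
  \<open>i p\<close>. The form enters only through the tensors built from \<open>DH\<close>,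
  \<open>us\<close> and \<open>vs\<close>.\<close>

locale gauss_setup = super_sp W for W :: "'v::real_vector super" +
  fixes s :: "'v \<Rightarrow> 'v" and pr :: "'v \<Rightarrow> 'v" and us :: "('v \<times> real) list" and vs :: "('v \<times> 'v) list"
    and DH :: "(real \<times> 'v \<times> 'v) list"
  assumes s: "odlin s" and pr: "evlin pr" and d_pr: "\<And>x. dif W (pr x) = pr (dif W x)"
    and sdr: "\<And>x. dif W (s x) + s (dif W x) = x - pr x"
    and us: "\<And>c. c \<in> set us \<Longrightarrow> fst c \<in> Ev W \<and> s (fst c) = 0 \<and> pr (fst c) = 0"
    and vs: "\<And>c. c \<in> set vs \<Longrightarrow> fst c \<in> Od W \<and> s (fst c) = 0 \<and> pr (fst c) = 0 \<and>
      snd c \<in> Od W \<and> s (snd c) = 0 \<and> pr (snd c) = 0"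
    and DH: "\<And>c. c \<in> set DH \<Longrightarrow> fst (snd c) \<in> Od W \<and> s (fst (snd c)) = 0 \<and> pr (fst (snd c)) = fst (snd c) \<and>
      snd (snd c) \<in> Ev W \<and> s (snd (snd c)) = 0 \<and> pr (snd (snd c)) = snd (snd c)"
begin

text \<open>\<open>DH\<close> and \<open>Dp\<close> are the Laplacians of \<open>H(W)\<close> and of its complement: up to scaling, \<open>d\<close> maps
  a basis of \<open>\<L>\<^sub>s\<close> to the dual basis of \<open>\<Pi> im d\<close>.\<close>

definition "De = map (\<lambda>c. (1, - snd c *\<^sub>R dif W (fst c), fst c)) us"
definition "Dx = map (\<lambda>c. (1, fst c, - 2 *\<^sub>R dif W (snd c))) vs"
definition "Dy = map (\<lambda>c. (1, snd c, 2 *\<^sub>R dif W (fst c))) vs"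
definition "Dp = De @ Dx @ Dy"
definition "D = DH @ Dp"

abbreviation "P \<equiv> gtensor us vs"

definition "scl t = (\<lambda>w. pr w + t *\<^sub>R (w - pr w))"

section \<open>The tensors under rescaling and under \<open>d\<close> and \<open>s\<close>\<close>

lemma lin_s: "linear s" and lin_pr: "linear pr" and lin_co: "linear (\<lambda>w. w - pr w)"
  using s pr linear_compose_sub[OF linear_ident, of pr] by (simp_all add: odlin_def evlin_def)

lemma d0: "dif W 0 = 0"
  using lin_dif by (rule linear_0)

lemma linear_scl: "linear (scl t)"
  unfolding scl_def by (intro linear_compose_add lin_pr linear_compose_scale_right lin_co)

lemma evlin_scl: "evlin (scl t)"
  unfolding evlin_def
proof (intro conjI ballI linear_scl)
  show "scl t x \<in> Ev W" if "x \<in> Ev W" for x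
    unfolding scl_def using that pr by (intro subspace_add subspace_scale subspace_diff sub_Ev) (simp_all add: evlin_def)
  show "scl t x \<in> Od W" if "x \<in> Od W" for x
    unfolding scl_def using that pr by (intro subspace_add subspace_scale subspace_diff sub_Od) (simp_all add: evlin_def)
qed

lemma d_scl: "dif W (scl t x) = scl t (dif W x)"
  unfolding scl_def by (simp add: linear_add[OF lin_dif] linear_diff[OF lin_dif] linear_scale[OF lin_dif] d_pr)

lemma scl_im: "pr x = x \<Longrightarrow> scl t x = x" and scl_ker: "pr x = 0 \<Longrightarrow> scl t x = t *\<^sub>R x"
  by (simp_all add: scl_def)

lemma sd: "s x = 0 \<Longrightarrow> pr x = 0 \<Longrightarrow> s (dif W x) = x"
  using sdr[of x] by (simp add: d0)

lemma pr_d: "pr x = 0 \<Longrightarrow> pr (dif W x) = 0"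
  by (simp add: d_pr[symmetric] d0)

lemma todd_D: "todd D"
  using us vs DH sub_Ev sub_Od
  by (auto simp: todd_def D_def Dp_def De_def Dx_def Dy_def dif_Ev dif_Od subspace_scale subspace_neg)

lemma teven_P: "teven P"
  using us vs by (auto simp: teven_def gtensor_def)

text \<open>The differential hits one leg of the propagator. For an even coordinate both legs give
  the same term, which removes the 1/2 of \<open>P\<close>; for an odd pair they give
  \<open>Dx\<close> and \<open>Dy\<close>.\<close>

lemma L2_P_ffdif:
  assumes F: "ff F" shows "L2 P (ffdif W F) = ffdif W (L2 P F) - L2 Dp F"
proof -
  let ?L = "\<lambda>T. L2 (tmap (\<lambda>x. dif W (gr x)) (\<lambda>x. x) T) F + L2 (tmap gr (\<lambda>x. dif W (gr x)) T) F"
  have 1: "?L (map (\<lambda>c. (snd c / 2, fst c, fst c)) us) = - L2 De F"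
    unfolding De_def using us
  proof (induction us)
    case Nil show ?case by simp
  next
    case (Cons c us)
    have u: "fst c \<in> Ev W" using Cons.prems[of c] by simp
    have IH: "?L (map (\<lambda>c. (snd c / 2, fst c, fst c)) us) = - L2 (map (\<lambda>c. (1, - snd c *\<^sub>R dif W (fst c), fst c)) us) F"
      by (rule Cons.IH) (use Cons.prems in simp)
    have g: "gr (fst c) = fst c" by (rule gr_Ev[OF u])
    have x: "dd (dif W (fst c)) (dd (fst c) F) = dd (fst c) (dd (dif W (fst c)) F)"
      by (rule dd_commute_Ev[OF F u])
    have h: "sc (fls_const (snd c / 2)) Y + sc (fls_const (snd c / 2)) Y = sc (fls_const (snd c)) Y" for Y :: "'v ffun"
      by (rule ext, rule fls_eqI) (simp add: pt)
    have e: "dd (fst c) (dd (- snd c *\<^sub>R dif W (fst c)) F) = - sc (fls_const (snd c)) (dd (fst c) (dd (dif W (fst c)) F))"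
      unfolding dd_scale_vec[OF F] dd_simps by (rule ext) (simp add: pt)
    have "?L (map (\<lambda>c. (snd c / 2, fst c, fst c)) (c # us)) =
       (sc (fls_const (snd c / 2)) (dd (fst c) (dd (dif W (fst c)) F)) + sc (fls_const (snd c / 2)) (dd (fst c) (dd (dif W (fst c)) F)))
       + ?L (map (\<lambda>c. (snd c / 2, fst c, fst c)) us)"
      unfolding list.map L2_Cons fst_conv snd_conv g x by (simp only: ac_simps)
    also have "\<dots> = - L2 (map (\<lambda>c. (1, - snd c *\<^sub>R dif W (fst c), fst c)) (c # us)) F"
      unfolding h IH unfolding list.map L2_Cons fst_conv snd_conv e by simp
    finally show ?case .
  qed
  have 2: "?L (map (\<lambda>c. (2, fst c, snd c)) vs) = - (L2 Dx F + L2 Dy F)"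
    unfolding Dx_def Dy_def using vs
  proof (induction vs)
    case Nil show ?case by simp
  next
    case (Cons c vs)
    obtain x y where c: "c = (x, y)" by (cases c)
    have x: "x \<in> Od W" and y: "y \<in> Od W" using Cons.prems[of c] by (simp_all add: c)
    have IH: "?L (map (\<lambda>c. (2, fst c, snd c)) vs) = - (L2 (map (\<lambda>c. (1, fst c, - 2 *\<^sub>R dif W (snd c))) vs) F
        + L2 (map (\<lambda>c. (1, snd c, 2 *\<^sub>R dif W (fst c))) vs) F)"
      by (rule Cons.IH) (use Cons.prems in simp)
    have n: "dif W (- v) = - dif W v" for v by (rule linear_neg[OF lin_dif])
    have xy: "dd y (dd (dif W x) F) = dd (dif W x) (dd y F)" by (rule dd_commute_Ev[OF F dif_Od[OF x]])
    have e1: "dd (dif W (gr y)) (dd (gr x) F) = dd (dif W y) (dd x F)"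
      by (simp add: gr_Od[OF x] gr_Od[OF y] n dd_neg_vec F ff_dd)
    have e2: "dd y (dd (dif W (gr x)) F) = - dd (dif W x) (dd y F)"
      by (simp add: gr_Od[OF x] n dd_neg_vec F xy)
    have e3: "dd (- 2 *\<^sub>R dif W y) (dd x F) = - sc (fls_const 2) (dd (dif W y) (dd x F))"
      unfolding dd_scale_vec[OF ff_dd[OF F]] by (rule ext) (simp add: pt)
    have e4: "dd (2 *\<^sub>R dif W x) (dd y F) = sc (fls_const 2) (dd (dif W x) (dd y F))"
      unfolding dd_scale_vec[OF ff_dd[OF F]] ..
    have "?L (map (\<lambda>c. (2, fst c, snd c)) (c # vs)) =
       (sc (fls_const 2) (dd (dif W y) (dd x F)) - sc (fls_const 2) (dd (dif W x) (dd y F)))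
       + ?L (map (\<lambda>c. (2, fst c, snd c)) vs)"
      unfolding list.map L2_Cons c fst_conv snd_conv e1 e2 sc_simps by simp
    also have "\<dots> = - (L2 (map (\<lambda>c. (1, fst c, - 2 *\<^sub>R dif W (snd c))) (c # vs)) F
      + L2 (map (\<lambda>c. (1, snd c, 2 *\<^sub>R dif W (fst c))) (c # vs)) F)"
      unfolding IH unfolding list.map L2_Cons c fst_conv snd_conv e3 e4 by simp
    finally show ?case .
  qed
  have "?L P = - L2 Dp F"
    unfolding Dp_def L2_append gtensor_def map_append using 1 2 by (simp add: algebra_simps)
  then show ?thesis unfolding L2_ffdif_even[OF F teven_P] by simp
qed

text \<open>\<open>scl t\<close> fixes the legs of \<open>DH\<close> and multiplies each of the two
  legs of \<open>Dp\<close> by \<open>t\<close>.\<close>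

lemma L2_scl_D:
  assumes F: "ff F" shows "L2 (tmap (scl t) (scl t) D) F = L2 DH F + sc (fls_const (t * t)) (L2 Dp F)"
proof -
  have 1: "L2 (tmap (scl t) (scl t) DH) F = L2 DH F"
  proof -
    have "tmap (scl t) (scl t) DH = DH"
      by (rule map_idI) (use DH in \<open>auto simp: scl_im\<close>)
    then show ?thesis by simp
  qed
  have k: "pr (fst (snd c)) = 0 \<and> pr (snd (snd c)) = 0" if "c \<in> set Dp" for c
  proof -
    have n: "pr (r *\<^sub>R x) = r *\<^sub>R pr x" "pr (- x) = - pr x" for r x
      by (simp_all add: linear_scale[OF lin_pr] linear_neg[OF lin_pr])
    show ?thesis using that us vs
      by (auto simp: Dp_def De_def Dx_def Dy_def n pr_d)
  qed
  have 2: "L2 (tmap (scl t) (scl t) T) F = sc (fls_const (t * t)) (L2 T F)"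
    if "\<And>c. c \<in> set T \<Longrightarrow> pr (fst (snd c)) = 0 \<and> pr (snd (snd c)) = 0" for T
    using that
  proof (induction T)
    case Nil show ?case by simp
  next
    case (Cons c T)
    have e: "dd (scl t (snd (snd c))) (dd (scl t (fst (snd c))) F)
        = sc (fls_const (t * t)) (dd (snd (snd c)) (dd (fst (snd c)) F))"
      using Cons.prems[of c] by (simp add: scl_ker dd_scale_vec F ff_dd)
    show ?case unfolding list.map L2_Cons fst_conv snd_conv e sc_simps
      using Cons.IH[OF Cons.prems] by (simp add: mult.commute)
  qed
  have 3: "L2 (tmap (scl t) (scl t) Dp) F = sc (fls_const (t * t)) (L2 Dp F)" by (rule 2[OF k])
  show ?thesis unfolding D_def map_append L2_append 1 3 ..
qed

text \<open>\<open>s\<close> kills all legs except those in the image of \<open>d\<close>, where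
  \<open>s (d x) = x\<close> restores a coordinate vector; the other leg contributes
  \<open>t\<close>. An odd pair arises once from \<open>Dx\<close> and once from \<open>Dy\<close>,
  each time with \<open>- 2 * t\<close>, which matches its coefficient 2 in
  \<open>P\<close>.\<close>

lemma L2_s_scl_D:
  assumes F: "ff F"
  shows "L2 (tmap s (scl t) D) F + L2 (tmap (scl t) s D) F = sc (fls_const (- 2 * t)) (L2 P F)"
proof -
  let ?L = "\<lambda>T. L2 (tmap s (scl t) T) F + L2 (tmap (scl t) s T) F"
  have z: "L2 (tmap s (scl t) T) F = 0 \<and> L2 (tmap (scl t) s T) F = 0"
    if "\<And>c. c \<in> set T \<Longrightarrow> s (fst (snd c)) = 0 \<and> s (snd (snd c)) = 0" for T
    using that
  proof (induction T)
    case (Cons c T)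
    have "s (fst (snd c)) = 0" "s (snd (snd c)) = 0" using Cons.prems[of c] by simp_all
    moreover have "L2 (tmap s (scl t) T) F = 0 \<and> L2 (tmap (scl t) s T) F = 0"
      using Cons.IH Cons.prems by simp
    ultimately show ?case by (simp add: dd_zero_vec F ff_dd)
  qed simp
  have n: "s (r *\<^sub>R x) = r *\<^sub>R s x" for r x by (simp add: linear_scale[OF lin_s])
  have m: "scl t (r *\<^sub>R x) = r *\<^sub>R scl t x" for r x by (simp add: linear_scale[OF linear_scl])
  have 0: "?L DH = 0" using z[of DH] DH by simp
  have 1: "?L De = sc (fls_const (- 2 * t)) (L2 (map (\<lambda>c. (snd c / 2, fst c, fst c)) us) F)"
    unfolding De_def using us
  proof (induction us)
    case Nil show ?case by simp
  next
    case (Cons c us)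
    have u: "s (fst c) = 0" "pr (fst c) = 0" using Cons.prems[of c] by simp_all
    have IH: "?L (map (\<lambda>c. (1, - snd c *\<^sub>R dif W (fst c), fst c)) us)
        = sc (fls_const (- 2 * t)) (L2 (map (\<lambda>c. (snd c / 2, fst c, fst c)) us) F)"
      by (rule Cons.IH) (use Cons.prems in simp)
    have e1: "dd (scl t (fst c)) (dd (s (- snd c *\<^sub>R dif W (fst c))) F)
        = sc (fls_const (- 2 * t)) (sc (fls_const (snd c / 2)) (dd (fst c) (dd (fst c) F)))"
      unfolding n sd[OF u] scl_ker[OF u(2)] dd_scale_vec[OF F] dd_scale_vec[OF ff_dd[OF F]] dd_simps sc_simps
      by (simp add: mult.commute)
    have e2: "dd (s (fst c)) X = 0" if "ff X" for X unfolding u by (rule dd_zero_vec[OF that])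
    have "?L (map (\<lambda>c. (1, - snd c *\<^sub>R dif W (fst c), fst c)) (c # us)) =
       sc (fls_const (- 2 * t)) (sc (fls_const (snd c / 2)) (dd (fst c) (dd (fst c) F)))
       + ?L (map (\<lambda>c. (1, - snd c *\<^sub>R dif W (fst c), fst c)) us)"
      unfolding list.map L2_Cons fst_conv snd_conv e1 e2[OF ff_dd[OF F]] by simp
    also have "\<dots> = sc (fls_const (- 2 * t)) (L2 (map (\<lambda>c. (snd c / 2, fst c, fst c)) (c # us)) F)"
      unfolding IH unfolding list.map L2_Cons fst_conv snd_conv sc_simps(1) ..
    finally show ?case .
  qed
  have 2: "?L Dx + ?L Dy = sc (fls_const (- 2 * t)) (L2 (map (\<lambda>c. (2, fst c, snd c)) vs) F)"
    unfolding Dx_def Dy_def using vs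
  proof (induction vs)
    case Nil show ?case by simp
  next
    case (Cons c vs)
    obtain x y where c: "c = (x, y)" by (cases c)
    have x: "x \<in> Od W" "s x = 0" "pr x = 0" and y: "y \<in> Od W" "s y = 0" "pr y = 0"
      using Cons.prems[of c] by (simp_all add: c)
    have IH: "?L (map (\<lambda>c. (1, fst c, - 2 *\<^sub>R dif W (snd c))) vs) + ?L (map (\<lambda>c. (1, snd c, 2 *\<^sub>R dif W (fst c))) vs)
        = sc (fls_const (- 2 * t)) (L2 (map (\<lambda>c. (2, fst c, snd c)) vs) F)"
      by (rule Cons.IH) (use Cons.prems in simp)
    have xy: "dd x (dd y F) = - dd y (dd x F)" by (rule dd_commute_Od[OF F y(1) x(1)])
    have z: "dd v (dd (s x) F) = 0" "dd v (dd (s y) F) = 0" for v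
      unfolding x y dd_zero_vec[OF F] by simp_all
    have e1: "dd (s (- 2 *\<^sub>R dif W y)) (dd (scl t x) F) = sc (fls_const (- 2 * t)) (dd y (dd x F))"
      unfolding n sd[OF y(2,3)] scl_ker[OF x(3)] dd_scale_vec[OF F] dd_scale_vec[OF ff_dd[OF F]] dd_simps sc_simps
      by (simp only: fls_const_mult_const mult.commute)
    have c2: "sc (fls_const (t * 2)) (- Y) = sc (fls_const (- 2 * t)) Y"
      "sc (fls_const (2 * t)) (- Y) = sc (fls_const (- 2 * t)) Y"
      "- sc (fls_const (t * 2)) Y = sc (fls_const (- 2 * t)) Y"
      "- sc (fls_const (2 * t)) Y = sc (fls_const (- 2 * t)) Y" for Y :: "'v ffun"
      by (rule ext, rule fls_eqI, simp add: pt)+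
    have e2: "dd (s (2 *\<^sub>R dif W x)) (dd (scl t y) F) = sc (fls_const (- 2 * t)) (dd y (dd x F))"
      unfolding n sd[OF x(2,3)] scl_ker[OF y(3)] dd_scale_vec[OF F] dd_scale_vec[OF ff_dd[OF F]] dd_simps sc_simps
      by (simp only: xy dd_simps sc_simps fls_const_mult_const c2)
    have two: "sc (fls_const 2) Y = Y + Y" for Y :: "'v ffun"
      by (rule ext, rule fls_eqI) (simp add: pt)
    have "?L (map (\<lambda>c. (1, fst c, - 2 *\<^sub>R dif W (snd c))) (c # vs)) + ?L (map (\<lambda>c. (1, snd c, 2 *\<^sub>R dif W (fst c))) (c # vs)) =
       (sc (fls_const (- 2 * t)) (dd y (dd x F)) + sc (fls_const (- 2 * t)) (dd y (dd x F)))
       + (?L (map (\<lambda>c. (1, fst c, - 2 *\<^sub>R dif W (snd c))) vs) + ?L (map (\<lambda>c. (1, snd c, 2 *\<^sub>R dif W (fst c))) vs))"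
      unfolding list.map L2_Cons c fst_conv snd_conv e1 e2 z by simp
    also have "\<dots> = sc (fls_const (- 2 * t)) (L2 (map (\<lambda>c. (2, fst c, snd c)) (c # vs)) F)"
      unfolding IH unfolding list.map L2_Cons c fst_conv snd_conv two sc_simps(1) ..
    finally show ?case .
  qed
  have "?L D = ?L DH + (?L De + (?L Dx + ?L Dy))"
    unfolding D_def Dp_def map_append L2_append by (simp only: ac_simps)
  also have "\<dots> = sc (fls_const (- 2 * t)) (L2 P F)"
    unfolding 0 1 2 gtensor_def L2_append by simp
  finally show ?thesis .
qed

section \<open>The heat flow of the exponential and its logarithm\<close>

context
  fixes a0 G
  assumes a0: "adm a0" and m0: "supp_in (\<lambda>g n. g \<ge> 0 \<and> 2 * g + n > 2) (sc fls_X a0)"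
    and qme0: "hd2 D (ffexp W a0) = 0"
    and G: "heatflow P (ffexp W a0) G"
begin

definition "L t = ffln W (G t)"
definition "N t = sc fls_X (L t)"

lemma dG: "dpath G (\<lambda>t. sc fls_X (L2 P (G t)))" and G0: "G 0 = ffexp W a0" and ffG: "ff (G t)" and bG: "bt 0 (G t)"
  using G by (simp_all add: heatflow_def)

lemma gG: "gm (G t) = G t"
  by (rule heatflow_gm[OF G gm_exp[OF a0] teven_P])

text \<open>The constant function 1 is stationary, so the exponential minus 1 flows by the same
  equation, which preserves the weight \<open>2 g + n\<close>.\<close>

lemma adm_G: "adm (G t - ffone)"
proof -
  have one: "L2 T ffone = 0" for T :: "(real \<times> 'v \<times> 'v) list" by (induction T) simp_all
  have h: "heatflow P (ffexp W a0 - ffone) (\<lambda>t. G t - ffone)"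
    unfolding heatflow_def L2_lin one
    using dpath_diff[OF dG dpath_const[of ffone]] by (simp add: G0 ff_minus ffG ff_one supp_in_diff bG bt_one)
  have "wt 1 (ffexp W a0 - ffone)" using adm_exp[OF a0] by (simp add: adm_def)
  from heatflow_supp[OF h this] have "wt 1 (G t - ffone)" by simp
  then show ?thesis unfolding adm_def by (simp add: ff_minus ffG ff_one gG supp_in_diff bG bt_one)
qed

lemma exp_L: "ffexp W (L t) = G t"
  unfolding L_def by (rule exp_ln[OF adm_G])

lemma adm_L: "adm (L t)"
  unfolding L_def ffln_fsub[OF adm_G] by (rule adm_fsub[OF adm_G]) simp

lemma L0: "L 0 = a0"
  unfolding L_def G0 by (rule ln_exp[OF a0])

lemma ff_N: "ff (N t)" and gm_N: "gm (N t) = N t" and bt_N: "bt 3 (N t)" and wt_N: "wt 3 (N t)"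
proof -
  note l = admD[OF adm_L[of t]]
  show "ff (N t)" unfolding N_def by (rule ff_sc[OF l(1)])
  show "gm (N t) = N t" unfolding N_def by (simp add: l(2))
  show "bt 3 (N t)" unfolding N_def by (rule supp_in_mono[OF supp_in_X[OF l(3)]]) simp
  show "wt 3 (N t)" unfolding N_def by (rule supp_in_mono[OF supp_in_X[OF l(4)]]) simp
qed

text \<open>Passing from \<open>L\<close> to \<open>N = \<hbar> L\<close> absorbs the powers of
  \<hbar> in the quadratic term: \<open>\<hbar> \<hbar> P(L, L) = P(N, N)\<close>.\<close>

lemma dN: obtains N' where "dpath N N'" "\<And>t. N' t = sc fls_X (L2 P (N t)) + tgmult P (N t) (N t)"
proof -
  obtain L' where L': "dpath (\<lambda>t. ffln W (G t)) L'" "\<And>t. L' t \<odot> G t = sc fls_X (L2 P (G t))"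
    by (rule dpath_ln[OF adm_G dG]) blast
  have dL: "dpath L L'" using L'(1) unfolding L_def .
  have ffL': "ff (L' t)" for t by (rule dpath_ff[OF dL admD(1)[OF adm_L]])
  have e: "L' t = sc fls_X (L2 P (L t) + tgmult P (L t) (L t))" for t
  proof -
    have "L' t \<odot> ffexp W (L t) = sc fls_X (L2 P (L t) + tgmult P (L t) (L t)) \<odot> ffexp W (L t)"
      using L'(2)[of t] L2_exp_even[OF adm_L teven_P, of t] unfolding exp_L by (simp add: mult_lin)
    then have "(L' t - sc fls_X (L2 P (L t) + tgmult P (L t) (L t))) \<odot> ffexp W (L t) = 0"
      by (simp only: mult_lin diff_self)
    then have "L' t - sc fls_X (L2 P (L t) + tgmult P (L t) (L t)) = 0"
      by (rule mult_exp_cancel[OF adm_L, rotated])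
         (intro ff_minus ff_sc ff_plus ff_L2 ff_tgmult ffL' admD(1)[OF adm_L])
    then show ?thesis by simp
  qed
  show ?thesis
  proof (rule that)
    show "dpath N (\<lambda>t. sc fls_X (L' t))" unfolding N_def by (rule dpath_sc_X[OF dL])
    show "sc fls_X (L' t) = sc fls_X (L2 P (N t)) + tgmult P (N t) (N t)" for t
      unfolding e N_def L2_lin tgmult_sc by simp
  qed
qed

lemma supp_N: "supp_in (\<lambda>g n. g \<ge> 0 \<and> 2 * g + n > 2) (N t)"
proof -
  obtain N' where N': "dpath N N'" "\<And>t. N' t = sc fls_X (L2 P (N t)) + tgmult P (N t) (N t)"
    by (rule dN) blast
  have "supp_in (\<lambda>g n. g \<ge> 0) (N 0)"
    unfolding N_def L0 by (rule supp_in_mono[OF m0]) simp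
  from linked_cluster[OF N' this bt_N] have "supp_in (\<lambda>g n. g \<ge> 0) (N t)" .
  then show ?thesis using supp_inD[OF wt_N[of t]] unfolding supp_in_def[of _ "N t"] by force
qed

text \<open>The left-hand side solves the heat equation of \<open>P\<close> itself: the commutator
  of \<open>d\<close> with \<open>\<hbar> P\<close> cancels the derivative of the explicit factor
  \<open>t\<close>. It vanishes at time 0 by the master equation, hence always.\<close>

lemma qme_flow: "ffdif W (G t) + sc fls_X (L2 D (G t)) - sc (fls_const t) (sc fls_X (L2 Dp (G t))) = 0"
proof (rule heat_unique[where T=P and c=0])
  let ?R = "\<lambda>t. ffdif W (G t) + sc fls_X (L2 D (G t)) - sc (fls_const (poly [:0, 1:] t)) (sc fls_X (L2 Dp (G t)))"
  let ?K = "\<lambda>t. sc fls_X (L2 P (G t))"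
  let ?R' = "\<lambda>t. ffdif W (?K t) + sc fls_X (L2 D (?K t)) -
    (sc (fls_const (poly (pderiv [:0, 1:]) t)) (sc fls_X (L2 Dp (G t))) + sc (fls_const (poly [:0, 1:] t)) (sc fls_X (L2 Dp (?K t))))"
  have p: "poly [:0, 1:] t = t" for t :: real by simp
  have p': "poly (pderiv [:0, 1:]) t = 1" for t :: real by (simp add: pderiv_pCons)
  show "dpath (\<lambda>t. ffdif W (G t) + sc fls_X (L2 D (G t)) - sc (fls_const t) (sc fls_X (L2 Dp (G t)))) ?R'"
    using dpath_diff[OF dpath_add[OF dpath_DV[OF dG] dpath_sc_X[OF dpath_L2[OF dG]]] dpath_sc_poly[OF dpath_sc_X[OF dpath_L2[OF dG]]], where r1="[:0, 1:]"]
    unfolding ffdif_DV p .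
  show "?R' t = sc fls_X (L2 P (ffdif W (G t) + sc fls_X (L2 D (G t)) - sc (fls_const t) (sc fls_X (L2 Dp (G t)))))" for t
    unfolding L2_lin ffdif_lin L2_P_ffdif[OF ffG] L2_commute[OF ffG teven_P] p p'
    by (simp add: ac_simps)
  show "ffdif W (G 0) + sc fls_X (L2 D (G 0)) - sc (fls_const 0) (sc fls_X (L2 Dp (G 0))) = 0"
    using qme0 by (simp add: G0 hd2_def)
  have b: "bt 0 (sc fls_X (L2 T (G t)))" for T t using bt_mono[OF bt_X_L2[OF bG]] by simp
  show "bt 0 (ffdif W (G t) + sc fls_X (L2 D (G t)) - sc (fls_const t) (sc fls_X (L2 Dp (G t))))" for t
    unfolding ffdif_DV by (intro supp_in_diff supp_in_add supp_in_const DV_supp bG b)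
qed

lemma qme_end: "ffdif W (G 1) + sc fls_X (L2 DH (G 1)) = 0"
  using qme_flow[of 1] unfolding D_def L2_append by simp

section \<open>The path and its \<open>dt\<close>-component\<close>

definition "At t = pullback (scl t) (N (1 - t * t))"
definition "Bt t = DV gr (scl t) s (N (1 - t * t))"

lemma At_0: "At 0 = pullback pr (N 1)"
  unfolding At_def by (simp add: scl_def)

lemma At_1: "At 1 = sc fls_X a0"
proof -
  have "scl 1 = (\<lambda>w. w)" by (rule ext) (simp add: scl_def)
  then show ?thesis unfolding At_def by (simp add: N_def L0 pullback_id)
qed

lemma hfun_At: "At t \<in> hfun W" and hfun_Bt: "Bt t \<in> hfun W"
proof -
  have h: "F \<in> hfun W" if "ff F" "supp_in (\<lambda>g n. g \<ge> 0 \<and> 2 * g + n > 2) F" for F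
    using that by (simp add: hfun_def supp_in_def)
  show "At t \<in> hfun W" unfolding At_def
    by (intro h ff_pullback_ev evlin_scl ff_N pullback_supp supp_N)
  show "Bt t \<in> hfun W" unfolding Bt_def
    by (intro h ff_DV evlin_scl s ff_N DV_supp supp_N)
qed

lemma gm_At: "gm (At t) = At t" and gm_Bt: "gm (Bt t) = - Bt t"
  unfolding At_def Bt_def gm_pullback[OF evlin_scl] gm_DV[OF evlin_scl s ff_N] gm_N by simp_all

lemma ff_At: "ff (At t)" and ff_Bt: "ff (Bt t)"
  using hfun_At[of t] hfun_Bt[of t] by (simp_all add: hfun_def)

lemma dpath_sq:
  assumes "dpath F F'"
  shows "dpath (\<lambda>t. F (1 - t * t)) (\<lambda>t. sc (fls_const (- 2 * t)) (F' (1 - t * t)))"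
proof -
  have p: "poly [:1, 0, -1:] t = 1 - t * t" and p': "poly (pderiv [:1, 0, -1:]) t = - 2 * t" for t :: real
    by (simp_all add: pderiv_pCons)
  show ?thesis using dpath_reparam[OF assms, of "[:1, 0, -1:]"] unfolding p p' .
qed

lemma dpath_Bt: obtains B' where "dpath Bt B'"
proof -
  obtain N' where N': "dpath N N'" by (rule dN) blast
  have "\<exists>b'. fpath (\<lambda>t. Bt t ws) b'" for ws
    unfolding Bt_def scl_def by (rule DV_path_exists[OF lin_pr lin_co dpath_sq[OF N'] ff_N])
  then obtain b' where "\<And>ws. fpath (\<lambda>t. Bt t ws) (b' ws)" by metis
  then have "dpath Bt (\<lambda>t ws. b' ws t)" by (simp add: dpath_def)
  then show ?thesis by (rule that)
qed

text \<open>Both equations are checked on the exponential \<open>Z\<close> of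
  \<open>At / \<hbar>\<close>, where they are linear: \<open>Z\<close> is closed, and
  \<open>d + \<hbar>\<Delta>\<close> of the derivation applied to the flow is minus the velocity of
  \<open>Z\<close>.\<close>

lemma homotopy:
  obtains A' where "dpath At A'" "\<And>t. hd2 D (At t) + sc (fls_const (1/2)) (br2 D (At t) (At t)) = 0"
    "\<And>t. hd2 D (Bt t) + A' t + br2 D (At t) (Bt t) = 0"
proof -
  let ?\<tau> = "\<lambda>t::real. 1 - t * t"
  define a where "a t = pullback (scl t) (L (?\<tau> t))" for t
  define Z where "Z t = pullback (scl t) (G (?\<tau> t))" for t
  have adm_a: "adm (a t)" for t
    using admD[OF adm_L[of "?\<tau> t"]] unfolding a_def adm_def
    by (simp add: ff_pullback_ev[OF evlin_scl] gm_pullback[OF evlin_scl] pullback_supp)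
  have Xa: "At t = sc fls_X (a t)" for t unfolding At_def N_def a_def pullback_lin ..
  have exp_a: "ffexp W (a t) = Z t" for t
    using pullback_fsub_ev[OF evlin_scl, of "fps_exp 1" t "L (?\<tau> t)"] exp_L[of "?\<tau> t"]
    unfolding a_def Z_def ffexp_fsub by simp
  \<comment> \<open>At time \<open>1 - t^2\<close> the complementary Laplacian has the coefficient
    \<open>1 - (1 - t^2) = t^2\<close>, the one that \<open>scl t\<close> produces.\<close>
  have flow: "ffdif W (G (?\<tau> t)) + sc fls_X (L2 (tmap (scl t) (scl t) D) (G (?\<tau> t))) = 0" for t
  proof -
    have "sc fls_X (L2 DH X + sc (fls_const (t * t)) (L2 Dp X)) =
      sc fls_X (L2 D X) - sc (fls_const (?\<tau> t)) (sc fls_X (L2 Dp X))" for X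
      unfolding D_def L2_append by (rule ext, rule fls_eqI) (simp add: pt algebra_simps)
    then show ?thesis using qme_flow[of "?\<tau> t"] unfolding L2_scl_D[OF ffG] by (simp only: add_diff_eq)
  qed
  have QZ: "hd2 D (Z t) = 0" for t
  proof -
    have "hd2 D (Z t) = pullback (scl t) (ffdif W (G (?\<tau> t)) + sc fls_X (L2 (tmap (scl t) (scl t) D) (G (?\<tau> t))))"
      unfolding hd2_def Z_def ffdif_pullback[OF evlin_scl d_scl] L2_pullback pullback_lin ..
    then show ?thesis unfolding flow by (simp add: pullback_lin)
  qed
  have one: "hd2 D (At t) + sc (fls_const (1/2)) (br2 D (At t) (At t)) = 0" for t
    unfolding Xa by (rule master_of_exp[OF adm_a todd_D]) (simp add: exp_a QZ)
  obtain L' where "dpath (\<lambda>t. ffln W (G t)) L'" by (rule dpath_ln[OF adm_G dG]) blast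
  then have dL: "dpath L L'" unfolding L_def .
  obtain a' where da: "dpath a a'"
    unfolding a_def scl_def using dpath_pullback[OF lin_pr lin_co dpath_sq[OF dL] admD(1)[OF adm_L]] by blast
  have ffa': "ff (a' t)" for t by (rule dpath_ff[OF da admD(1)[OF adm_a]])
  let ?Z' = "\<lambda>t. pullback (scl t) (sc (fls_const (- 2 * t)) (sc fls_X (L2 P (G (?\<tau> t)))))
    + DV (\<lambda>w. w) (scl t) (\<lambda>w. w - pr w) (G (?\<tau> t))"
  have dZ: "dpath Z ?Z'"
    unfolding Z_def scl_def by (rule dpath_pullback[OF lin_pr lin_co dpath_sq[OF dG] ffG])
  \<comment> \<open>The velocity of \<open>Z\<close> is known in two ways, through the moving
    pullback and through the exponential; uniqueness identifies them.\<close>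
  have Z': "?Z' t = a' t \<odot> Z t" for t
    using dpath_unique[OF dZ] dpath_exp[OF adm_a da] unfolding exp_a by blast
  \<comment> \<open>The Cartan formula yields the motion of \<open>scl t\<close>, the contraction of
    \<open>s\<close> with the Laplacian yields the motion of the time, and what remains is the
    derivation applied to \<open>flow\<close>, which is zero.\<close>
  have DZ: "hd2 D (DV gr (scl t) s (G (?\<tau> t))) = - ?Z' t" for t
  proof -
    let ?G = "G (?\<tau> t)" and ?p = "pullback (scl t)" and ?D = "DV gr (scl t) s"
    have 1: "ffdif W (?D ?G) = - DV (\<lambda>w. w) (scl t) (\<lambda>w. w - pr w) ?G - ?D (ffdif W ?G)"
      using DV_anticommute[OF evlin_scl s d_scl ffG, of "\<lambda>w. w - pr w" t "?\<tau> t"] sdr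
      by (simp add: eq_diff_eq)
    have 2: "L2 D (?D ?G) = - ?p (sc (fls_const (- 2 * t)) (L2 P ?G)) - ?D (L2 (tmap (scl t) (scl t) D) ?G)"
      unfolding L2_DV_odd[OF evlin_scl s ffG todd_D] L2_s_scl_D[OF ffG] ..
    have "hd2 D (?D ?G) = - DV (\<lambda>w. w) (scl t) (\<lambda>w. w - pr w) ?G - ?p (sc (fls_const (- 2 * t)) (sc fls_X (L2 P ?G)))
      - ?D (ffdif W ?G + sc fls_X (L2 (tmap (scl t) (scl t) D) ?G))"
      unfolding hd2_def 1 2 DV_lin pullback_lin sc_simps by (simp add: mult.commute)
    then show ?thesis unfolding flow DV_lin by simp
  qed
  have two: "hd2 D (Bt t) + br2 D (At t) (Bt t) = - sc fls_X (a' t)" for t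
    unfolding Xa
  proof (rule master_linear[OF adm_a todd_D])
    show "hd2 D (ffexp W (a t)) = 0" unfolding exp_a by (rule QZ)
    show "ff (Bt t)" by (rule ff_Bt)
    show "ff (- sc fls_X (a' t))" by (intro ff_uminus ff_sc ffa')
    \<comment> \<open>By the chain rule, \<open>Bt t\<close> times the exponential is \<hbar> times
      the derivation applied to the heat flow itself, for which \<open>DZ\<close> is
      available.\<close>
    have "ffexp W (a t) \<odot> Bt t = Bt t \<odot> Z t"
      unfolding exp_a[symmetric] by (rule exp_commute[OF adm_a ff_Bt, symmetric])
    also have "\<dots> = sc fls_X (DV gr (scl t) s (G (?\<tau> t)))"
      using DV_exp[OF adm_L evlin_scl s, of t "?\<tau> t"] exp_L[of "?\<tau> t"]
      unfolding Bt_def N_def DV_lin mult_lin Z_def by simp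
    finally have e: "ffexp W (a t) \<odot> Bt t = sc fls_X (DV gr (scl t) s (G (?\<tau> t)))" .
    show "hd2 D (ffexp W (a t) \<odot> Bt t) = - sc fls_X (a' t) \<odot> ffexp W (a t)"
      unfolding e hd2_lin DZ Z' unfolding exp_a mult_lin by simp
  qed
  show ?thesis
  proof (rule that)
    show "dpath At (\<lambda>t. sc fls_X (a' t))"
    proof -
      have "At = (\<lambda>t. sc fls_X (a t))" by (rule ext) (rule Xa)
      then show ?thesis using dpath_sc_X[OF da] by simp
    qed
    show "hd2 D (At t) + sc (fls_const (1/2)) (br2 D (At t) (At t)) = 0" for t by (rule one)
    show "hd2 D (Bt t) + sc fls_X (a' t) + br2 D (At t) (Bt t) = 0" for t
      using two[of t] by (metis add.commute add.left_commute add.right_inverse)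
  qed
qed

end

end

section \<open>Dual and Darboux bases\<close>

text \<open>The \<open>j\<close>-th functional vanishes on the span of the other vectors but not on
  the \<open>j\<close>-th.\<close>

lemma dual_independent:
  fixes bs :: "'v::real_vector list"
  assumes "\<And>j. j < length bs \<Longrightarrow> \<exists>l :: 'v \<Rightarrow> real. linear l \<and> (\<forall>k<length bs. l (bs ! k) = (if k = j then 1 else 0))"
  shows "distinct bs" "independent (set bs)"
proof -
  obtain l where l: "\<And>j. j < length bs \<Longrightarrow> linear (l j :: 'v \<Rightarrow> real)"
    "\<And>j k. j < length bs \<Longrightarrow> k < length bs \<Longrightarrow> l j (bs ! k) = (if k = j then 1 else 0)"
    using assms by metis
  show d: "distinct bs"
    unfolding distinct_conv_nth
  proof (intro allI impI)
    fix j k assume jk: "j < length bs" "k < length bs" "j \<noteq> k"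
    show "bs ! j \<noteq> bs ! k" using l(2)[OF jk(1,1)] l(2)[OF jk(1,2)] jk(3) by auto
  qed
  show "independent (set bs)"
    unfolding dependent_def
  proof
    assume "\<exists>a\<in>set bs. a \<in> span (set bs - {a})"
    then obtain j where j: "j < length bs" "bs ! j \<in> span (set bs - {bs ! j})" by (metis in_set_conv_nth)
    have "l j v = 0" if "v \<in> set bs - {bs ! j}" for v
    proof -
      from that obtain k where k: "k < length bs" "v = bs ! k" "k \<noteq> j" by (auto simp: in_set_conv_nth)
      then show ?thesis using l(2)[OF j(1) k(1)] by simp
    qed
    from linear_eq_0_on_span[OF l(1)[OF j(1)] this j(2)] show False using l(2)[OF j(1,1)] by simp
  qed
qed

lemma length_dual_le:
  fixes bs :: "'v::real_vector list"
  assumes "finite B" "span B = (UNIV :: 'v set)"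
    and "\<And>j. j < length bs \<Longrightarrow> \<exists>l :: 'v \<Rightarrow> real. linear l \<and> (\<forall>k<length bs. l (bs ! k) = (if k = j then 1 else 0))"
  shows "length bs \<le> card B"
proof -
  note d = dual_independent[OF assms(3)]
  have "card (set bs) \<le> card B"
    using independent_span_bound[OF assms(1) d(2)] assms(2) by simp
  then show ?thesis by (simp add: distinct_card[OF d(1)])
qed

lemma longest_list_exists:
  fixes P :: "'a list \<Rightarrow> bool"
  assumes "P []" "\<And>T. P T \<Longrightarrow> length T \<le> b"
  obtains T where "P T" "\<And>T'. P T' \<Longrightarrow> length T' \<le> length T"
proof -
  have "\<exists>T. P T \<and> (\<forall>T'. P T' \<longrightarrow> length T' \<le> length T)"
    by (rule ex_has_greatest_nat[where k="[]" and b="Suc b"]) (use assms in \<open>auto simp: less_Suc_eq_le\<close>)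
  then show ?thesis using that by blast
qed

lemma all_less_Suc_append:
  assumes "\<And>j k. j < n \<Longrightarrow> k < n \<Longrightarrow> Q j k" "\<And>j. j < n \<Longrightarrow> Q j n" "\<And>j. j < n \<Longrightarrow> Q n j" "Q n n"
  shows "\<forall>j<Suc n. \<forall>k<Suc n. Q j k"
  using assms less_Suc_eq by auto

text \<open>Gram-Schmidt by maximality: \<open>pa\<close> and \<open>pb\<close> project onto the
  complements of a longest dual system. A nonzero pairing of two projections would extend the
  system, so all of them pair to zero and vanish by nondegeneracy.\<close>

lemma dual_bases_exist:
  fixes \<tau> :: "'v::real_vector \<Rightarrow> 'v \<Rightarrow> real"
  assumes bil: "bilinear \<tau>" and A: "subspace A" and B: "subspace B"
    and ndA: "\<And>a. a \<in> A \<Longrightarrow> (\<forall>b\<in>B. \<tau> a b = 0) \<Longrightarrow> a = 0"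
    and ndB: "\<And>b. b \<in> B \<Longrightarrow> (\<forall>a\<in>A. \<tau> a b = 0) \<Longrightarrow> b = 0"
    and fin: "finite C" "span C = (UNIV :: 'v set)"
  obtains T where "\<And>c. c \<in> set T \<Longrightarrow> fst c \<in> A \<and> snd c \<in> B"
    "\<forall>j<length T. \<forall>k<length T. \<tau> (fst (T ! j)) (snd (T ! k)) = (if j = k then 1 else 0)"
    "A \<subseteq> span (fst ` set T)" "B \<subseteq> span (snd ` set T)"
proof -
  define P where "P T \<longleftrightarrow> (\<forall>c\<in>set T. fst c \<in> A \<and> snd c \<in> B) \<and>
    (\<forall>j<length T. \<forall>k<length T. \<tau> (fst (T ! j)) (snd (T ! k)) = (if j = k then 1 else 0))" for T
  have lin1: "linear (\<lambda>x. \<tau> x y)" and lin2: "linear (\<lambda>y. \<tau> x y)" for x y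
    using bil by (simp_all add: bilinear_def)
  have len: "length T \<le> card C" if "P T" for T
  proof -
    have "length (map fst T) \<le> card C"
    proof (rule length_dual_le[OF fin])
      fix j assume j: "j < length (map fst T)"
      show "\<exists>l :: 'v \<Rightarrow> real. linear l \<and> (\<forall>k<length (map fst T). l (map fst T ! k) = (if k = j then 1 else 0))"
        by (rule exI[of _ "\<lambda>x. \<tau> x (snd (T ! j))"]) (use that j lin1 in \<open>auto simp: P_def\<close>)
    qed
    then show ?thesis by simp
  qed
  obtain T where T: "P T" and max: "\<And>T'. P T' \<Longrightarrow> length T' \<le> length T"
    by (rule longest_list_exists[of P "card C"]) (use len in \<open>auto simp: P_def\<close>)
  let ?n = "length T"
  let ?e = "\<lambda>j. fst (T ! j)" and ?f = "\<lambda>j. snd (T ! j)"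
  have ef: "?e j \<in> A" "?f j \<in> B" if "j < ?n" for j using T that by (auto simp: P_def)
  have d: "\<tau> (?e j) (?f k) = (if j = k then 1 else 0)" if "j < ?n" "k < ?n" for j k using T that by (simp add: P_def)
  define pa where "pa a = a - (\<Sum>k<?n. \<tau> a (?f k) *\<^sub>R ?e k)" for a
  define pb where "pb b = b - (\<Sum>k<?n. \<tau> (?e k) b *\<^sub>R ?f k)" for b
  have pa: "pa a \<in> A" if "a \<in> A" for a
    unfolding pa_def using that ef by (intro subspace_diff[OF A] subspace_sum[OF A] subspace_scale[OF A]) auto
  have pb: "pb b \<in> B" if "b \<in> B" for b
    unfolding pb_def using that ef by (intro subspace_diff[OF B] subspace_sum[OF B] subspace_scale[OF B]) auto
  have pa0: "\<tau> (pa a) (?f j) = 0" if "j < ?n" for a j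
  proof -
    have "(\<Sum>k<?n. \<tau> a (?f k) * \<tau> (?e k) (?f j)) = (\<Sum>k<?n. if k = j then \<tau> a (?f j) else 0)"
      by (rule sum.cong) (use d that in auto)
    then show ?thesis using that
      unfolding pa_def linear_diff[OF lin1] linear_sum[OF lin1] linear_scale[OF lin1] by simp
  qed
  have pb0: "\<tau> (?e j) (pb b) = 0" if "j < ?n" for b j
  proof -
    have "(\<Sum>k<?n. \<tau> (?e k) b * \<tau> (?e j) (?f k)) = (\<Sum>k<?n. if k = j then \<tau> (?e j) b else 0)"
      by (rule sum.cong) (use d that in auto)
    then show ?thesis using that
      unfolding pb_def linear_diff[OF lin2] linear_sum[OF lin2] linear_scale[OF lin2] by simp
  qed
  have ab1: "\<tau> (pa a) (pb b) = \<tau> (pa a) b" for a b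
    using pa0 unfolding pb_def linear_diff[OF lin2] linear_sum[OF lin2] linear_scale[OF lin2] by simp
  have ab2: "\<tau> (pa a) (pb b) = \<tau> a (pb b)" for a b
    using pb0 unfolding pa_def linear_diff[OF lin1] linear_sum[OF lin1] linear_scale[OF lin1] by simp
  have key: "\<tau> (pa a) (pb b) = 0" if "a \<in> A" "b \<in> B" for a b
  proof (rule ccontr)
    assume nz: "\<tau> (pa a) (pb b) \<noteq> 0"
    let ?c = "(pa a, (1 / \<tau> (pa a) (pb b)) *\<^sub>R pb b)"
    have "P (T @ [?c])"
      unfolding P_def
    proof (intro conjI)
      show "\<forall>c\<in>set (T @ [?c]). fst c \<in> A \<and> snd c \<in> B"
        using T pa[OF that(1)] subspace_scale[OF B pb[OF that(2)]] by (auto simp: P_def)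
      show "\<forall>j<length (T @ [?c]). \<forall>k<length (T @ [?c]).
          \<tau> (fst ((T @ [?c]) ! j)) (snd ((T @ [?c]) ! k)) = (if j = k then 1 else 0)"
        unfolding length_append_singleton
        by (rule all_less_Suc_append) (use d pa0 pb0 nz in \<open>simp_all add: nth_append linear_scale[OF lin2]\<close>)
    qed
    from max[OF this] show False by simp
  qed
  show ?thesis
  proof (rule that)
    show "A \<subseteq> span (fst ` set T)"
    proof
      fix a assume a: "a \<in> A"
      have "pa a = 0" by (rule ndA[OF pa[OF a]]) (use key[OF a] ab1 in simp)
      then have "a = (\<Sum>k<?n. \<tau> a (?f k) *\<^sub>R ?e k)" by (simp add: pa_def)
      also have "\<dots> \<in> span (fst ` set T)" by (intro span_sum span_scale span_base) auto
      finally show "a \<in> span (fst ` set T)" .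
    qed
    show "B \<subseteq> span (snd ` set T)"
    proof
      fix b assume b: "b \<in> B"
      have "pb b = 0" by (rule ndB[OF pb[OF b]]) (use key[OF _ b] ab2 in simp)
      then have "b = (\<Sum>k<?n. \<tau> (?e k) b *\<^sub>R ?f k)" by (simp add: pb_def)
      also have "\<dots> \<in> span (snd ` set T)" by (intro span_sum span_scale span_base) auto
      finally show "b \<in> span (snd ` set T)" .
    qed
  qed (use T in \<open>auto simp: P_def\<close>)
qed

text \<open>Sylvester's normal form: a vector orthogonal to a longest orthonormal system is
  isotropic, since otherwise it could be normalized and appended. Polarization and nondegeneracy
  then leave no complement.\<close>

lemma orthonormal_basis_exists:
  fixes q :: "'v::real_vector \<Rightarrow> 'v \<Rightarrow> real"
  assumes bil: "bilinear q" and A: "subspace A"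
    and sym: "\<And>x y. x \<in> A \<Longrightarrow> y \<in> A \<Longrightarrow> q x y = q y x"
    and nd: "\<And>a. a \<in> A \<Longrightarrow> (\<forall>b\<in>A. q a b = 0) \<Longrightarrow> a = 0"
    and fin: "finite C" "span C = (UNIV :: 'v set)"
  obtains T where "\<And>c. c \<in> set T \<Longrightarrow> fst c \<in> A \<and> snd c \<in> {1, -1}"
    "\<forall>j<length T. \<forall>k<length T. q (fst (T ! j)) (fst (T ! k)) = (if j = k then snd (T ! j) else 0)"
    "A \<subseteq> span (fst ` set T)"
proof -
  define P where "P T \<longleftrightarrow> (\<forall>c\<in>set T. fst c \<in> A \<and> snd c \<in> {1, -1}) \<and>
    (\<forall>j<length T. \<forall>k<length T. q (fst (T ! j)) (fst (T ! k)) = (if j = k then snd (T ! j) else 0))" for T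
  have lin1: "linear (\<lambda>x. q x y)" and lin2: "linear (\<lambda>y. q x y)" for x y
    using bil by (simp_all add: bilinear_def)
  have sq: "snd (T ! j) * snd (T ! j) = 1" if "P T" "j < length T" for T j
  proof -
    have "snd (T ! j) \<in> {1, -1}" using that by (simp add: P_def)
    then show ?thesis by auto
  qed
  have len: "length T \<le> card C" if "P T" for T
  proof -
    have "length (map fst T) \<le> card C"
    proof (rule length_dual_le[OF fin])
      fix j assume j: "j < length (map fst T)"
      have "linear (\<lambda>x. snd (T ! j) * q x (fst (T ! j)))"
        using linear_compose_scale_right[OF lin1, of "snd (T ! j)" "fst (T ! j)"] by simp
      then show "\<exists>l :: 'v \<Rightarrow> real. linear l \<and> (\<forall>k<length (map fst T). l (map fst T ! k) = (if k = j then 1 else 0))"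
        using that j sq[OF that] by (intro exI[of _ "\<lambda>x. snd (T ! j) * q x (fst (T ! j))"]) (auto simp: P_def)
    qed
    then show ?thesis by simp
  qed
  obtain T where T: "P T" and max: "\<And>T'. P T' \<Longrightarrow> length T' \<le> length T"
    by (rule longest_list_exists[of P "card C"]) (use len in \<open>auto simp: P_def\<close>)
  let ?n = "length T"
  let ?e = "\<lambda>j. fst (T ! j)" and ?s = "\<lambda>j. snd (T ! j)"
  have e: "?e j \<in> A" if "j < ?n" for j using T that by (auto simp: P_def)
  have d: "q (?e j) (?e k) = (if j = k then ?s j else 0)" if "j < ?n" "k < ?n" for j k using T that by (simp add: P_def)
  define pa where "pa a = a - (\<Sum>k<?n. (?s k * q a (?e k)) *\<^sub>R ?e k)" for a
  have pa: "pa a \<in> A" if "a \<in> A" for a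
    unfolding pa_def using that e by (intro subspace_diff[OF A] subspace_sum[OF A] subspace_scale[OF A]) auto
  have pa0: "q (pa a) (?e j) = 0" if "j < ?n" for a j
  proof -
    have "(\<Sum>k<?n. (?s k * q a (?e k)) * q (?e k) (?e j)) = (\<Sum>k<?n. if k = j then q a (?e j) else 0)"
      by (rule sum.cong) (use d that sq[OF T that] in auto)
    then show ?thesis using that
      unfolding pa_def linear_diff[OF lin1] linear_sum[OF lin1] linear_scale[OF lin1] by simp
  qed
  have ext: "q c c = 0" if c: "c \<in> A" and orth: "\<And>j. j < ?n \<Longrightarrow> q c (?e j) = 0" for c
  proof (rule ccontr)
    assume nz: "q c c \<noteq> 0"
    define r where "r = sqrt \<bar>q c c\<bar>"
    have r: "r \<noteq> 0" "r * r = \<bar>q c c\<bar>" using nz by (simp_all add: r_def)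
    have one: "q ((1 / r) *\<^sub>R c) ((1 / r) *\<^sub>R c) = sgn (q c c)"
    proof -
      have "q ((1 / r) *\<^sub>R c) ((1 / r) *\<^sub>R c) = q c c / (r * r)"
        unfolding linear_scale[OF lin1] linear_scale[OF lin2] by simp
      then show ?thesis unfolding r(2) by (simp add: sgn_if abs_if)
    qed
    have z: "q ((1 / r) *\<^sub>R c) (?e j) = 0" "q (?e j) ((1 / r) *\<^sub>R c) = 0" if "j < ?n" for j
      using orth[OF that] sym[OF c e[OF that]] unfolding linear_scale[OF lin1] linear_scale[OF lin2] by simp_all
    have "P (T @ [((1 / r) *\<^sub>R c, sgn (q c c))])"
      unfolding P_def
    proof (intro conjI)
      show "\<forall>c\<in>set (T @ [((1 / r) *\<^sub>R c, sgn (q c c))]). fst c \<in> A \<and> snd c \<in> {1, - 1}"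
        using T subspace_scale[OF A c] nz by (auto simp: P_def sgn_if)
      show "\<forall>j<length (T @ [((1 / r) *\<^sub>R c, sgn (q c c))]). \<forall>k<length (T @ [((1 / r) *\<^sub>R c, sgn (q c c))]).
          q (fst ((T @ [((1 / r) *\<^sub>R c, sgn (q c c))]) ! j)) (fst ((T @ [((1 / r) *\<^sub>R c, sgn (q c c))]) ! k))
            = (if j = k then snd ((T @ [((1 / r) *\<^sub>R c, sgn (q c c))]) ! j) else 0)"
        unfolding length_append_singleton
        by (rule all_less_Suc_append) (use d z one in \<open>simp_all add: nth_append\<close>)
    qed
    from max[OF this] show False by simp
  qed
  have key: "q (pa a) b = 0" if a: "a \<in> A" and b: "b \<in> A" for a b
  proof -
    have 1: "q (pa a) (pa b) = q (pa a) b"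
      using pa0 unfolding pa_def[of b] linear_diff[OF lin2] linear_sum[OF lin2] linear_scale[OF lin2] by simp
    have "q (pa a + pa b) (pa a + pa b) = 0"
      by (rule ext) (use pa0 pa[OF a] pa[OF b] in \<open>simp_all add: subspace_add[OF A] linear_add[OF lin1]\<close>)
    moreover have "q (pa a) (pa a) = 0" "q (pa b) (pa b) = 0"
      using ext[OF pa[OF a] pa0] ext[OF pa[OF b] pa0] by simp_all
    ultimately have "q (pa a) (pa b) = 0"
      using sym[OF pa[OF a] pa[OF b]] by (simp add: linear_add[OF lin1] linear_add[OF lin2])
    then show ?thesis using 1 by simp
  qed
  show ?thesis
  proof (rule that)
    show "A \<subseteq> span (fst ` set T)"
    proof
      fix a assume a: "a \<in> A"
      have "pa a = 0" by (rule nd[OF pa[OF a]]) (use key[OF a] in simp)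
      then have "a = (\<Sum>k<?n. (?s k * q a (?e k)) *\<^sub>R ?e k)" by (simp add: pa_def)
      also have "\<dots> \<in> span (fst ` set T)" by (intro span_sum span_scale span_base) auto
      finally show "a \<in> span (fst ` set T)" .
    qed
  qed (use T in \<open>auto simp: P_def\<close>)
qed

text \<open>Again by maximality, now adding a pair at a time. The value \<open>-1\<close>
  anticipates the term \<open>- \<xi> \<eta>\<close> of the quadratic function.\<close>

lemma symplectic_basis_exists:
  fixes q :: "'v::real_vector \<Rightarrow> 'v \<Rightarrow> real"
  assumes bil: "bilinear q" and A: "subspace A"
    and alt: "\<And>x y. x \<in> A \<Longrightarrow> y \<in> A \<Longrightarrow> q x y = - q y x"
    and nd: "\<And>a. a \<in> A \<Longrightarrow> (\<forall>b\<in>A. q a b = 0) \<Longrightarrow> a = 0"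
    and fin: "finite C" "span C = (UNIV :: 'v set)"
  obtains T where "\<And>c. c \<in> set T \<Longrightarrow> fst c \<in> A \<and> snd c \<in> A"
    "\<forall>j<length T. \<forall>k<length T. q (fst (T ! j)) (fst (T ! k)) = 0 \<and> q (snd (T ! j)) (snd (T ! k)) = 0 \<and>
      q (fst (T ! j)) (snd (T ! k)) = (if j = k then -1 else 0)"
    "A \<subseteq> span (fst ` set T \<union> snd ` set T)"
proof -
  define Q where "Q T j k \<longleftrightarrow> q (fst (T ! j)) (fst (T ! k)) = 0 \<and> q (snd (T ! j)) (snd (T ! k)) = 0 \<and>
      q (fst (T ! j)) (snd (T ! k)) = (if j = k then -1 else 0)" for T j k
  define P where "P T \<longleftrightarrow> (\<forall>c\<in>set T. fst c \<in> A \<and> snd c \<in> A) \<and> (\<forall>j<length T. \<forall>k<length T. Q T j k)" for T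
  have lin1: "linear (\<lambda>x. q x y)" and lin2: "linear (\<lambda>y. q x y)" for x y
    using bil by (simp_all add: bilinear_def)
  have len: "length T \<le> card C" if "P T" for T
  proof -
    have "length (map fst T) \<le> card C"
    proof (rule length_dual_le[OF fin])
      fix j assume j: "j < length (map fst T)"
      have "linear (\<lambda>x. - q x (snd (T ! j)))" by (rule linear_compose_neg[OF lin1])
      then show "\<exists>l :: 'v \<Rightarrow> real. linear l \<and> (\<forall>k<length (map fst T). l (map fst T ! k) = (if k = j then 1 else 0))"
        using that j by (intro exI[of _ "\<lambda>x. - q x (snd (T ! j))"]) (auto simp: P_def Q_def)
    qed
    then show ?thesis by simp
  qed
  obtain T where T: "P T" and max: "\<And>T'. P T' \<Longrightarrow> length T' \<le> length T"
    by (rule longest_list_exists[of P "card C"]) (use len in \<open>auto simp: P_def\<close>)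
  let ?n = "length T"
  let ?x = "\<lambda>j. fst (T ! j)" and ?y = "\<lambda>j. snd (T ! j)"
  have xA: "?x j \<in> A" and yA: "?y j \<in> A" if "j < ?n" for j using T that by (auto simp: P_def)
  have d: "q (?x j) (?x k) = 0" "q (?y j) (?y k) = 0" "q (?x j) (?y k) = (if j = k then -1 else 0)"
    "q (?y j) (?x k) = (if j = k then 1 else 0)" if "j < ?n" "k < ?n" for j k
    using T that alt[OF yA[OF that(1)] xA[OF that(2)]] by (auto simp: P_def Q_def)
  \<comment> \<open>As \<open>q x y = -1\<close> and \<open>q y x = 1\<close> within a pair, these
    signs make the residue orthogonal to both of its members.\<close>
  define pa where "pa a = a - (\<Sum>k<?n. q a (?x k) *\<^sub>R ?y k - q a (?y k) *\<^sub>R ?x k)" for a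
  have pa: "pa a \<in> A" if "a \<in> A" for a
    unfolding pa_def using that xA yA by (intro subspace_diff[OF A] subspace_sum[OF A] subspace_scale[OF A]) auto
  have pax: "q (pa a) (?x j) = 0" if "j < ?n" for a j
  proof -
    have "(\<Sum>k<?n. q a (?x k) * q (?y k) (?x j) - q a (?y k) * q (?x k) (?x j)) = (\<Sum>k<?n. if k = j then q a (?x j) else 0)"
      by (rule sum.cong) (use d that in auto)
    then show ?thesis using that
      unfolding pa_def linear_diff[OF lin1] linear_sum[OF lin1] linear_scale[OF lin1] by simp
  qed
  have pay: "q (pa a) (?y j) = 0" if "j < ?n" for a j
  proof -
    have "(\<Sum>k<?n. q a (?x k) * q (?y k) (?y j) - q a (?y k) * q (?x k) (?y j)) = (\<Sum>k<?n. if k = j then q a (?y j) else 0)"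
      by (rule sum.cong) (use d that in auto)
    then show ?thesis using that
      unfolding pa_def linear_diff[OF lin1] linear_sum[OF lin1] linear_scale[OF lin1] by simp
  qed
  have key: "q (pa a) b = 0" if a: "a \<in> A" and b: "b \<in> A" for a b
  proof (rule ccontr)
    assume nz: "q (pa a) b \<noteq> 0"
    have 1: "q (pa a) (pa b) = q (pa a) b"
      using pax pay unfolding pa_def[of b] linear_diff[OF lin2] linear_sum[OF lin2] linear_scale[OF lin2] by simp
    define y where "y = (- 1 / q (pa a) (pa b)) *\<^sub>R pa b"
    have yA': "y \<in> A" unfolding y_def by (rule subspace_scale[OF A pa[OF b]])
    have xy: "q (pa a) y = -1" using nz unfolding y_def linear_scale[OF lin2] 1 by simp
    have self: "q z z = 0" if "z \<in> A" for z using alt[OF that that] by simp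
    have y0: "q y (?x j) = 0" "q y (?y j) = 0" if "j < ?n" for j
      unfolding y_def linear_scale[OF lin1] using pax[OF that] pay[OF that] by simp_all
    have r: "q (?x j) z = 0" "q (?y j) z = 0" if "j < ?n" "z \<in> A" "q z (?x j) = 0" "q z (?y j) = 0" for j z
      using alt[OF xA[OF that(1)] that(2)] alt[OF yA[OF that(1)] that(2)] that(3,4) by simp_all
    have "P (T @ [(pa a, y)])"
      unfolding P_def
    proof (intro conjI)
      show "\<forall>c\<in>set (T @ [(pa a, y)]). fst c \<in> A \<and> snd c \<in> A"
        using T pa[OF a] yA' by (auto simp: P_def)
      show "\<forall>j<length (T @ [(pa a, y)]). \<forall>k<length (T @ [(pa a, y)]). Q (T @ [(pa a, y)]) j k"
        unfolding length_append_singleton Q_def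
        by (rule all_less_Suc_append)
           (use d pax pay y0 r[OF _ pa[OF a] pax pay] r[OF _ yA' y0] xy self[OF pa[OF a]] self[OF yA'] in
            \<open>simp_all add: nth_append\<close>)
    qed
    from max[OF this] show False by simp
  qed
  show ?thesis
  proof (rule that)
    show "A \<subseteq> span (fst ` set T \<union> snd ` set T)"
    proof
      fix a assume a: "a \<in> A"
      have "pa a = 0" by (rule nd[OF pa[OF a]]) (use key[OF a] in simp)
      then have "a = (\<Sum>k<?n. q a (?x k) *\<^sub>R ?y k - q a (?y k) *\<^sub>R ?x k)" by (simp add: pa_def)
      also have "\<dots> \<in> span (fst ` set T \<union> snd ` set T)" by (intro span_sum span_diff span_scale span_base) auto
      finally show "a \<in> span (fst ` set T \<union> snd ` set T)" .
    qed
  qed (use T in \<open>auto simp: P_def Q_def\<close>)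
qed

section \<open>Darboux bases and the Laplacian\<close>

definition dualsys :: "('v \<Rightarrow> 'v \<Rightarrow> real) \<Rightarrow> ('v \<times> 'v) list \<Rightarrow> bool" where
  "dualsys \<tau> T \<longleftrightarrow> (\<forall>j<length T. \<forall>k<length T. \<tau> (fst (T ! j)) (snd (T ! k)) = (if j = k then 1 else 0))"

lemma dualsys_append:
  assumes "dualsys \<tau> S" "dualsys \<tau> T"
    and "\<And>c c'. c \<in> set S \<Longrightarrow> c' \<in> set T \<Longrightarrow> \<tau> (fst c) (snd c') = 0 \<and> \<tau> (fst c') (snd c) = 0"
  shows "dualsys \<tau> (S @ T)"
  unfolding dualsys_def
proof (intro allI impI)
  fix j k assume jk: "j < length (S @ T)" "k < length (S @ T)"
  have S: "S ! i \<in> set S" if "i < length S" for i using that by simp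
  have T: "T ! (i - length S) \<in> set T" if "\<not> i < length S" "i < length (S @ T)" for i
    using that by (intro nth_mem) simp
  show "\<tau> (fst ((S @ T) ! j)) (snd ((S @ T) ! k)) = (if j = k then 1 else 0)"
    using jk assms(1,2) assms(3)[OF S[of j] T[of k]] assms(3)[OF S[of k] T[of j]]
    by (cases "j < length S"; cases "k < length S") (auto simp: nth_append dualsys_def)
qed

text \<open>Pairs are stored as (even, odd), whereas the tensor of an odd operator has its odd leg
  first.\<close>

definition ptensor :: "('v \<times> 'v) list \<Rightarrow> (real \<times> 'v \<times> 'v) list" where
  "ptensor T = map (\<lambda>c. (1, snd c, fst c)) T"

context super_sp
begin

text \<open>Independence: pairing with its partner is a dual functional for each vector, and by
  parity it vanishes on the half of the basis that contains the partner.\<close>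

lemma darboux_of_dualsys:
  assumes bil: "bilinear \<tau>"
    and par: "\<forall>x\<in>Ev W. \<forall>y\<in>Ev W. \<tau> x y = 0" "\<forall>x\<in>Od W. \<forall>y\<in>Od W. \<tau> x y = 0"
    and T: "dualsys \<tau> T" and EO: "\<And>c. c \<in> set T \<Longrightarrow> fst c \<in> Ev W \<and> snd c \<in> Od W"
    and sp: "span (fst ` set T \<union> snd ` set T) = UNIV"
  shows "darboux W \<tau> (map fst T) (map snd T)"
proof -
  have lin1: "linear (\<lambda>x. \<tau> x y)" and lin2: "linear (\<lambda>y. \<tau> x y)" for x y
    using bil by (simp_all add: bilinear_def)
  let ?bs = "map fst T @ map snd T"
  have dual: "\<exists>l :: 'v \<Rightarrow> real. linear l \<and> (\<forall>k<length ?bs. l (?bs ! k) = (if k = j then 1 else 0))" if j: "j < length ?bs" for j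
  proof (cases "j < length T")
    case True
    have "\<tau> (?bs ! k) (snd (T ! j)) = (if k = j then 1 else 0)" if "k < length ?bs" for k
    proof (cases "k < length T")
      case k: True
      then show ?thesis using T True by (simp add: nth_append dualsys_def)
    next
      case k: False
      then have "T ! (k - length T) \<in> set T" using that by (intro nth_mem) simp
      then show ?thesis using k that True EO[of "T ! (k - length T)"] EO[OF nth_mem[OF True]]
        by (simp add: nth_append par)
    qed
    then show ?thesis using lin1 by blast
  next
    case False
    then have j': "j - length T < length T" using j by simp
    have "\<tau> (fst (T ! (j - length T))) (?bs ! k) = (if k = j then 1 else 0)" if "k < length ?bs" for k
    proof (cases "k < length T")
      case k: True
      then show ?thesis using False EO[OF nth_mem[OF k]] EO[OF nth_mem[OF j']]
        by (auto simp add: nth_append par)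
    next
      case k: False
      then have k': "k - length T < length T" using that by simp
      have "(j - length T = k - length T) = (k = j)" using k False by auto
      then show ?thesis using T k' j' k by (simp add: nth_append dualsys_def)
    qed
    then show ?thesis using lin2 by blast
  qed
  note d = dual_independent[of ?bs, OF dual]
  have "(fst ` set T \<union> snd ` set T) = set ?bs" by auto
  then show ?thesis unfolding darboux_def
    using d T EO sp by (auto simp: dualsys_def)
qed

text \<open>The candidate expansion is linear and fixes the basis, so it is the identity; on a
  homogeneous vector one of its two sums vanishes by parity.\<close>

lemma darboux_expand:
  assumes bil: "bilinear \<tau>"
    and par: "\<forall>x\<in>Ev W. \<forall>y\<in>Ev W. \<tau> x y = 0" "\<forall>x\<in>Od W. \<forall>y\<in>Od W. \<tau> x y = 0"
    and D: "darboux W \<tau> es fs"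
  shows "e \<in> Ev W \<Longrightarrow> e = (\<Sum>k<length es. \<tau> e (fs ! k) *\<^sub>R es ! k)"
    and "f \<in> Od W \<Longrightarrow> f = (\<Sum>k<length es. \<tau> (es ! k) f *\<^sub>R fs ! k)"
proof -
  have lin1: "linear (\<lambda>x. \<tau> x y)" and lin2: "linear (\<lambda>y. \<tau> x y)" for x y
    using bil by (simp_all add: bilinear_def)
  have len: "length fs = length es" and E: "set es \<subseteq> Ev W" and O: "set fs \<subseteq> Od W"
    and sp: "span (set (es @ fs)) = UNIV"
    and d: "\<And>j k. j < length es \<Longrightarrow> k < length es \<Longrightarrow> \<tau> (es ! j) (fs ! k) = (if j = k then 1 else 0)"
    using D by (simp_all add: darboux_def)
  define q where "q w = (\<Sum>k<length es. \<tau> w (fs ! k) *\<^sub>R es ! k) + (\<Sum>k<length es. \<tau> (es ! k) w *\<^sub>R fs ! k)" for w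
  have lq: "linear q" unfolding q_def
    by (intro linear_compose_add linear_compose_sum ballI linearI)
       (simp_all add: linear_add[OF lin1] linear_add[OF lin2] linear_scale[OF lin1] linear_scale[OF lin2] algebra_simps)
  have Ej: "es ! j \<in> Ev W" "fs ! j \<in> Od W" if "j < length es" for j
    using E O that len by (simp_all add: subset_iff)
  have "q w = w" if "w \<in> set (es @ fs)" for w
  proof -
    from that consider j where "j < length es" "w = es ! j" | j where "j < length es" "w = fs ! j"
      using len by (auto simp: in_set_conv_nth)
    then show ?thesis
    proof cases
      case 1
      have "(\<Sum>k<length es. \<tau> w (fs ! k) *\<^sub>R es ! k) = (\<Sum>k<length es. if k = j then es ! j else 0)"
        by (rule sum.cong) (use d 1 in auto)
      moreover have "(\<Sum>k<length es. \<tau> (es ! k) w *\<^sub>R fs ! k) = 0"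
        by (rule sum.neutral) (use 1 Ej par in auto)
      ultimately show ?thesis using 1 by (simp add: q_def)
    next
      case 2
      have "(\<Sum>k<length es. \<tau> (es ! k) w *\<^sub>R fs ! k) = (\<Sum>k<length es. if k = j then fs ! j else 0)"
        by (rule sum.cong) (use d 2 in auto)
      moreover have "(\<Sum>k<length es. \<tau> w (fs ! k) *\<^sub>R es ! k) = 0"
        by (rule sum.neutral) (use 2 Ej par in auto)
      ultimately show ?thesis using 2 by (simp add: q_def)
    qed
  qed
  then have q: "q w = w" for w
    using linear_eq_on_span[OF lq linear_ident, of "set (es @ fs)" w] sp by auto
  show "e = (\<Sum>k<length es. \<tau> e (fs ! k) *\<^sub>R es ! k)" if "e \<in> Ev W"
  proof -
    have "(\<Sum>k<length es. \<tau> (es ! k) e *\<^sub>R fs ! k) = 0" by (rule sum.neutral) (use that Ej par in auto)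
    then show ?thesis using q[of e] by (simp add: q_def)
  qed
  show "f = (\<Sum>k<length es. \<tau> (es ! k) f *\<^sub>R fs ! k)" if "f \<in> Od W"
  proof -
    have "(\<Sum>k<length es. \<tau> f (fs ! k) *\<^sub>R es ! k) = 0" by (rule sum.neutral) (use that Ej par in auto)
    then show ?thesis using q[of f] by (simp add: q_def)
  qed
qed

lemma ff_lincomb:
  assumes "ff F"
  shows "F (xs @ (\<Sum>k<(n::nat). a k *\<^sub>R v k) # ys) = (\<Sum>k<n. fls_const (a k) * F (xs @ v k # ys))"
  by (induction n) (simp_all add: ff_zero[OF assms] ff_add[OF assms] ff_scale[OF assms])

text \<open>The matrix \<open>\<tau> (es ! j) (fs' ! k)\<close> expresses \<open>es\<close> through
  \<open>es'\<close> and, read the other way, \<open>fs'\<close> through \<open>fs\<close>;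
  exchanging the two sums converts one Laplacian into the other.\<close>

lemma darboux_invariant:
  assumes bil: "bilinear \<tau>"
    and par: "\<forall>x\<in>Ev W. \<forall>y\<in>Ev W. \<tau> x y = 0" "\<forall>x\<in>Od W. \<forall>y\<in>Od W. \<tau> x y = 0"
    and D: "darboux W \<tau> es fs" and D': "darboux W \<tau> es' fs'" and F: "ff F"
  shows "(\<Sum>j<length es. F (fs ! j # es ! j # ws)) = (\<Sum>k<length es'. F (fs' ! k # es' ! k # ws))"
proof -
  have E: "es ! j \<in> Ev W" if "j < length es" for j using D that by (auto simp: darboux_def)
  have O: "fs' ! k \<in> Od W" if "k < length es'" for k using D' that by (auto simp: darboux_def)
  note x = darboux_expand[OF bil par]
  have "(\<Sum>j<length es. F (fs ! j # es ! j # ws))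
      = (\<Sum>j<length es. \<Sum>k<length es'. fls_const (\<tau> (es ! j) (fs' ! k)) * F (fs ! j # es' ! k # ws))"
  proof (rule sum.cong[OF refl])
    fix j assume "j \<in> {..<length es}"
    then have "F (fs ! j # es ! j # ws) = F ([fs ! j] @ (\<Sum>k<length es'. \<tau> (es ! j) (fs' ! k) *\<^sub>R es' ! k) # ws)"
      using x(1)[OF D' E[of j]] by simp
    then show "F (fs ! j # es ! j # ws) = (\<Sum>k<length es'. fls_const (\<tau> (es ! j) (fs' ! k)) * F (fs ! j # es' ! k # ws))"
      unfolding ff_lincomb[OF F] by simp
  qed
  also have "\<dots> = (\<Sum>k<length es'. \<Sum>j<length es. fls_const (\<tau> (es ! j) (fs' ! k)) * F (fs ! j # es' ! k # ws))"
    by (rule sum.swap)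
  also have "\<dots> = (\<Sum>k<length es'. F (fs' ! k # es' ! k # ws))"
  proof (rule sum.cong[OF refl])
    fix k assume "k \<in> {..<length es'}"
    then have "F (fs' ! k # es' ! k # ws) = F ([] @ (\<Sum>j<length es. \<tau> (es ! j) (fs' ! k) *\<^sub>R fs ! j) # es' ! k # ws)"
      using x(2)[OF D O[of k]] by simp
    then show "(\<Sum>j<length es. fls_const (\<tau> (es ! j) (fs' ! k)) * F (fs ! j # es' ! k # ws)) = F (fs' ! k # es' ! k # ws)"
      unfolding ff_lincomb[OF F] by simp
  qed
  finally show ?thesis .
qed

text \<open>The basis selected by \<open>SOME\<close> may be traded for a convenient one, here a
  basis adapted to the retract.\<close>

lemma lap_eq_L2:
  assumes bil: "bilinear \<tau>"
    and par: "\<forall>x\<in>Ev W. \<forall>y\<in>Ev W. \<tau> x y = 0" "\<forall>x\<in>Od W. \<forall>y\<in>Od W. \<tau> x y = 0"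
    and T: "darboux W \<tau> (map fst T) (map snd T)" and F: "ff F"
  shows "lap W \<tau> F = L2 (ptensor T) F"
proof
  fix ws
  obtain es fs where ef: "(SOME (es, fs). darboux W \<tau> es fs) = (es, fs)" by (metis surj_pair)
  have "case (SOME (es, fs). darboux W \<tau> es fs) of (es, fs) \<Rightarrow> darboux W \<tau> es fs"
    by (rule someI[of "\<lambda>(es, fs). darboux W \<tau> es fs" "(map fst T, map snd T)"]) (use T in simp)
  then have D: "darboux W \<tau> es fs" by (simp add: ef)
  have "lap W \<tau> F ws = (\<Sum>j<length es. F (fs ! j # es ! j # ws))" by (simp add: lap_def ef)
  also have "\<dots> = (\<Sum>k<length T. F (snd (T ! k) # fst (T ! k) # ws))"
    using darboux_invariant[OF bil par D T F, of ws] by simp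
  also have "\<dots> = L2 (ptensor T) F ws"
    unfolding L2_def ptensor_def by (simp add: sum_list_sum_nth comp_def lessThan_atLeast0)
  finally show "lap W \<tau> F ws = L2 (ptensor T) F ws" .
qed

end

section \<open>Cyclic retracts\<close>

lemma super_space_parity_rev: assumes "super_space V" shows "super_space (parity_rev V)"
proof -
  have h: "hpart (parity_rev V) p = hpart V (Suc p)" "hpart V (Suc (Suc p)) = hpart V p" for p
    by (simp_all add: hpart_def parity_rev_def)
  have "dif V ` hpart V (Suc p) \<subseteq> hpart V (Suc (Suc p))" for p
    using assms unfolding super_space_def by blast
  then have "\<forall>p. dif V ` hpart (parity_rev V) p \<subseteq> hpart (parity_rev V) (Suc p)"
    unfolding h by blast
  moreover have "\<exists>a\<in>Od V. \<exists>c\<in>Ev V. v = a + c" for v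
    using assms unfolding super_space_def by (metis add.commute)
  ultimately show ?thesis
    using assms unfolding super_space_def by (simp add: parity_rev_def Int_commute)
qed

locale cyclic_data =
  fixes V :: "'v::real_vector super" and b :: "'v \<Rightarrow> 'v \<Rightarrow> real"
    and H :: "'h::real_vector super" and bH :: "'h \<Rightarrow> 'h \<Rightarrow> real"
    and \<pi> :: "'v \<Rightarrow> 'h" and i :: "'h \<Rightarrow> 'v" and p :: "'v \<Rightarrow> 'h" and s :: "'v \<Rightarrow> 'v"
  assumes superV: "super_space V" and form: "odd_sym_form V b"
    and hom: "homology_of V b H bH \<pi>" and sdr: "cyclic_sdr V b H bH i p s"
begin

abbreviation "W \<equiv> parity_rev V"
abbreviation "WH \<equiv> parity_rev H"
abbreviation "d \<equiv> dif V"
abbreviation "\<tau> \<equiv> sympl V b"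
abbreviation "\<tau>H \<equiv> sympl H bH"

section \<open>Parity reversion of the space and of its homology\<close>

lemma superH: "super_space H"
  using hom by (simp add: homology_of_def)

sublocale V: super_sp V by unfold_locales (rule superV)
sublocale H: super_sp H by unfold_locales (rule superH)
sublocale W: super_sp "parity_rev V" by unfold_locales (rule super_space_parity_rev[OF superV])
sublocale WH: super_sp "parity_rev H" by unfold_locales (rule super_space_parity_rev[OF superH])

lemma EvW [simp]: "Ev W = Od V" and OdW [simp]: "Od W = Ev V" and difW [simp]: "dif W = d"
  and EvWH [simp]: "Ev WH = Od H" and OdWH [simp]: "Od WH = Ev H" and difWH [simp]: "dif WH = dif H"
  by (simp_all add: parity_rev_def)

lemma evproj_W: "ev_proj W x = V.od x" "od_proj W x = V.ev x"
proof -
  have x: "x = V.od x + V.ev x" using V.ev_plus_od[of x] by (simp add: add.commute)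
  show "ev_proj W x = V.od x" by (subst x, rule W.ev_eqI) simp_all
  show "od_proj W x = V.ev x" by (subst x, rule W.od_eqI) simp_all
qed

lemma evproj_WH: "ev_proj WH x = H.od x" "od_proj WH x = H.ev x"
proof -
  have x: "x = H.od x + H.ev x" using H.ev_plus_od[of x] by (simp add: add.commute)
  show "ev_proj WH x = H.od x" by (subst x, rule WH.ev_eqI) simp_all
  show "od_proj WH x = H.ev x" by (subst x, rule WH.od_eqI) simp_all
qed

lemma lin_i: "linear i" and lin_p: "linear p" and lin_s: "linear s"
  and pi [simp]: "p (i h) = h" and ps [simp]: "p (s v) = 0" and si [simp]: "s (i h) = 0" and ss [simp]: "s (s v) = 0"
  and ds_sd: "d (s v) + s (d v) = v - i (p v)" and b_i: "b (i h) (i h') = bH h h'"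
  and b_ker: "p v = 0 \<Longrightarrow> b v (i h) = 0"
  using sdr by (simp_all add: cyclic_sdr_def)

lemma i_par: "h \<in> Ev H \<Longrightarrow> i h \<in> Ev V" "h \<in> Od H \<Longrightarrow> i h \<in> Od V"
proof -
  have "i ` hpart H q \<subseteq> hpart V q" for q using sdr by (simp add: cyclic_sdr_def)
  from this[of 0] this[of 1] show "h \<in> Ev H \<Longrightarrow> i h \<in> Ev V" "h \<in> Od H \<Longrightarrow> i h \<in> Od V"
    by (auto simp: hpart_def)
qed

lemma p_par: "v \<in> Ev V \<Longrightarrow> p v \<in> Ev H" "v \<in> Od V \<Longrightarrow> p v \<in> Od H"
proof -
  have "p ` hpart V q \<subseteq> hpart H q" for q using sdr by (simp add: cyclic_sdr_def)
  from this[of 0] this[of 1] show "v \<in> Ev V \<Longrightarrow> p v \<in> Ev H" "v \<in> Od V \<Longrightarrow> p v \<in> Od H"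
    by (auto simp: hpart_def)
qed

lemma s_par: "v \<in> Ev V \<Longrightarrow> s v \<in> Od V" "v \<in> Od V \<Longrightarrow> s v \<in> Ev V"
proof -
  have "s ` hpart V q \<subseteq> hpart V (Suc q)" for q using sdr by (simp add: cyclic_sdr_def)
  from this[of 0] this[of 1] show "v \<in> Ev V \<Longrightarrow> s v \<in> Od V" "v \<in> Od V \<Longrightarrow> s v \<in> Ev V"
    by (auto simp: hpart_def)
qed

lemma difH [simp]: "dif H h = 0"
  using hom by (simp add: homology_of_def)

lemma i_0 [simp]: "i 0 = 0" and p_0 [simp]: "p 0 = 0" and d_0 [simp]: "d 0 = 0"
  using lin_i lin_p V.lin_dif by (simp_all add: linear_0)

lemma d_i [simp]: "d (i h) = 0" and p_d [simp]: "p (d v) = 0"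
proof -
  have "d (i h) = i (dif H h)" "dif H (p v) = p (d v)" using sdr by (simp_all add: cyclic_sdr_def)
  then show "d (i h) = 0" "p (d v) = 0" by simp_all
qed

section \<open>The form, its adjunction rules and the induced form\<close>

lemma bil: "bilinear b"
  using form unfolding odd_sym_form_def by (elim conjE)

lemma lin_b1: "linear (\<lambda>x. b x y)" and lin_b2: "linear (b x)"
  using bil by (simp_all add: bilinear_def)

lemmas b_add1 = linear_add[OF lin_b1] and b_add2 = linear_add[OF lin_b2]
  and b_neg1 = linear_neg[OF lin_b1] and b_neg2 = linear_neg[OF lin_b2]
  and b_sc1 = linear_scale[OF lin_b1] and b_sc2 = linear_scale[OF lin_b2]
  and b_01 = linear_0[OF lin_b1] and b_02 = linear_0[OF lin_b2]

lemma nondeg: assumes "\<And>y. b x y = 0" shows "x = 0"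
proof -
  have "\<forall>x. (\<forall>y. b x y = 0) \<longrightarrow> x = 0"
    using form unfolding odd_sym_form_def by (elim conjE)
  then show ?thesis using assms by blast
qed

lemma b_ee: "x \<in> Ev V \<Longrightarrow> y \<in> Ev V \<Longrightarrow> b x y = 0" and b_oo: "x \<in> Od V \<Longrightarrow> y \<in> Od V \<Longrightarrow> b x y = 0"
proof -
  have h: "\<forall>p q. \<forall>x\<in>hpart V p. \<forall>y\<in>hpart V q. even (p + q) \<longrightarrow> b x y = 0"
    using form unfolding odd_sym_form_def by (elim conjE)
  from h[rule_format, of x 0 y 0] show "x \<in> Ev V \<Longrightarrow> y \<in> Ev V \<Longrightarrow> b x y = 0" by (simp add: hpart_def)
  from h[rule_format, of x 1 y 1] show "x \<in> Od V \<Longrightarrow> y \<in> Od V \<Longrightarrow> b x y = 0" by (simp add: hpart_def)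
qed

lemma b_split: "b x y = b (V.ev x) (V.od y) + b (V.od x) (V.ev y)"
proof -
  have "b x y = b (V.ev x + V.od x) (V.ev y + V.od y)" by (simp add: V.ev_plus_od)
  also have "\<dots> = b (V.ev x) (V.od y) + b (V.od x) (V.ev y)"
    unfolding b_add1 b_add2 by (simp add: b_ee b_oo)
  finally show ?thesis .
qed

text \<open>The form is odd, so only pairs of opposite parity contribute, and for these the sign is
  trivial.\<close>

lemma b_sym: "b x y = b y x"
proof -
  have h: "\<forall>p q. \<forall>x\<in>hpart V p. \<forall>y\<in>hpart V q. b x y = (-1) ^ (p * q) * b y x"
    using form unfolding odd_sym_form_def by (elim conjE)
  have eo: "b x y = b y x" if "x \<in> Ev V" "y \<in> Od V" for x y
    using h[rule_format, of x 0 y 1] that by (simp add: hpart_def)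
  show ?thesis unfolding b_split[of x y] b_split[of y x]
    using eo[of "V.ev x" "V.od y"] eo[of "V.ev y" "V.od x"] by simp
qed

lemma b_d: "x \<in> Ev V \<Longrightarrow> b (d x) y = - b x (d y)" "x \<in> Od V \<Longrightarrow> b (d x) y = b x (d y)"
proof -
  have h: "\<forall>p. \<forall>x\<in>hpart V p. \<forall>y. b (d x) y + (-1) ^ p * b x (d y) = 0"
    using form unfolding odd_sym_form_def by (elim conjE)
  from h[rule_format, of x 0 y] show "x \<in> Ev V \<Longrightarrow> b (d x) y = - b x (d y)" by (simp add: hpart_def)
  from h[rule_format, of x 1 y] show "x \<in> Od V \<Longrightarrow> b (d x) y = b x (d y)" by (simp add: hpart_def)
qed

lemma b_s: "x \<in> Ev V \<Longrightarrow> b (s x) y = b x (s y)" "x \<in> Od V \<Longrightarrow> b (s x) y = - b x (s y)"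
proof -
  have h: "\<forall>q. \<forall>x\<in>hpart V q. \<forall>y. b (s x) y = (-1) ^ q * b x (s y)"
    using sdr unfolding cyclic_sdr_def by (elim conjE)
  from h[rule_format, of x 0 y] show "x \<in> Ev V \<Longrightarrow> b (s x) y = b x (s y)" by (simp add: hpart_def)
  from h[rule_format, of x 1 y] show "x \<in> Od V \<Longrightarrow> b (s x) y = - b x (s y)" by (simp add: hpart_def)
qed

lemma b_s_s [simp]: "b (s x) (s y) = 0"
proof -
  have "b (s (V.ev x) + s (V.od x)) (s y) = 0"
    unfolding b_add1 by (simp add: b_s b_02)
  then show ?thesis by (simp add: linear_add[OF lin_s, symmetric] V.ev_plus_od)
qed

lemma b_d_d [simp]: "b (d x) (d y) = 0"
proof -
  have "b (d (V.ev x) + d (V.od x)) (d y) = 0"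
    unfolding b_add1 by (simp add: b_d b_02)
  then show ?thesis by (simp add: linear_add[OF V.lin_dif, symmetric] V.ev_plus_od)
qed

lemma b_i_s [simp]: "b (i h) (s x) = 0" "b (s x) (i h) = 0" and b_i_d [simp]: "b (i h) (d x) = 0" "b (d x) (i h) = 0"
  using b_ker[of "s x" h] b_ker[of "d x" h] b_sym[of "i h" "s x"] b_sym[of "i h" "d x"] by simp_all

lemma finV: obtains C where "finite C" "span C = (UNIV :: 'v set)"
proof -
  have "\<exists>B. finite B \<and> span B = (UNIV :: 'v set)"
    using form unfolding odd_sym_form_def by (elim conjE)
  then show ?thesis using that by blast
qed

lemma finH: obtains C where "finite C" "span C = (UNIV :: 'h set)"
proof -
  obtain C where C: "finite C" "span C = (UNIV :: 'v set)" by (rule finV)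
  have "span (p ` C) = p ` span C" by (rule linear_span_image[OF lin_p])
  also have "\<dots> = UNIV" unfolding C(2) by (metis pi surj_def)
  finally show ?thesis using that[of "p ` C"] C(1) by simp
qed

lemma bH_i: "bH = (\<lambda>x y. b (i x) (i y))"
  by (intro ext) (simp add: b_i)

text \<open>Every \<open>v\<close> differs from \<open>i (p v)\<close> by an element of the kernel
  of \<open>p\<close>, which is orthogonal to the image of \<open>i\<close>.\<close>

lemma nondegH: assumes "\<And>y. bH x y = 0" shows "x = 0"
proof -
  have "b (i x) v = 0" for v
  proof -
    have "b (i x) v = b (i x) (i (p v)) + b (i x) (v - i (p v))"
      unfolding b_add2[symmetric] by simp
    also have "b (i x) (v - i (p v)) = 0"
      using b_ker[of "v - i (p v)" x] b_sym[of "i x" "v - i (p v)"] by (simp add: linear_diff[OF lin_p])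
    finally show ?thesis using assms by (simp add: b_i)
  qed
  then have "i x = 0" by (rule nondeg)
  then show ?thesis using pi[of x] by simp
qed

lemma formH: "odd_sym_form H bH"
proof -
  have ih: "i x \<in> hpart V q" if "x \<in> hpart H q" for x q
    using that i_par by (auto simp: hpart_def split: if_splits)
  have "bilinear bH"
    unfolding bH_i bilinear_def
  proof (intro conjI allI)
    show "linear (\<lambda>y. b (i x) (i y))" for x
      using linear_compose[OF lin_i lin_b2[of "i x"]] by (simp add: comp_def)
    show "linear (\<lambda>x. b (i x) (i y))" for y
      using linear_compose[OF lin_i lin_b1[of "i y"]] by (simp add: comp_def)
  qed
  moreover have "\<forall>p q. \<forall>x\<in>hpart H p. \<forall>y\<in>hpart H q. even (p + q) \<longrightarrow> bH x y = 0"
  proof -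
    have "\<forall>p q. \<forall>x\<in>hpart V p. \<forall>y\<in>hpart V q. even (p + q) \<longrightarrow> b x y = 0"
      using form unfolding odd_sym_form_def by (elim conjE)
    then show ?thesis using ih unfolding bH_i by blast
  qed
  moreover have "\<forall>p q. \<forall>x\<in>hpart H p. \<forall>y\<in>hpart H q. bH x y = (-1) ^ (p * q) * bH y x"
  proof (intro allI ballI)
    fix p q x y assume xy: "x \<in> hpart H p" "y \<in> hpart H q"
    have "\<forall>p q. \<forall>x\<in>hpart V p. \<forall>y\<in>hpart V q. b x y = (-1) ^ (p * q) * b y x"
      using form unfolding odd_sym_form_def by (elim conjE)
    from this[rule_format, OF ih[OF xy(1)] ih[OF xy(2)]]
    show "bH x y = (-1) ^ (p * q) * bH y x" unfolding bH_i .
  qed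
  moreover have "\<forall>p. \<forall>x\<in>hpart H p. \<forall>y. bH (dif H x) y + (-1) ^ p * bH x (dif H y) = 0"
    by (simp add: bH_i b_01 b_02)
  moreover have "\<exists>B. finite B \<and> span B = (UNIV :: 'h set)" by (rule finH) blast
  moreover have "\<forall>x. (\<forall>y. bH x y = 0) \<longrightarrow> x = 0" using nondegH by blast
  ultimately show ?thesis unfolding odd_sym_form_def by blast
qed

section \<open>The symplectic forms and a Darboux basis of the homology\<close>

lemma gr_W: "grade W x = - grade V x" and gr_WH: "grade WH h = - grade H h"
  by (simp_all add: grade_def evproj_W evproj_WH)

lemma tau_Ev: "x \<in> Ev V \<Longrightarrow> \<tau> x y = b x y" and tau_Od: "x \<in> Od V \<Longrightarrow> \<tau> x y = - b x y"
  by (simp_all add: sympl_def b_neg1)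

lemma tau_bil: "bilinear \<tau>"
  unfolding bilinear_def
proof (intro conjI allI)
  show "linear (\<lambda>y. \<tau> x y)" for x unfolding sympl_def by (rule lin_b2)
  show "linear (\<lambda>x. \<tau> x y)" for y
    using linear_compose[OF V.linear_gr lin_b1[of y]] by (simp add: sympl_def comp_def)
qed

lemma tau_par: "\<forall>x\<in>Ev W. \<forall>y\<in>Ev W. \<tau> x y = 0" "\<forall>x\<in>Od W. \<forall>y\<in>Od W. \<tau> x y = 0"
  by (simp_all add: tau_Ev tau_Od b_ee b_oo)

lemma i_projV: "V.ev (i h) = i (H.ev h)" "V.od (i h) = i (H.od h)"
proof -
  have x: "i h = i (H.ev h) + i (H.od h)" unfolding linear_add[OF lin_i, symmetric] by (simp add: H.ev_plus_od)
  show "V.ev (i h) = i (H.ev h)" unfolding x by (rule V.ev_eqI) (simp_all add: i_par)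
  show "V.od (i h) = i (H.od h)" unfolding x by (rule V.od_eqI) (simp_all add: i_par)
qed

lemma i_grade: "grade V (i h) = i (grade H h)"
  by (simp add: grade_def i_projV linear_diff[OF lin_i])

lemma tauH: "\<tau>H x y = \<tau> (i x) (i y)"
  by (simp add: sympl_def i_grade b_i)

lemma tauH_bil: "bilinear \<tau>H"
proof -
  have "bilinear (\<lambda>x y. \<tau> (i x) (i y))"
    using tau_bil unfolding bilinear_def
    by (auto intro: linear_compose[OF lin_i, unfolded comp_def])
  then show ?thesis unfolding tauH[symmetric] .
qed

lemma tauH_par: "\<forall>x\<in>Ev WH. \<forall>y\<in>Ev WH. \<tau>H x y = 0" "\<forall>x\<in>Od WH. \<forall>y\<in>Od WH. \<tau>H x y = 0"
  using tau_par i_par by (simp_all add: tauH)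

lemma darbouxH:
  obtains TH where "dualsys \<tau>H TH" "\<And>c. c \<in> set TH \<Longrightarrow> fst c \<in> Od H \<and> snd c \<in> Ev H"
    "span (fst ` set TH \<union> snd ` set TH) = UNIV"
proof -
  obtain C where C: "finite C" "span C = (UNIV :: 'h set)" by (rule finH)
  have o: "\<tau>H x y = - bH x y" if "x \<in> Od H" for x y using that i_par(2)[OF that] by (simp add: tauH tau_Od b_i)
  have s: "bH x y = bH y x" for x y unfolding bH_i by (rule b_sym)
  have par: "bH x y = 0" if "x \<in> Ev H \<and> y \<in> Ev H \<or> x \<in> Od H \<and> y \<in> Od H" for x y
    using that i_par by (auto simp: bH_i intro: b_ee b_oo)
  have add: "bH x (y + y') = bH x y + bH x y'" for x y y' by (simp add: bH_i linear_add[OF lin_i] b_add2)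
  show ?thesis
  proof (rule dual_bases_exist[OF tauH_bil H.sub_Od H.sub_Ev _ _ C])
    fix a assume a: "a \<in> Od H" "\<forall>b\<in>Ev H. \<tau>H a b = 0"
    show "a = 0"
    proof (rule nondegH)
      fix y
      have "bH a y = bH a (H.ev y) + bH a (H.od y)" unfolding add[symmetric] by (simp add: H.ev_plus_od)
      then show "bH a y = 0" using a o[OF a(1), of "H.ev y"] par[of a "H.od y"] by simp
    qed
  next
    fix a assume a: "a \<in> Ev H" "\<forall>b\<in>Od H. \<tau>H b a = 0"
    show "a = 0"
    proof (rule nondegH)
      fix y
      have "bH a y = bH a (H.ev y) + bH a (H.od y)" unfolding add[symmetric] by (simp add: H.ev_plus_od)
      then show "bH a y = 0" using a o[of "H.od y" a] par[of a "H.ev y"] s[of a "H.od y"] by simp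
    qed
  next
    fix T assume T: "\<And>c. c \<in> set T \<Longrightarrow> fst c \<in> Od H \<and> snd c \<in> Ev H"
      "\<forall>j<length T. \<forall>k<length T. \<tau>H (fst (T ! j)) (snd (T ! k)) = (if j = k then 1 else 0)"
      "Od H \<subseteq> span (fst ` set T)" "Ev H \<subseteq> span (snd ` set T)"
    have "x \<in> span (fst ` set T \<union> snd ` set T)" for x
    proof -
      have "H.ev x \<in> span (fst ` set T \<union> snd ` set T)" "H.od x \<in> span (fst ` set T \<union> snd ` set T)"
        using T(3,4) H.ev_in[of x] H.od_in[of x] span_mono[of "fst ` set T" "fst ` set T \<union> snd ` set T"]
          span_mono[of "snd ` set T" "fst ` set T \<union> snd ` set T"] by blast+
      from span_add[OF this] show ?thesis by (simp add: H.ev_plus_od)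
    qed
    then show ?thesis using T(1,2) that[of T] by (auto simp: dualsys_def)
  qed
qed

section \<open>Normal coordinates on the image of \<open>s\<close>\<close>

lemma sd_range: "x \<in> range s \<Longrightarrow> s (d x) = x" and s_range: "x \<in> range s \<Longrightarrow> s x = 0" and p_range: "x \<in> range s \<Longrightarrow> p x = 0"
proof -
  assume "x \<in> range s"
  then obtain y where y: "x = s y" by auto
  show "s x = 0" "p x = 0" by (simp_all add: y)
  then show "s (d x) = x" using ds_sd[of x] by simp
qed

lemma b_range: "x \<in> range s \<Longrightarrow> y \<in> range s \<Longrightarrow> b x y = 0"
  by auto

text \<open>Gaussian coordinates in terms of the form: the coefficients of the quadratic function
  are \<open>2 * b x (d y)\<close> in the even and \<open>- 2 * b x (d y)\<close> in the odd
  directions of \<Pi> V, so its values \<open>2 * snd (us ! j)\<close> and \<open>-1\<close> become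
  \<open>snd (us ! j)\<close> and \<open>1 / 2\<close>.\<close>

definition coords :: "('v \<times> real) list \<Rightarrow> ('v \<times> 'v) list \<Rightarrow> bool" where
  "coords us vs \<longleftrightarrow>
     (\<forall>c\<in>set us. fst c \<in> Od V \<and> fst c \<in> range s \<and> snd c \<in> {1, -1}) \<and>
     (\<forall>c\<in>set vs. fst c \<in> Ev V \<and> fst c \<in> range s \<and> snd c \<in> Ev V \<and> snd c \<in> range s) \<and>
     (\<forall>j<length us. \<forall>k<length us. b (fst (us ! j)) (d (fst (us ! k))) = (if j = k then snd (us ! j) else 0)) \<and>
     (\<forall>j<length vs. \<forall>k<length vs. b (fst (vs ! j)) (d (fst (vs ! k))) = 0 \<and> b (snd (vs ! j)) (d (snd (vs ! k))) = 0 \<and>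
        b (fst (vs ! j)) (d (snd (vs ! k))) = (if j = k then 1 / 2 else 0)) \<and>
     range s \<subseteq> span (fst ` set us \<union> (fst ` set vs \<union> snd ` set vs))"

lemma sub_range_s: "subspace (range s)"
  by (rule linear_subspace_image[OF lin_s subspace_UNIV])

text \<open>Of the three summands in \<open>v = i (p v) + d (s v) + s (d v)\<close>, the first and
  the last are orthogonal to the image of \<open>s\<close>.\<close>

lemma nondeg_range:
  assumes x: "x \<in> range s" "\<And>y. y \<in> range s \<Longrightarrow> b x (d y) = 0" shows "x = 0"
proof (rule nondeg)
  fix v
  have "v = i (p v) + (d (s v) + s (d v))" using ds_sd[of v] by simp
  then have "b x v = b x (i (p v)) + (b x (d (s v)) + b x (s (d v)))" by (metis b_add2)
  then show "b x v = 0" using x b_ker[OF p_range[OF x(1)]] b_range[OF x(1), of "s (d v)"] by simp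
qed

lemma odlin_s: "W.odlin s"
  by (simp add: W.odlin_def lin_s s_par)

lemma evlin_pr: "W.evlin (\<lambda>v. i (p v))"
  using linear_compose[OF lin_p lin_i] by (simp add: W.evlin_def comp_def i_par p_par)

lemma range_parts: assumes "y \<in> range s" shows "V.ev y \<in> range s" "V.od y \<in> range s"
proof -
  obtain x where x: "y = s x" using assms by auto
  have sum: "y = s (V.od x) + s (V.ev x)" unfolding x linear_add[OF lin_s, symmetric]
    by (simp add: add.commute V.ev_plus_od)
  have "V.ev y = s (V.od x)" unfolding sum by (rule V.ev_eqI) (simp_all add: s_par)
  then show "V.ev y \<in> range s" by simp
  have "V.od y = s (V.ev x)" unfolding sum by (rule V.od_eqI) (simp_all add: s_par)
  then show "V.od y \<in> range s" by simp
qed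

lemma coords_exist: obtains us vs where "coords us vs"
proof -
  obtain C where C: "finite C" "span C = (UNIV :: 'v set)" by (rule finV)
  \<comment> \<open>The factor is 1 for the even coordinates and \<open>-2\<close> for the odd ones,
    where it converts the normal form value \<open>-1\<close> into \<open>1 / 2\<close>.\<close>
  have bq: "bilinear (\<lambda>x y. r * b x (d y))" for r
    unfolding bilinear_def
  proof (intro conjI allI)
    show "linear (\<lambda>y. r * b x (d y))" for x
      using linear_compose_scale_right[OF linear_compose[OF V.lin_dif lin_b2[of x]], of r] by (simp add: comp_def)
    show "linear (\<lambda>x. r * b x (d y))" for y
      using linear_compose_scale_right[OF lin_b1[of "d y"], of r] by simp
  qed
  have AE: "subspace (Od V \<inter> range s)" and AO: "subspace (Ev V \<inter> range s)"
    by (intro subspace_inter V.sub_Od V.sub_Ev sub_range_s)+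
  obtain us where us: "\<And>c. c \<in> set us \<Longrightarrow> fst c \<in> Od V \<inter> range s \<and> snd c \<in> {1, -1}"
    "\<forall>j<length us. \<forall>k<length us. 1 * b (fst (us ! j)) (d (fst (us ! k))) = (if j = k then snd (us ! j) else 0)"
    "Od V \<inter> range s \<subseteq> span (fst ` set us)"
  proof (rule orthonormal_basis_exists[OF bq[of 1] AE _ _ C])
    show "1 * b x (d y) = 1 * b y (d x)" if "x \<in> Od V \<inter> range s" "y \<in> Od V \<inter> range s" for x y
      using b_d(2)[of x y] b_sym[of "d x" y] that by simp
    show "a = 0" if "a \<in> Od V \<inter> range s" "\<forall>c\<in>Od V \<inter> range s. 1 * b a (d c) = 0" for a
    proof (rule nondeg_range)
      show "a \<in> range s" using that by simp
      fix y assume y: "y \<in> range s"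
      have "b a (d y) = b a (d (V.ev y)) + b a (d (V.od y))"
        unfolding b_add2[symmetric] linear_add[OF V.lin_dif, symmetric] V.ev_plus_od ..
      then show "b a (d y) = 0" using that range_parts[OF y] b_oo[of a "d (V.ev y)"] by (simp add: V.dif_Ev)
    qed
  qed blast
  obtain vs where vs: "\<And>c. c \<in> set vs \<Longrightarrow> fst c \<in> Ev V \<inter> range s \<and> snd c \<in> Ev V \<inter> range s"
    "\<forall>j<length vs. \<forall>k<length vs. - 2 * b (fst (vs ! j)) (d (fst (vs ! k))) = 0 \<and> - 2 * b (snd (vs ! j)) (d (snd (vs ! k))) = 0 \<and>
       - 2 * b (fst (vs ! j)) (d (snd (vs ! k))) = (if j = k then - 1 else 0)"
    "Ev V \<inter> range s \<subseteq> span (fst ` set vs \<union> snd ` set vs)"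
  proof (rule symplectic_basis_exists[OF bq[of "-2"] AO _ _ C])
    show "- 2 * b x (d y) = - (- 2 * b y (d x))" if "x \<in> Ev V \<inter> range s" "y \<in> Ev V \<inter> range s" for x y
      using b_d(1)[of x y] b_sym[of "d x" y] that by simp
    show "a = 0" if "a \<in> Ev V \<inter> range s" "\<forall>c\<in>Ev V \<inter> range s. - 2 * b a (d c) = 0" for a
    proof (rule nondeg_range)
      show "a \<in> range s" using that by simp
      fix y assume y: "y \<in> range s"
      have "b a (d y) = b a (d (V.ev y)) + b a (d (V.od y))"
        unfolding b_add2[symmetric] linear_add[OF V.lin_dif, symmetric] V.ev_plus_od ..
      then show "b a (d y) = 0" using that range_parts[OF y] b_ee[of a "d (V.od y)"] by (simp add: V.dif_Od)
    qed
  qed blast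
  have "coords us vs"
    unfolding coords_def
  proof (intro conjI)
    show "\<forall>c\<in>set us. fst c \<in> Od V \<and> fst c \<in> range s \<and> snd c \<in> {1, -1}" using us(1) by auto
    show "\<forall>c\<in>set vs. fst c \<in> Ev V \<and> fst c \<in> range s \<and> snd c \<in> Ev V \<and> snd c \<in> range s" using vs(1) by auto
    show "\<forall>j<length us. \<forall>k<length us. b (fst (us ! j)) (d (fst (us ! k))) = (if j = k then snd (us ! j) else 0)"
      using us(2) by simp
    show "\<forall>j<length vs. \<forall>k<length vs. b (fst (vs ! j)) (d (fst (vs ! k))) = 0 \<and> b (snd (vs ! j)) (d (snd (vs ! k))) = 0 \<and>
        b (fst (vs ! j)) (d (snd (vs ! k))) = (if j = k then 1 / 2 else 0)"
    proof (intro allI impI)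
      fix j k assume "j < length vs" "k < length vs"
      with vs(2) have "- 2 * b (fst (vs ! j)) (d (fst (vs ! k))) = 0 \<and> - 2 * b (snd (vs ! j)) (d (snd (vs ! k))) = 0 \<and>
        - 2 * b (fst (vs ! j)) (d (snd (vs ! k))) = (if j = k then - 1 else 0)" by blast
      then show "b (fst (vs ! j)) (d (fst (vs ! k))) = 0 \<and> b (snd (vs ! j)) (d (snd (vs ! k))) = 0 \<and>
        b (fst (vs ! j)) (d (snd (vs ! k))) = (if j = k then 1 / 2 else 0)" by (cases "j = k") simp_all
    qed
    let ?S = "fst ` set us \<union> (fst ` set vs \<union> snd ` set vs)"
    show "range s \<subseteq> span ?S"
    proof
      fix y assume y: "y \<in> range s"
      have "V.od y \<in> Od V \<inter> range s" "V.ev y \<in> Ev V \<inter> range s" using range_parts[OF y] by simp_all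
      then have "V.od y \<in> span (fst ` set us)" "V.ev y \<in> span (fst ` set vs \<union> snd ` set vs)"
        using us(3) vs(3) by blast+
      then have "V.od y \<in> span ?S" and "V.ev y \<in> span ?S"
        using span_mono[of "fst ` set us" ?S] span_mono[of "fst ` set vs \<union> snd ` set vs" ?S] by blast+
      then have "V.ev y + V.od y \<in> span ?S" by (intro span_add)
      then show "y \<in> span ?S" by (simp add: V.ev_plus_od)
    qed
  qed
  then show ?thesis by (rule that)
qed

text \<open>The partner of a coordinate vector lies in the image of \<open>d\<close>. Since
  \<open>\<tau>\<close> is \<open>- b\<close> on odd vectors of \<open>V\<close>, the value
  \<open>b x (d x) = snd c\<close> makes \<open>- snd c *\<^sub>R d x\<close> the partner of
  \<open>x\<close>. For an odd pair the partner of one member is a multiple of \<open>d\<close> of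
  the other, with factors \<open>-2\<close> and \<open>2\<close> from the value
  \<open>1 / 2\<close>.\<close>

definition adapted_pairs :: "('h \<times> 'h) list \<Rightarrow> ('v \<times> real) list \<Rightarrow> ('v \<times> 'v) list \<Rightarrow> ('v \<times> 'v) list" where
  "adapted_pairs TH us vs = map (\<lambda>c. (i (fst c), i (snd c))) TH @ map (\<lambda>c. (fst c, - snd c *\<^sub>R d (fst c))) us @
     map (\<lambda>c. (- 2 *\<^sub>R d (snd c), fst c)) vs @ map (\<lambda>c. (2 *\<^sub>R d (fst c), snd c)) vs"

text \<open>The images of \<open>s\<close> and \<open>d\<close> are isotropic and orthogonal to the
  image of \<open>i\<close>, so apart from the normalized values all pairings vanish. Spanning comes
  from \<open>v = i (p v) + d (s v) + s (d v)\<close>.\<close>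

lemma darboux_adapted_pairs:
  assumes TH: "dualsys \<tau>H TH" "\<And>c. c \<in> set TH \<Longrightarrow> fst c \<in> Od H \<and> snd c \<in> Ev H"
    "span (fst ` set TH \<union> snd ` set TH) = UNIV" and co: "coords us vs"
  shows "darboux W \<tau> (map fst (adapted_pairs TH us vs)) (map snd (adapted_pairs TH us vs))"
proof (rule W.darboux_of_dualsys[OF tau_bil tau_par])
  have u: "fst c \<in> Od V" "fst c \<in> range s" "snd c \<in> {1, -1}" if "c \<in> set us" for c
    using co that by (auto simp: coords_def)
  have v: "fst c \<in> Ev V" "fst c \<in> range s" "snd c \<in> Ev V" "snd c \<in> range s" if "c \<in> set vs" for c
    using co that by (auto simp: coords_def)
  have uu: "b (fst (us ! j)) (d (fst (us ! k))) = (if j = k then snd (us ! j) else 0)" if "j < length us" "k < length us" for j k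
    using co that by (simp add: coords_def)
  have vv: "b (fst (vs ! j)) (d (fst (vs ! k))) = 0" "b (snd (vs ! j)) (d (snd (vs ! k))) = 0"
    "b (fst (vs ! j)) (d (snd (vs ! k))) = (if j = k then 1 / 2 else 0)" if "j < length vs" "k < length vs" for j k
    using co that by (simp_all add: coords_def)
  have sq: "e * e = 1" if "e \<in> {1, -1 :: real}" for e using that by auto
  have scO: "r *\<^sub>R x \<in> Od V" if "x \<in> Od V" for r x using that V.sub_Od by (simp add: subspace_scale)
  have scE: "r *\<^sub>R x \<in> Ev V" if "x \<in> Ev V" for r x using that V.sub_Ev by (simp add: subspace_scale)
  have negE: "- x \<in> Ev V" if "x \<in> Ev V" for x using that V.sub_Ev by (simp add: subspace_neg)
  have negO: "- x \<in> Od V" if "x \<in> Od V" for x using that V.sub_Od by (simp add: subspace_neg)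
  show EO: "fst c \<in> Ev W \<and> snd c \<in> Od W" if "c \<in> set (adapted_pairs TH us vs)" for c
    using that TH(2) u v by (auto simp: adapted_pairs_def i_par scO scE negE negO V.dif_Ev V.dif_Od)
  let ?A = "map (\<lambda>c. (i (fst c), i (snd c))) TH" and ?B = "map (\<lambda>c. (fst c, - snd c *\<^sub>R d (fst c))) us"
  let ?C = "map (\<lambda>c. (- 2 *\<^sub>R d (snd c), fst c)) vs" and ?D = "map (\<lambda>c. (2 *\<^sub>R d (fst c), snd c)) vs"
  have A: "dualsys \<tau> ?A" using TH(1) by (simp add: dualsys_def tauH)
  have B: "dualsys \<tau> ?B" unfolding dualsys_def
  proof (intro allI impI)
    fix j k assume "j < length ?B" "k < length ?B"
    then have jk: "j < length us" "k < length us" by simp_all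
    show "\<tau> (fst (?B ! j)) (snd (?B ! k)) = (if j = k then 1 else 0)"
      using jk u[OF nth_mem[OF jk(1)]] sq[OF u(3)[OF nth_mem[OF jk(2)]]] uu[OF jk]
      by (simp add: tau_Od b_sc2 b_neg2)
  qed
  have C: "dualsys \<tau> ?C" unfolding dualsys_def
  proof (intro allI impI)
    fix j k assume "j < length ?C" "k < length ?C"
    then have jk: "j < length vs" "k < length vs" by simp_all
    have "\<tau> (- 2 *\<^sub>R d (snd (vs ! j))) (fst (vs ! k)) = - b (- 2 *\<^sub>R d (snd (vs ! j))) (fst (vs ! k))"
      by (rule tau_Od) (rule scO[OF V.dif_Ev[OF v(3)[OF nth_mem[OF jk(1)]]]])
    then show "\<tau> (fst (?C ! j)) (snd (?C ! k)) = (if j = k then 1 else 0)"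
      using jk vv(3)[OF jk(2,1)] b_sym[of "d (snd (vs ! j))" "fst (vs ! k)"]
      by (simp add: b_sc1 b_neg1)
  qed
  have D: "dualsys \<tau> ?D" unfolding dualsys_def
  proof (intro allI impI)
    fix j k assume "j < length ?D" "k < length ?D"
    then have jk: "j < length vs" "k < length vs" by simp_all
    have "\<tau> (2 *\<^sub>R d (fst (vs ! j))) (snd (vs ! k)) = - b (2 *\<^sub>R d (fst (vs ! j))) (snd (vs ! k))"
      by (rule tau_Od) (rule scO[OF V.dif_Ev[OF v(1)[OF nth_mem[OF jk(1)]]]])
    moreover have "b (d (fst (vs ! j))) (snd (vs ! k)) = - b (fst (vs ! j)) (d (snd (vs ! k)))"
      by (rule b_d(1)[OF v(1)[OF nth_mem[OF jk(1)]]])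
    ultimately show "\<tau> (fst (?D ! j)) (snd (?D ! k)) = (if j = k then 1 else 0)"
      using jk vv(3)[OF jk] by (simp add: b_sc1)
  qed
  have CD: "\<tau> (fst c) (snd c') = 0 \<and> \<tau> (fst c') (snd c) = 0" if cc: "c \<in> set ?C" "c' \<in> set ?D" for c c'
  proof -
    obtain j k where jk: "j < length vs" "k < length vs" and c: "c = (- 2 *\<^sub>R d (snd (vs ! j)), fst (vs ! j))"
      and c': "c' = (2 *\<^sub>R d (fst (vs ! k)), snd (vs ! k))"
      using cc by (auto simp: in_set_conv_nth)
    have "\<tau> (- 2 *\<^sub>R d (snd (vs ! j))) (snd (vs ! k)) = - b (- 2 *\<^sub>R d (snd (vs ! j))) (snd (vs ! k))"
      by (rule tau_Od) (rule scO[OF V.dif_Ev[OF v(3)[OF nth_mem[OF jk(1)]]]])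
    moreover have "\<tau> (2 *\<^sub>R d (fst (vs ! k))) (fst (vs ! j)) = - b (2 *\<^sub>R d (fst (vs ! k))) (fst (vs ! j))"
      by (rule tau_Od) (rule scO[OF V.dif_Ev[OF v(1)[OF nth_mem[OF jk(2)]]]])
    ultimately show ?thesis
      using vv(1)[OF jk] vv(2)[OF jk(2,1)] b_sym[of "d (snd (vs ! j))" "snd (vs ! k)"] b_sym[of "d (fst (vs ! k))" "fst (vs ! j)"]
      by (simp add: c c' b_sc1 b_neg1)
  qed
  have zero: "\<tau> x y = 0" if "b x y = 0" "x \<in> Ev V \<or> x \<in> Od V" for x y
    using that by (auto simp: tau_Ev tau_Od)
  have BCD: "\<tau> (fst c) (snd c') = 0 \<and> \<tau> (fst c') (snd c) = 0" if cc: "c \<in> set ?B" "c' \<in> set (?C @ ?D)" for c c'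
  proof -
    obtain k where k: "k \<in> set us" "c = (fst k, - snd k *\<^sub>R d (fst k))" using cc(1) by auto
    from cc(2) consider l where "l \<in> set vs" "c' = (- 2 *\<^sub>R d (snd l), fst l)"
      | l where "l \<in> set vs" "c' = (2 *\<^sub>R d (fst l), snd l)" by auto
    then obtain r x y where l: "c' = (r *\<^sub>R d x, y)" "x \<in> Ev V" "y \<in> range s"
      by cases (use v in blast)+
    have "b (fst k) y = 0" by (rule b_range[OF u(2)[OF k(1)] l(3)])
    moreover have "b (r *\<^sub>R d x) (- snd k *\<^sub>R d (fst k)) = 0" by (simp add: b_sc1 b_sc2 b_neg2)
    ultimately show ?thesis
      using zero[of "fst k" y] zero[of "r *\<^sub>R d x" "- snd k *\<^sub>R d (fst k)"] u(1)[OF k(1)] scO[OF V.dif_Ev[OF l(2)]]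
      by (simp add: k l)
  qed
  have ABCD: "\<tau> (fst c) (snd c') = 0 \<and> \<tau> (fst c') (snd c) = 0" if cc: "c \<in> set ?A" "c' \<in> set (?B @ ?C @ ?D)" for c c'
  proof -
    obtain k where k: "k \<in> set TH" "c = (i (fst k), i (snd k))" using cc(1) by auto
    have r: "b (i h) x = 0" "b x (i h) = 0" if "x \<in> range s \<or> (\<exists>r y. x = r *\<^sub>R d y)" for x h
      using that by (auto simp: b_sc1 b_sc2)
    have c': "fst c' \<in> range s \<or> (\<exists>r y. fst c' = r *\<^sub>R d y)" "snd c' \<in> range s \<or> (\<exists>r y. snd c' = r *\<^sub>R d y)"
      using cc(2) u v by (auto, (metis scaleR_minus_left)+)
    have "fst c' \<in> Ev W" using cc EO[of c'] by (auto simp: adapted_pairs_def)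
    then show ?thesis
      using r[OF c'(1)] r[OF c'(2)] zero[of "i (fst k)" "snd c'"] zero[of "fst c'" "i (snd k)"] TH(2)[OF k(1)]
      by (simp add: k i_par)
  qed
  show "dualsys \<tau> (adapted_pairs TH us vs)"
    unfolding adapted_pairs_def by (intro dualsys_append A B C D CD BCD ABCD)
  let ?S = "fst ` set (adapted_pairs TH us vs) \<union> snd ` set (adapted_pairs TH us vs)"
  have iH: "i h \<in> span ?S" for h
  proof -
    have "i h \<in> i ` span (fst ` set TH \<union> snd ` set TH)" using TH(3) by simp
    also have "\<dots> = span (i ` (fst ` set TH \<union> snd ` set TH))" by (rule linear_span_image[OF lin_i, symmetric])
    also have "\<dots> \<subseteq> span ?S" by (rule span_mono) (force simp: adapted_pairs_def)
    finally show ?thesis .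
  qed
  have base: "fst ` set us \<union> (fst ` set vs \<union> snd ` set vs) \<subseteq> ?S" by (force simp: adapted_pairs_def)
  have rs: "range s \<subseteq> span (fst ` set us \<union> (fst ` set vs \<union> snd ` set vs))" using co by (simp add: coords_def)
  have sV: "s x \<in> span ?S" for x
    using rs span_mono[OF base] by blast
  have dS: "d y \<in> span ?S" if y: "y \<in> fst ` set us \<union> (fst ` set vs \<union> snd ` set vs)" for y
  proof -
    have mem: "a \<in> span ?S" "b \<in> span ?S" if "(a, b) \<in> set (adapted_pairs TH us vs)" for a b
      using imageI[OF that, of fst] imageI[OF that, of snd] by (simp_all add: span_base)
    have half: "d y \<in> span ?S" if "r *\<^sub>R d y \<in> span ?S" "r \<noteq> 0" for r
      using span_scale[OF that(1), of "1 / r"] that(2) by simp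
    from y consider c where "c \<in> set us" "y = fst c" | c where "c \<in> set vs" "y = fst c" | c where "c \<in> set vs" "y = snd c" by auto
    then show ?thesis
    proof cases
      case 1
      have "(fst c, - snd c *\<^sub>R d (fst c)) \<in> set (adapted_pairs TH us vs)"
        using imageI[OF 1(1), of "\<lambda>c. (fst c, - snd c *\<^sub>R d (fst c))"] unfolding adapted_pairs_def by simp
      from mem(2)[OF this] show ?thesis using u(3)[OF 1(1)] half[of "- snd c"] unfolding 1(2) by auto
    next
      case 2
      have "(2 *\<^sub>R d (fst c), snd c) \<in> set (adapted_pairs TH us vs)"
        using imageI[OF 2(1), of "\<lambda>c. (2 *\<^sub>R d (fst c), snd c)"] unfolding adapted_pairs_def by simp
      from mem(1)[OF this] show ?thesis using half[of 2] unfolding 2(2) by simp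
    next
      case 3
      have "(- 2 *\<^sub>R d (snd c), fst c) \<in> set (adapted_pairs TH us vs)"
        using imageI[OF 3(1), of "\<lambda>c. (- 2 *\<^sub>R d (snd c), fst c)"] unfolding adapted_pairs_def by simp
      from mem(1)[OF this] show ?thesis using half[of "-2"] unfolding 3(2) by simp
    qed
  qed
  have ds: "d (s x) \<in> span ?S" for x
  proof -
    have "s x \<in> span (fst ` set us \<union> (fst ` set vs \<union> snd ` set vs))" using rs by blast
    then have "d (s x) \<in> d ` span (fst ` set us \<union> (fst ` set vs \<union> snd ` set vs))" by blast
    also have "\<dots> = span (d ` (fst ` set us \<union> (fst ` set vs \<union> snd ` set vs)))" by (rule linear_span_image[OF V.lin_dif, symmetric])
    also have "\<dots> \<subseteq> span ?S" by (rule span_minimal) (use dS in auto)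
    finally show ?thesis .
  qed
  show "span ?S = UNIV"
  proof -
    have "v \<in> span ?S" for v
    proof -
      have "i (p v) + (d (s v) + s (d v)) \<in> span ?S" by (intro span_add iH ds sV)
      then show ?thesis using ds_sd[of v] by simp
    qed
    then show ?thesis by auto
  qed
qed

end

section \<open>The minimal model\<close>

lemma ffdif_pullback_hom:
  assumes "\<And>x. grade W (f x) = f (grade W' x)" "\<And>x. dif W (f x) = f (dif W' x)"
  shows "ffdif W' (pullback f F) = pullback f (ffdif W F)"
proof
  fix ws
  have g: "grade W \<circ> f = f \<circ> grade W'" using assms(1) by (simp add: fun_eq_iff)
  have "map f (map (grade W') xs) = map (grade W) (map f xs)" for xs
    unfolding map_map g ..
  then show "ffdif W' (pullback f F) ws = pullback f (ffdif W F) ws"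
    unfolding ffdif_def pullback_apply map_append list.map length_map assms(2)[symmetric] assms(1)[symmetric]
    by (intro sum.cong refl) (simp add: take_map drop_map g)
qed

context cyclic_data
begin

section \<open>Comparison with the coordinates of the Gaussian integral\<close>

lemma sigma_range: "x \<in> range s \<Longrightarrow> y \<in> range s \<Longrightarrow> sigma V b s [x, y] = fls_const (2 * b (grade W x) (d y))"
  by (simp add: sigma_def sd_range)

lemma sigma_Ev: "x \<in> Od V \<Longrightarrow> x \<in> range s \<Longrightarrow> y \<in> range s \<Longrightarrow> sigma V b s [x, y] = fls_const (2 * b x (d y))"
  using W.gr_Ev[of x] sigma_range[of x y] by simp

lemma sigma_Od: "x \<in> Ev V \<Longrightarrow> x \<in> range s \<Longrightarrow> y \<in> range s \<Longrightarrow> sigma V b s [x, y] = fls_const (- 2 * b x (d y))"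
  using W.gr_Od[of x] sigma_range[of x y] by (simp add: b_neg1)

lemma fls_const_inj: "fls_const (a::real) = fls_const c \<longleftrightarrow> a = c"
  by (metis fls_const_nth)

lemma coords_of_gauss_coords:
  assumes g: "gauss_coords V b s us vs" shows "coords us vs"
proof -
  let ?B = "map fst us @ map fst vs @ map snd vs"
  have g': "fst ` set us \<subseteq> Od V" "fst ` set vs \<subseteq> Ev V" "snd ` set vs \<subseteq> Ev V" "span (set ?B) = range s"
    "snd ` set us \<subseteq> {1, -1}"
    and gu: "\<And>j k. j < length us \<Longrightarrow> k < length us \<Longrightarrow>
      sigma V b s [fst (us ! j), fst (us ! k)] = (if j = k then fls_const (2 * snd (us ! j)) else 0)"
    and gv: "\<And>j k. j < length vs \<Longrightarrow> k < length vs \<Longrightarrow>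
      sigma V b s [fst (vs ! j), fst (vs ! k)] = 0 \<and> sigma V b s [snd (vs ! j), snd (vs ! k)] = 0 \<and>
      sigma V b s [fst (vs ! j), snd (vs ! k)] = (if j = k then -1 else 0)"
    using g unfolding gauss_coords_def Let_def EvW OdW by (elim conjE, simp)+
  have B: "set ?B \<subseteq> range s" using g'(4) span_superset[of "set ?B"] by simp
  have u: "fst c \<in> Od V" "fst c \<in> range s" if "c \<in> set us" for c using g'(1) B that by auto
  have v: "fst c \<in> Ev V" "fst c \<in> range s" "snd c \<in> Ev V" "snd c \<in> range s" if "c \<in> set vs" for c
    using g'(2,3) B that by auto
  show ?thesis
    unfolding coords_def
  proof (intro conjI)
    show "\<forall>c\<in>set us. fst c \<in> Od V \<and> fst c \<in> range s \<and> snd c \<in> {1, -1}" using u g'(5) by blast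
    show "\<forall>c\<in>set vs. fst c \<in> Ev V \<and> fst c \<in> range s \<and> snd c \<in> Ev V \<and> snd c \<in> range s" using v by blast
    show "\<forall>j<length us. \<forall>k<length us. b (fst (us ! j)) (d (fst (us ! k))) = (if j = k then snd (us ! j) else 0)"
    proof (intro allI impI)
      fix j k assume jk: "j < length us" "k < length us"
      have "fls_const (2 * b (fst (us ! j)) (d (fst (us ! k)))) = fls_const (if j = k then 2 * snd (us ! j) else 0)"
        using gu[OF jk] sigma_Ev[OF u[OF nth_mem[OF jk(1)]] u(2)[OF nth_mem[OF jk(2)]]] by simp
      then show "b (fst (us ! j)) (d (fst (us ! k))) = (if j = k then snd (us ! j) else 0)"
        unfolding fls_const_inj by (simp split: if_splits)
    qed
    show "\<forall>j<length vs. \<forall>k<length vs. b (fst (vs ! j)) (d (fst (vs ! k))) = 0 \<and> b (snd (vs ! j)) (d (snd (vs ! k))) = 0 \<and>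
        b (fst (vs ! j)) (d (snd (vs ! k))) = (if j = k then 1 / 2 else 0)"
    proof (intro allI impI)
      fix j k assume jk: "j < length vs" "k < length vs"
      note vj = v[OF nth_mem[OF jk(1)]] and vk = v[OF nth_mem[OF jk(2)]]
      have "fls_const (- 2 * b (fst (vs ! j)) (d (fst (vs ! k)))) = fls_const 0"
        "fls_const (- 2 * b (snd (vs ! j)) (d (snd (vs ! k)))) = fls_const 0"
        "fls_const (- 2 * b (fst (vs ! j)) (d (snd (vs ! k)))) = fls_const (if j = k then - 1 else 0)"
        using gv[OF jk] sigma_Od[OF vj(1,2) vk(2)] sigma_Od[OF vj(3,4) vk(4)] sigma_Od[OF vj(1,2) vk(4)] by simp_all
      then show "b (fst (vs ! j)) (d (fst (vs ! k))) = 0 \<and> b (snd (vs ! j)) (d (snd (vs ! k))) = 0 \<and>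
        b (fst (vs ! j)) (d (snd (vs ! k))) = (if j = k then 1 / 2 else 0)"
        unfolding fls_const_inj by (simp split: if_splits)
    qed
    show "range s \<subseteq> span (fst ` set us \<union> (fst ` set vs \<union> snd ` set vs))" using g'(4) by simp
  qed
qed

text \<open>Independence holds because the coordinate vectors belong to an adapted Darboux basis.
  Together with \<open>coords_exist\<close> this guarantees that \<open>SOME\<close> in
  \<open>gauss_int\<close> selects genuine coordinates.\<close>

lemma gauss_coords_of_coords:
  assumes co: "coords us vs" shows "gauss_coords V b s us vs"
proof -
  obtain TH where TH: "dualsys \<tau>H TH" "\<And>c. c \<in> set TH \<Longrightarrow> fst c \<in> Od H \<and> snd c \<in> Ev H"
    "span (fst ` set TH \<union> snd ` set TH) = UNIV" using darbouxH by blast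
  have D: "darboux W \<tau> (map fst (adapted_pairs TH us vs)) (map snd (adapted_pairs TH us vs))" by (rule darboux_adapted_pairs[OF TH co])
  let ?E = "map fst (adapted_pairs TH us vs) @ map snd (adapted_pairs TH us vs)"
  let ?B = "map fst us @ map fst vs @ map snd vs"
  have E: "distinct ?E" "independent (set ?E)" using D by (simp_all add: darboux_def)
  have dB: "distinct ?B" using E(1) by (auto simp: adapted_pairs_def comp_def)
  have "set ?B \<subseteq> set ?E" by (force simp: adapted_pairs_def comp_def)
  with E(2) have iB: "independent (set ?B)" by (rule independent_mono)
  have u: "fst c \<in> Od V" "fst c \<in> range s" "snd c \<in> {1, -1}" if "c \<in> set us" for c
    using co that by (auto simp: coords_def)
  have v: "fst c \<in> Ev V" "fst c \<in> range s" "snd c \<in> Ev V" "snd c \<in> range s" if "c \<in> set vs" for c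
    using co that by (auto simp: coords_def)
  have sp: "span (set ?B) = range s"
  proof
    show "span (set ?B) \<subseteq> range s" by (rule span_minimal[OF _ sub_range_s]) (use u v in auto)
    show "range s \<subseteq> span (set ?B)" using co by (simp add: coords_def)
  qed
  show ?thesis
    unfolding gauss_coords_def Let_def EvW OdW
  proof (intro conjI)
    show "fst ` set us \<subseteq> Od V" "fst ` set vs \<subseteq> Ev V" "snd ` set vs \<subseteq> Ev V" "snd ` set us \<subseteq> {1, -1}" using u v by blast+
    show "distinct ?B" "independent (set ?B)" "span (set ?B) = range s" by (rule dB iB sp)+
    show "\<forall>j<length us. \<forall>k<length us.
      sigma V b s [fst (us ! j), fst (us ! k)] = (if j = k then fls_const (2 * snd (us ! j)) else 0)"
    proof (intro allI impI)
      fix j k assume jk: "j < length us" "k < length us"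
      have "b (fst (us ! j)) (d (fst (us ! k))) = (if j = k then snd (us ! j) else 0)" using co jk by (simp add: coords_def)
      then show "sigma V b s [fst (us ! j), fst (us ! k)] = (if j = k then fls_const (2 * snd (us ! j)) else 0)"
        unfolding sigma_Ev[OF u(1,2)[OF nth_mem[OF jk(1)]] u(2)[OF nth_mem[OF jk(2)]]] by simp
    qed
    show "\<forall>j<length vs. \<forall>k<length vs.
      sigma V b s [fst (vs ! j), fst (vs ! k)] = 0 \<and> sigma V b s [snd (vs ! j), snd (vs ! k)] = 0 \<and>
      sigma V b s [fst (vs ! j), snd (vs ! k)] = (if j = k then -1 else 0)"
    proof (intro allI impI)
      fix j k assume jk: "j < length vs" "k < length vs"
      note vj = v[OF nth_mem[OF jk(1)]] and vk = v[OF nth_mem[OF jk(2)]]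
      have "b (fst (vs ! j)) (d (fst (vs ! k))) = 0" "b (snd (vs ! j)) (d (snd (vs ! k))) = 0"
        "b (fst (vs ! j)) (d (snd (vs ! k))) = (if j = k then 1 / 2 else 0)"
        using co jk by (simp_all add: coords_def)
      then show "sigma V b s [fst (vs ! j), fst (vs ! k)] = 0 \<and> sigma V b s [snd (vs ! j), snd (vs ! k)] = 0 \<and>
        sigma V b s [fst (vs ! j), snd (vs ! k)] = (if j = k then -1 else 0)"
        unfolding sigma_Od[OF vj(1,2) vk(2)] sigma_Od[OF vj(3,4) vk(4)] sigma_Od[OF vj(1,2) vk(4)] by simp
    qed
  qed
qed

lemma gauss_setup_W:
  assumes TH: "\<And>c. c \<in> set TH \<Longrightarrow> fst c \<in> Od H \<and> snd c \<in> Ev H" and co: "coords us vs"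
  shows "gauss_setup W s (\<lambda>v. i (p v)) us vs (map (\<lambda>c. (1, i (snd c), i (fst c))) TH)"
proof unfold_locales
  show "W.odlin s" by (rule odlin_s)
  show "W.evlin (\<lambda>v. i (p v))" by (rule evlin_pr)
  show "dif W (s x) + s (dif W x) = x - i (p x)" for x by (simp add: ds_sd)
  show "fst c \<in> Ev W \<and> s (fst c) = 0 \<and> i (p (fst c)) = 0" if "c \<in> set us" for c
    using co that s_range[of "fst c"] p_range[of "fst c"] by (simp add: coords_def)
  show "fst c \<in> Od W \<and> s (fst c) = 0 \<and> i (p (fst c)) = 0 \<and> snd c \<in> Od W \<and> s (snd c) = 0 \<and> i (p (snd c)) = 0"
    if "c \<in> set vs" for c
    using co that s_range[of "fst c"] p_range[of "fst c"] s_range[of "snd c"] p_range[of "snd c"] by (simp add: coords_def)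
  show "fst (snd c) \<in> Od W \<and> s (fst (snd c)) = 0 \<and> i (p (fst (snd c))) = fst (snd c) \<and>
      snd (snd c) \<in> Ev W \<and> s (snd (snd c)) = 0 \<and> i (p (snd (snd c))) = snd (snd c)"
    if "c \<in> set (map (\<lambda>c. (1, i (snd c), i (fst c))) TH)" for c
    using that TH by (auto simp: i_par)
qed simp_all

theorem minimal_model_rho:
  assumes "quantum_Linf V b m"
  shows "quantum_Linf H bH (rho V b H i s m)"
    and "mc_homotopic W \<tau> (pullback p (rho V b H i s m)) m"
proof -
  have m: "m \<in> hfun W" "even_fun W m" "qme W \<tau> m" using assms by (simp_all add: quantum_Linf_def)
  have ffm: "W.ff m" and suppm: "supp_in (\<lambda>g n. g \<ge> 0 \<and> 2 * g + n > 2) m"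
    using m(1) by (simp_all add: hfun_def supp_in_def)
  obtain TH where TH: "dualsys \<tau>H TH" "\<And>c. c \<in> set TH \<Longrightarrow> fst c \<in> Od H \<and> snd c \<in> Ev H"
    "span (fst ` set TH \<union> snd ` set TH) = UNIV" using darbouxH by blast
  obtain us vs where uv: "(SOME (us, vs). gauss_coords V b s us vs) = (us, vs)" by (metis surj_pair)
  obtain us0 vs0 where "coords us0 vs0" by (rule coords_exist)
  then have ex: "gauss_coords V b s us0 vs0" by (rule gauss_coords_of_coords)
  have "case (SOME (us, vs). gauss_coords V b s us vs) of (us, vs) \<Rightarrow> gauss_coords V b s us vs"
    by (rule someI[of "\<lambda>(us, vs). gauss_coords V b s us vs" "(us0, vs0)"]) (use ex in simp)
  then have co: "coords us vs" by (intro coords_of_gauss_coords) (simp add: uv)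
  let ?pr = "\<lambda>v. i (p v)" and ?DH = "map (\<lambda>c. (1, i (snd c), i (fst c))) TH"
  interpret GS: gauss_setup W s ?pr us vs ?DH by (rule gauss_setup_W[OF TH(2) co])
  \<comment> \<open>The tensor of the adapted basis is the sum of \<open>DH\<close> and the
    complementary part, so \<open>lap\<close> is the Laplacian to which the flow argument
    applies.\<close>
  have D: "ptensor (adapted_pairs TH us vs) = GS.D"
    by (simp add: ptensor_def adapted_pairs_def GS.D_def GS.Dp_def GS.De_def GS.Dx_def GS.Dy_def comp_def)
  have lap: "lap W \<tau> F = L2 GS.D F" if "W.ff F" for F
    using W.lap_eq_L2[OF tau_bil tau_par darboux_adapted_pairs[OF TH co] that] unfolding D .
  have hd: "hdif W \<tau> F = W.hd2 GS.D F" if "W.ff F" for F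
    by (rule ext) (simp add: hdif_def W.hd2_def lap[OF that] pt)
  have br: "bracket W \<tau> F G = W.br2 GS.D F G" if "W.ff F" "W.ff G" for F G
    by (rule ext) (simp add: bracket_def W.br2_def lap that W.ff_mult W.ff_gm pt)
  have lapH: "lap WH \<tau>H F = L2 (ptensor TH) F" if "WH.ff F" for F
  proof (rule WH.lap_eq_L2[OF tauH_bil tauH_par _ that])
    show "darboux WH \<tau>H (map fst TH) (map snd TH)"
      by (rule WH.darboux_of_dualsys[OF tauH_bil tauH_par TH(1) _ TH(3)]) (use TH(2) in simp)
  qed
  define a0 where "a0 = sc fls_X_inv m"
  have Xinv: "fls_X * fls_X_inv = (1 :: real fls)" unfolding fls_X_inv_times_conv_shift(2) fls_X_conv_shift_1 by simp
  have Xa0: "sc fls_X a0 = m" unfolding a0_def by (simp add: Xinv)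
  have div: "x / fls_X = fls_X_inv * x" for x :: "real fls"
    using Xinv by (metis fls_X_nonzero mult.commute mult.left_neutral mult.assoc nonzero_mult_div_cancel_left times_divide_eq_right)
  have div_m: "(\<lambda>ws. m ws / fls_X) = a0" unfolding a0_def by (rule ext) (simp only: div sc_apply)
  have nth_a0: "fls_nth (a0 ws) g = fls_nth (m ws) (g + 1)" for ws g
    unfolding a0_def sc_apply fls_X_inv_times_conv_shift by simp
  have a0: "W.adm a0"
  proof -
    have S: "supp_in (\<lambda>g n. g + 1 \<ge> 0 \<and> 2 * (g + 1) + n > 2) a0"
      unfolding supp_in_def nth_a0 using supp_inD[OF suppm] by blast
    have "bt 0 a0" by (rule supp_in_mono[OF S]) presburger
    moreover have "wt 1 a0" by (rule supp_in_mono[OF S]) presburger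
    moreover have "W.gm a0 = a0" using m(2) unfolding a0_def by (simp add: even_fun_def)
    moreover have "W.ff a0" unfolding a0_def by (rule W.ff_sc[OF ffm])
    ultimately show ?thesis by (simp add: W.adm_def)
  qed
  have m0: "supp_in (\<lambda>g n. g \<ge> 0 \<and> 2 * g + n > 2) (sc fls_X a0)" unfolding Xa0 by (rule suppm)
  have q0: "W.hd2 GS.D (ffexp W a0) = 0"
    using m(3) unfolding qme_def div_m hd[OF W.ff_exp[OF a0]] by (simp add: zero_fun_def)
  have uu: "fst ` set us \<subseteq> Ev W" and vv: "fst ` set vs \<subseteq> Od W" "snd ` set vs \<subseteq> Od W"
    using GS.us GS.vs by auto
  obtain G where G: "W.heatflow (W.gtensor us vs) (ffexp W a0) G"
    and G1: "G 1 = foldr int_even us (foldr int_odd vs (ffexp W a0))"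
    by (rule W.gaussian_heatflow[OF uu vv W.ff_exp[OF a0] W.bt_exp[OF a0]])
  note GG = a0 m0 q0 G
  have gi: "gauss_int V b i s (ffexp W (\<lambda>ws. m ws / fls_X)) = pullback i (G 1)"
    unfolding gauss_int_def uv div_m prod.case G1 by (rule ext) (simp add: pullback_apply)
  have i_ev: "ev_proj W (i x) = i (ev_proj WH x)" and i_od: "od_proj W (i x) = i (od_proj WH x)"
    and i_gr: "grade W (i x) = i (grade WH x)" for x
    by (simp_all add: evproj_W evproj_WH i_projV gr_W gr_WH i_grade linear_neg[OF lin_i])
  have ff_i: "WH.ff (pullback i F)" if "W.ff F" for F
    by (rule WH.ff_pullback[OF that lin_i]) (simp_all add: i_par W.super_sp_axioms)
  have gm_i: "WH.gm (pullback i F) = pullback i (W.gm F)" for F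
    by (rule ext) (simp add: ffgrade_def pullback_apply comp_def i_gr)
  have adm_i: "WH.adm (pullback i F)" if "W.adm F" for F
    using that by (simp add: WH.adm_def W.adm_def ff_i gm_i pullback_supp)
  \<comment> \<open>Restriction along \<open>i\<close> is compatible with products, hence commutes
    with the logarithm.\<close>
  have ln_i: "ffln WH (pullback i (G 1)) = pullback i (GS.L G 1)"
  proof -
    note ad = GS.adm_G[OF GG, of 1]
    have e: "pullback i (G 1) - ffone = pullback i (G 1 - ffone)" by (simp add: pullback_lin pullback_one)
    show ?thesis
      unfolding GS.L_def[OF GG] W.ffln_fsub[OF ad]
        WH.ffln_fsub[of "pullback i (G 1)", unfolded e, OF adm_i[OF ad]]
      by (rule pullback_fsub) (rule i_ev i_od i_gr)+
  qed
  have rho: "rho V b H i s m = pullback i (GS.N G 1)"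
    unfolding rho_def gi ln_i GS.N_def[OF GG] by (rule ext) (simp add: pullback_lin pt)
  have exp_rho: "ffexp WH (\<lambda>ws. pullback i (GS.N G 1) ws / fls_X) = pullback i (G 1)"
  proof -
    have "(\<lambda>ws. pullback i (GS.N G 1) ws / fls_X) = pullback i (GS.L G 1)"
      unfolding GS.N_def[OF GG] by (rule ext) (simp add: pullback_lin pt fls_X_times_conv_shift)
    then show ?thesis
      using pullback_fsub[of W i WH "fps_exp 1" "GS.L G 1", OF i_ev i_od i_gr] GS.exp_L[OF GG, of 1]
      by (simp add: WH.ffexp_fsub W.ffexp_fsub)
  qed
  have ffG: "W.ff (G 1)" using GS.ffG[OF GG] .
  have qmeH: "qme WH \<tau>H (rho V b H i s m)"
    unfolding qme_def rho exp_rho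
  proof
    fix hs
    have t: "tmap i i (ptensor TH) = ?DH" by (simp add: ptensor_def)
    have "hdif WH \<tau>H (pullback i (G 1)) hs = (ffdif WH (pullback i (G 1)) + sc fls_X (L2 (ptensor TH) (pullback i (G 1)))) hs"
      by (simp add: hdif_def lapH[OF ff_i[OF ffG]] pt)
    also have "\<dots> = pullback i (ffdif W (G 1) + sc fls_X (L2 ?DH (G 1))) hs"
      unfolding L2_pullback t pullback_lin
      using ffdif_pullback_hom[of W i WH "G 1", OF i_gr] by simp
    also have "\<dots> = 0" unfolding GS.qme_end[OF GG] by (simp add: pullback_lin pt)
    finally show "hdif WH \<tau>H (pullback i (G 1)) hs = 0" .
  qed
  show "quantum_Linf H bH (rho V b H i s m)"
    unfolding quantum_Linf_def
  proof (intro conjI)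
    show "super_space H" by (rule superH)
    show "odd_sym_form H bH" by (rule formH)
    show "rho V b H i s m \<in> hfun WH"
      using ff_i[OF GS.ff_N[OF GG, of 1]] pullback_supp[OF GS.supp_N[OF GG, of 1], of i]
      unfolding rho by (simp add: hfun_def supp_in_def)
    show "even_fun WH (rho V b H i s m)"
      unfolding rho even_fun_def gm_i GS.gm_N[OF GG] ..
    show "qme WH \<tau>H (rho V b H i s m)" by (rule qmeH)
  qed
  obtain A' where A': "dpath (GS.At G) A'"
    and MC1: "\<And>t. W.hd2 GS.D (GS.At G t) + sc (fls_const (1/2)) (W.br2 GS.D (GS.At G t) (GS.At G t)) = 0"
    and MC2: "\<And>t. W.hd2 GS.D (GS.Bt G t) + A' t + W.br2 GS.D (GS.At G t) (GS.Bt G t) = 0"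
    by (rule GS.homotopy[OF GG]) (rule that; blast)
  obtain B' where B': "dpath (GS.Bt G) B'" using GS.dpath_Bt[OF GG] by blast
  note gA = GS.gm_At[OF GG] and gB = GS.gm_Bt[OF GG] and fA = GS.ff_At[OF GG] and fB = GS.ff_Bt[OF GG]
  have pp: "poly_path W F" if "dpath F F'" "\<And>t. F t \<in> hfun W" for F F'
    using that unfolding poly_path_def dpath_def fpath_def by blast
  \<comment> \<open>The derivative of a path of even functions is even, which removes
    \<open>ffgrade\<close> from \<open>tdt_dif\<close>.\<close>
  have gA': "W.gm (A' t) = A' t" for t
    using dpath_unique[OF dpath_ffgrade[OF A', of W], of A'] A' unfolding gA by blast
  have mc: "tdt_mc W \<tau> (GS.At G, GS.Bt G)"
    unfolding tdt_mc_def fst_conv snd_conv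
  proof (intro conjI allI)
    show "poly_path W (GS.At G)" by (rule pp[OF A' GS.hfun_At[OF GG]])
    show "poly_path W (GS.Bt G)" by (rule pp[OF B' GS.hfun_Bt[OF GG]])
    fix t
    show "even_fun W (GS.At G t)" by (simp add: even_fun_def gA)
    show "odd_fun W (GS.Bt G t)" unfolding odd_fun_def gB by (rule ext) (simp add: pt)
    fix ws
    have "(W.hd2 GS.D (GS.At G t) + sc (fls_const (1/2)) (W.br2 GS.D (GS.At G t) (GS.At G t))) ws = 0"
      unfolding MC1 by (simp add: pt)
    then show "fst (tdt_dif W \<tau> (GS.At G, GS.Bt G)) t ws
        + fls_const (1 / 2) * fst (tdt_bracket W \<tau> (GS.At G, GS.Bt G) (GS.At G, GS.Bt G)) t ws = 0"
      unfolding tdt_dif_def tdt_bracket_def prod.case fst_conv hd[OF fA] br[OF fA fA] by (simp only: pt)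
    \<comment> \<open>By \<open>br2_swap\<close> the two mixed brackets differ by a sign, so half of
      their difference is a single bracket.\<close>
    have h: "fls_const (1 / 2) * (x - - x) = x" for x :: "real fls"
      by (rule fls_eqI) simp
    have "(W.hd2 GS.D (GS.Bt G t) + A' t + W.br2 GS.D (GS.At G t) (GS.Bt G t)) ws = 0"
      unfolding MC2 by (simp add: pt)
    then show "snd (tdt_dif W \<tau> (GS.At G, GS.Bt G)) t ws
        + fls_const (1 / 2) * snd (tdt_bracket W \<tau> (GS.At G, GS.Bt G) (GS.At G, GS.Bt G)) t ws = 0"
      unfolding tdt_dif_def tdt_bracket_def prod.case snd_conv hd[OF fB] tderiv_dpath[OF A'] gA'
        br[OF fA fB] br[OF fB W.ff_gm[OF fA]] W.br2_swap[OF fA gA fB gB GS.todd_D] uminus_apply h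
      by (simp only: pt)
  qed
  show "mc_homotopic W \<tau> (pullback p (rho V b H i s m)) m"
    unfolding mc_homotopic_def
  proof (intro exI[of _ "(GS.At G, GS.Bt G)"] conjI mc)
    have "GS.At G 0 = pullback p (pullback i (GS.N G 1))"
      unfolding GS.At_0[OF GG] by (rule ext) (simp add: pullback_apply comp_def)
    then show "fst (GS.At G, GS.Bt G) 0 = pullback p (rho V b H i s m)" unfolding rho by simp
    show "fst (GS.At G, GS.Bt G) 1 = m" using GS.At_1[OF GG] Xa0 by simp
  qed
qed

end

theorem theorem4p2:
  fixes V :: "'v::real_vector super" and b :: "'v \<Rightarrow> 'v \<Rightarrow> real"
    and H :: "'h::real_vector super" and bH :: "'h \<Rightarrow> 'h \<Rightarrow> real"
    and \<pi> :: "'v \<Rightarrow> 'h" and i :: "'h \<Rightarrow> 'v" and p :: "'v \<Rightarrow> 'h" and s :: "'v \<Rightarrow> 'v"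
    and m :: "'v ffun"
  assumes "quantum_Linf V b m"
    and "homology_of V b H bH \<pi>"
    and "cyclic_sdr V b H bH i p s"
  shows "quantum_Linf H bH (rho V b H i s m) \<and>
         minimal_model V b H bH p m (rho V b H i s m)"
proof -
  interpret cyclic_data V b H bH \<pi> i p s
    using assms by unfold_locales (simp_all add: quantum_Linf_def)
  show ?thesis
    unfolding minimal_model_def using minimal_model_rho[OF assms(1)] by blast
qed

end
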